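(* Let $\mathcal{D}_H$ be a left $H$-category and $M$ a right-left SAYD module over $H$. Let $\phi \in C^n_H(\mathcal{D}_H,M)$. Then the following conditions are equivalent: (1) $\phi$ is the character of an $n$-dimensional cycle over $\mathcal D_H$, i.e., there is an $n$-dimensional cycle $(\mathcal{S}_H,\hat{\partial}_H, \hat{\mathscr T}^H)$ with coefficients in $M$ and an $H$-linear semifunctor $\rho:\mathcal{D}_H \longrightarrow \mathcal{S}_H^0$ such that $$\phi(m \otimes f^0 \otimes \ldots \otimes f^n)=\hat{\mathscr T}^H_{\rho(X_0)}\big((id_M\otimes\hat\rho)(m\otimes f^0df^1\ldots df^n)\big)=\hat{\mathscr T}^H_{\rho(X_0)}\big(m \otimes \rho(f^0)\hat{\partial}_H^0(\rho(f^1)) \ldots \hat{\partial}_H^0(\rho(f^n))\big)$$ for any $m \in M$ and $f^0 \otimes \ldots \otimes f^n \in Hom_{\mathcal{D}_H}(X_1,X_0) \otimes Hom_{\mathcal{D}_H}(X_2,X_1) \otimes \ldots \otimes Hom_{\mathcal{D}_H}(X_0,X_n)$. (2) There exists a closed graded $(H,M)$-trace $\mathscr{T}^H$ of dimension $n$ on $(\Omega(\mathcal{D}_H),\partial_H)$ such that $$\phi(m \otimes f^0 \otimes \ldots \otimes f^n)=\mathscr{T}^H_{X_0}(m \otimes f^0df^1 \ldots df^n)$$ for any $m \in M$ and $f^0 \otimes \ldots \otimes f^n \in Hom_{\mathcal{D}_H}(X_1,X_0) \otimes Hom_{\mathcal{D}_H}(X_2,X_1) \otimes \ldots \otimes Hom_{\mathcal{D}_H}(X_0,X_n)$.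 (3) $\phi \in Z^n_H(\mathcal{D}_H,M)$.
   Context: $k$ is a field of characteristic zero; $H$ is a Hopf algebra over $k$ with coproduct $\Delta(h)=h_1\otimes h_2$, counit $\varepsilon$, bijective antipode $S$. A semicategory is like a category but possibly without identity morphisms (associative composition); a semifunctor preserves composition. A left $H$-semicategory is a small $k$-linear semicategory with each Hom a left $H$-module and $h(gf)=(h_1g)(h_2f)$; a left $H$-category is a small $k$-linear category with these properties and $h(id_X)=\varepsilon(h)id_X$. A right-left SAYD module is a right $H$-module and left $H$-comodule $M$, $m\mapsto m_{(-1)}\otimes m_{(0)}$, with $(mh)_{(-1)}\otimes(mh)_{(0)}=S(h_3)m_{(-1)}h_1\otimes m_{(0)}h_2$ and $m_{(0)}m_{(-1)}=m$. $CN_n(\mathcal D_H)=\bigoplus_{(X_0,\ldots,X_n)}Hom_{\mathcal D_H}(X_1,X_0)\otimes Hom_{\mathcal D_H}(X_2,X_1)\otimes\ldots\otimes Hom_{\mathcal D_H}(X_0,X_n)$ with diagonal $H$-action. $C^n_H(\mathcal D_H,M)$ is the space of $k$-linear $\phi:M\otimes CN_n(\mathcal D_H)\to k$ with $\phi(mh_1\otimes S(h_2)(f^0\otimes\ldots\otimes f^n))=\varepsilon(h)\phi(m\otimes f^0\otimes\ldots\otimes f^n)$. It carries operators $\delta_i:C^{n-1}_H\to C^n_H$, $(\delta_i\phi)(m\otimes f^0\otimes\ldots\otimes f^n)=\phi(m\otimes f^0\otimes\ldots\otimes f^if^{i+1}\otimes\ldots\otimes f^n)$ for $0\le i\le n-1$,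 $(\delta_n\phi)(m\otimes f^0\otimes\ldots\otimes f^n)=\phi(m_{(0)}\otimes(S^{-1}(m_{(-1)})f^n)f^0\otimes f^1\otimes\ldots\otimes f^{n-1})$, and $(\tau_n\phi)(m\otimes f^0\otimes\ldots\otimes f^n)=\phi(m_{(0)}\otimes S^{-1}(m_{(-1)})f^n\otimes f^0\otimes\ldots\otimes f^{n-1})$. $Z^n_H(\mathcal D_H,M)$ is the set of $\phi\in C^n_H(\mathcal D_H,M)$ with $b\phi:=\sum_{i=0}^{n+1}(-1)^i\delta_i\phi=0$ and $\phi=(-1)^n\tau_n\phi$. DG-semicategory $(\mathcal S,\hat\partial)$: a $k$-linear semicategory whose Homs are cochain complexes $(Hom^n_{\mathcal S}(X,Y),\hat\partial^n)_{n\ge0}$ with composition a morphism of complexes, i.e. $\hat\partial(gf)=\hat\partial(g)f+(-1)^{\deg g}g\hat\partial(f)$. $\mathcal S^0$ denotes the semicategory with the same objects and $Hom_{\mathcal S^0}=Hom^0_{\mathcal S}$. A left DGH-semicategory $(\mathcal S_H,\hat\partial_H)$ is a left $H$-semicategory with a DG-semicategory structure such that each $Hom^n_{\mathcal S_H}(X,Y)$ is a left $H$-module and $\hat\partial_H$ is $H$-linear. A closed graded $(H,M)$-trace of dimension $n$ on $\mathcal S_H$ is a collection of $k$-linear maps $\hat{\mathscr T}^H_X:M\otimes Hom^n_{\mathcal S_H}(X,X)\to k$, $X\in Ob(\mathcal S_H)$, with: $\hat{\mathscr T}^H_X(mh_1\otimes S(h_2)f)=\varepsilon(h)\hat{\mathscr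 T}^H_X(m\otimes f)$; $\hat{\mathscr T}^H_X(m\otimes\hat\partial_H^{n-1}(f'))=0$ for $f'\in Hom^{n-1}_{\mathcal S_H}(X,X)$; $\hat{\mathscr T}^H_X(m\otimes g'g)=(-1)^{ij}\hat{\mathscr T}^H_Y(m_{(0)}\otimes(S^{-1}(m_{(-1)})g)g')$ for $g\in Hom^i_{\mathcal S_H}(X,Y)$, $g'\in Hom^j_{\mathcal S_H}(Y,X)$, $i+j=n$. An $n$-dimensional cycle with coefficients in $M$ is a triple $(\mathcal S_H,\hat\partial_H,\hat{\mathscr T}^H)$ of a left DGH-semicategory and such a trace; a cycle over $\mathcal D_H$ is such a triple together with an $H$-linear semifunctor $\rho:\mathcal D_H\to\mathcal S^0_H$. For a small $k$-linear semicategory $\mathcal C$, $\tilde{\mathcal C}$ is the category obtained by formally adjoining (new) units: $Hom_{\tilde{\mathcal C}}(X,X)=Hom_{\mathcal C}(X,X)\oplus k$, $Hom_{\tilde{\mathcal C}}(X,Y)=Hom_{\mathcal C}(X,Y)$ for $X\neq Y$. The universal DG-semicategory $\Omega\mathcal C$ has the objects of $\mathcal C$, $Hom^0_{\Omega\mathcal C}(X,Y)=Hom_{\mathcal C}(X,Y)$ and for $n\ge1$ $Hom^n_{\Omega\mathcal C}(X,Y)=\bigoplus_{(X_1,\ldots,X_n)}Hom_{\tilde{\mathcal C}}(X_1,Y)\otimes Hom_{\mathcal C}(X_2,X_1)\otimes\ldots\otimes Hom_{\mathcal C}(X,X_n)$, with elements written $(f^0+\mu)df^1\ldots df^n$, $\mu\in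 k$. Composition is determined by $f^0\circ df^1\circ\ldots\circ df^n=f^0df^1\ldots df^n$, $df^1\circ\ldots\circ df^n=df^1\ldots df^n$, $(df^0)\circ f^1=d(f^0f^1)-f^0df^1$; the differential is $\partial((f^0+\mu)df^1\ldots df^n)=df^0df^1\ldots df^n$. For $\mathcal C=\mathcal D_H$, $\Omega(\mathcal D_H)$ is a left DGH-semicategory via $h\cdot((f^0+\mu)df^1\ldots df^n)=(h_1f^0+\mu\varepsilon(h_1))d(h_2f^1)\ldots d(h_{n+1}f^n)$, with differential denoted $\partial_H$. Given $\rho:\mathcal D_H\to\mathcal S^0_H$, $\hat\rho:\Omega(\mathcal D_H)\to\mathcal S_H$ is the induced DGH-semifunctor, $\hat\rho((f^0+\mu)df^1\ldots df^n)=\rho(f^0)\hat\partial_H^0(\rho(f^1))\ldots\hat\partial_H^0(\rho(f^n))+\mu\,\hat\partial_H^0(\rho(f^1))\ldots\hat\partial_H^0(\rho(f^n))$. *)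

theory Defs
  imports Complex_Main "HOL-Library.Function_Algebras" "HOL-Library.Product_Plus"
begin

section \<open>Linear maps and tensor products\<close>

text \<open>
  A vector space is a pair of an additive group type and a scalar multiplication (library locale
  \<^locale>\<open>vector_space\<close>); most spaces below are linear subspaces of such an ambient space.
\<close>

definition linear_on ::
  "'a set \<Rightarrow> ('k \<Rightarrow> 'a \<Rightarrow> 'a) \<Rightarrow> ('k \<Rightarrow> 'b \<Rightarrow> 'b) \<Rightarrow> ('a::ab_group_add \<Rightarrow> 'b::ab_group_add) \<Rightarrow> bool" where
  "linear_on V sV sW f \<longleftrightarrow>
     (\<forall>x\<in>V. \<forall>y\<in>V. f (x + y) = f x + f y) \<and> (\<forall>c. \<forall>x\<in>V. f (sV c x) = sW c (f x))"

definition bilinear_on ::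
  "('k \<Rightarrow> 'a \<Rightarrow> 'a) \<Rightarrow> 'a set \<Rightarrow> ('k \<Rightarrow> 'b \<Rightarrow> 'b) \<Rightarrow> 'b set \<Rightarrow> ('k \<Rightarrow> 'c \<Rightarrow> 'c) \<Rightarrow>
   ('a::ab_group_add \<Rightarrow> 'b::ab_group_add \<Rightarrow> 'c::ab_group_add) \<Rightarrow> bool" where
  "bilinear_on sV V sW W sU f \<longleftrightarrow>
     (\<forall>w\<in>W. linear_on V sV sU (\<lambda>v. f v w)) \<and> (\<forall>v\<in>V. linear_on W sW sU (f v))"

definition multilinear_on ::
  "('k::field \<Rightarrow> 'a \<Rightarrow> 'a) \<Rightarrow> 'a set list \<Rightarrow> ('k \<Rightarrow> 'b \<Rightarrow> 'b) \<Rightarrow>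
   ('a::ab_group_add list \<Rightarrow> 'b::ab_group_add) \<Rightarrow> bool" where
  "multilinear_on s Vs sU F \<longleftrightarrow>
     (\<forall>i<length Vs. \<forall>xs. list_all2 (\<in>) xs Vs \<longrightarrow> linear_on (Vs ! i) s sU (\<lambda>x. F (xs[i := x])))"

text \<open>
  Tensor products over a field, as subspaces of a function space: \<open>v \<otimes> w\<close> is the evaluation
  functional \<open>B \<mapsto> B v w\<close> on bilinear forms on \<open>V \<times> W\<close>, and \<open>V \<otimes> W\<close> is the span of these.  Over a
  field this has the universal property of the tensor product, see \<open>tensor_universal\<close> and
  \<open>tensors_universal\<close>.
\<close>

type_synonym ('k, 'a, 'b) tensor = "('a \<Rightarrow> 'b \<Rightarrow> 'k) \<Rightarrow> 'k"
type_synonym ('k, 'a) tensors = "('a list \<Rightarrow> 'k) \<Rightarrow> 'k"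

definition fscale :: "('k \<Rightarrow> 'b \<Rightarrow> 'b) \<Rightarrow> 'k \<Rightarrow> ('a \<Rightarrow> 'b) \<Rightarrow> 'a \<Rightarrow> 'b" where
  "fscale s c f = (\<lambda>x. s c (f x))"

definition ten ::
  "('k::field \<Rightarrow> 'a \<Rightarrow> 'a) \<Rightarrow> 'a set \<Rightarrow> ('k \<Rightarrow> 'b \<Rightarrow> 'b) \<Rightarrow> 'b set \<Rightarrow>
   'a::ab_group_add \<Rightarrow> 'b::ab_group_add \<Rightarrow> ('k, 'a, 'b) tensor" where
  "ten sV V sW W v w = (\<lambda>B. if bilinear_on sV V sW W (*) B then B v w else 0)"

definition tensor_space ::
  "('k::field \<Rightarrow> 'a::ab_group_add \<Rightarrow> 'a) \<Rightarrow> 'a set \<Rightarrow> ('k \<Rightarrow> 'b::ab_group_add \<Rightarrow> 'b) \<Rightarrow> 'b set \<Rightarrow>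
   ('k, 'a, 'b) tensor set" where
  "tensor_space sV V sW W = module.span (fscale (*)) {ten sV V sW W v w | v w. v \<in> V \<and> w \<in> W}"

definition tens :: 
  "('k::field \<Rightarrow> 'a \<Rightarrow> 'a) \<Rightarrow> 'a set list \<Rightarrow> 'a::ab_group_add list \<Rightarrow> ('k, 'a) tensors" where
  "tens s Vs xs = (\<lambda>F. if multilinear_on s Vs (*) F then F xs else 0)"

definition tensors_space ::
  "('k::field \<Rightarrow> 'a \<Rightarrow> 'a) \<Rightarrow> 'a::ab_group_add set list \<Rightarrow> ('k, 'a) tensors set" where
  "tensors_space s Vs = module.span (fscale (*)) {tens s Vs xs | xs. list_all2 (\<in>) xs Vs}"

lemma linear_separation:
  assumes "vector_space (s :: 'k::field \<Rightarrow> 'w \<Rightarrow> 'w::ab_group_add)"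
    and "\<And>\<xi>. Vector_Spaces.linear s (*) \<xi> \<Longrightarrow> \<xi> w = 0"
  shows "w = 0"
proof (rule ccontr)
  assume "w \<noteq> 0"
  interpret W: vector_space s by fact
  interpret K: vector_space "(*) :: 'k \<Rightarrow> 'k \<Rightarrow> 'k" by unfold_locales (simp_all add: algebra_simps)
  interpret vector_space_pair s "(*) :: 'k \<Rightarrow> 'k \<Rightarrow> 'k" by unfold_locales
  have "W.independent {w}" using \<open>w \<noteq> 0\<close> by simp
  from linear_independent_extend[OF this, of "\<lambda>_. 1"]
  obtain \<xi> where "Vector_Spaces.linear s (*) \<xi>" "\<xi> w = 1" by auto
  with assms(2) show False by force
qed

lemma vector_space_fscale:
  assumes "vector_space (s :: 'k::field \<Rightarrow> 'w \<Rightarrow> 'w::ab_group_add)"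
  shows "vector_space (fscale s :: 'k \<Rightarrow> ('i \<Rightarrow> 'w) \<Rightarrow> 'i \<Rightarrow> 'w)"
proof -
  interpret vector_space s by fact
  show ?thesis
    by unfold_locales (auto simp: fscale_def fun_eq_iff scale_right_distrib scale_left_distrib)
qed

lemma vector_space_field: "vector_space ((*) :: 'k::field \<Rightarrow> 'k \<Rightarrow> 'k)"
  by unfold_locales (simp_all add: algebra_simps)

lemma evaluation_span_universal:
  fixes e :: "'p \<Rightarrow> 'f \<Rightarrow> 'k::field" and g :: "'p \<Rightarrow> 'w::ab_group_add"
  assumes W: "vector_space sW"
    and form: "\<And>\<xi>. Vector_Spaces.linear sW (*) \<xi> \<Longrightarrow> \<exists>F. \<forall>p\<in>P. e p F = \<xi> (g p)"
  shows "\<exists>L. linear_on (module.span (fscale (*)) (e ` P)) (fscale (*)) sW L \<and> (\<forall>p\<in>P. L (e p) = g p)"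
proof -
  interpret E: vector_space "fscale (*) :: 'k \<Rightarrow> ('f \<Rightarrow> 'k) \<Rightarrow> 'f \<Rightarrow> 'k"
    by (intro vector_space_fscale vector_space_field)
  interpret W: vector_space sW by fact
  interpret EW: vector_space_pair "fscale (*) :: 'k \<Rightarrow> ('f \<Rightarrow> 'k) \<Rightarrow> 'f \<Rightarrow> 'k" sW by unfold_locales
  obtain B where B: "B \<subseteq> e ` P" "E.independent B" "e ` P \<subseteq> E.span B"
    using E.maximal_independent_subset[of "e ` P"] by blast
  define q where "q = inv_into P e"
  have q: "q b \<in> P" "e (q b) = b" if "b \<in> B" for b
    using that B(1) by (auto simp: q_def inv_into_into f_inv_into_f)
  define L where "L = EW.construct B (\<lambda>b. g (q b))"
  have lin: "Vector_Spaces.linear (fscale (*)) sW L"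
    unfolding L_def by (rule EW.linear_construct[OF B(2)])
  interpret L: Vector_Spaces.linear "fscale (*)" sW L by (rule lin)
  have LB: "L b = g (q b)" if "b \<in> B" for b
    unfolding L_def by (rule EW.construct_basis[OF B(2) that])
  have "L (e p) = g p" if p: "p \<in> P" for p
  proof -
    from p B(3) have "e p \<in> E.span B" by blast
    then obtain t r where t: "finite t" "t \<subseteq> B" "e p = (\<Sum>b\<in>t. fscale (*) (r b) b)"
      unfolding E.span_explicit by blast
    have Lep: "L (e p) = (\<Sum>b\<in>t. sW (r b) (g (q b)))"
      unfolding t(3) L.sum L.scale using t(2) LB by (intro sum.cong) auto
    have "L (e p) - g p = 0"
    proof (rule linear_separation[OF W])
      fix \<xi> assume l: "Vector_Spaces.linear sW (*) \<xi>"
      interpret l: Vector_Spaces.linear sW "(*)" \<xi> by (rule l)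
      obtain F where F: "\<forall>p\<in>P. e p F = \<xi> (g p)" using form[OF l] by blast
      have "\<xi> (L (e p)) = (\<Sum>b\<in>t. r b * \<xi> (g (q b)))"
        unfolding Lep l.sum l.scale ..
      also have "\<dots> = (\<Sum>b\<in>t. r b * b F)"
        using F q t(2) by (intro sum.cong refl arg_cong2[where f = "(*)"]) (metis subsetD)
      also have "\<dots> = e p F"
      proof -
        have "(\<Sum>b\<in>t. fscale (*) (r b) b) F = (\<Sum>b\<in>t. r b * b F)"
          using t(1) by (induction t rule: finite_induct) (auto simp: fscale_def)
        then show ?thesis using t(3) by simp
      qed
      also have "\<dots> = \<xi> (g p)" using F p by blast
      finally show "\<xi> (L (e p) - g p) = 0" by (simp add: l.diff)
    qed
    then show ?thesis by simp
  qed
  moreover have "linear_on (E.span (e ` P)) (fscale (*)) sW L"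
    unfolding linear_on_def by (simp add: L.add L.scale)
  ultimately show ?thesis by blast
qed

lemma linear_on_compose:
  assumes "Vector_Spaces.linear sU (*) \<xi>" "linear_on V sV sU f"
  shows "linear_on V sV (*) (\<lambda>x. \<xi> (f x))"
proof -
  interpret Vector_Spaces.linear sU "(*)" \<xi> by fact
  show ?thesis using assms(2) by (simp add: linear_on_def add scale)
qed

lemma tensor_universal:
  assumes "vector_space sU" "bilinear_on sV V sW W sU f"
  shows "\<exists>L. linear_on (tensor_space sV V sW W) (fscale (*)) sU L \<and>
             (\<forall>v\<in>V. \<forall>w\<in>W. L (ten sV V sW W v w) = f v w)"
proof -
  have "\<exists>L. linear_on (module.span (fscale (*)) ((\<lambda>(v, w). ten sV V sW W v w) ` (V \<times> W)))
              (fscale (*)) sU L \<and>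
            (\<forall>p\<in>V \<times> W. L ((\<lambda>(v, w). ten sV V sW W v w) p) = (\<lambda>(v, w). f v w) p)"
  proof (rule evaluation_span_universal[OF assms(1)])
    fix \<xi> assume l: "Vector_Spaces.linear sU (*) \<xi>"
    have "bilinear_on sV V sW W (*) (\<lambda>v w. \<xi> (f v w))"
      unfolding bilinear_on_def
      by (intro conjI ballI linear_on_compose[OF l]) (use assms(2) in \<open>auto simp: bilinear_on_def\<close>)
    then show "\<exists>F. \<forall>p\<in>V \<times> W. (\<lambda>(v, w). ten sV V sW W v w) p F = \<xi> ((\<lambda>(v, w). f v w) p)"
      by (intro exI[of _ "\<lambda>v w. \<xi> (f v w)"]) (simp add: ten_def split_beta)
  qed
  moreover have "(\<lambda>(v, w). ten sV V sW W v w) ` (V \<times> W) = {ten sV V sW W v w | v w. v \<in> V \<and> w \<in> W}"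
    by auto
  ultimately show ?thesis unfolding tensor_space_def by auto
qed

lemma tensors_universal:
  assumes "vector_space sU" "multilinear_on s Vs sU f"
  shows "\<exists>L. linear_on (tensors_space s Vs) (fscale (*)) sU L \<and>
             (\<forall>xs. list_all2 (\<in>) xs Vs \<longrightarrow> L (tens s Vs xs) = f xs)"
proof -
  have "\<exists>L. linear_on (module.span (fscale (*)) (tens s Vs ` {xs. list_all2 (\<in>) xs Vs}))
              (fscale (*)) sU L \<and>
            (\<forall>xs\<in>{xs. list_all2 (\<in>) xs Vs}. L (tens s Vs xs) = f xs)"
  proof (rule evaluation_span_universal[OF assms(1)])
    fix \<xi> assume l: "Vector_Spaces.linear sU (*) \<xi>"
    have "multilinear_on s Vs (*) (\<lambda>xs. \<xi> (f xs))"
      using assms(2) linear_on_compose[OF l] unfolding multilinear_on_def by blast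
    then show "\<exists>F. \<forall>xs\<in>{xs. list_all2 (\<in>) xs Vs}. tens s Vs xs F = \<xi> (f xs)"
      by (intro exI[of _ "\<lambda>xs. \<xi> (f xs)"]) (simp add: tens_def)
  qed
  moreover have "tens s Vs ` {xs. list_all2 (\<in>) xs Vs} = {tens s Vs xs | xs. list_all2 (\<in>) xs Vs}"
    by auto
  ultimately show ?thesis unfolding tensors_space_def by auto
qed

text \<open>A chosen expression of a tensor as a finite sum of pure tensors.\<close>

definition tensor_rep ::
  "('k::field \<Rightarrow> 'a \<Rightarrow> 'a) \<Rightarrow> 'a set \<Rightarrow> ('k \<Rightarrow> 'b \<Rightarrow> 'b) \<Rightarrow> 'b set \<Rightarrow>
   ('k, 'a::ab_group_add, 'b::ab_group_add) tensor \<Rightarrow> ('a \<times> 'b) list" where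
  "tensor_rep sV V sW W t =
     (SOME xs. set xs \<subseteq> V \<times> W \<and> t = (\<Sum>(v, w)\<leftarrow>xs. ten sV V sW W v w))"

text \<open>The linear map on the span of \<open>e ` G\<close> that sends \<open>e p\<close> to \<open>g p\<close> for all \<open>p \<in> G\<close>.\<close>

definition lin_ext ::
  "('k::field \<Rightarrow> 'v \<Rightarrow> 'v) \<Rightarrow> ('k \<Rightarrow> 'w \<Rightarrow> 'w) \<Rightarrow> 'p set \<Rightarrow> ('p \<Rightarrow> 'v::ab_group_add) \<Rightarrow>
   ('p \<Rightarrow> 'w::ab_group_add) \<Rightarrow> 'v \<Rightarrow> 'w" where
  "lin_ext sV sW G e g =
     (SOME L. linear_on (module.span sV (e ` G)) sV sW L \<and> (\<forall>p\<in>G. L (e p) = g p))"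

definition direct_sum :: "'i set \<Rightarrow> ('i \<Rightarrow> 'v set) \<Rightarrow> ('i \<Rightarrow> 'v::zero) set" where
  "direct_sum I V =
     {x. (\<forall>i\<in>I. x i \<in> V i) \<and> (\<forall>i. i \<notin> I \<longrightarrow> x i = 0) \<and> finite {i. x i \<noteq> 0}}"

definition single :: "'i \<Rightarrow> 'v \<Rightarrow> 'i \<Rightarrow> 'v::zero" where
  "single i v = (\<lambda>j. if j = i then v else 0)"


section \<open>Hopf algebras and SAYD modules\<close>

record ('k, 'h) hopf =
  hscale :: "'k \<Rightarrow> 'h \<Rightarrow> 'h"
  cop :: "'h \<Rightarrow> ('k, 'h, 'h) tensor"
  counit :: "'h \<Rightarrow> 'k"
  antipode :: "'h \<Rightarrow> 'h"

abbreviation hten :: "('k::field, 'h::ring_1) hopf \<Rightarrow> 'h \<Rightarrow> 'h \<Rightarrow> ('k, 'h, 'h) tensor" where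
  "hten H \<equiv> ten (hscale H) UNIV (hscale H) UNIV"

text \<open>Sweedler notation: \<open>\<Sum>(a, b)\<leftarrow>sw H h. E a b\<close> stands for \<open>E h\<^sub>1 h\<^sub>2\<close>, \<open>E\<close> bilinear, and
  \<open>\<Sum>hs\<leftarrow>sweedler H n h. E hs\<close> stands for \<open>E [h\<^sub>1, \<dots>, h\<^sub>n\<^sub>+\<^sub>1]\<close>, \<open>E\<close> multilinear.\<close>

definition sw :: "('k::field, 'h::ring_1) hopf \<Rightarrow> 'h \<Rightarrow> ('h \<times> 'h) list" where
  "sw H h = tensor_rep (hscale H) UNIV (hscale H) UNIV (cop H h)"

fun sweedler :: "('k::field, 'h::ring_1) hopf \<Rightarrow> nat \<Rightarrow> 'h \<Rightarrow> 'h list list" where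
  "sweedler H 0 h = [[h]]"
| "sweedler H (Suc n) h = concat (map (\<lambda>(a, b). map ((#) a) (sweedler H n b)) (sw H h))"

locale hopf_algebra = vector_space "hscale H"
  for H :: "('k::field, 'h::ring_1) hopf" +
  assumes mult_bilinear: "bilinear_on (hscale H) UNIV (hscale H) UNIV (hscale H) (*)"
    and cop_closed: "cop H h \<in> tensor_space (hscale H) UNIV (hscale H) UNIV"
    and cop_linear: "linear_on UNIV (hscale H) (fscale (*)) (cop H)"
    and coassoc:
      "(\<Sum>(a, b)\<leftarrow>sw H h. \<Sum>(c, d)\<leftarrow>sw H a. tens (hscale H) [UNIV, UNIV, UNIV] [c, d, b])
       = (\<Sum>(a, b)\<leftarrow>sw H h. \<Sum>(c, d)\<leftarrow>sw H b. tens (hscale H) [UNIV, UNIV, UNIV] [a, c, d])"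
    and counit_linear: "linear_on UNIV (hscale H) (*) (counit H)"
    and counit_left: "(\<Sum>(a, b)\<leftarrow>sw H h. hscale H (counit H a) b) = h"
    and counit_right: "(\<Sum>(a, b)\<leftarrow>sw H h. hscale H (counit H b) a) = h"
    and cop_one: "cop H 1 = hten H 1 1"
    and cop_mult:
      "cop H (g * h) = (\<Sum>(a, b)\<leftarrow>sw H g. \<Sum>(c, d)\<leftarrow>sw H h. hten H (a * c) (b * d))"
    and counit_one: "counit H 1 = 1"
    and counit_mult: "counit H (g * h) = counit H g * counit H h"
    and antipode_linear: "linear_on UNIV (hscale H) (hscale H) (antipode H)"
    and antipode_left: "(\<Sum>(a, b)\<leftarrow>sw H h. antipode H a * b) = hscale H (counit H h) 1"
    and antipode_right: "(\<Sum>(a, b)\<leftarrow>sw H h. a * antipode H b) = hscale H (counit H h) 1"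
    and antipode_bij: "bij (antipode H)"

record ('k, 'h, 'm) sayd =
  mscale :: "'k \<Rightarrow> 'm \<Rightarrow> 'm"
  mact :: "'m \<Rightarrow> 'h \<Rightarrow> 'm"
  coact :: "'m \<Rightarrow> ('k, 'h, 'm) tensor"

text \<open>Sweedler notation for \<open>m\<^sub>(\<^sub>-\<^sub>1\<^sub>) \<otimes> m\<^sub>(\<^sub>0\<^sub>)\<close>.\<close>

definition csw ::
  "('k::field, 'h::ring_1) hopf \<Rightarrow> ('k, 'h, 'm::ab_group_add) sayd \<Rightarrow> 'm \<Rightarrow> ('h \<times> 'm) list" where
  "csw H M m = tensor_rep (hscale H) UNIV (mscale M) UNIV (coact M m)"

abbreviation hmten ::
  "('k::field, 'h::ring_1) hopf \<Rightarrow> ('k, 'h, 'm::ab_group_add) sayd \<Rightarrow> 'h \<Rightarrow> 'm \<Rightarrow> ('k, 'h, 'm) tensor"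
  where "hmten H M \<equiv> ten (hscale H) UNIV (mscale M) UNIV"

abbreviation hhmten ::
  "('k::field, 'h::ring_1) hopf \<Rightarrow> ('k, 'h, 'm::ab_group_add) sayd \<Rightarrow> 'h \<Rightarrow> 'h \<Rightarrow> 'm \<Rightarrow>
   ('k, 'h, ('k, 'h, 'm) tensor) tensor"
  where "hhmten H M a b m \<equiv>
    ten (hscale H) UNIV (fscale (*)) (tensor_space (hscale H) UNIV (mscale M) UNIV) a (hmten H M b m)"

locale sayd_module = hopf_algebra H + M: vector_space "mscale M"
  for H :: "('k::field, 'h::ring_1) hopf" and M :: "('k, 'h, 'm::ab_group_add) sayd" +
  assumes mact_bilinear: "bilinear_on (mscale M) UNIV (hscale H) UNIV (mscale M) (mact M)"
    and mact_one: "mact M m 1 = m"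
    and mact_mult: "mact M m (g * h) = mact M (mact M m g) h"
    and coact_closed: "coact M m \<in> tensor_space (hscale H) UNIV (mscale M) UNIV"
    and coact_linear: "linear_on UNIV (mscale M) (fscale (*)) (coact M)"
    and coact_coassoc:
      "(\<Sum>(a, n)\<leftarrow>csw H M m. \<Sum>(b, c)\<leftarrow>sw H a. hhmten H M b c n)
       = (\<Sum>(a, n)\<leftarrow>csw H M m. \<Sum>(b, l)\<leftarrow>csw H M n. hhmten H M a b l)"
    and coact_counit: "(\<Sum>(a, n)\<leftarrow>csw H M m. mscale M (counit H a) n) = m"
    and anti_yetter_drinfeld:
      "coact M (mact M m h) =
         (\<Sum>(a, n)\<leftarrow>csw H M m. \<Sum>(h1, h')\<leftarrow>sw H h. \<Sum>(h2, h3)\<leftarrow>sw H h'.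
            hmten H M (antipode H h3 * a * h1) (mact M n h2))"
    and stable: "(\<Sum>(a, n)\<leftarrow>csw H M m. mact M n a) = m"


section \<open>H-semicategories\<close>

text \<open>
  \<open>Hom C X Y\<close> is the space of morphisms from \<open>X\<close> to \<open>Y\<close>, a subspace of one ambient vector space
  (no disjointness is required, so all operations are indexed by objects).
  \<open>cmp C X Y Z g f\<close> is the composite \<open>gf\<close> of \<open>f\<close> from \<open>X\<close> to \<open>Y\<close> and \<open>g\<close> from \<open>Y\<close> to \<open>Z\<close>, and
  \<open>act C X Y h f\<close> is \<open>hf\<close> for \<open>f\<close> from \<open>X\<close> to \<open>Y\<close>.
\<close>

record ('k, 'h, 'o, 'a) hsemicat =
  Ob :: "'o set"
  Hom :: "'o \<Rightarrow> 'o \<Rightarrow> 'a set"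
  scal :: "'k \<Rightarrow> 'a \<Rightarrow> 'a"
  cmp :: "'o \<Rightarrow> 'o \<Rightarrow> 'o \<Rightarrow> 'a \<Rightarrow> 'a \<Rightarrow> 'a"
  act :: "'o \<Rightarrow> 'o \<Rightarrow> 'h \<Rightarrow> 'a \<Rightarrow> 'a"

locale linear_semicategory = vector_space "scal C"
  for C :: "('k::field, 'h, 'o, 'a::ab_group_add, 'z) hsemicat_scheme" +
  assumes Hom_subspace: "\<lbrakk>X \<in> Ob C; Y \<in> Ob C\<rbrakk> \<Longrightarrow> module.subspace (scal C) (Hom C X Y)"
    and cmp_closed:
      "\<lbrakk>X \<in> Ob C; Y \<in> Ob C; Z \<in> Ob C; g \<in> Hom C Y Z; f \<in> Hom C X Y\<rbrakk> \<Longrightarrow> cmp C X Y Z g f \<in> Hom C X Z"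
    and cmp_bilinear:
      "\<lbrakk>X \<in> Ob C; Y \<in> Ob C; Z \<in> Ob C\<rbrakk> \<Longrightarrow>
         bilinear_on (scal C) (Hom C Y Z) (scal C) (Hom C X Y) (scal C) (cmp C X Y Z)"
    and cmp_assoc:
      "\<lbrakk>W \<in> Ob C; X \<in> Ob C; Y \<in> Ob C; Z \<in> Ob C; g \<in> Hom C Y Z; f \<in> Hom C X Y; e \<in> Hom C W X\<rbrakk> \<Longrightarrow>
         cmp C W X Z (cmp C X Y Z g f) e = cmp C W Y Z g (cmp C W X Y f e)"

locale H_semicategory = hopf_algebra H + C: linear_semicategory C
  for H :: "('k::field, 'h::ring_1) hopf"
    and C :: "('k, 'h, 'o, 'a::ab_group_add, 'z) hsemicat_scheme" +
  assumes act_closed: "\<lbrakk>X \<in> Ob C; Y \<in> Ob C; f \<in> Hom C X Y\<rbrakk> \<Longrightarrow> act C X Y h f \<in> Hom C X Y"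
    and act_bilinear:
      "\<lbrakk>X \<in> Ob C; Y \<in> Ob C\<rbrakk> \<Longrightarrow>
         bilinear_on (hscale H) UNIV (scal C) (Hom C X Y) (scal C) (act C X Y)"
    and act_one: "\<lbrakk>X \<in> Ob C; Y \<in> Ob C; f \<in> Hom C X Y\<rbrakk> \<Longrightarrow> act C X Y 1 f = f"
    and act_mult:
      "\<lbrakk>X \<in> Ob C; Y \<in> Ob C; f \<in> Hom C X Y\<rbrakk> \<Longrightarrow> act C X Y (h * h') f = act C X Y h (act C X Y h' f)"
    and act_cmp:
      "\<lbrakk>X \<in> Ob C; Y \<in> Ob C; Z \<in> Ob C; g \<in> Hom C Y Z; f \<in> Hom C X Y\<rbrakk> \<Longrightarrow>
         act C X Z h (cmp C X Y Z g f) = (\<Sum>(a, b)\<leftarrow>sw H h. cmp C X Y Z (act C Y Z a g) (act C X Y b f))"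

locale H_category = H_semicategory H C
  for H :: "('k::field, 'h::ring_1) hopf"
    and C :: "('k, 'h, 'o, 'a::ab_group_add, 'z) hsemicat_scheme" +
  assumes identities:
    "X \<in> Ob C \<Longrightarrow> \<exists>e\<in>Hom C X X.
       (\<forall>Y\<in>Ob C. \<forall>f\<in>Hom C X Y. cmp C X X Y f e = f) \<and>
       (\<forall>Y\<in>Ob C. \<forall>f\<in>Hom C Y X. cmp C Y X X e f = f) \<and>
       (\<forall>h. act C X X h e = scal C (counit H h) e)"

text \<open>H-linear semifunctors, given by an object map and morphism maps.\<close>

definition H_semifunctor ::
  "('k::field, 'h, 'o, 'a::ab_group_add, 'z) hsemicat_scheme \<Rightarrow>
   ('k, 'h, 'p, 's::ab_group_add, 'y) hsemicat_scheme \<Rightarrow>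
   ('o \<Rightarrow> 'p) \<Rightarrow> ('o \<Rightarrow> 'o \<Rightarrow> 'a \<Rightarrow> 's) \<Rightarrow> bool" where
  "H_semifunctor C D \<rho>o \<rho> \<longleftrightarrow>
     (\<forall>X\<in>Ob C. \<rho>o X \<in> Ob D) \<and>
     (\<forall>X\<in>Ob C. \<forall>Y\<in>Ob C.
        \<rho> X Y ` Hom C X Y \<subseteq> Hom D (\<rho>o X) (\<rho>o Y) \<and>
        linear_on (Hom C X Y) (scal C) (scal D) (\<rho> X Y) \<and>
        (\<forall>h. \<forall>f\<in>Hom C X Y. \<rho> X Y (act C X Y h f) = act D (\<rho>o X) (\<rho>o Y) h (\<rho> X Y f))) \<and>
     (\<forall>X\<in>Ob C. \<forall>Y\<in>Ob C. \<forall>Z\<in>Ob C. \<forall>g\<in>Hom C Y Z. \<forall>f\<in>Hom C X Y.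
        \<rho> X Z (cmp C X Y Z g f) = cmp D (\<rho>o X) (\<rho>o Y) (\<rho>o Z) (\<rho> Y Z g) (\<rho> X Y f))"

text \<open>
  A path is a list \<open>[X\<^sub>0, \<dots>, X\<^sub>p]\<close> of objects with morphisms \<open>[f\<^sub>0, \<dots>, f\<^sub>p\<^sub>-\<^sub>1]\<close>, where \<open>f\<^sub>i\<close> goes
  \<^emph>\<open>from\<close> \<open>X\<^sub>i\<^sub>+\<^sub>1\<close> \<^emph>\<open>to\<close> \<open>X\<^sub>i\<close>.
\<close>

definition path_homs :: "('k, 'h, 'o, 'a, 'z) hsemicat_scheme \<Rightarrow> 'o list \<Rightarrow> 'a set list" where
  "path_homs C Xs = map (\<lambda>i. Hom C (Xs ! Suc i) (Xs ! i)) [0..<length Xs - 1]"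

definition path_act ::
  "('k, 'h, 'o, 'a, 'z) hsemicat_scheme \<Rightarrow> 'o list \<Rightarrow> 'h list \<Rightarrow> 'a list \<Rightarrow> 'a list" where
  "path_act C Xs hs fs =
     map (\<lambda>i. act C (Xs ! Suc i) (Xs ! i) (hs ! i) (fs ! i)) [0..<length fs]"

fun path_cmp ::
  "('k, 'h, 'o, 'a::zero, 'z) hsemicat_scheme \<Rightarrow> 'o list \<Rightarrow> 'a list \<Rightarrow> 'a" where
  "path_cmp C [X, Y] [f] = f"
| "path_cmp C (X # Y # Z # Xs) (f # g # fs) =
     cmp C (last (Z # Xs)) Y X f (path_cmp C (Y # Z # Xs) (g # fs))"
| "path_cmp C _ _ = 0"

definition drop_nth :: "nat \<Rightarrow> 'a list \<Rightarrow> 'a list" where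
  "drop_nth i xs = take i xs @ drop (Suc i) xs"

text \<open>Compose \<open>f\<^sub>i\<close> and \<open>f\<^sub>i\<^sub>+\<^sub>1\<close>; the object \<open>X\<^sub>i\<^sub>+\<^sub>1\<close> disappears from the path.\<close>

definition merge ::
  "('k, 'h, 'o, 'a, 'z) hsemicat_scheme \<Rightarrow> nat \<Rightarrow> 'o list \<Rightarrow> 'a list \<Rightarrow> 'a list" where
  "merge C i Xs fs =
     take i fs
     @ [cmp C (Xs ! (i + 2)) (Xs ! (i + 1)) (Xs ! i) (fs ! i) (fs ! (i + 1))]
     @ drop (i + 2) fs"


section \<open>The cocyclic complex\<close>

text \<open>
  The direct sum over \<open>[X\<^sub>0, \<dots>, X\<^sub>n]\<close> in \<open>CN\<^sub>n\<close>; the summand belongs to the closed path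
  \<open>[X\<^sub>0, \<dots>, X\<^sub>n, X\<^sub>0]\<close>.
\<close>

type_synonym ('k, 'o, 'a) cn = "'o list \<Rightarrow> ('k, 'a) tensors"

abbreviation cn_scale :: "'k::field \<Rightarrow> ('k, 'o, 'a) cn \<Rightarrow> ('k, 'o, 'a) cn" where
  "cn_scale \<equiv> fscale (fscale (*))"

abbreviation cyc_path :: "'o list \<Rightarrow> 'o list" where
  "cyc_path Xs \<equiv> Xs @ [hd Xs]"

definition CN ::
  "('k::field, 'h, 'o, 'a::ab_group_add, 'z) hsemicat_scheme \<Rightarrow> nat \<Rightarrow> ('k, 'o, 'a) cn set" where
  "CN D n = direct_sum {Xs. length Xs = Suc n \<and> set Xs \<subseteq> Ob D}
              (\<lambda>Xs. tensors_space (scal D) (path_homs D (cyc_path Xs)))"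

definition cn_elem ::
  "('k::field, 'h, 'o, 'a::ab_group_add, 'z) hsemicat_scheme \<Rightarrow> 'o list \<Rightarrow> 'a list \<Rightarrow> ('k, 'o, 'a) cn"
  where "cn_elem D Xs fs = single Xs (tens (scal D) (path_homs D (cyc_path Xs)) fs)"

definition cn_words ::
  "('k::field, 'h, 'o, 'a::ab_group_add, 'z) hsemicat_scheme \<Rightarrow> nat \<Rightarrow> ('o list \<times> 'a list) set" where
  "cn_words D n = {(Xs, fs). length Xs = Suc n \<and> set Xs \<subseteq> Ob D \<and>
                             list_all2 (\<in>) fs (path_homs D (cyc_path Xs))}"

definition cn_act ::
  "('k::field, 'h::ring_1) hopf \<Rightarrow> ('k, 'h, 'o, 'a::ab_group_add, 'z) hsemicat_scheme \<Rightarrow>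
   'h \<Rightarrow> 'o list \<Rightarrow> 'a list \<Rightarrow> ('k, 'o, 'a) cn" where
  "cn_act H D h Xs fs =
     (\<Sum>hs\<leftarrow>sweedler H (length Xs - 1) h. cn_elem D Xs (path_act D (cyc_path Xs) hs fs))"

abbreviation mcn_space ::
  "('k::field, 'h, 'm::ab_group_add) sayd \<Rightarrow> ('k, 'h, 'o, 'a::ab_group_add, 'z) hsemicat_scheme \<Rightarrow>
   nat \<Rightarrow> ('k, 'm, ('k, 'o, 'a) cn) tensor set" where
  "mcn_space M D n \<equiv> tensor_space (mscale M) UNIV cn_scale (CN D n)"

abbreviation mcn_ten ::
  "('k::field, 'h, 'm::ab_group_add) sayd \<Rightarrow> ('k, 'h, 'o, 'a::ab_group_add, 'z) hsemicat_scheme \<Rightarrow>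
   nat \<Rightarrow> 'm \<Rightarrow> ('k, 'o, 'a) cn \<Rightarrow> ('k, 'm, ('k, 'o, 'a) cn) tensor" where
  "mcn_ten M D n \<equiv> ten (mscale M) UNIV cn_scale (CN D n)"

type_synonym ('k, 'm, 'o, 'a) cochain = "('k, 'm, ('k, 'o, 'a) cn) tensor \<Rightarrow> 'k"

text \<open>Cochains are total functions whose values outside \<open>M \<otimes> CN\<^sub>n\<close> are irrelevant.\<close>

definition cochains ::
  "('k::field, 'h::ring_1) hopf \<Rightarrow> ('k, 'h, 'm::ab_group_add) sayd \<Rightarrow>
   ('k, 'h, 'o, 'a::ab_group_add, 'z) hsemicat_scheme \<Rightarrow> nat \<Rightarrow> ('k, 'm, 'o, 'a) cochain set" where
  "cochains H M D n =
     {\<phi>. linear_on (mcn_space M D n) (fscale (*)) (*) \<phi> \<and>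
         (\<forall>m h. \<forall>(Xs, fs)\<in>cn_words D n.
            \<phi> (\<Sum>(a, b)\<leftarrow>sw H h. mcn_ten M D n (mact M m a) (cn_act H D (antipode H b) Xs fs))
            = counit H h * \<phi> (mcn_ten M D n m (cn_elem D Xs fs)))}"

text \<open>The linear form on \<open>M \<otimes> CN\<^sub>n\<close> with value \<open>g m Xs fs\<close> on \<open>m \<otimes> f\<^sup>0 \<otimes> \<dots> \<otimes> f\<^sup>n\<close>.\<close>

definition cochain_of ::
  "('k::field, 'h, 'm::ab_group_add) sayd \<Rightarrow> ('k, 'h, 'o, 'a::ab_group_add, 'z) hsemicat_scheme \<Rightarrow>
   nat \<Rightarrow> ('m \<Rightarrow> 'o list \<Rightarrow> 'a list \<Rightarrow> 'k) \<Rightarrow> ('k, 'm, 'o, 'a) cochain" where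
  "cochain_of M D n g =
     lin_ext (fscale (*)) (*) (UNIV \<times> cn_words D n)
       (\<lambda>(m, Xs, fs). mcn_ten M D n m (cn_elem D Xs fs)) (\<lambda>(m, Xs, fs). g m Xs fs)"

text \<open>
  \<open>coface H M D n i\<close> is \<open>\<delta>\<^sub>i\<close> from degree \<open>n - 1\<close> to degree \<open>n\<close> (\<open>n \<ge> 1\<close>, \<open>i \<le> n\<close>).
  For \<open>i = n\<close> the morphism \<open>(S\<inverse>(m\<^sub>(\<^sub>-\<^sub>1\<^sub>)) f\<^sup>n) f\<^sup>0\<close> goes from \<open>X\<^sub>1\<close> via \<open>X\<^sub>0\<close> to \<open>X\<^sub>n\<close>, so the resulting
  closed path is \<open>[X\<^sub>n, X\<^sub>1, \<dots>, X\<^sub>n\<^sub>-\<^sub>1, X\<^sub>n]\<close>.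
\<close>

definition coface ::
  "('k::field, 'h::ring_1) hopf \<Rightarrow> ('k, 'h, 'm::ab_group_add) sayd \<Rightarrow>
   ('k, 'h, 'o, 'a::ab_group_add, 'z) hsemicat_scheme \<Rightarrow> nat \<Rightarrow> nat \<Rightarrow>
   ('k, 'm, 'o, 'a) cochain \<Rightarrow> ('k, 'm, 'o, 'a) cochain" where
  "coface H M D n i \<phi> = cochain_of M D n (\<lambda>m Xs fs.
     if i < n
     then \<phi> (mcn_ten M D (n - 1) m
               (cn_elem D (drop_nth (Suc i) Xs) (merge D i (cyc_path Xs) fs)))
     else \<phi> (\<Sum>(a, m0)\<leftarrow>csw H M m. mcn_ten M D (n - 1) m0
               (cn_elem D (last Xs # butlast (tl Xs))
                  (cmp D (cyc_path Xs ! 1) (hd Xs) (last Xs)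
                     (act D (hd Xs) (last Xs) (inv (antipode H) a) (last fs)) (hd fs)
                   # butlast (tl fs)))))"

definition cyclic_op ::
  "('k::field, 'h::ring_1) hopf \<Rightarrow> ('k, 'h, 'm::ab_group_add) sayd \<Rightarrow>
   ('k, 'h, 'o, 'a::ab_group_add, 'z) hsemicat_scheme \<Rightarrow> nat \<Rightarrow>
   ('k, 'm, 'o, 'a) cochain \<Rightarrow> ('k, 'm, 'o, 'a) cochain" where
  "cyclic_op H M D n \<phi> = cochain_of M D n (\<lambda>m Xs fs.
     \<phi> (\<Sum>(a, m0)\<leftarrow>csw H M m. mcn_ten M D n m0
          (cn_elem D (last Xs # butlast Xs)
             (act D (hd Xs) (last Xs) (inv (antipode H) a) (last fs) # butlast fs))))"

definition hochschild_b ::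
  "('k::field, 'h::ring_1) hopf \<Rightarrow> ('k, 'h, 'm::ab_group_add) sayd \<Rightarrow>
   ('k, 'h, 'o, 'a::ab_group_add, 'z) hsemicat_scheme \<Rightarrow> nat \<Rightarrow>
   ('k, 'm, 'o, 'a) cochain \<Rightarrow> ('k, 'm, 'o, 'a) cochain" where
  "hochschild_b H M D n \<phi> = (\<lambda>t. \<Sum>i\<le>Suc n. (- 1) ^ i * coface H M D (Suc n) i \<phi> t)"

definition cyclic_cocycles ::
  "('k::field, 'h::ring_1) hopf \<Rightarrow> ('k, 'h, 'm::ab_group_add) sayd \<Rightarrow>
   ('k, 'h, 'o, 'a::ab_group_add, 'z) hsemicat_scheme \<Rightarrow> nat \<Rightarrow> ('k, 'm, 'o, 'a) cochain set" where
  "cyclic_cocycles H M D n =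
     {\<phi> \<in> cochains H M D n.
        (\<forall>t\<in>mcn_space M D (Suc n). hochschild_b H M D n \<phi> t = 0) \<and>
        (\<forall>t\<in>mcn_space M D n. \<phi> t = (- 1) ^ n * cyclic_op H M D n \<phi> t)}"


section \<open>DGH-semicategories, traces and cycles\<close>

text \<open>\<open>Hom S X Y\<close> is the total Hom space, the direct sum of its subspaces \<open>HomD S n X Y\<close> of degree \<open>n\<close>.\<close>

record ('k, 'h, 'o, 'a) dgh = "('k, 'h, 'o, 'a) hsemicat" +
  HomD :: "nat \<Rightarrow> 'o \<Rightarrow> 'o \<Rightarrow> 'a set"
  diff :: "'o \<Rightarrow> 'o \<Rightarrow> 'a \<Rightarrow> 'a"

locale DGH_semicategory = H_semicategory H S
  for H :: "('k::field, 'h::ring_1) hopf" and S :: "('k, 'h, 'o, 'a::ab_group_add) dgh" +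
  assumes HomD_subspace: "\<lbrakk>X \<in> Ob S; Y \<in> Ob S\<rbrakk> \<Longrightarrow> module.subspace (scal S) (HomD S n X Y)"
    and HomD_subset: "\<lbrakk>X \<in> Ob S; Y \<in> Ob S\<rbrakk> \<Longrightarrow> HomD S n X Y \<subseteq> Hom S X Y"
    and Hom_direct_sum:
      "\<lbrakk>X \<in> Ob S; Y \<in> Ob S; f \<in> Hom S X Y\<rbrakk> \<Longrightarrow>
         \<exists>!x. x \<in> direct_sum UNIV (\<lambda>n. HomD S n X Y) \<and> f = (\<Sum>n\<in>{n. x n \<noteq> 0}. x n)"
    and cmp_degree:
      "\<lbrakk>X \<in> Ob S; Y \<in> Ob S; Z \<in> Ob S; g \<in> HomD S j Y Z; f \<in> HomD S i X Y\<rbrakk> \<Longrightarrow>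
         cmp S X Y Z g f \<in> HomD S (j + i) X Z"
    and act_degree:
      "\<lbrakk>X \<in> Ob S; Y \<in> Ob S; f \<in> HomD S n X Y\<rbrakk> \<Longrightarrow> act S X Y h f \<in> HomD S n X Y"
    and diff_degree:
      "\<lbrakk>X \<in> Ob S; Y \<in> Ob S; f \<in> HomD S n X Y\<rbrakk> \<Longrightarrow> diff S X Y f \<in> HomD S (Suc n) X Y"
    and diff_linear:
      "\<lbrakk>X \<in> Ob S; Y \<in> Ob S\<rbrakk> \<Longrightarrow> linear_on (Hom S X Y) (scal S) (scal S) (diff S X Y)"
    and diff_diff:
      "\<lbrakk>X \<in> Ob S; Y \<in> Ob S; f \<in> Hom S X Y\<rbrakk> \<Longrightarrow> diff S X Y (diff S X Y f) = 0"
    and leibniz: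
      "\<lbrakk>X \<in> Ob S; Y \<in> Ob S; Z \<in> Ob S; g \<in> HomD S j Y Z; f \<in> HomD S i X Y\<rbrakk> \<Longrightarrow>
         diff S X Z (cmp S X Y Z g f)
         = cmp S X Y Z (diff S Y Z g) f + scal S ((- 1) ^ j) (cmp S X Y Z g (diff S X Y f))"
    and diff_act:
      "\<lbrakk>X \<in> Ob S; Y \<in> Ob S; f \<in> Hom S X Y\<rbrakk> \<Longrightarrow>
         diff S X Y (act S X Y h f) = act S X Y h (diff S X Y f)"

definition degree0 :: "('k, 'h, 'o, 'a) dgh \<Rightarrow> ('k, 'h, 'o, 'a) hsemicat" where
  "degree0 S = \<lparr>Ob = Ob S, Hom = HomD S 0, scal = scal S, cmp = cmp S, act = act S\<rparr>"

abbreviation trace_ten ::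
  "('k::field, 'h, 'm::ab_group_add) sayd \<Rightarrow> nat \<Rightarrow> ('k, 'h, 'o, 'a::ab_group_add) dgh \<Rightarrow>
   'o \<Rightarrow> 'm \<Rightarrow> 'a \<Rightarrow> ('k, 'm, 'a) tensor" where
  "trace_ten M n S X \<equiv> ten (mscale M) UNIV (scal S) (HomD S n X X)"

definition closed_graded_trace ::
  "('k::field, 'h::ring_1) hopf \<Rightarrow> ('k, 'h, 'm::ab_group_add) sayd \<Rightarrow> nat \<Rightarrow>
   ('k, 'h, 'o, 'a::ab_group_add) dgh \<Rightarrow> ('o \<Rightarrow> ('k, 'm, 'a) tensor \<Rightarrow> 'k) \<Rightarrow> bool" where
  "closed_graded_trace H M n S T \<longleftrightarrow>
     (\<forall>X\<in>Ob S. linear_on (tensor_space (mscale M) UNIV (scal S) (HomD S n X X)) (fscale (*)) (*) (T X)) \<and>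
     (\<forall>X\<in>Ob S. \<forall>m h. \<forall>f\<in>HomD S n X X.
        T X (\<Sum>(a, b)\<leftarrow>sw H h. trace_ten M n S X (mact M m a) (act S X X (antipode H b) f))
        = counit H h * T X (trace_ten M n S X m f)) \<and>
     (\<forall>X\<in>Ob S. \<forall>m j. \<forall>f\<in>HomD S j X X. Suc j = n \<longrightarrow> T X (trace_ten M n S X m (diff S X X f)) = 0) \<and>
     (\<forall>X\<in>Ob S. \<forall>Y\<in>Ob S. \<forall>m i j. \<forall>g\<in>HomD S i X Y. \<forall>g'\<in>HomD S j Y X. i + j = n \<longrightarrow>
        T X (trace_ten M n S X m (cmp S X Y X g' g))
        = (- 1) ^ (i * j) *
          T Y (\<Sum>(a, m0)\<leftarrow>csw H M m.
                 trace_ten M n S Y m0 (cmp S Y X Y (act S X Y (inv (antipode H) a) g) g')))"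

definition is_cycle ::
  "('k::field, 'h::ring_1) hopf \<Rightarrow> ('k, 'h, 'm::ab_group_add) sayd \<Rightarrow> nat \<Rightarrow>
   ('k, 'h, 'o, 'a::ab_group_add) dgh \<Rightarrow> ('o \<Rightarrow> ('k, 'm, 'a) tensor \<Rightarrow> 'k) \<Rightarrow> bool" where
  "is_cycle H M n S T \<longleftrightarrow> DGH_semicategory H S \<and> closed_graded_trace H M n S T"


section \<open>The universal DG-semicategory\<close>

text \<open>The category obtained by adjoining new units; \<open>(f, \<mu>)\<close> stands for \<open>f + \<mu>\<close>.\<close>

definition adjoin_units ::
  "('k::field, 'h::ring_1) hopf \<Rightarrow> ('k, 'h, 'o, 'a::ab_group_add, 'z) hsemicat_scheme \<Rightarrow>
   ('k, 'h, 'o, 'a \<times> 'k) hsemicat" where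
  "adjoin_units H C =
     \<lparr>Ob = Ob C,
      Hom = (\<lambda>X Y. {(f, \<mu>). f \<in> Hom C X Y \<and> (X \<noteq> Y \<longrightarrow> \<mu> = 0)}),
      scal = (\<lambda>c (f, \<mu>). (scal C c f, c * \<mu>)),
      cmp = (\<lambda>X Y Z (g, \<nu>) (f, \<mu>). (cmp C X Y Z g f + scal C \<nu> f + scal C \<mu> g, \<nu> * \<mu>)),
      act = (\<lambda>X Y h (f, \<mu>). (act C X Y h f, counit H h * \<mu>))\<rparr>"

text \<open>
  \<open>omega_factors H C X Y [X\<^sub>1, \<dots>, X\<^sub>n]\<close> lists the tensor factors of the summand of
  \<open>Hom\<^sup>n\<close> from \<open>X\<close> to \<open>Y\<close> at \<open>(X\<^sub>1, \<dots>, X\<^sub>n)\<close>; all of them are taken inside the category with adjoined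
  units, where \<open>f\<close> is identified with \<open>(f, 0)\<close>.  For \<open>n = 0\<close> the only factor is the original Hom
  space.
\<close>

fun omega_factors ::
  "('k::field, 'h::ring_1) hopf \<Rightarrow> ('k, 'h, 'o, 'a::ab_group_add, 'z) hsemicat_scheme \<Rightarrow>
   'o \<Rightarrow> 'o \<Rightarrow> 'o list \<Rightarrow> ('a \<times> 'k) set list" where
  "omega_factors H C X Y [] = [Hom C X Y \<times> {0}]"
| "omega_factors H C X Y (X1 # Xs) =
     Hom (adjoin_units H C) X1 Y # map (\<lambda>V. V \<times> {0}) (path_homs C (X1 # Xs @ [X]))"

type_synonym ('k, 'o, 'a) omega = "'o list \<Rightarrow> ('k, 'a \<times> 'k) tensors"

abbreviation omega_scale :: "'k::field \<Rightarrow> ('k, 'o, 'a) omega \<Rightarrow> ('k, 'o, 'a) omega" where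
  "omega_scale \<equiv> fscale (fscale (*))"

definition omega_sum ::
  "('k::field, 'h::ring_1) hopf \<Rightarrow> ('k, 'h, 'o, 'a::ab_group_add, 'z) hsemicat_scheme \<Rightarrow>
   'o list set \<Rightarrow> 'o \<Rightarrow> 'o \<Rightarrow> ('k, 'o, 'a) omega set" where
  "omega_sum H C I X Y =
     direct_sum {Xs \<in> I. set Xs \<subseteq> Ob C}
       (\<lambda>Xs. tensors_space (scal (adjoin_units H C)) (omega_factors H C X Y Xs))"

text \<open>
  \<open>omega_elem H C X Y ([X\<^sub>1, \<dots>, X\<^sub>n], [(f\<^sup>0, \<mu>), (f\<^sup>1, 0), \<dots>, (f\<^sup>n, 0)])\<close> is
  \<open>(f\<^sup>0 + \<mu>) df\<^sup>1 \<dots> df\<^sup>n\<close>.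
\<close>

definition omega_words ::
  "('k::field, 'h::ring_1) hopf \<Rightarrow> ('k, 'h, 'o, 'a::ab_group_add, 'z) hsemicat_scheme \<Rightarrow>
   'o \<Rightarrow> 'o \<Rightarrow> ('o list \<times> ('a \<times> 'k) list) set" where
  "omega_words H C X Y =
     {(Xs, xs). set Xs \<subseteq> Ob C \<and> list_all2 (\<in>) xs (omega_factors H C X Y Xs)}"

definition omega_elem ::
  "('k::field, 'h::ring_1) hopf \<Rightarrow> ('k, 'h, 'o, 'a::ab_group_add, 'z) hsemicat_scheme \<Rightarrow>
   'o \<Rightarrow> 'o \<Rightarrow> 'o list \<times> ('a \<times> 'k) list \<Rightarrow> ('k, 'o, 'a) omega" where
  "omega_elem H C X Y = (\<lambda>(Xs, xs).
     single Xs (tens (scal (adjoin_units H C)) (omega_factors H C X Y Xs) xs))"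

abbreviation omega_lin_ext ::
  "('k::field, 'h::ring_1) hopf \<Rightarrow> ('k, 'h, 'o, 'a::ab_group_add, 'z) hsemicat_scheme \<Rightarrow>
   'o \<Rightarrow> 'o \<Rightarrow> ('k \<Rightarrow> 'w \<Rightarrow> 'w) \<Rightarrow> ('o list \<times> ('a \<times> 'k) list \<Rightarrow> 'w::ab_group_add) \<Rightarrow>
   ('k, 'o, 'a) omega \<Rightarrow> 'w" where
  "omega_lin_ext H C X Y sW \<equiv> lin_ext omega_scale sW (omega_words H C X Y) (omega_elem H C X Y)"

text \<open>
  Repeated use of \<open>(df) g = d(fg) - f dg\<close> moves \<open>g\<^sup>0\<close> to the left and gives, with \<open>f\<^sup>p\<^sup>+\<^sup>1 = g\<^sup>0\<close>,
  \<open>(f\<^sup>0 + \<mu>) df\<^sup>1 \<dots> df\<^sup>p \<circ> (g\<^sup>0 + \<nu>) dg\<^sup>1 \<dots> dg\<^sup>q =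
    (\<Sum>i\<le>p. (-1)\<^sup>p\<^sup>-\<^sup>i (f\<^sup>0 + \<mu>) df\<^sup>1 \<dots> d(f\<^sup>i f\<^sup>i\<^sup>+\<^sup>1) \<dots> df\<^sup>p\<^sup>+\<^sup>1 dg\<^sup>1 \<dots> dg\<^sup>q)
    + \<nu> (f\<^sup>0 + \<mu>) df\<^sup>1 \<dots> df\<^sup>p dg\<^sup>1 \<dots> dg\<^sup>q\<close>,
  where the term for \<open>i = 0\<close> starts with the undifferentiated \<open>(f\<^sup>0 + \<mu>) f\<^sup>1\<close>.
  In the last summand \<open>\<nu> \<noteq> 0\<close> forces the first intermediate object of the right factor to be its
  target \<open>Y\<close>.
\<close>

definition omega_word_cmp ::
  "('k::field, 'h::ring_1) hopf \<Rightarrow> ('k, 'h, 'o, 'a::ab_group_add, 'z) hsemicat_scheme \<Rightarrow>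
   'o \<Rightarrow> 'o \<Rightarrow> 'o \<Rightarrow> 'o list \<times> ('a \<times> 'k) list \<Rightarrow> 'o list \<times> ('a \<times> 'k) list \<Rightarrow>
   ('k, 'o, 'a) omega" where
  "omega_word_cmp H C X Y Z = (\<lambda>(Xs, xs) (Ys, ys).
     let p = length Xs; g0 = fst (hd ys); \<nu> = snd (hd ys) in
     (\<Sum>i\<le>p. omega_scale ((- 1) ^ (p - i))
        (omega_elem H C X Z
          (drop_nth i (Xs @ Y # Ys),
           merge (adjoin_units H C) i (Z # Xs @ Y # Ys @ [X]) (xs @ (g0, 0) # tl ys))))
     + omega_scale \<nu> (omega_elem H C X Z (Xs @ Ys, xs @ tl ys)))"

definition omega_word_diff ::
  "('k::field, 'h::ring_1) hopf \<Rightarrow> ('k, 'h, 'o, 'a::ab_group_add, 'z) hsemicat_scheme \<Rightarrow>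
   'o \<Rightarrow> 'o \<Rightarrow> 'o list \<times> ('a \<times> 'k) list \<Rightarrow> ('k, 'o, 'a) omega" where
  "omega_word_diff H C X Y = (\<lambda>(Xs, xs).
     omega_elem H C X Y (Y # Xs, (0, 1) # (fst (hd xs), 0) # tl xs))"

definition omega_word_act ::
  "('k::field, 'h::ring_1) hopf \<Rightarrow> ('k, 'h, 'o, 'a::ab_group_add, 'z) hsemicat_scheme \<Rightarrow>
   'o \<Rightarrow> 'o \<Rightarrow> 'h \<Rightarrow> 'o list \<times> ('a \<times> 'k) list \<Rightarrow> ('k, 'o, 'a) omega" where
  "omega_word_act H C X Y h = (\<lambda>(Xs, xs).
     \<Sum>hs\<leftarrow>sweedler H (length Xs) h.
       omega_elem H C X Y (Xs, path_act (adjoin_units H C) (Y # Xs @ [X]) hs xs))"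

definition Omega ::
  "('k::field, 'h::ring_1) hopf \<Rightarrow> ('k, 'h, 'o, 'a::ab_group_add, 'z) hsemicat_scheme \<Rightarrow>
   ('k, 'h, 'o, ('k, 'o, 'a) omega) dgh" where
  "Omega H C =
     \<lparr>Ob = Ob C,
      Hom = omega_sum H C UNIV,
      scal = omega_scale,
      cmp = (\<lambda>X Y Z x y.
        omega_lin_ext H C Y Z omega_scale
          (\<lambda>v. omega_lin_ext H C X Y omega_scale (omega_word_cmp H C X Y Z v) y) x),
      act = (\<lambda>X Y h. omega_lin_ext H C X Y omega_scale (omega_word_act H C X Y h)),
      HomD = (\<lambda>n. omega_sum H C {Xs. length Xs = n}),
      diff = (\<lambda>X Y. omega_lin_ext H C X Y omega_scale (omega_word_diff H C X Y))\<rparr>"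

text \<open>The element \<open>f\<^sup>0 df\<^sup>1 \<dots> df\<^sup>n\<close> for a closed path \<open>[X\<^sub>0, \<dots>, X\<^sub>n, X\<^sub>0]\<close>.\<close>

definition omega_cyc ::
  "('k::field, 'h::ring_1) hopf \<Rightarrow> ('k, 'h, 'o, 'a::ab_group_add, 'z) hsemicat_scheme \<Rightarrow>
   'o list \<Rightarrow> 'a list \<Rightarrow> ('k, 'o, 'a) omega" where
  "omega_cyc H C Xs fs = omega_elem H C (hd Xs) (hd Xs) (tl Xs, map (\<lambda>f. (f, 0)) fs)"

text \<open>The morphisms \<open>\<rho>(f\<^sup>0), d\<rho>(f\<^sup>1), \<dots>, d\<rho>(f\<^sup>n)\<close> along a path.\<close>

definition rho_path ::
  "('k, 'h, 'p, 's) dgh \<Rightarrow> ('o \<Rightarrow> 'p) \<Rightarrow> ('o \<Rightarrow> 'o \<Rightarrow> 'a \<Rightarrow> 's) \<Rightarrow> 'o list \<Rightarrow> 'a list \<Rightarrow> 's list" where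
  "rho_path S \<rho>o \<rho> Xs fs =
     map (\<lambda>i. let r = \<rho> (Xs ! Suc i) (Xs ! i) (fs ! i) in
              if i = 0 then r else diff S (\<rho>o (Xs ! Suc i)) (\<rho>o (Xs ! i)) r) [0..<length fs]"

text \<open>The morphism maps of the induced semifunctor on the universal DG-semicategory.\<close>

definition rho_hat ::
  "('k::field, 'h::ring_1) hopf \<Rightarrow> ('k, 'h, 'o, 'a::ab_group_add, 'z) hsemicat_scheme \<Rightarrow>
   ('k, 'h, 'p, 's::ab_group_add) dgh \<Rightarrow> ('o \<Rightarrow> 'p) \<Rightarrow> ('o \<Rightarrow> 'o \<Rightarrow> 'a \<Rightarrow> 's) \<Rightarrow>
   'o \<Rightarrow> 'o \<Rightarrow> ('k, 'o, 'a) omega \<Rightarrow> 's" where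
  "rho_hat H C S \<rho>o \<rho> X Y = omega_lin_ext H C X Y (scal S) (\<lambda>(Xs, xs).
     let rs = rho_path S \<rho>o \<rho> (Y # Xs @ [X]) (map fst xs) in
     path_cmp S (map \<rho>o (Y # Xs @ [X])) rs
     + scal S (snd (hd xs)) (path_cmp S (map \<rho>o (Xs @ [X])) (tl rs)))"

text \<open>\<open>\<phi>\<close> is the character of the cycle \<open>(S, T)\<close> over \<open>D\<close> given by \<open>\<rho>\<close>.\<close>

definition is_character_of ::
  "('k::field, 'h::ring_1) hopf \<Rightarrow> ('k, 'h, 'm::ab_group_add) sayd \<Rightarrow>
   ('k, 'h, 'o, 'a::ab_group_add, 'z) hsemicat_scheme \<Rightarrow> nat \<Rightarrow> ('k, 'm, 'o, 'a) cochain \<Rightarrow>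
   ('k, 'h, 'p, 's::ab_group_add) dgh \<Rightarrow> ('p \<Rightarrow> ('k, 'm, 's) tensor \<Rightarrow> 'k) \<Rightarrow>
   ('o \<Rightarrow> 'p) \<Rightarrow> ('o \<Rightarrow> 'o \<Rightarrow> 'a \<Rightarrow> 's) \<Rightarrow> bool" where
  "is_character_of H M D n \<phi> S T \<rho>o \<rho> \<longleftrightarrow>
     is_cycle H M n S T \<and> H_semifunctor D (degree0 S) \<rho>o \<rho> \<and>
     (\<forall>m. \<forall>(Xs, fs)\<in>cn_words D n.
        \<phi> (mcn_ten M D n m (cn_elem D Xs fs))
          = T (\<rho>o (hd Xs)) (trace_ten M n S (\<rho>o (hd Xs)) m
                (rho_hat H D S \<rho>o \<rho> (hd Xs) (hd Xs) (omega_cyc H D Xs fs))) \<and>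
        T (\<rho>o (hd Xs)) (trace_ten M n S (\<rho>o (hd Xs)) m
                (rho_hat H D S \<rho>o \<rho> (hd Xs) (hd Xs) (omega_cyc H D Xs fs)))
          = T (\<rho>o (hd Xs)) (trace_ten M n S (\<rho>o (hd Xs)) m
                (path_cmp S (map \<rho>o (cyc_path Xs)) (rho_path S \<rho>o \<rho> (cyc_path Xs) fs))))"

end

theory Submission
  imports Defs
begin

text \<open>
  The Hom spaces of \<open>\<Omega>\<close> are spanned by the words \<open>W = f\<^sup>0 df\<^sup>1 \<dots> df\<^sup>n\<close> and \<open>U = df\<^sup>0 \<dots> df\<^sup>n = dW\<close>, and these
  are generated from degree 0 by \<open>d\<close> and by left multiplication with morphisms. Since
  \<open>(df) v = d(f v) - f dv\<close>, composition is determined by these two operations, and every identity of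
  the DGH-semicategory \<open>\<Omega>\<close> and of the functor \<open>\<rho>\<close>-hat follows by induction over the generation of its
  leftmost factor.

  A character of a cycle yields a trace on \<open>\<Omega>\<close> by pulling back along \<open>\<rho>\<close>-hat; conversely \<open>\<Omega>\<close> itself,
  with the inclusion of \<open>\<D>\<close> in degree 0, is a cycle. Given a trace, the telescoping formula for
  \<open>(f\<^sup>0 df\<^sup>1 \<dots> df\<^sup>n) f\<^sup>n\<^sup>+\<^sup>1\<close> turns the trace property for a factor of degree 0 into \<open>b\<phi> = 0\<close>, and the one for a
  factor \<open>df\<^sup>n\<close>, together with closedness, into cyclicity; for \<open>n = 0\<close> there is no such factor, and a unit of
  \<open>\<D>\<close> takes its place. Given a cocycle, put
  \<open>T(m \<otimes> f\<^sup>0 df\<^sup>1 \<dots> df\<^sup>n) = \<phi>(m \<otimes> f\<^sup>0 \<otimes> \<dots> \<otimes> f\<^sup>n)\<close> and \<open>T(m \<otimes> df\<^sup>1 \<dots> df\<^sup>n) = 0\<close>. The trace identity for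
  \<open>g' g\<close> is multiplicative in \<open>g\<close>, because \<open>S\<^sup>-\<^sup>1\<close> reverses the coproduct and the coaction is
  coassociative; so it suffices to check it for \<open>g = f\<close> and \<open>g = df\<close>.
\<close>

section \<open>Linear algebra\<close>

text \<open>Two kinds of choice shape the proof. The operations of \<Omega> are linear extensions
  picked by Hilbert choice, so a formula on words means nothing until a linear map with those values
  is exhibited. A Sweedler sum runs over a chosen representative of a tensor, so it may be
  transformed only inside an expression that is linear in every leg. Most side conditions are of one
  of these two kinds. The explicit composition formula is an alternating sum over merged words and
  resists induction. Hence left multiplication operators are built recursively, where linearity is
  visible, and the formula is recognised as their closed form; the alternating sum returns only when
  a form is evaluated on a product with a morphism of degree 0. A unit can occur only in the first
  factor of a word and only if the two objects there agree; splitting it off yields the two families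
  of words and confines the case distinctions on objects to a few lemmas. Inductions over the left
  factor carry its degree because of the signs, and quantify over the right factor because the rule
  for \<open>(df) v\<close> uses the hypothesis at \<open>v\<close> and at
  \<open>dv\<close>.\<close>

lemma subspace_closed:
  assumes "vector_space s" "module.subspace s V"
  shows "0 \<in> V" "x \<in> V \<Longrightarrow> y \<in> V \<Longrightarrow> x + y \<in> V" "x \<in> V \<Longrightarrow> s c x \<in> V"
    "(\<And>i. i \<in> set is \<Longrightarrow> g i \<in> V) \<Longrightarrow> (\<Sum>i\<leftarrow>is. g i) \<in> V"
    "(\<And>i. i \<in> I \<Longrightarrow> g' i \<in> V) \<Longrightarrow> sum g' I \<in> V"
proof -
  interpret vector_space s by fact
  show "0 \<in> V" "x \<in> V \<Longrightarrow> y \<in> V \<Longrightarrow> x + y \<in> V" "x \<in> V \<Longrightarrow> s c x \<in> V"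
    using assms(2) by (auto simp: subspace_def)
  show "(\<And>i. i \<in> set is \<Longrightarrow> g i \<in> V) \<Longrightarrow> (\<Sum>i\<leftarrow>is. g i) \<in> V"
    by (induction "is") (use assms(2) in \<open>auto simp: subspace_def\<close>)
  show "(\<And>i. i \<in> I \<Longrightarrow> g' i \<in> V) \<Longrightarrow> sum g' I \<in> V"
    by (rule subspace_sum[OF assms(2)])
qed

lemma linear_onI:
  assumes "\<And>x y. x \<in> V \<Longrightarrow> y \<in> V \<Longrightarrow> f (x + y) = f x + f y" "\<And>c x. x \<in> V \<Longrightarrow> f (s c x) = s' c (f x)"
  shows "linear_on V s s' f"
  using assms by (simp add: linear_on_def)

lemma linear_on_addD: "linear_on V s s' f \<Longrightarrow> x \<in> V \<Longrightarrow> y \<in> V \<Longrightarrow> f (x + y) = f x + f y"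
  and linear_on_scaleD: "linear_on V s s' f \<Longrightarrow> x \<in> V \<Longrightarrow> f (s c x) = s' c (f x)"
  by (simp_all add: linear_on_def)

lemma linear_on_zero: "linear_on V s s' f \<Longrightarrow> 0 \<in> V \<Longrightarrow> f 0 = 0"
  using linear_on_addD[of V s s' f 0 0] by simp

lemma linear_on_sum_list:
  assumes "linear_on V s s' f" "vector_space s" "module.subspace s V" "\<And>i. i \<in> set is \<Longrightarrow> g i \<in> V"
  shows "f (\<Sum>i\<leftarrow>is. g i) = (\<Sum>i\<leftarrow>is. f (g i))"
  using assms(4)
proof (induction "is")
  case Nil
  then show ?case using linear_on_zero[OF assms(1)] subspace_closed[OF assms(2,3)] by simp
next
  case (Cons i "is")
  then have "(\<Sum>i\<leftarrow>is. g i) \<in> V" by (intro subspace_closed(4)[OF assms(2,3)]) auto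
  then show ?case using Cons linear_on_addD[OF assms(1)] by simp
qed

lemma linear_on_sum:
  assumes "linear_on V s s' f" "vector_space s" "module.subspace s V" "finite I" "\<And>i. i \<in> I \<Longrightarrow> g i \<in> V"
  shows "f (\<Sum>i\<in>I. g i) = (\<Sum>i\<in>I. f (g i))"
  using assms(4,5)
proof (induction I rule: finite_induct)
  case empty
  then show ?case using linear_on_zero[OF assms(1)] subspace_closed[OF assms(2,3)] by simp
next
  case (insert i I)
  then have "(\<Sum>i\<in>I. g i) \<in> V" by (intro subspace_closed(5)[OF assms(2,3)]) auto
  then show ?case using insert linear_on_addD[OF assms(1)] by simp
qed

lemma linear_on_mono: "linear_on V s s' f \<Longrightarrow> U \<subseteq> V \<Longrightarrow> linear_on U s s' f"
  unfolding linear_on_def by blast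

lemma linear_on_comp:
  "linear_on V s s' f \<Longrightarrow> linear_on W s' s'' g \<Longrightarrow> (\<And>x. x \<in> V \<Longrightarrow> f x \<in> W) \<Longrightarrow>
     linear_on V s s'' (\<lambda>x. g (f x))"
  unfolding linear_on_def by simp

lemma linear_on_id: "linear_on V s s (\<lambda>x. x)"
  by (simp add: linear_on_def)

lemma linear_on_add:
  assumes "vector_space s'" "linear_on V s s' f" "linear_on V s s' g"
  shows "linear_on V s s' (\<lambda>x. f x + g x)"
proof -
  interpret vector_space s' by fact
  show ?thesis using assms(2,3) by (auto simp: linear_on_def scale_right_distrib)
qed

lemma linear_on_scale:
  assumes "vector_space s'" "linear_on V s s' f"
  shows "linear_on V s s' (\<lambda>x. s' c (f x))"
proof -
  interpret vector_space s' by fact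
  show ?thesis using assms(2) by (auto simp: linear_on_def scale_right_distrib mult.commute)
qed

lemma linear_on_const0:
  assumes "vector_space s'"
  shows "linear_on V s s' (\<lambda>x. 0)"
proof -
  interpret vector_space s' by fact
  show ?thesis by (auto simp: linear_on_def)
qed

lemma linear_on_sum_list_fun:
  assumes "vector_space s'" "\<And>i. i \<in> set is \<Longrightarrow> linear_on V s s' (f i)"
  shows "linear_on V s s' (\<lambda>x. \<Sum>i\<leftarrow>is. f i x)"
  using assms(2) by (induction "is") (auto intro: linear_on_const0[OF assms(1)] linear_on_add[OF assms(1)])

lemma linear_on_sum_fun:
  assumes "vector_space s'" "\<And>i. i \<in> I \<Longrightarrow> linear_on V s s' (f i)"
  shows "linear_on V s s' (\<lambda>x. \<Sum>i\<in>I. f i x)"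
proof (cases "finite I")
  case True
  then show ?thesis using assms(2)
    by (induction I rule: finite_induct) (auto intro: linear_on_const0[OF assms(1)] linear_on_add[OF assms(1)])
qed (simp add: linear_on_const0[OF assms(1)])

text \<open>\<open>linear_on\<close> evaluates a function at sums and multiples of elements of
  \<open>V\<close>; agreement on \<open>V\<close> transfers linearity because these stay in
  \<open>V\<close>, hence the subspace assumption.\<close>

lemma linear_on_cong: "(\<And>x. x \<in> V \<Longrightarrow> f x = g x) \<Longrightarrow> module.subspace s V \<Longrightarrow> vector_space s \<Longrightarrow>
    linear_on V s s' f = linear_on V s s' g"
  using subspace_closed[of s V] unfolding linear_on_def by (simp cong: ball_cong)

lemma subspace_whole: "vector_space s \<Longrightarrow> module.subspace s UNIV"
proof -
  assume "vector_space s"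
  then interpret vector_space s .
  show ?thesis by (rule subspace_UNIV)
qed

text \<open>The mechanism behind all later checks on words: once the equalizer is a subspace,
  agreement on generators spreads to their span.\<close>

lemma subspace_linear_eq:
  assumes "vector_space s" "module.subspace s V" "linear_on V s s' f" "linear_on V s s' g"
  shows "module.subspace s {x\<in>V. f x = g x}"
proof -
  interpret vector_space s by fact
  show ?thesis using assms(3,4) subspace_closed[OF assms(1,2)] linear_on_zero[of V s s' f] linear_on_zero[of V s s' g]
    by (auto simp: subspace_def linear_on_def)
qed

lemma span_mem_of:
  assumes "vector_space s" "x \<in> G"
  shows "x \<in> module.span s G"
proof -
  interpret vector_space s by fact
  show ?thesis using assms(2) by (rule span_base)
qed

lemma subspace_span_of:
  assumes "vector_space s"
  shows "module.subspace s (module.span s G)"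
proof -
  interpret vector_space s by fact
  show ?thesis by (rule subspace_span)
qed

lemma span_predicate_induct:
  assumes "vector_space s" "x \<in> module.span s G" "\<And>g. g \<in> G \<Longrightarrow> P g" "module.subspace s {x. P x}"
  shows "P x"
proof -
  interpret vector_space s by fact
  have "x \<in> {x. P x}"
    by (rule span_induct[OF assms(2)]) (use assms(3,4) in auto)
  then show ?thesis by simp
qed

lemma linear_on_span_eq:
  assumes "vector_space s" "linear_on (module.span s G) s s' f" "linear_on (module.span s G) s s' g"
    "\<And>x. x \<in> G \<Longrightarrow> f x = g x" "x \<in> module.span s G"
  shows "f x = g x"
proof -
  interpret vector_space s by fact
  have "x \<in> span G \<and> f x = g x"
    by (rule span_predicate_induct[OF assms(1,5)])
      (use assms(4) span_base subspace_linear_eq[OF assms(1) subspace_span assms(2,3)] in auto)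
  then show ?thesis ..
qed

lemma vector_space_fscale_mult: "vector_space (fscale ((*) :: 'k::field \<Rightarrow> 'k \<Rightarrow> 'k))"
  by (intro vector_space_fscale vector_space_field)

lemma vector_space_fscale2_mult: "vector_space (fscale (fscale ((*) :: 'k::field \<Rightarrow> 'k \<Rightarrow> 'k)))"
  by (intro vector_space_fscale vector_space_field)

text \<open>\<open>lin_ext\<close> is a Hilbert choice over maps that may fail to exist, so it has
  its intended properties only after a witness \<open>L\<close> is supplied. The witness will come
  from the universal property of a tensor product or a direct sum.\<close>

lemma lin_ext_unique_spec:
  assumes "linear_on (module.span sV (e ` G)) sV sW L" "\<And>p. p \<in> G \<Longrightarrow> L (e p) = g p"
  shows "linear_on (module.span sV (e ` G)) sV sW (lin_ext sV sW G e g)"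
    "p \<in> G \<Longrightarrow> lin_ext sV sW G e g (e p) = g p"
proof -
  have "linear_on (module.span sV (e ` G)) sV sW (lin_ext sV sW G e g) \<and> (\<forall>p\<in>G. lin_ext sV sW G e g (e p) = g p)"
    unfolding lin_ext_def by (rule someI[of _ L]) (use assms in auto)
  then show "linear_on (module.span sV (e ` G)) sV sW (lin_ext sV sW G e g)"
    "p \<in> G \<Longrightarrow> lin_ext sV sW G e g (e p) = g p" by auto
qed

section \<open>Tensor products and chosen representatives\<close>

lemma bilinear_onD:
  assumes "bilinear_on sV V sW W sU f"
  shows "w \<in> W \<Longrightarrow> linear_on V sV sU (\<lambda>v. f v w)" "v \<in> V \<Longrightarrow> linear_on W sW sU (f v)"
  using assms by (auto simp: bilinear_on_def)

lemma bilinear_onI: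
  assumes "\<And>w. w \<in> W \<Longrightarrow> linear_on V sV sU (\<lambda>v. f v w)" "\<And>v. v \<in> V \<Longrightarrow> linear_on W sW sU (\<lambda>w. f v w)"
  shows "bilinear_on sV V sW W sU f"
  using assms by (auto simp: bilinear_on_def)

lemma ten_bilinear: "bilinear_on sV V sW W (fscale (*)) (ten sV V sW W)"
  by (rule bilinear_onI; rule linear_onI)
    (auto simp: ten_def fscale_def fun_eq_iff bilinear_on_def linear_on_def)

lemma ten_in_tensor_space: "v \<in> V \<Longrightarrow> w \<in> W \<Longrightarrow> ten sV V sW W v w \<in> tensor_space sV V sW W"
  unfolding tensor_space_def by (intro span_mem_of[OF vector_space_fscale_mult]) auto

lemma subspace_tensor_space: "module.subspace (fscale (*)) (tensor_space sV V sW W)"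
  unfolding tensor_space_def by (rule subspace_span_of[OF vector_space_fscale_mult])

lemma tensor_space_eq:
  assumes "linear_on (tensor_space sV V sW W) (fscale (*)) s f" "linear_on (tensor_space sV V sW W) (fscale (*)) s g"
    "\<And>v w. v \<in> V \<Longrightarrow> w \<in> W \<Longrightarrow> f (ten sV V sW W v w) = g (ten sV V sW W v w)" "t \<in> tensor_space sV V sW W"
  shows "f t = g t"
  using assms(4) unfolding tensor_space_def
  by (rule linear_on_span_eq[OF vector_space_fscale_mult assms(1,2)[unfolded tensor_space_def], rotated])
    (use assms(3) in blast)

lemma tensor_rep_spec:
  assumes "vector_space sV" "module.subspace sV V" "t \<in> tensor_space sV V sW W"
  shows "set (tensor_rep sV V sW W t) \<subseteq> V \<times> W" "(\<Sum>(v, w)\<leftarrow>tensor_rep sV V sW W t. ten sV V sW W v w) = t"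
proof -
  interpret T: vector_space "fscale (*) :: _ \<Rightarrow> _ \<Rightarrow> ('a, 'b, 'c) tensor" by (rule vector_space_fscale_mult)
  have "\<exists>xs. set xs \<subseteq> V \<times> W \<and> t = (\<Sum>(v, w)\<leftarrow>xs. ten sV V sW W v w)"
    using assms(3) unfolding tensor_space_def
  proof (induction rule: T.span_induct_alt)
    case base
    show ?case by (intro exI[of _ "[]"]) simp
  next
    case (step c x y)
    then obtain v w xs where *: "x = ten sV V sW W v w" "v \<in> V" "w \<in> W" "set xs \<subseteq> V \<times> W"
      "y = (\<Sum>(v, w)\<leftarrow>xs. ten sV V sW W v w)" by auto
    \<comment> \<open>The span consists of linear combinations, but \<open>tensor_rep\<close> allows
      only plain sums; scalars are absorbed into the first leg.\<close>
    have "fscale (*) c x = ten sV V sW W (sV c v) w"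
      unfolding *(1) by (rule linear_on_scaleD[OF bilinear_onD(1)[OF ten_bilinear *(3)] *(2), symmetric])
    with * show ?case
      by (intro exI[of _ "(sV c v, w) # xs"]) (simp add: subspace_closed[OF assms(1,2)])
  qed
  then have "set (tensor_rep sV V sW W t) \<subseteq> V \<times> W \<and> t = (\<Sum>(v, w)\<leftarrow>tensor_rep sV V sW W t. ten sV V sW W v w)"
    unfolding tensor_rep_def by (rule someI_ex)
  then show "set (tensor_rep sV V sW W t) \<subseteq> V \<times> W" "(\<Sum>(v, w)\<leftarrow>tensor_rep sV V sW W t. ten sV V sW W v w) = t"
    by auto
qed

text \<open>The choice in \<open>tensor_rep\<close> is invisible to any expression that factors
  through a linear map on the tensor product; this legitimises Sweedler notation.\<close>

lemma tensor_rep_sum: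
  assumes "vector_space sV" "module.subspace sV V" "linear_on (tensor_space sV V sW W) (fscale (*)) s L"
    "t \<in> tensor_space sV V sW W"
  shows "(\<Sum>(v, w)\<leftarrow>tensor_rep sV V sW W t. L (ten sV V sW W v w)) = L t"
proof -
  note * = tensor_rep_spec[OF assms(1,2,4)]
  have "L (\<Sum>p\<leftarrow>tensor_rep sV V sW W t. case p of (v, w) \<Rightarrow> ten sV V sW W v w)
      = (\<Sum>p\<leftarrow>tensor_rep sV V sW W t. L (case p of (v, w) \<Rightarrow> ten sV V sW W v w))"
    by (rule linear_on_sum_list[OF assms(3) vector_space_fscale_mult subspace_tensor_space])
      (use *(1) in \<open>auto intro!: ten_in_tensor_space\<close>)
  then show ?thesis using *(2) by (simp add: case_prod_beta')
qed

text \<open>Converts the entry-wise definition into a recursion along the list, the form needed for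
  inductions over paths. Linearity in the head is tested by updating the head of some list, and
  \<open>0 \<in> V\<close> guarantees that such a list exists.\<close>

lemma multilinear_on_Cons:
  "multilinear_on s (V # Vs) sU F \<longleftrightarrow>
     (\<forall>xs. list_all2 (\<in>) xs Vs \<longrightarrow> linear_on V s sU (\<lambda>x. F (x # xs))) \<and>
     (\<forall>x\<in>V. multilinear_on s Vs sU (\<lambda>xs. F (x # xs)))" if "0 \<in> V"
proof
  assume L: "multilinear_on s (V # Vs) sU F"
  show "(\<forall>xs. list_all2 (\<in>) xs Vs \<longrightarrow> linear_on V s sU (\<lambda>x. F (x # xs))) \<and>
     (\<forall>x\<in>V. multilinear_on s Vs sU (\<lambda>xs. F (x # xs)))"
  proof (intro conjI allI impI ballI)
    fix xs assume "list_all2 (\<in>) xs Vs"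
    with L that have "linear_on ((V # Vs) ! 0) s sU (\<lambda>x. F ((0 # xs)[0 := x]))"
      unfolding multilinear_on_def by (metis length_greater_0_conv list.discI list_all2_Cons)
    then show "linear_on V s sU (\<lambda>x. F (x # xs))" by simp
  next
    fix x assume "x \<in> V"
    show "multilinear_on s Vs sU (\<lambda>xs. F (x # xs))"
      unfolding multilinear_on_def
    proof (intro allI impI)
      fix i xs assume "i < length Vs" "list_all2 (\<in>) xs Vs"
      with L \<open>x \<in> V\<close> have "linear_on ((V # Vs) ! Suc i) s sU (\<lambda>y. F ((x # xs)[Suc i := y]))"
        unfolding multilinear_on_def by (metis Suc_less_eq length_Cons list_all2_Cons)
      then show "linear_on (Vs ! i) s sU (\<lambda>y. F (x # xs[i := y]))" by simp
    qed
  qed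
next
  assume R: "(\<forall>xs. list_all2 (\<in>) xs Vs \<longrightarrow> linear_on V s sU (\<lambda>x. F (x # xs))) \<and>
     (\<forall>x\<in>V. multilinear_on s Vs sU (\<lambda>xs. F (x # xs)))"
  show "multilinear_on s (V # Vs) sU F"
    unfolding multilinear_on_def
  proof (intro allI impI)
    fix i ys assume i: "i < length (V # Vs)" and "list_all2 (\<in>) ys (V # Vs)"
    then obtain x xs where ys: "ys = x # xs" "x \<in> V" "list_all2 (\<in>) xs Vs"
      by (auto simp: list_all2_Cons2)
    show "linear_on ((V # Vs) ! i) s sU (\<lambda>x. F (ys[i := x]))"
      using R i ys by (cases i) (auto simp: multilinear_on_def)
  qed
qed

lemma multilinear_on_Nil: "multilinear_on s [] sU F"
  by (simp add: multilinear_on_def)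

lemma tens_multilinear: "multilinear_on s Vs (fscale (*)) (tens s Vs)"
  unfolding multilinear_on_def
  by (intro allI impI linear_onI)
    (auto simp: tens_def fscale_def fun_eq_iff multilinear_on_def linear_on_def)

lemma direct_sum_universal:
  assumes sV: "vector_space sV" and sU: "vector_space sU"
    and V: "\<And>i. i \<in> I \<Longrightarrow> module.subspace sV (V i)" and L: "\<And>i. i \<in> I \<Longrightarrow> linear_on (V i) sV sU (L i)"
  shows "\<exists>F. linear_on (direct_sum I V) (fscale sV) sU F \<and> (\<forall>i\<in>I. \<forall>v\<in>V i. F (single i v) = L i v)"
proof -
  interpret U: vector_space sU by fact
  interpret V: vector_space sV by fact
  define F where "F x = (\<Sum>i | x i \<noteq> 0. L i (x i))" for x
  \<comment> \<open>The support varies with \<open>x\<close>; summing over any larger finite set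
    \<open>J\<close> lets \<open>x\<close>, \<open>y\<close> and \<open>x + y\<close> be compared
    over one index set. The extra terms vanish because each \<open>L i\<close> maps 0 to 0.\<close>
  have F: "F x = (\<Sum>i\<in>J. L i (x i))" if "x \<in> direct_sum I V" "finite J" "{i. x i \<noteq> 0} \<subseteq> J" "J \<subseteq> I" for x J
    unfolding F_def using that
    by (intro sum.mono_neutral_left)
      (auto intro!: linear_on_zero[OF L] subspace_closed(1)[OF sV V])
  have "linear_on (direct_sum I V) (fscale sV) sU F"
  proof (rule linear_onI)
    fix x y assume xy: "x \<in> direct_sum I V" "y \<in> direct_sum I V"
    let ?J = "{i. x i \<noteq> 0} \<union> {i. y i \<noteq> 0}"
    have J: "finite ?J" "?J \<subseteq> I" using xy by (auto simp: direct_sum_def)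
    have s: "x + y \<in> direct_sum I V"
      using xy subspace_closed(2)[OF sV V] by (auto simp: direct_sum_def intro: finite_subset[OF _ J(1)])
    have "F (x + y) = (\<Sum>i\<in>?J. L i ((x + y) i))" using J by (intro F s) auto
    also have "\<dots> = (\<Sum>i\<in>?J. L i (x i) + L i (y i))"
      using xy J by (intro sum.cong refl) (auto simp: direct_sum_def intro!: linear_on_addD[OF L])
    also have "\<dots> = F x + F y"
      unfolding sum.distrib using xy J by (subst (1 2) F) auto
    finally show "F (x + y) = F x + F y" .
  next
    fix c x assume x: "x \<in> direct_sum I V"
    let ?J = "{i. x i \<noteq> 0}"
    have J: "finite ?J" "?J \<subseteq> I" using x by (auto simp: direct_sum_def)
    have s: "fscale sV c x \<in> direct_sum I V"
      using x subspace_closed(3)[OF sV V] by (auto simp: direct_sum_def fscale_def intro: finite_subset[OF _ J(1)])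
    have "F (fscale sV c x) = (\<Sum>i\<in>?J. L i (fscale sV c x i))" using J by (intro F s) (auto simp: fscale_def)
    also have "\<dots> = (\<Sum>i\<in>?J. sU c (L i (x i)))"
      using x J by (intro sum.cong refl) (auto simp: direct_sum_def fscale_def intro!: linear_on_scaleD[OF L])
    also have "\<dots> = sU c (F x)" unfolding F_def U.scale_sum_right ..
    finally show "F (fscale sV c x) = sU c (F x)" .
  qed
  moreover have "F (single i v) = L i v" if "i \<in> I" "v \<in> V i" for i v
  proof -
    have "F (single i v) = (\<Sum>j\<in>{i}. L j (single i v j))"
      using that subspace_closed(1)[OF sV V] by (intro F) (auto simp: direct_sum_def single_def)
    then show ?thesis by (simp add: single_def)
  qed
  ultimately show ?thesis by blast
qed

lemma sum_fun_apply: "(\<Sum>i\<in>I. f i) j = (\<Sum>i\<in>I. f i j)"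
  by (induction I rule: infinite_finite_induct) auto

lemma direct_sum_span:
  assumes sV: "vector_space sV"
  shows "direct_sum I (\<lambda>i. module.span sV (G i)) = module.span (fscale sV) {single i v | i v. i \<in> I \<and> v \<in> G i}"
    (is "?L = module.span _ ?G")
proof -
  interpret V: vector_space sV by fact
  interpret F: vector_space "fscale sV" by (rule vector_space_fscale[OF sV])
  have sub: "F.subspace ?L"
    unfolding F.subspace_def
  proof (intro conjI ballI allI)
    fix x y assume xy: "x \<in> ?L" "y \<in> ?L"
    then have "finite ({i. x i \<noteq> 0} \<union> {i. y i \<noteq> 0})" by (auto simp: direct_sum_def)
    then have "finite {i. (x + y) i \<noteq> 0}" by (rule finite_subset[rotated]) auto
    with xy show "x + y \<in> ?L" by (simp add: direct_sum_def V.span_add)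
  next
    fix c x assume x: "x \<in> ?L"
    then have "finite {i. x i \<noteq> 0}" by (auto simp: direct_sum_def)
    then have "finite {i. fscale sV c x i \<noteq> 0}" by (rule finite_subset[rotated]) (auto simp: fscale_def)
    with x show "fscale sV c x \<in> ?L" by (simp add: direct_sum_def fscale_def V.span_scale)
  qed (auto simp: direct_sum_def V.span_zero)
  have "?G \<subseteq> ?L"
    by (auto simp: direct_sum_def single_def V.span_base V.span_zero)
  then have "F.span ?G \<subseteq> ?L" using sub by (rule F.span_minimal)
  moreover have "x \<in> F.span ?G" if x: "x \<in> ?L" for x
  proof -
    have fin: "finite {i. x i \<noteq> 0}" and I: "{i. x i \<noteq> 0} \<subseteq> I" using x by (auto simp: direct_sum_def)
    have 1: "single i v \<in> F.span ?G" if "i \<in> I" "v \<in> V.span (G i)" for i v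
    proof (rule span_predicate_induct[OF sV that(2)])
      show "module.subspace sV {v. single i v \<in> F.span ?G}"
        unfolding V.subspace_def
      proof (intro conjI ballI allI, goal_cases)
        case 1
        have "single i 0 = (0 :: _ \<Rightarrow> 'b)" by (simp add: single_def fun_eq_iff)
        then show ?case using F.span_zero by simp
      next
        case (2 v w)
        have "single i (v + w) = single i v + single i w" by (simp add: single_def fun_eq_iff)
        with 2 show ?case using F.span_add by auto
      next
        case (3 c v)
        have "single i (sV c v) = fscale sV c (single i v)" by (simp add: single_def fun_eq_iff fscale_def)
        with 3 show ?case using F.span_scale by auto
      qed
      fix g assume "g \<in> G i"
      then show "single i g \<in> F.span ?G" using that by (intro F.span_base) auto
    qed
    have "x = (\<Sum>i | x i \<noteq> 0. single i (x i))"
    proof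
      fix j
      have "(\<Sum>i | x i \<noteq> 0. single i (x i)) j = (\<Sum>i | x i \<noteq> 0. if i = j then x j else 0)"
        unfolding sum_fun_apply by (intro sum.cong refl) (simp add: single_def)
      then show "x j = (\<Sum>i | x i \<noteq> 0. single i (x i)) j" using fin by auto
    qed
    moreover have "(\<Sum>i | x i \<noteq> 0. single i (x i)) \<in> F.span ?G"
      using x I by (intro F.span_sum 1) (auto simp: direct_sum_def)
    ultimately show ?thesis by simp
  qed
  ultimately show ?thesis by blast
qed

text \<open>\<open>lin_ext\<close> is specified on the span of the images of words. Identifying that
  span with the full direct sum, both for the Hom spaces of \<Omega> and for \<open>CN\<close>,
  makes linear extensions defined everywhere.\<close>

lemma span_single_tens:
  "module.span (fscale (fscale (*))) ((\<lambda>(i, xs). single i (tens s (Vs i) xs)) ` {(i, xs). i \<in> I \<and> list_all2 (\<in>) xs (Vs i)})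
    = direct_sum I (\<lambda>i. tensors_space s (Vs i))"
proof -
  have "(\<lambda>(i, xs). single i (tens s (Vs i) xs)) ` {(i, xs). i \<in> I \<and> list_all2 (\<in>) xs (Vs i)}
    = {single i v | i v. i \<in> I \<and> v \<in> {tens s (Vs i) xs | xs. list_all2 (\<in>) xs (Vs i)}}" by auto
  then show ?thesis unfolding tensors_space_def direct_sum_span[OF vector_space_fscale_mult] by simp
qed

lemma subspace_tensors_space: "module.subspace (fscale (*)) (tensors_space s Vs)"
  unfolding tensors_space_def by (rule subspace_span_of[OF vector_space_fscale_mult])

lemma tens_in_tensors_space: "list_all2 (\<in>) xs Vs \<Longrightarrow> tens s Vs xs \<in> tensors_space s Vs"
  unfolding tensors_space_def by (intro span_mem_of[OF vector_space_fscale_mult]) auto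

lemma single_tens_universal:
  assumes sU: "vector_space sU" and g: "\<And>i. i \<in> I \<Longrightarrow> multilinear_on s (Vs i) sU (g i)"
  shows "\<exists>F. linear_on (direct_sum I (\<lambda>i. tensors_space s (Vs i))) (fscale (fscale (*))) sU F \<and>
    (\<forall>i\<in>I. \<forall>xs. list_all2 (\<in>) xs (Vs i) \<longrightarrow> F (single i (tens s (Vs i) xs)) = g i xs)"
proof -
  have "\<forall>i\<in>I. \<exists>L. linear_on (tensors_space s (Vs i)) (fscale (*)) sU L \<and>
             (\<forall>xs. list_all2 (\<in>) xs (Vs i) \<longrightarrow> L (tens s (Vs i) xs) = g i xs)"
    using tensors_universal[OF sU g] by blast
  then obtain L where L: "\<And>i. i \<in> I \<Longrightarrow> linear_on (tensors_space s (Vs i)) (fscale (*)) sU (L i)"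
    "\<And>i xs. i \<in> I \<Longrightarrow> list_all2 (\<in>) xs (Vs i) \<Longrightarrow> L i (tens s (Vs i) xs) = g i xs"
    by metis
  obtain F where F: "linear_on (direct_sum I (\<lambda>i. tensors_space s (Vs i))) (fscale (fscale (*))) sU F"
    "\<forall>i\<in>I. \<forall>v\<in>tensors_space s (Vs i). F (single i v) = L i v"
    using direct_sum_universal[OF vector_space_fscale_mult sU subspace_tensors_space L(1), of I "\<lambda>i. i"] by blast
  show ?thesis
    using F(2) L(2) by (intro exI[of _ F] conjI F(1)) (simp add: tens_in_tensors_space)
qed

section \<open>Sweedler calculus\<close>

lemma sum_list_fun_apply: "(\<Sum>i\<leftarrow>is. f i) j = (\<Sum>i\<leftarrow>is. f i j)"
  by (induction "is") auto

lemma sum_list_cong_set: "(\<And>x. x \<in> set xs \<Longrightarrow> f x = g x) \<Longrightarrow> (\<Sum>x\<leftarrow>xs. f x) = (\<Sum>x\<leftarrow>xs. g x)"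
  by (induction xs) auto

lemma sum_list_swap:
  "(\<Sum>x\<leftarrow>xs. \<Sum>y\<leftarrow>ys. f x y) = (\<Sum>y\<leftarrow>ys. \<Sum>x\<leftarrow>xs. f x y :: _ :: comm_monoid_add)"
  by (induction xs) (auto simp: sum_list_addf)

lemma scale_sum_list_pairs:
  assumes "vector_space s"
  shows "s c (\<Sum>(a, b)\<leftarrow>ps. f a b) = (\<Sum>(a, b)\<leftarrow>ps. s c (f a b))"
proof -
  interpret vector_space s by fact
  show ?thesis by (induction ps) (auto simp: scale_right_distrib)
qed

lemma linear_on_sum_list_pairs:
  assumes "vector_space s'" "\<And>a b. linear_on V s s' (\<lambda>x. f x a b)"
  shows "linear_on V s s' (\<lambda>x. \<Sum>(a, b)\<leftarrow>ps. f x a b)"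
  unfolding case_prod_beta' by (rule linear_on_sum_list_fun[OF assms(1)]) (rule assms(2))

context hopf_algebra
begin

lemma vector_space_H: "vector_space (hscale H)"
  by (rule vector_space_axioms)

text \<open>Translates Sweedler sums back to the coproduct: a bilinear summand becomes a linear map
  \<open>L\<close> applied to \<open>cop H h\<close>, and axioms that speak about \<open>cop\<close>
  are then transported along \<open>L\<close>.\<close>

lemma sw_functional:
  assumes "vector_space sU" "bilinear_on (hscale H) UNIV (hscale H) UNIV sU f"
  obtains L where "linear_on (tensor_space (hscale H) UNIV (hscale H) UNIV) (fscale (*)) sU L"
    "\<And>a b. L (hten H a b) = f a b" "\<And>h. (\<Sum>(a, b)\<leftarrow>sw H h. f a b) = L (cop H h)"
proof -
  obtain L where L: "linear_on (tensor_space (hscale H) UNIV (hscale H) UNIV) (fscale (*)) sU L"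
    "\<And>a b. L (hten H a b) = f a b"
    using tensor_universal[OF assms] by blast
  moreover have "(\<Sum>(a, b)\<leftarrow>sw H h. f a b) = L (cop H h)" for h
    using tensor_rep_sum[OF vector_space_H subspace_whole[OF vector_space_H] L(1) cop_closed, of h]
    unfolding sw_def L(2) .
  ultimately show thesis by (rule that)
qed

lemma linear_on_sw:
  assumes "vector_space sU" "linear_on V s (hscale H) g" "bilinear_on (hscale H) UNIV (hscale H) UNIV sU f"
  shows "linear_on V s sU (\<lambda>x. \<Sum>(a, b)\<leftarrow>sw H (g x). f a b)"
proof -
  obtain L where L: "linear_on (tensor_space (hscale H) UNIV (hscale H) UNIV) (fscale (*)) sU L"
    "\<And>h. (\<Sum>(a, b)\<leftarrow>sw H h. f a b) = L (cop H h)"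
    using sw_functional[OF assms(1,3)] by metis
  have "linear_on V s sU (\<lambda>x. L (cop H (g x)))"
    by (rule linear_on_comp[OF linear_on_comp[OF assms(2) cop_linear] L(1)]) (auto simp: cop_closed)
  then show ?thesis unfolding L(2) .
qed

lemma sw_mult:
  assumes "vector_space sU" "bilinear_on (hscale H) UNIV (hscale H) UNIV sU f"
  shows "(\<Sum>(a, b)\<leftarrow>sw H (g * h). f a b) = (\<Sum>(a, b)\<leftarrow>sw H g. \<Sum>(c, d)\<leftarrow>sw H h. f (a * c) (b * d))"
proof -
  obtain L where L: "linear_on (tensor_space (hscale H) UNIV (hscale H) UNIV) (fscale (*)) sU L"
    "\<And>a b. L (hten H a b) = f a b" "\<And>h. (\<Sum>(a, b)\<leftarrow>sw H h. f a b) = L (cop H h)"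
    using sw_functional[OF assms] by metis
  note S = linear_on_sum_list[OF L(1) vector_space_fscale_mult subspace_tensor_space]
  note T = subspace_closed(4)[OF vector_space_fscale_mult subspace_tensor_space]
  show ?thesis
    unfolding L(3) unfolding cop_mult case_prod_beta'
    by (simp add: S T ten_in_tensor_space L(2))
qed

lemma sw_one:
  assumes "vector_space sU" "bilinear_on (hscale H) UNIV (hscale H) UNIV sU f"
  shows "(\<Sum>(a, b)\<leftarrow>sw H 1. f a b) = f 1 1"
  using sw_functional[OF assms] cop_one by metis

lemma sw_counit_left:
  assumes "vector_space sU" "linear_on UNIV (hscale H) sU f"
  shows "(\<Sum>(a, b)\<leftarrow>sw H h. sU (counit H a) (f b)) = f h"
proof -
  have "f (\<Sum>(a, b)\<leftarrow>sw H h. hscale H (counit H a) b) = (\<Sum>(a, b)\<leftarrow>sw H h. sU (counit H a) (f b))"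
    unfolding case_prod_beta'
    by (subst linear_on_sum_list[OF assms(2) vector_space_H subspace_whole[OF vector_space_H]])
      (simp_all add: linear_on_scaleD[OF assms(2)])
  then show ?thesis unfolding counit_left by simp
qed

lemma sw_counit_right:
  assumes "vector_space sU" "linear_on UNIV (hscale H) sU f"
  shows "(\<Sum>(a, b)\<leftarrow>sw H h. sU (counit H b) (f a)) = f h"
proof -
  have "f (\<Sum>(a, b)\<leftarrow>sw H h. hscale H (counit H b) a) = (\<Sum>(a, b)\<leftarrow>sw H h. sU (counit H b) (f a))"
    unfolding case_prod_beta'
    by (subst linear_on_sum_list[OF assms(2) vector_space_H subspace_whole[OF vector_space_H]])
      (simp_all add: linear_on_scaleD[OF assms(2)])
  then show ?thesis unfolding counit_right by simp
qed

lemma sw_antipode_left: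
  assumes "vector_space sU" "linear_on UNIV (hscale H) sU f"
  shows "(\<Sum>(a, b)\<leftarrow>sw H h. f (antipode H a * b)) = sU (counit H h) (f 1)"
proof -
  have "f (\<Sum>(a, b)\<leftarrow>sw H h. antipode H a * b) = (\<Sum>(a, b)\<leftarrow>sw H h. f (antipode H a * b))"
    unfolding case_prod_beta'
    by (subst linear_on_sum_list[OF assms(2) vector_space_H subspace_whole[OF vector_space_H]]) simp_all
  then show ?thesis unfolding antipode_left by (simp add: linear_on_scaleD[OF assms(2)])
qed

lemma sw_antipode_right:
  assumes "vector_space sU" "linear_on UNIV (hscale H) sU f"
  shows "(\<Sum>(a, b)\<leftarrow>sw H h. f (a * antipode H b)) = sU (counit H h) (f 1)"
proof -
  have "f (\<Sum>(a, b)\<leftarrow>sw H h. a * antipode H b) = (\<Sum>(a, b)\<leftarrow>sw H h. f (a * antipode H b))"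
    unfolding case_prod_beta'
    by (subst linear_on_sum_list[OF assms(2) vector_space_H subspace_whole[OF vector_space_H]]) simp_all
  then show ?thesis unfolding antipode_right by (simp add: linear_on_scaleD[OF assms(2)])
qed

lemma sw_coassoc:
  assumes sU: "vector_space sU"
    and "\<And>b c. linear_on UNIV (hscale H) sU (\<lambda>a. F a b c)"
    and "\<And>a c. linear_on UNIV (hscale H) sU (\<lambda>b. F a b c)"
    and "\<And>a b. linear_on UNIV (hscale H) sU (\<lambda>c. F a b c)"
  shows "(\<Sum>(a, b)\<leftarrow>sw H h. \<Sum>(c, d)\<leftarrow>sw H a. F c d b) = (\<Sum>(a, b)\<leftarrow>sw H h. \<Sum>(c, d)\<leftarrow>sw H b. F a c d)"
proof -
  let ?V = "[UNIV, UNIV, UNIV] :: 'h set list"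
  \<comment> \<open>Coassociativity is an identity in the threefold tensor product; \<open>F\<close>
    induces a linear map there, which is applied to both sides.\<close>
  have "multilinear_on (hscale H) ?V sU (\<lambda>xs. F (xs ! 0) (xs ! 1) (xs ! 2))"
    by (simp add: multilinear_on_Cons multilinear_on_Nil list_all2_Cons2 assms)
  then obtain L where L: "linear_on (tensors_space (hscale H) ?V) (fscale (*)) sU L"
    "\<And>xs. list_all2 (\<in>) xs ?V \<Longrightarrow> L (tens (hscale H) ?V xs) = F (xs ! 0) (xs ! 1) (xs ! 2)"
    using tensors_universal[OF sU] by blast
  note S = linear_on_sum_list[OF L(1) vector_space_fscale_mult subspace_tensors_space]
  note T = subspace_closed(4)[OF vector_space_fscale_mult subspace_tensors_space]
  show ?thesis
    using arg_cong[OF coassoc[of h], of L] unfolding case_prod_beta'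
    by (simp add: S T tens_in_tensors_space L(2))
qed

lemma linear_on_mult_left: "linear_on V s (hscale H) g \<Longrightarrow> linear_on V s (hscale H) (\<lambda>x. g x * c)"
  using mult_bilinear by (auto simp: linear_on_def bilinear_on_def)

lemma linear_on_mult_right: "linear_on V s (hscale H) g \<Longrightarrow> linear_on V s (hscale H) (\<lambda>x. c * g x)"
  using mult_bilinear by (auto simp: linear_on_def bilinear_on_def)

lemma linear_on_antipode: "linear_on V s (hscale H) g \<Longrightarrow> linear_on V s (hscale H) (\<lambda>x. antipode H (g x))"
  using antipode_linear by (auto simp: linear_on_def)

lemma linear_on_counit_scale:
  assumes "vector_space sU" "linear_on V s (hscale H) g"
  shows "linear_on V s sU (\<lambda>x. sU (counit H (g x)) u)"
proof -
  interpret U: vector_space sU by fact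
  show ?thesis using assms(2) counit_linear by (auto simp: linear_on_def U.scale_left_distrib)
qed

lemma linear_on_bilinear:
  assumes "bilinear_on sA UNIV sB UNIV sU f"
  shows "linear_on V s sA g \<Longrightarrow> linear_on V s sU (\<lambda>x. f (g x) b)"
    "linear_on V s sB g' \<Longrightarrow> linear_on V s sU (\<lambda>x. f a (g' x))"
  using assms by (auto simp: linear_on_def bilinear_on_def)

text \<open>
  Both sides are convolution inverse to the coproduct; the proof evaluates
  \<open>\<Delta>(S h\<^sub>1) \<Delta>(h\<^sub>2) (S h\<^sub>4 \<otimes> S h\<^sub>3)\<close> in two ways.
\<close>

lemma sw_antipode:
  assumes sU: "vector_space sU" and B: "bilinear_on (hscale H) UNIV (hscale H) UNIV sU B"
  shows "(\<Sum>(x, y)\<leftarrow>sw H (antipode H h). B x y) = (\<Sum>(a, b)\<leftarrow>sw H h. B (antipode H b) (antipode H a))"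
proof -
  let ?S = "antipode H" and ?\<epsilon> = "counit H"
  interpret U: vector_space sU by fact
  note lin = linear_on_sum_list_pairs[OF sU] linear_on_sw[OF sU] linear_on_mult_left linear_on_mult_right
    linear_on_antipode linear_on_counit_scale[OF sU] linear_on_bilinear[OF B] linear_on_id bilinear_onI
    linear_on_scale[OF sU]
  \<comment> \<open>This is \<open>B\<close> evaluated on \<Delta>(g) (x \<otimes> y), the product
    being taken in the tensor square of \<open>H\<close>.\<close>
  define \<Phi> where "\<Phi> g x y = (\<Sum>(p, q)\<leftarrow>sw H g. B (p * x) (q * y))" for g x y
  have \<Phi>_lin: "linear_on V s sU (\<lambda>v. \<Phi> (g v) x y)" "linear_on V s sU (\<lambda>v. \<Phi> g' (g v) y)"
    "linear_on V s sU (\<lambda>v. \<Phi> g' x (g v))" if "linear_on V s (hscale H) g" for V s g g' x y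
    unfolding \<Phi>_def by (intro lin that)+
  have \<Phi>_one: "\<Phi> 1 x y = B x y" for x y
    unfolding \<Phi>_def by (subst sw_one[OF sU]) (auto intro!: lin)
  have \<Phi>_mult: "\<Phi> (g * h) x y = (\<Sum>(p, q)\<leftarrow>sw H g. \<Sum>(u, v)\<leftarrow>sw H h. B (p * u * x) (q * v * y))" for g h x y
    unfolding \<Phi>_def by (subst sw_mult[OF sU]) (auto intro!: lin)
  \<comment> \<open>With \<open>a\<close>, \<open>b\<close>, \<open>c\<close>, \<open>d\<close> the
    four legs of \<open>h\<close>, this is \<open>B\<close> on the product \<Delta>(S(a) b) (S(d)
    \<otimes> S(c)).\<close>
  define G where "G a b s = (\<Sum>(c, d)\<leftarrow>sw H s. \<Phi> (?S a * b) (?S d) (?S c))" for a b s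
  have "(\<Sum>(a, r)\<leftarrow>sw H h. \<Sum>(b, s)\<leftarrow>sw H r. G a b s) = (\<Sum>(t, s)\<leftarrow>sw H h. \<Sum>(a, b)\<leftarrow>sw H t. G a b s)"
    by (rule sw_coassoc[OF sU, symmetric]) (unfold G_def, (intro lin \<Phi>_lin)+)
  \<comment> \<open>First evaluation: bracketing to the left lets S(a) b collapse to a counit before
    the coproduct is applied to it.\<close>
  also have "\<dots> = (\<Sum>(t, s)\<leftarrow>sw H h. sU (?\<epsilon> t) (\<Sum>(c, d)\<leftarrow>sw H s. B (?S d) (?S c)))"
  proof -
    have "(\<Sum>(a, b)\<leftarrow>sw H t. G a b s) = sU (?\<epsilon> t) (\<Sum>(c, d)\<leftarrow>sw H s. \<Phi> 1 (?S d) (?S c))" for t s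
      unfolding G_def by (rule sw_antipode_left[OF sU]) (intro lin \<Phi>_lin)
    then show ?thesis by (simp add: \<Phi>_one)
  qed
  also have "\<dots> = (\<Sum>(c, d)\<leftarrow>sw H h. B (?S d) (?S c))"
    by (rule sw_counit_left[OF sU]) (intro lin)
  finally have 1: "(\<Sum>(a, r)\<leftarrow>sw H h. \<Sum>(b, s)\<leftarrow>sw H r. G a b s) = (\<Sum>(c, d)\<leftarrow>sw H h. B (?S d) (?S c))" .
  \<comment> \<open>Second evaluation: with \<open>a\<close> fixed, the coproduct of
    \<open>b\<close> meets the reversed antipodes. Its second leg cancels against the adjacent leg
    of \<open>s\<close> (\<open>K1\<close>), which makes its first leg adjacent to the remaining one
    (\<open>K2\<close>).\<close>
  have 2: "(\<Sum>(b, s)\<leftarrow>sw H r. G a b s) = sU (?\<epsilon> r) (\<Sum>(p, q)\<leftarrow>sw H (?S a). B p q)" for a r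
  proof -
    define K where "K p q u v s = (\<Sum>(c, d)\<leftarrow>sw H s. B (p * u * ?S d) (q * v * ?S c))" for p q u v s
    have K_lin: "linear_on V s' sU (\<lambda>x. K p q (g x) v s)" "linear_on V s' sU (\<lambda>x. K p q u (g x) s)"
      "linear_on V s' sU (\<lambda>x. K p q u v (g x))" if "linear_on V s' (hscale H) g" for V s' g p q u v s
      unfolding K_def by (intro lin that)+
    have K1: "(\<Sum>(v, s)\<leftarrow>sw H w. K p q u v s) = B (p * u * ?S w) q" for w p q u
    proof -
      have "(\<Sum>(v, s)\<leftarrow>sw H w. K p q u v s)
          = (\<Sum>(t, d)\<leftarrow>sw H w. \<Sum>(v, c)\<leftarrow>sw H t. B (p * u * ?S d) (q * (v * ?S c)))"
        unfolding K_def mult.assoc by (rule sw_coassoc[OF sU, symmetric]) (intro lin)+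
      also have "\<dots> = (\<Sum>(t, d)\<leftarrow>sw H w. sU (?\<epsilon> t) (B (p * u * ?S d) q))"
        by (subst sw_antipode_right[OF sU]) (auto intro!: lin)
      also have "\<dots> = B (p * u * ?S w) q"
        by (rule sw_counit_left[OF sU]) (intro lin)
      finally show ?thesis .
    qed
    have K2: "(\<Sum>(b, s)\<leftarrow>sw H r. \<Sum>(u, v)\<leftarrow>sw H b. K p q u v s) = sU (?\<epsilon> r) (B p q)" for p q
    proof -
      have "(\<Sum>(b, s)\<leftarrow>sw H r. \<Sum>(u, v)\<leftarrow>sw H b. K p q u v s) = (\<Sum>(u, w)\<leftarrow>sw H r. \<Sum>(v, s)\<leftarrow>sw H w. K p q u v s)"
        by (rule sw_coassoc[OF sU]) (intro lin K_lin)+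
      also have "\<dots> = (\<Sum>(u, w)\<leftarrow>sw H r. B (p * (u * ?S w)) q)"
        unfolding K1 mult.assoc ..
      also have "\<dots> = sU (?\<epsilon> r) (B p q)"
        by (subst sw_antipode_right[OF sU]) (auto intro!: lin)
      finally show ?thesis .
    qed
    have K3: "G a b s = (\<Sum>(p, q)\<leftarrow>sw H (?S a). \<Sum>(u, v)\<leftarrow>sw H b. K p q u v s)" for b s
      unfolding G_def \<Phi>_mult K_def
      unfolding case_prod_beta' by (subst sum_list_swap, rule sum_list_cong_set, rule sum_list_swap)
    have "(\<Sum>(b, s)\<leftarrow>sw H r. G a b s)
        = (\<Sum>(p, q)\<leftarrow>sw H (?S a). \<Sum>(b, s)\<leftarrow>sw H r. \<Sum>(u, v)\<leftarrow>sw H b. K p q u v s)"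
      unfolding K3 case_prod_beta' by (rule sum_list_swap)
    also have "\<dots> = (\<Sum>(p, q)\<leftarrow>sw H (?S a). sU (?\<epsilon> r) (B p q))"
      unfolding K2 ..
    also have "\<dots> = sU (?\<epsilon> r) (\<Sum>(p, q)\<leftarrow>sw H (?S a). B p q)"
      by (rule scale_sum_list_pairs[OF sU, symmetric])
    finally show ?thesis .
  qed
  have "(\<Sum>(a, r)\<leftarrow>sw H h. \<Sum>(b, s)\<leftarrow>sw H r. G a b s) = (\<Sum>(p, q)\<leftarrow>sw H (?S h). B p q)"
    unfolding 2 by (rule sw_counit_right[OF sU]) (intro lin B)
  with 1 show ?thesis by simp
qed

lemma linear_on_inv_antipode:
  assumes "linear_on V s (hscale H) g"
  shows "linear_on V s (hscale H) (\<lambda>x. inv (antipode H) (g x))"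
proof -
  let ?S = "antipode H"
  have i: "inj ?S" and s: "\<And>x. ?S (inv ?S x) = x"
    using antipode_bij by (auto simp: bij_def surj_f_inv_f)
  have "linear_on UNIV (hscale H) (hscale H) (inv ?S)"
    by (rule linear_onI; rule injD[OF i]) (use antipode_linear in \<open>auto simp: s linear_on_def\<close>)
  then show ?thesis using assms by (auto simp: linear_on_def)
qed

text \<open>This is \<open>sw_antipode\<close> at the preimage of \<open>h\<close> under the
  antipode, for the form whose two legs are swapped and precomposed with the inverse
  antipode.\<close>

lemma sw_inv_antipode:
  assumes sU: "vector_space sU" and B: "bilinear_on (hscale H) UNIV (hscale H) UNIV sU B"
  shows "(\<Sum>(x, y)\<leftarrow>sw H (inv (antipode H) h). B x y)
    = (\<Sum>(a, b)\<leftarrow>sw H h. B (inv (antipode H) b) (inv (antipode H) a))"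
proof -
  let ?S = "antipode H"
  have s: "\<And>x. ?S (inv ?S x) = x" "\<And>x. inv ?S (?S x) = x"
    using antipode_bij by (auto simp: bij_def surj_f_inv_f)
  have "bilinear_on (hscale H) UNIV (hscale H) UNIV sU (\<lambda>x y. B (inv ?S y) (inv ?S x))"
    by (intro bilinear_onI linear_on_bilinear[OF B] linear_on_inv_antipode linear_on_id)
  from sw_antipode[OF sU this, of "inv ?S h"] show ?thesis by (simp add: s)
qed

end

section \<open>The coaction of the module\<close>

context sayd_module
begin

lemma csw_functional:
  assumes "vector_space sU" "bilinear_on (hscale H) UNIV (mscale M) UNIV sU f"
  obtains L where "linear_on (tensor_space (hscale H) UNIV (mscale M) UNIV) (fscale (*)) sU L"
    "\<And>a b. L (hmten H M a b) = f a b" "\<And>m. (\<Sum>(a, n)\<leftarrow>csw H M m. f a n) = L (coact M m)"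
proof -
  obtain L where L: "linear_on (tensor_space (hscale H) UNIV (mscale M) UNIV) (fscale (*)) sU L"
    "\<And>a b. L (hmten H M a b) = f a b"
    using tensor_universal[OF assms] by blast
  moreover have "(\<Sum>(a, n)\<leftarrow>csw H M m. f a n) = L (coact M m)" for m
    using tensor_rep_sum[OF vector_space_H subspace_whole[OF vector_space_H] L(1) coact_closed, of m]
    unfolding csw_def L(2) .
  ultimately show thesis by (rule that)
qed

lemma linear_on_csw:
  assumes "vector_space sU" "bilinear_on (hscale H) UNIV (mscale M) UNIV sU f"
  shows "linear_on UNIV (mscale M) sU (\<lambda>m. \<Sum>(a, n)\<leftarrow>csw H M m. f a n)"
proof -
  obtain L where L: "linear_on (tensor_space (hscale H) UNIV (mscale M) UNIV) (fscale (*)) sU L"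
    "\<And>m. (\<Sum>(a, n)\<leftarrow>csw H M m. f a n) = L (coact M m)"
    using csw_functional[OF assms] by metis
  have "linear_on UNIV (mscale M) sU (\<lambda>x. L (coact M x))"
    by (rule linear_on_comp[OF coact_linear L(1)]) (auto simp: coact_closed)
  then show ?thesis unfolding L(2) .
qed

lemma csw_coassoc:
  fixes F :: "'h \<Rightarrow> 'h \<Rightarrow> 'm \<Rightarrow> 'k"
  assumes F1: "\<And>b n. linear_on UNIV (hscale H) (*) (\<lambda>a. F a b n)"
    and F2: "\<And>a n. linear_on UNIV (hscale H) (*) (\<lambda>b. F a b n)"
    and F3: "\<And>a b. linear_on UNIV (mscale M) (*) (\<lambda>n. F a b n)"
  shows "(\<Sum>(a, n)\<leftarrow>csw H M m. \<Sum>(b, c)\<leftarrow>sw H a. F b c n) = (\<Sum>(a, n)\<leftarrow>csw H M m. \<Sum>(b, l)\<leftarrow>csw H M n. F a b l)"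
proof -
  let ?T = "tensor_space (hscale H) UNIV (mscale M) UNIV"
  \<comment> \<open>Elements of the inner tensor product are functionals on bilinear forms, so
    \<open>t\<close> can be evaluated at \<open>F a\<close> directly. \<open>B\<close> is the
    bilinear form at which both sides of the coassociativity axiom are evaluated; this is why
    \<open>F\<close> has scalar values.\<close>
  define B where "B = (\<lambda>a t. t (F a) :: 'k)"
  have Fb: "bilinear_on (hscale H) UNIV (mscale M) UNIV (*) (F a)" for a
    by (intro bilinear_onI F2 F3)
  have B: "B a (hmten H M b n) = F a b n" for a b n
    by (simp add: B_def ten_def Fb)
  have "bilinear_on (hscale H) UNIV (fscale (*)) ?T (*) B"
  proof (rule bilinear_onI)
    fix t assume t: "t \<in> ?T"
    \<comment> \<open>Linearity in \<open>a\<close> is not visible in \<open>t (F a)\<close> for an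
      arbitrary functional \<open>t\<close>; it appears after \<open>t\<close> is written as a sum
      of pure tensors.\<close>
    have eq: "B a t = (\<Sum>(b, n)\<leftarrow>tensor_rep (hscale H) UNIV (mscale M) UNIV t. F a b n)" for a
      by (subst tensor_rep_spec(2)[OF vector_space_H subspace_whole[OF vector_space_H] t, symmetric])
        (simp add: B_def sum_list_fun_apply case_prod_beta' ten_def Fb)
    show "linear_on UNIV (hscale H) (*) (\<lambda>a. B a t)"
      unfolding eq by (intro linear_on_sum_list_pairs vector_space_field F1)
  next
    fix a show "linear_on ?T (fscale (*)) (*) (B a)"
      by (rule linear_onI) (simp_all add: B_def fscale_def)
  qed
  then have E: "hhmten H M a b n B = F a b n" for a b n
    using B by (simp add: ten_def[of _ _ _ ?T])
  show ?thesis
    using arg_cong[OF coact_coassoc[of m], of "\<lambda>t. t B"]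
    by (simp add: sum_list_fun_apply case_prod_beta' E)
qed

end

section \<open>Words of the universal DG-semicategory\<close>

lemma multilinear_on_cong:
  assumes "multilinear_on s Vs sU F" "vector_space s" "\<And>V. V \<in> set Vs \<Longrightarrow> module.subspace s V"
    "\<And>xs. list_all2 (\<in>) xs Vs \<Longrightarrow> F xs = G xs"
  shows "multilinear_on s Vs sU G"
  unfolding multilinear_on_def
proof (intro allI impI)
  fix i xs assume i: "i < length Vs" and xs: "list_all2 (\<in>) xs Vs"
  have "linear_on (Vs ! i) s sU (\<lambda>x. F (xs[i := x]))" using assms(1) i xs by (simp add: multilinear_on_def)
  moreover have "F (xs[i := x]) = G (xs[i := x])" if "x \<in> Vs ! i" for x
    using xs i that by (intro assms(4)) (metis list_all2_update_cong list_update_id)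
  ultimately show "linear_on (Vs ! i) s sU (\<lambda>x. G (xs[i := x]))"
    using i assms(3) by (subst linear_on_cong[OF _ _ assms(2), symmetric]) auto
qed

lemma multilinear_on_comp:
  assumes "multilinear_on s Vs sU F" "linear_on V sU sW L" "\<And>xs. list_all2 (\<in>) xs Vs \<Longrightarrow> F xs \<in> V"
  shows "multilinear_on s Vs sW (\<lambda>xs. L (F xs))"
  unfolding multilinear_on_def
proof (intro allI impI)
  fix i xs assume i: "i < length Vs" and xs: "list_all2 (\<in>) xs Vs"
  show "linear_on (Vs ! i) s sW (\<lambda>x. L (F (xs[i := x])))"
  proof (rule linear_on_comp[OF _ assms(2)])
    show "linear_on (Vs ! i) s sU (\<lambda>x. F (xs[i := x]))" using assms(1) i xs by (simp add: multilinear_on_def)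
    show "F (xs[i := x]) \<in> V" if "x \<in> Vs ! i" for x
      using xs i that by (intro assms(3)) (metis list_all2_update_cong list_update_id)
  qed
qed

lemma multilinear_on_add:
  "vector_space sU \<Longrightarrow> multilinear_on s Vs sU F \<Longrightarrow> multilinear_on s Vs sU G \<Longrightarrow> multilinear_on s Vs sU (\<lambda>xs. F xs + G xs)"
  unfolding multilinear_on_def by (auto intro!: linear_on_add)

lemma multilinear_on_scale:
  "vector_space sU \<Longrightarrow> multilinear_on s Vs sU F \<Longrightarrow> multilinear_on s Vs sU (\<lambda>xs. sU c (F xs))"
  unfolding multilinear_on_def by (auto intro!: linear_on_scale)

lemma multilinear_on_const0: "vector_space sU \<Longrightarrow> multilinear_on s Vs sU (\<lambda>xs. 0)"
  unfolding multilinear_on_def by (auto intro!: linear_on_const0)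

lemma multilinear_on_sum_list_pairs:
  "vector_space sU \<Longrightarrow> (\<And>a b. multilinear_on s Vs sU (F a b)) \<Longrightarrow>
     multilinear_on s Vs sU (\<lambda>xs. \<Sum>(a, b)\<leftarrow>ps. F a b xs)"
  unfolding multilinear_on_def by (auto intro!: linear_on_sum_list_pairs)

lemma multilinear_on_map_fst:
  fixes s' :: "'k::field \<Rightarrow> 'b::ab_group_add \<times> 'c::ab_group_add \<Rightarrow> 'b \<times> 'c"
  assumes "\<And>c x. s' c (x, 0) = (s c x, 0)" "multilinear_on s Vs sU F"
  shows "multilinear_on s' (map (\<lambda>V. V \<times> {0}) Vs) sU (\<lambda>xs. F (map fst xs))"
  unfolding multilinear_on_def
proof (intro allI impI)
  fix i and xs :: "('b \<times> 'c) list"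
  assume i: "i < length (map (\<lambda>V. V \<times> {0}) Vs)" and xs: "list_all2 (\<in>) xs (map (\<lambda>V. V \<times> {0}) Vs)"
  have "list_all2 (\<in>) (map fst xs) Vs" using xs by (auto simp: list_all2_conv_all_nth mem_Times_iff)
  with assms(2) i have "linear_on (Vs ! i) s sU (\<lambda>x. F ((map fst xs)[i := x]))"
    by (simp add: multilinear_on_def)
  then show "linear_on (map (\<lambda>V. V \<times> {0}) Vs ! i) s' sU (\<lambda>x. F (map fst (xs[i := x])))"
    using i by (auto simp: linear_on_def assms(1) map_update)
qed

lemma single_linear: "linear_on UNIV s (fscale s) (single i)" if "vector_space s"
proof -
  interpret vector_space s by fact
  show ?thesis by (rule linear_onI) (auto simp: single_def fscale_def fun_eq_iff)
qed

section \<open>Paths of composable morphisms\<close>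

lemma path_homs_Cons: "path_homs C (Y # Z # P) = Hom C Z Y # path_homs C (Z # P)"
  by (simp add: path_homs_def upt_conv_Cons map_Suc_upt[symmetric] del: upt_Suc)

lemma path_homs_single: "path_homs C [X] = []"
  by (simp add: path_homs_def)

lemma path_act_Cons: "path_act C (Y # Z # P) (h # hs) (f # fs) = act C Z Y h f # path_act C (Z # P) hs fs"
  by (simp add: path_act_def upt_conv_Cons map_Suc_upt[symmetric] del: upt_Suc)

lemma path_act_Nil: "path_act C P hs [] = []"
  by (simp add: path_act_def)

context linear_semicategory
begin

text \<open>Inner objects are listed from the target side, as in \<open>omega_factors\<close>.
  Consing an object changes the target and keeps the source, so inductions over paths fix
  \<open>X\<close> and generalise \<open>Y\<close>.\<close>

definition path :: "'o \<Rightarrow> 'o \<Rightarrow> 'o list \<Rightarrow> 'a list \<Rightarrow> bool" where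
  "path X Y Xs fs \<longleftrightarrow> set Xs \<subseteq> Ob C \<and> list_all2 (\<in>) fs (path_homs C (Y # Xs @ [X]))"

lemma path_Nil: "path X Y [] fs \<longleftrightarrow> (\<exists>f\<in>Hom C X Y. fs = [f])"
  by (auto simp: path_def path_homs_Cons path_homs_single list_all2_Cons2)

lemma path_Cons: "path X Y (X1 # Xs) fs \<longleftrightarrow>
    X1 \<in> Ob C \<and> (\<exists>f\<in>Hom C X1 Y. \<exists>gs. fs = f # gs \<and> path X X1 Xs gs)"
  by (auto simp: path_def path_homs_Cons list_all2_Cons2)

lemma path_iff: "path X Y Xs fs \<longleftrightarrow> set Xs \<subseteq> Ob C \<and>
    (\<exists>f\<in>Hom C (hd (Xs @ [X])) Y. \<exists>gs. fs = f # gs \<and> list_all2 (\<in>) gs (path_homs C (Xs @ [X])))"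
  by (cases Xs) (auto simp: path_def path_homs_Cons path_homs_single list_all2_Cons2)

lemma path_length: "path X Y Xs fs \<Longrightarrow> length fs = Suc (length Xs)"
  by (auto simp: path_def path_homs_def dest: list_all2_lengthD)

lemma path_set: "path X Y Xs fs \<Longrightarrow> set Xs \<subseteq> Ob C"
  by (simp add: path_def)

lemma vector_space_scal: "vector_space (scal C)" by (rule vector_space_axioms)

lemma Hom_zero: "X \<in> Ob C \<Longrightarrow> Y \<in> Ob C \<Longrightarrow> 0 \<in> Hom C X Y"
  and Hom_scale: "X \<in> Ob C \<Longrightarrow> Y \<in> Ob C \<Longrightarrow> f \<in> Hom C X Y \<Longrightarrow> scal C c f \<in> Hom C X Y"
  using subspace_closed[OF vector_space_scal Hom_subspace] by auto

lemma subspace_path_homs: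
  assumes "set P \<subseteq> Ob C" "V \<in> set (path_homs C P)"
  shows "module.subspace (scal C) V"
proof -
  obtain i where i: "i < length P - 1" "V = Hom C (P ! Suc i) (P ! i)"
    using assms(2) by (auto simp: path_homs_def)
  then show ?thesis using assms(1) by (auto intro!: Hom_subspace simp: subset_iff)
qed

end

lemma multilinear_path_Nil:
  "multilinear_on s (path_homs C [Y, X]) sU F \<longleftrightarrow> linear_on (Hom C X Y) s sU (\<lambda>f. F [f])" if "0 \<in> Hom C X Y"
  using that by (simp add: path_homs_Cons path_homs_single multilinear_on_Cons multilinear_on_Nil)

lemma multilinear_path_Cons:
  "multilinear_on s (path_homs C (Y # Z # P)) sU F \<longleftrightarrow>
    (\<forall>fs. list_all2 (\<in>) fs (path_homs C (Z # P)) \<longrightarrow> linear_on (Hom C Z Y) s sU (\<lambda>f. F (f # fs))) \<and>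
    (\<forall>f\<in>Hom C Z Y. multilinear_on s (path_homs C (Z # P)) sU (\<lambda>fs. F (f # fs)))" if "0 \<in> Hom C Z Y"
  using that by (simp add: path_homs_Cons multilinear_on_Cons)

context H_semicategory
begin

abbreviation osc :: "'k \<Rightarrow> ('k, 'o, 'a) omega \<Rightarrow> ('k, 'o, 'a) omega" where
  "osc \<equiv> fscale (fscale (*))"

lemma vs_omega: "vector_space osc"
  by (rule vector_space_fscale2_mult)

lemma omega_words_cases:
  "(Xs, xs) \<in> omega_words H C X Y \<longleftrightarrow>
     (case Xs of [] \<Rightarrow> (\<exists>f\<in>Hom C X Y. xs = [(f, 0)])
      | X1 # Xs' \<Rightarrow> X1 \<in> Ob C \<and> (\<exists>f \<mu> fs. xs = (f, \<mu>) # map (\<lambda>f. (f, 0)) fs \<and>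
           f \<in> Hom C X1 Y \<and> (X1 \<noteq> Y \<longrightarrow> \<mu> = 0) \<and> C.path X X1 Xs' fs))"
proof -
  have *: "list_all2 (\<in>) xs (map (\<lambda>V. V \<times> {0}) Vs) \<longleftrightarrow> (\<exists>fs. xs = map (\<lambda>f. (f, 0)) fs \<and> list_all2 (\<in>) fs Vs)"
    for xs :: "('a \<times> 'k) list" and Vs
  proof
    assume L: "list_all2 (\<in>) xs (map (\<lambda>V. V \<times> {0}) Vs)"
    then have "xs = map (\<lambda>f. (f, 0)) (map fst xs) \<and> list_all2 (\<in>) (map fst xs) Vs"
      by (induction xs "map (\<lambda>V. V \<times> {0 :: 'k}) Vs" arbitrary: Vs rule: list_all2_induct) auto
    then show "\<exists>fs. xs = map (\<lambda>f. (f, 0)) fs \<and> list_all2 (\<in>) fs Vs" by blast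
  qed (auto simp: list_all2_conv_all_nth)
  show ?thesis
    by (cases Xs) (auto simp: omega_words_def list_all2_Cons2 * adjoin_units_def C.path_def)
qed

definition W :: "'o \<Rightarrow> 'o \<Rightarrow> 'o list \<Rightarrow> 'a list \<Rightarrow> ('k, 'o, 'a) omega" where
  "W X Y Xs fs = omega_elem H C X Y (Xs, map (\<lambda>f. (f, 0)) fs)"

text \<open>The head entry is the unit adjoined at \<open>Y\<close>, so the list of inner objects
  starts with \<open>Y\<close> once more: \<open>U\<close> over \<open>Xs\<close> has degree
  \<open>Suc (length Xs)\<close>, one more than \<open>W\<close> over \<open>Xs\<close>.\<close>

definition U :: "'o \<Rightarrow> 'o \<Rightarrow> 'o list \<Rightarrow> 'a list \<Rightarrow> ('k, 'o, 'a) omega" where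
  "U X Y Xs fs = omega_elem H C X Y (Y # Xs, (0, 1) # map (\<lambda>f. (f, 0)) fs)"

lemma W_word: "C.path X Y Xs fs \<Longrightarrow> (Xs, map (\<lambda>f. (f, 0)) fs) \<in> omega_words H C X Y"
  by (cases Xs) (auto simp: omega_words_cases C.path_Nil C.path_Cons)

lemma U_word: "X \<in> Ob C \<Longrightarrow> Y \<in> Ob C \<Longrightarrow> C.path X Y Xs fs \<Longrightarrow>
    (Y # Xs, (0, 1) # map (\<lambda>f. (f, 0)) fs) \<in> omega_words H C X Y"
  using C.Hom_zero by (auto simp: omega_words_cases)

lemma omega_elem_multilinear:
  "multilinear_on (scal (adjoin_units H C)) (omega_factors H C X Y Xs) osc (\<lambda>xs. omega_elem H C X Y (Xs, xs))"
  unfolding omega_elem_def prod.case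
  by (rule multilinear_on_comp[OF tens_multilinear single_linear[OF vector_space_fscale_mult]]) simp

lemma omega_factors_zero: "X \<in> Ob C \<Longrightarrow> Y \<in> Ob C \<Longrightarrow> X1 \<in> Ob C \<Longrightarrow> 0 \<in> Hom (adjoin_units H C) X1 Y"
  using C.Hom_zero by (simp add: adjoin_units_def zero_prod_def)

text \<open>A nonzero \<mu> forces \<open>X1 = Y\<close>, and then \<open>(f, \<mu>)\<close> is
  \<open>(f, 0)\<close> plus \<mu> times the unit in the head factor. If \<mu> is 0, the last term
  vanishes whatever \<open>U\<close> denotes there.\<close>

lemma omega_elem_head:
  assumes X: "X \<in> Ob C" "Y \<in> Ob C" and p: "C.path X Y (X1 # Xs) (f # fs)" and \<mu>: "X1 \<noteq> Y \<Longrightarrow> \<mu> = 0"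
  shows "omega_elem H C X Y (X1 # Xs, (f, \<mu>) # map (\<lambda>f. (f, 0)) fs) = W X Y (X1 # Xs) (f # fs) + osc \<mu> (U X Y Xs fs)"
proof -
  have p': "X1 \<in> Ob C" "f \<in> Hom C X1 Y" "C.path X X1 Xs fs" using p by (auto simp: C.path_Cons)
  interpret O: vector_space osc by (rule vs_omega)
  let ?h = "\<lambda>x. omega_elem H C X Y (X1 # Xs, x # map (\<lambda>f. (f, 0)) fs)"
  have "list_all2 (\<in>) (map (\<lambda>f. (f, 0)) fs) (map (\<lambda>V. V \<times> {0 :: 'k}) (path_homs C (X1 # Xs @ [X])))"
    using p'(3) by (auto simp: C.path_def list_all2_conv_all_nth)
  with omega_elem_multilinear[of X Y "X1 # Xs"]
  have lin: "linear_on (Hom (adjoin_units H C) X1 Y) (scal (adjoin_units H C)) osc ?h"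
    using omega_factors_zero[OF X p'(1)] by (simp add: multilinear_on_Cons)
  show ?thesis
  proof (cases "X1 = Y")
    case True
    have m: "(f, 0) \<in> Hom (adjoin_units H C) X1 Y" "(0, 1) \<in> Hom (adjoin_units H C) X1 Y" "(0, \<mu>) \<in> Hom (adjoin_units H C) X1 Y"
      using True X p' C.Hom_zero by (auto simp: adjoin_units_def)
    have 1: "?h (f, \<mu>) = ?h (f, 0) + ?h (0, \<mu>)"
      using linear_on_addD[OF lin m(1,3)] by simp
    have 2: "?h (0, \<mu>) = osc \<mu> (?h (0, 1))"
      using linear_on_scaleD[OF lin m(2), of \<mu>] by (simp add: adjoin_units_def)
    show ?thesis using 1 unfolding 2 by (simp add: W_def U_def True)
  next
    case False
    then show ?thesis using \<mu> by (simp add: W_def)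
  qed
qed

lemma omega_sum_span:
  "omega_sum H C I X Y = module.span osc (omega_elem H C X Y ` {w \<in> omega_words H C X Y. fst w \<in> I})"
proof -
  have 1: "(\<lambda>(i, xs). single i (tens (scal (adjoin_units H C)) (omega_factors H C X Y i) xs)) = omega_elem H C X Y"
    by (auto simp: omega_elem_def)
  have 2: "{(i, xs). i \<in> {Xs \<in> I. set Xs \<subseteq> Ob C} \<and> list_all2 (\<in>) xs (omega_factors H C X Y i)}
    = {w \<in> omega_words H C X Y. fst w \<in> I}" by (auto simp: omega_words_def)
  show ?thesis
    unfolding omega_sum_def
    using span_single_tens[of "scal (adjoin_units H C)" "omega_factors H C X Y" "{Xs \<in> I. set Xs \<subseteq> Ob C}"]
    unfolding 1 2 by simp
qed

lemma subspace_omega_sum: "module.subspace osc (omega_sum H C I X Y)"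
  unfolding omega_sum_span by (rule subspace_span_of[OF vs_omega])

lemma omega_elem_mem: "w \<in> omega_words H C X Y \<Longrightarrow> fst w \<in> I \<Longrightarrow> omega_elem H C X Y w \<in> omega_sum H C I X Y"
  unfolding omega_sum_span by (rule span_mem_of[OF vs_omega]) blast

lemma W_mem: "C.path X Y Xs fs \<Longrightarrow> Xs \<in> I \<Longrightarrow> W X Y Xs fs \<in> omega_sum H C I X Y"
  unfolding W_def by (rule omega_elem_mem) (auto simp: W_word)

lemma U_mem: "X \<in> Ob C \<Longrightarrow> Y \<in> Ob C \<Longrightarrow> C.path X Y Xs fs \<Longrightarrow> Y # Xs \<in> I \<Longrightarrow> U X Y Xs fs \<in> omega_sum H C I X Y"
  unfolding U_def by (rule omega_elem_mem) (auto simp: U_word)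

lemma omega_word_induct:
  assumes X: "X \<in> Ob C" "Y \<in> Ob C" and w: "w \<in> omega_words H C X Y" "fst w \<in> I"
    and P: "\<And>Xs fs. C.path X Y Xs fs \<Longrightarrow> Xs \<in> I \<Longrightarrow> P (W X Y Xs fs)"
    "\<And>Xs fs. C.path X Y Xs fs \<Longrightarrow> Y # Xs \<in> I \<Longrightarrow> P (U X Y Xs fs)"
    and sub: "module.subspace osc {x. P x}"
  shows "P (omega_elem H C X Y w)"
proof -
  obtain Xs xs where w': "w = (Xs, xs)" by (cases w)
  show ?thesis
  proof (cases Xs)
    case Nil
    with w w' obtain f where f: "f \<in> Hom C X Y" "xs = [(f, 0)]" by (auto simp: omega_words_cases)
    have "P (W X Y [] [f])" using w w' Nil f by (intro P) (auto simp: C.path_Nil)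
    then show ?thesis using w' Nil f by (simp add: W_def)
  next
    case (Cons X1 Xs')
    with w w' obtain f \<mu> fs where *: "xs = (f, \<mu>) # map (\<lambda>f. (f, 0)) fs" "X1 \<in> Ob C"
      "f \<in> Hom C X1 Y" "X1 \<noteq> Y \<Longrightarrow> \<mu> = 0" "C.path X X1 Xs' fs" by (auto simp: omega_words_cases)
    have eq: "omega_elem H C X Y w = W X Y Xs (f # fs) + osc \<mu> (U X Y Xs' fs)"
      unfolding w' Cons *(1) by (rule omega_elem_head[OF X]) (use * in \<open>auto simp: C.path_Cons\<close>)
    have PW: "P (W X Y Xs (f # fs))" using w w' Cons * by (intro P) (auto simp: C.path_Cons)
    have "P (osc \<mu> (U X Y Xs' fs))"
    \<comment> \<open>If \<mu> is 0, then \<open>fs\<close> need not be a path into \<open>Y\<close>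
      and the hypothesis on \<open>U\<close> may not apply; in that case the term is just
      zero.\<close>
    proof (cases "\<mu> = 0")
      case True
      interpret O: vector_space osc by (rule vs_omega)
      show ?thesis using subspace_closed(1)[OF vs_omega sub] True by simp
    next
      case False
      then have "P (U X Y Xs' fs)" using w w' Cons * by (intro P) auto
      then show ?thesis using subspace_closed(3)[OF vs_omega sub] by simp
    qed
    with PW show ?thesis unfolding eq using subspace_closed(2)[OF vs_omega sub] by simp
  qed
qed

lemma omega_induct:
  assumes X: "X \<in> Ob C" "Y \<in> Ob C" and x: "x \<in> omega_sum H C I X Y"
    and P: "\<And>Xs fs. C.path X Y Xs fs \<Longrightarrow> Xs \<in> I \<Longrightarrow> P (W X Y Xs fs)"
    "\<And>Xs fs. C.path X Y Xs fs \<Longrightarrow> Y # Xs \<in> I \<Longrightarrow> P (U X Y Xs fs)"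
    and sub: "module.subspace osc {x. P x}"
  shows "P x"
  using x unfolding omega_sum_span
  by (rule span_predicate_induct[OF vs_omega _ _ sub]) (auto intro: omega_word_induct[OF X _ _ P sub])

text \<open>\<open>I\<close> selects words by their list of inner objects: the lists of one length
  give statements about a single degree, \<open>UNIV\<close> gives plain membership.\<close>

lemma omega_mem_image:
  assumes X: "X \<in> Ob C" "Y \<in> Ob C" and x: "x \<in> omega_sum H C I X Y"
    and L: "linear_on (omega_sum H C UNIV X Y) osc sU L" and V: "vector_space sU" "module.subspace sU V"
    and P: "\<And>Xs fs. C.path X Y Xs fs \<Longrightarrow> Xs \<in> I \<Longrightarrow> L (W X Y Xs fs) \<in> V"
    "\<And>Xs fs. C.path X Y Xs fs \<Longrightarrow> Y # Xs \<in> I \<Longrightarrow> L (U X Y Xs fs) \<in> V"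
  shows "L x \<in> V"
proof -
  interpret O: vector_space osc by (rule vs_omega)
  have "x \<in> omega_sum H C UNIV X Y \<and> L x \<in> V"
  proof (rule omega_induct[OF X x])
    show "module.subspace osc {x. x \<in> omega_sum H C UNIV X Y \<and> L x \<in> V}"
      unfolding O.subspace_def
      using subspace_closed[OF vs_omega subspace_omega_sum[of UNIV X Y]] subspace_closed[OF V]
        linear_on_zero[OF L] linear_on_addD[OF L] linear_on_scaleD[OF L] by auto
  qed (use P X W_mem U_mem in auto)
  then show ?thesis ..
qed

lemma omega_eqI:
  assumes X: "X \<in> Ob C" "Y \<in> Ob C" and x: "x \<in> omega_sum H C I X Y"
    and L: "linear_on (omega_sum H C I X Y) osc sU L" "linear_on (omega_sum H C I X Y) osc sU L'"
    and P: "\<And>Xs fs. C.path X Y Xs fs \<Longrightarrow> Xs \<in> I \<Longrightarrow> L (W X Y Xs fs) = L' (W X Y Xs fs)"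
    "\<And>Xs fs. C.path X Y Xs fs \<Longrightarrow> Y # Xs \<in> I \<Longrightarrow> L (U X Y Xs fs) = L' (U X Y Xs fs)"
  shows "L x = L' x"
proof -
  have "x \<in> omega_sum H C I X Y \<and> L x = L' x"
    by (rule omega_induct[OF X x])
      (use P X W_mem U_mem subspace_linear_eq[OF vs_omega subspace_omega_sum L] in auto)
  then show ?thesis ..
qed

lemma omega_sum_mono: "I \<subseteq> J \<Longrightarrow> omega_sum H C I X Y \<subseteq> omega_sum H C J X Y"
proof -
  interpret O: vector_space osc by (rule vs_omega)
  show "I \<subseteq> J \<Longrightarrow> omega_sum H C I X Y \<subseteq> omega_sum H C J X Y"
    unfolding omega_sum_span by (rule O.span_mono) blast
qed

lemma W_multilinear:
  assumes X: "X \<in> Ob C" "Y \<in> Ob C" "set Xs \<subseteq> Ob C"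
  shows "multilinear_on (scal C) (path_homs C (Y # Xs @ [X])) osc (W X Y Xs)"
  unfolding multilinear_on_def
proof (intro allI impI)
  fix i fs assume i: "i < length (path_homs C (Y # Xs @ [X]))" and fs: "list_all2 (\<in>) fs (path_homs C (Y # Xs @ [X]))"
  have "list_all2 (\<in>) (map (\<lambda>f. (f, 0)) fs) (omega_factors H C X Y Xs)"
    using W_word[of X Y Xs fs] fs X(3) by (auto simp: C.path_def omega_words_def)
  moreover have len: "length (omega_factors H C X Y Xs) = length (path_homs C (Y # Xs @ [X]))"
    by (cases Xs) (simp_all add: path_homs_def)
  ultimately have *: "linear_on (omega_factors H C X Y Xs ! i) (scal (adjoin_units H C)) osc
      (\<lambda>x. omega_elem H C X Y (Xs, (map (\<lambda>f. (f, 0)) fs)[i := x]))"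
    using omega_elem_multilinear[of X Y Xs] i by (simp add: multilinear_on_def)
  have "(f, 0) \<in> omega_factors H C X Y Xs ! i" if "f \<in> path_homs C (Y # Xs @ [X]) ! i" for f
    using that i by (cases Xs; cases i) (auto simp: path_homs_Cons path_homs_single adjoin_units_def)
  then show "linear_on (path_homs C (Y # Xs @ [X]) ! i) (scal C) osc (\<lambda>x. W X Y Xs (fs[i := x]))"
    using linear_on_addD[OF *, of "(_, 0)" "(_, 0)"] linear_on_scaleD[OF *, of "(_, 0)"]
    by (intro linear_onI) (simp_all add: W_def map_update adjoin_units_def)
qed

lemma U_multilinear:
  assumes X: "X \<in> Ob C" "Y \<in> Ob C" "set Xs \<subseteq> Ob C"
  shows "multilinear_on (scal C) (path_homs C (Y # Xs @ [X])) osc (U X Y Xs)"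
  unfolding multilinear_on_def
proof (intro allI impI)
  fix i fs assume i: "i < length (path_homs C (Y # Xs @ [X]))" and fs: "list_all2 (\<in>) fs (path_homs C (Y # Xs @ [X]))"
  have "list_all2 (\<in>) ((0, 1) # map (\<lambda>f. (f, 0)) fs) (omega_factors H C X Y (Y # Xs))"
    using U_word[of X Y Xs fs] fs X by (auto simp: C.path_def omega_words_def)
  moreover have len: "length (omega_factors H C X Y (Y # Xs)) = Suc (length (path_homs C (Y # Xs @ [X])))"
    by (simp add: path_homs_def)
  ultimately have *: "linear_on (omega_factors H C X Y (Y # Xs) ! Suc i) (scal (adjoin_units H C)) osc
      (\<lambda>x. omega_elem H C X Y (Y # Xs, ((0, 1) # map (\<lambda>f. (f, 0)) fs)[Suc i := x]))"
    using omega_elem_multilinear[of X Y "Y # Xs"] i unfolding multilinear_on_def by (metis Suc_less_eq)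
  have "(f, 0) \<in> omega_factors H C X Y (Y # Xs) ! Suc i" if "f \<in> path_homs C (Y # Xs @ [X]) ! i" for f
    using that i by auto
  then show "linear_on (path_homs C (Y # Xs @ [X]) ! i) (scal C) osc (\<lambda>x. U X Y Xs (fs[i := x]))"
    using linear_on_addD[OF *, of "(_, 0)" "(_, 0)"] linear_on_scaleD[OF *, of "(_, 0)"]
    by (intro linear_onI) (simp_all add: U_def map_update adjoin_units_def)
qed

text \<open>
  A linear map on a Hom space of \<open>\<Omega>\<close> is determined by its values on the words
  \<open>W f\<^sup>0 \<dots> f\<^sup>n = f\<^sup>0 df\<^sup>1 \<dots> df\<^sup>n\<close> and \<open>U f\<^sup>0 \<dots> f\<^sup>n = df\<^sup>0 \<dots> df\<^sup>n\<close>, which may be prescribed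
  arbitrarily subject to multilinearity.
\<close>

lemma omega_lin_ext_values:
  assumes X: "X \<in> Ob C" "Y \<in> Ob C" and sU: "vector_space sU"
    and gW: "\<And>Xs. set Xs \<subseteq> Ob C \<Longrightarrow> multilinear_on (scal C) (path_homs C (Y # Xs @ [X])) sU (gW Xs)"
    and gU: "\<And>Xs. set Xs \<subseteq> Ob C \<Longrightarrow> multilinear_on (scal C) (path_homs C (Y # Xs @ [X])) sU (gU Xs)"
    and g0: "\<And>f. f \<in> Hom C X Y \<Longrightarrow> g ([], [(f, 0)]) = gW [] [f]"
    and g1: "\<And>X1 Xs f \<mu> fs. C.path X Y (X1 # Xs) (f # fs) \<Longrightarrow> (X1 \<noteq> Y \<Longrightarrow> \<mu> = 0) \<Longrightarrow>
        g (X1 # Xs, (f, \<mu>) # map (\<lambda>f. (f, 0)) fs) = gW (X1 # Xs) (f # fs) + sU \<mu> (gU Xs fs)"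
  shows "linear_on (omega_sum H C UNIV X Y) osc sU (omega_lin_ext H C X Y sU g)"
    "C.path X Y Xs fs \<Longrightarrow> omega_lin_ext H C X Y sU g (W X Y Xs fs) = gW Xs fs"
    "C.path X Y Xs fs \<Longrightarrow> omega_lin_ext H C X Y sU g (U X Y Xs fs) = gU Xs fs"
proof -
  interpret U: vector_space sU by fact
  let ?A = "adjoin_units H C"
  \<comment> \<open>The splitting of the head as in \<open>omega_elem_head\<close>, turned into a
    function on all words; the universal property of the direct sum of tensor spaces applies once it
    is multilinear.\<close>
  define G where "G Xs xs = gW Xs (map fst xs) + sU (snd (hd xs)) (gU (tl Xs) (tl (map fst xs)))"
    for Xs and xs :: "('a \<times> 'k) list"
  have fst0: "scal ?A c (x, 0) = (scal C c x, 0)" for c x by (simp add: adjoin_units_def)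
  have ml: "multilinear_on (scal ?A) (omega_factors H C X Y Xs) sU (G Xs)" if Xs: "set Xs \<subseteq> Ob C" for Xs
  proof (cases Xs)
    case Nil
    have "linear_on (Hom C X Y) (scal C) sU (\<lambda>f. gW [] [f])"
      using gW[of "[]"] C.Hom_zero[OF X] by (simp add: multilinear_path_Nil)
    then show ?thesis
      using C.Hom_zero[OF X] unfolding Nil
      by (auto simp: multilinear_on_Cons multilinear_on_Nil G_def linear_on_def fst0 zero_prod_def)
  next
    case (Cons X1 Xs')
    then have X1: "X1 \<in> Ob C" and Xs': "set Xs' \<subseteq> Ob C" using Xs by auto
    have P: "linear_on (Hom C X1 Y) (scal C) sU (\<lambda>f. gW Xs (f # fs))" if "list_all2 (\<in>) fs (path_homs C (X1 # Xs' @ [X]))" for fs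
      using gW[OF Xs] C.Hom_zero[OF X1 X(2)] that by (simp add: Cons multilinear_path_Cons)
    have Q: "multilinear_on (scal C) (path_homs C (X1 # Xs' @ [X])) sU (\<lambda>fs. gW Xs (f # fs))" if "f \<in> Hom C X1 Y" for f
      using gW[OF Xs] C.Hom_zero[OF X1 X(2)] that by (simp add: Cons multilinear_path_Cons)
    have a: "linear_on (Hom ?A X1 Y) (scal ?A) sU (\<lambda>x. G Xs (x # xs))"
      if "list_all2 (\<in>) xs (map (\<lambda>V. V \<times> {0}) (path_homs C (X1 # Xs' @ [X])))" for xs
    proof -
      have "list_all2 (\<in>) (map fst xs) (path_homs C (X1 # Xs' @ [X]))"
        using that by (auto simp: list_all2_conv_all_nth mem_Times_iff)
      from P[OF this] show ?thesis
        by (auto simp: linear_on_def G_def adjoin_units_def U.scale_left_distrib U.scale_right_distrib)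
    qed
    have b: "multilinear_on (scal ?A) (map (\<lambda>V. V \<times> {0}) (path_homs C (X1 # Xs' @ [X]))) sU (\<lambda>xs. G Xs (x # xs))"
      if "x \<in> Hom ?A X1 Y" for x
    proof -
      have x: "fst x \<in> Hom C X1 Y" "X1 \<noteq> Y \<Longrightarrow> snd x = 0" using that by (auto simp: adjoin_units_def)
      \<comment> \<open>Multilinearity of \<open>gU Xs'\<close> is available on paths into
        \<open>Y\<close> only; when \<open>X1\<close> differs from \<open>Y\<close> the unit
        coefficient is 0 and the term is constantly zero.\<close>
      have "multilinear_on (scal C) (path_homs C (X1 # Xs' @ [X])) sU (\<lambda>fs. sU (snd x) (gU Xs' fs))"
        using gU[OF Xs'] x(2) by (cases "X1 = Y") (auto intro: multilinear_on_scale multilinear_on_const0 sU)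
      then have "multilinear_on (scal C) (path_homs C (X1 # Xs' @ [X])) sU (\<lambda>fs. gW Xs (fst x # fs) + sU (snd x) (gU Xs' fs))"
        by (intro multilinear_on_add[OF sU] Q x)
      from multilinear_on_map_fst[OF fst0 this] show ?thesis by (simp add: G_def Cons)
    qed
    show ?thesis using a b omega_factors_zero[OF X X1] unfolding Cons by (simp add: multilinear_on_Cons)
  qed
  obtain F where F: "linear_on (omega_sum H C UNIV X Y) osc sU F"
    "\<And>Xs xs. (Xs, xs) \<in> omega_words H C X Y \<Longrightarrow> F (omega_elem H C X Y (Xs, xs)) = G Xs xs"
    using single_tens_universal[OF sU, of "{Xs \<in> UNIV. set Xs \<subseteq> Ob C}" "scal ?A" "omega_factors H C X Y" G] ml
    unfolding omega_sum_def omega_words_def omega_elem_def by auto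
  have Fg: "F (omega_elem H C X Y w) = g w" if w: "w \<in> omega_words H C X Y" for w
  proof -
    obtain Xs xs where w': "w = (Xs, xs)" by (cases w)
    show ?thesis
    proof (cases Xs)
      case Nil
      then show ?thesis using w F(2) g0 unfolding w' by (auto simp: omega_words_cases G_def)
    next
      case (Cons X1 Xs')
      with w w' obtain f \<mu> fs where *: "xs = (f, \<mu>) # map (\<lambda>f. (f, 0)) fs" "X1 \<in> Ob C"
        "f \<in> Hom C X1 Y" "X1 \<noteq> Y \<Longrightarrow> \<mu> = 0" "C.path X X1 Xs' fs" by (auto simp: omega_words_cases)
      have "g w = gW Xs (f # fs) + sU \<mu> (gU Xs' fs)"
        unfolding w' Cons *(1) using * by (intro g1) (auto simp: C.path_Cons)
      then show ?thesis using F(2) w unfolding w' by (simp add: G_def Cons * comp_def)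
    qed
  qed
  have sp: "module.span osc (omega_elem H C X Y ` omega_words H C X Y) = omega_sum H C UNIV X Y"
    using omega_sum_span[of UNIV X Y] by simp
  note L = lin_ext_unique_spec[of osc "omega_elem H C X Y" "omega_words H C X Y" sU F g, unfolded sp, OF F(1) Fg]
  show "linear_on (omega_sum H C UNIV X Y) osc sU (omega_lin_ext H C X Y sU g)" using L(1) by blast
  assume p: "C.path X Y Xs fs"
  show "omega_lin_ext H C X Y sU g (W X Y Xs fs) = gW Xs fs"
    using L(2)[OF _ W_word[OF p]] F(2)[OF W_word[OF p]] Fg[OF W_word[OF p]]
    by (simp add: W_def G_def comp_def hd_map C.path_length[OF p] split: list.splits) (cases fs, use C.path_length[OF p] in auto)
  show "omega_lin_ext H C X Y sU g (U X Y Xs fs) = gU Xs fs"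
  proof -
    \<comment> \<open>The word of \<open>U\<close> has head \<open>(0, 1)\<close>, so besides
      \<open>gU\<close> the map \<open>G\<close> contributes \<open>gW\<close> with first entry 0;
      linearity in that entry makes it vanish.\<close>
    have "multilinear_on (scal C) (path_homs C (Y # (Y # Xs) @ [X])) sU (gW (Y # Xs))"
      using X p by (intro gW) (auto dest: C.path_set)
    then have "linear_on (Hom C Y Y) (scal C) sU (\<lambda>f. gW (Y # Xs) (f # fs))"
      using p C.Hom_zero[OF X(2) X(2)] by (simp add: multilinear_path_Cons C.path_def)
    then have "gW (Y # Xs) (0 # fs) = 0" using linear_on_zero C.Hom_zero[OF X(2) X(2)] by blast
    then show ?thesis
      using L(2)[OF _ U_word[OF X p]] F(2)[OF U_word[OF X p]] Fg[OF U_word[OF X p]]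
      by (simp add: U_def G_def comp_def)
  qed
qed

end

section \<open>The structure of the universal DG-semicategory\<close>

text \<open>Elements of \<open>\<Omega>\<close> are functions; they should not be eta-expanded by the simplifier.\<close>

declare plus_fun_apply [simp del] zero_fun_apply [simp del] minus_apply [simp del] uminus_apply [simp del]

context H_semicategory
begin

abbreviation \<Omega> :: "('k, 'h, 'o, ('k, 'o, 'a) omega) dgh" where
  "\<Omega> \<equiv> Omega H C"

abbreviation OM :: "'o \<Rightarrow> 'o \<Rightarrow> ('k, 'o, 'a) omega set" where
  "OM X Y \<equiv> omega_sum H C UNIV X Y"

abbreviation OD :: "nat \<Rightarrow> 'o \<Rightarrow> 'o \<Rightarrow> ('k, 'o, 'a) omega set" where
  "OD n X Y \<equiv> omega_sum H C {Xs. length Xs = n} X Y"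

lemma Omega_simps [simp]:
  "Ob \<Omega> = Ob C" "Hom \<Omega> = omega_sum H C UNIV" "scal \<Omega> = osc"
  "HomD \<Omega> n = omega_sum H C {Xs. length Xs = n}"
  by (simp_all add: Omega_def)

lemma OD_OM: "x \<in> OD n X Y \<Longrightarrow> x \<in> OM X Y"
  using omega_sum_mono[of "{Xs. length Xs = n}" UNIV] by blast

lemmas osc_closed = subspace_closed[OF vs_omega subspace_omega_sum]

lemma osc_zero [simp]: "osc 0 x = 0" "osc c 0 = 0"
  and osc_one [simp]: "osc 1 x = x"
  and osc_osc: "osc c (osc c' x) = osc (c * c') x"
  and osc_add: "osc c (x + y) = osc c x + osc c y"
  and osc_diff: "osc c (x - y) = osc c x - osc c y"
  and osc_minus: "osc c (- x) = - osc c x" "osc (- c) x = - osc c x"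
proof -
  interpret O: vector_space osc by (rule vs_omega)
  show "osc 0 x = 0" "osc c 0 = 0" "osc 1 x = x" "osc c (osc c' x) = osc (c * c') x"
    "osc c (x + y) = osc c x + osc c y" "osc c (x - y) = osc c x - osc c y"
    "osc c (- x) = - osc c x" "osc (- c) x = - osc c x"
    by (simp_all add: O.scale_right_distrib O.scale_right_diff_distrib)
qed

lemma osc_closed_diff: "x \<in> omega_sum H C I X Y \<Longrightarrow> y \<in> omega_sum H C I X Y \<Longrightarrow> x - y \<in> omega_sum H C I X Y"
  using osc_closed(2)[of x I X Y "osc (-1) y"] osc_closed(3)[of y I X Y "-1"] by (simp add: osc_minus)

lemma linear_diff:
  assumes "linear_on (omega_sum H C I X Y) osc s' L" "vector_space s'" "x \<in> omega_sum H C I X Y" "y \<in> omega_sum H C I X Y"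
  shows "L (x - y) = L x - L y"
proof -
  interpret V: vector_space s' by fact
  have "L (x + osc (-1) y) = L x + s' (-1) (L y)"
    using linear_on_addD[OF assms(1,3) osc_closed(3)[OF assms(4)]] linear_on_scaleD[OF assms(1,4)] by simp
  then show ?thesis by (simp add: osc_minus)
qed

lemma omega_induct_mem:
  assumes X: "X \<in> Ob C" "Y \<in> Ob C" and x: "x \<in> omega_sum H C I X Y"
    and P: "\<And>Xs fs. C.path X Y Xs fs \<Longrightarrow> Xs \<in> I \<Longrightarrow> P (W X Y Xs fs)"
    "\<And>Xs fs. C.path X Y Xs fs \<Longrightarrow> Y # Xs \<in> I \<Longrightarrow> P (U X Y Xs fs)"
    and "P 0" "\<And>x y. x \<in> omega_sum H C I X Y \<Longrightarrow> y \<in> omega_sum H C I X Y \<Longrightarrow> P x \<Longrightarrow> P y \<Longrightarrow> P (x + y)"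
    "\<And>c x. x \<in> omega_sum H C I X Y \<Longrightarrow> P x \<Longrightarrow> P (osc c x)"
  shows "P x"
proof -
  interpret O: vector_space osc by (rule vs_omega)
  have "x \<in> omega_sum H C I X Y \<and> P x"
  proof (rule omega_induct[OF X x])
    show "module.subspace osc {x. x \<in> omega_sum H C I X Y \<and> P x}"
      unfolding O.subspace_def using assms(6-) osc_closed by auto
  qed (use P X W_mem U_mem in auto)
  then show ?thesis ..
qed

lemma path_homs_hd: "path_homs C (Y # Xs @ [X]) = Hom C (hd (Xs @ [X])) Y # path_homs C (Xs @ [X])"
  by (cases Xs) (simp_all add: path_homs_Cons)

lemma multilinear_path_hd:
  assumes "X \<in> Ob C" "Y \<in> Ob C" "set Xs \<subseteq> Ob C"
  shows "multilinear_on s (path_homs C (Y # Xs @ [X])) sU F \<longleftrightarrow>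
    (\<forall>fs. list_all2 (\<in>) fs (path_homs C (Xs @ [X])) \<longrightarrow> linear_on (Hom C (hd (Xs @ [X])) Y) s sU (\<lambda>f. F (f # fs))) \<and>
    (\<forall>f\<in>Hom C (hd (Xs @ [X])) Y. multilinear_on s (path_homs C (Xs @ [X])) sU (\<lambda>fs. F (f # fs)))"
proof -
  have "hd (Xs @ [X]) \<in> Ob C" using assms by (cases Xs) auto
  then show ?thesis unfolding path_homs_hd using C.Hom_zero assms by (simp add: multilinear_on_Cons)
qed

lemma path_hd: "C.path X Y Xs (f # fs) \<longleftrightarrow>
    set Xs \<subseteq> Ob C \<and> f \<in> Hom C (hd (Xs @ [X])) Y \<and> list_all2 (\<in>) fs (path_homs C (Xs @ [X]))"
  by (auto simp: C.path_iff)

lemma hd_path_Ob: "X \<in> Ob C \<Longrightarrow> set Xs \<subseteq> Ob C \<Longrightarrow> hd (Xs @ [X]) \<in> Ob C"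
  by (cases Xs) auto

lemma W_head_linear:
  assumes "X \<in> Ob C" "Y \<in> Ob C" "set Xs \<subseteq> Ob C" "list_all2 (\<in>) fs (path_homs C (Xs @ [X]))"
  shows "linear_on (Hom C (hd (Xs @ [X])) Y) (scal C) osc (\<lambda>f. W X Y Xs (f # fs))"
  using W_multilinear[OF assms(1-3)] assms by (simp add: multilinear_path_hd)

subsection \<open>Left multiplication by morphisms\<close>

text \<open>Left multiplication by a morphism of degree 0, read off on words and not through
  \<open>cmp\<close>: it is one of the two operations from which composition is rebuilt. On
  \<open>U\<close> the morphism replaces the adjoined unit.\<close>

definition lam :: "'o \<Rightarrow> 'o \<Rightarrow> 'o \<Rightarrow> 'a \<Rightarrow> ('k, 'o, 'a) omega \<Rightarrow> ('k, 'o, 'a) omega" where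
  "lam X Y Z f = omega_lin_ext H C X Y osc (\<lambda>(Xs, xs).
     W X Z Xs (cmp C (hd (Xs @ [X])) Y Z f (hd (map fst xs)) # tl (map fst xs))
     + osc (snd (hd xs)) (W X Z (Y # tl Xs) (f # tl (map fst xs))))"

lemma
  assumes X: "X \<in> Ob C" "Y \<in> Ob C" "Z \<in> Ob C" and f: "f \<in> Hom C Y Z"
  shows lam_linear: "linear_on (OM X Y) osc osc (lam X Y Z f)"
    and lam_W: "C.path X Y Xs (g # gs) \<Longrightarrow> lam X Y Z f (W X Y Xs (g # gs)) = W X Z Xs (cmp C (hd (Xs @ [X])) Y Z f g # gs)"
    and lam_U: "C.path X Y Xs gs \<Longrightarrow> lam X Y Z f (U X Y Xs gs) = W X Z (Y # Xs) (f # gs)"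
proof -
  let ?gW = "\<lambda>Xs fs. W X Z Xs (cmp C (hd (Xs @ [X])) Y Z f (hd fs) # tl fs)"
  let ?gU = "\<lambda>Xs fs. W X Z (Y # Xs) (f # fs)"
  let ?g = "\<lambda>(Xs, xs). W X Z Xs (cmp C (hd (Xs @ [X])) Y Z f (hd (map fst xs)) # tl (map fst xs))
     + osc (snd (hd xs)) (W X Z (Y # tl Xs) (f # tl (map fst xs)))"
  have 1: "multilinear_on (scal C) (path_homs C (Y # Xs @ [X])) osc (?gW Xs)" if Xs: "set Xs \<subseteq> Ob C" for Xs
  proof -
    have h: "hd (Xs @ [X]) \<in> Ob C" by (rule hd_path_Ob[OF X(1) Xs])
    note m = W_multilinear[OF X(1,3) Xs, unfolded multilinear_path_hd[OF X(1,3) Xs]]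
    have "linear_on (Hom C (hd (Xs @ [X])) Y) (scal C) osc (\<lambda>g. W X Z Xs (cmp C (hd (Xs @ [X])) Y Z f g # fs))"
      if "list_all2 (\<in>) fs (path_homs C (Xs @ [X]))" for fs
      using m that C.cmp_closed[OF h X(2,3) f]
      by (intro linear_on_comp[OF bilinear_onD(2)[OF C.cmp_bilinear[OF h X(2,3)] f]]) auto
    then show ?thesis
      using m C.cmp_closed[OF h X(2,3) f] by (simp add: multilinear_path_hd[OF X(1,2) Xs])
  qed
  have 2: "multilinear_on (scal C) (path_homs C (Y # Xs @ [X])) osc (?gU Xs)" if Xs: "set Xs \<subseteq> Ob C" for Xs
  proof -
    have YXs: "set (Y # Xs) \<subseteq> Ob C" using X Xs by simp
    show ?thesis using W_multilinear[OF X(1,3) YXs, unfolded multilinear_path_hd[OF X(1,3) YXs]] f by simp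
  qed
  note * = omega_lin_ext_values[OF X(1,2) vs_omega 1 2, where g = ?g]
  show "linear_on (OM X Y) osc osc (lam X Y Z f)"
    unfolding lam_def by (rule *(1)) (auto simp: comp_def)
  show "C.path X Y Xs (g # gs) \<Longrightarrow> lam X Y Z f (W X Y Xs (g # gs)) = W X Z Xs (cmp C (hd (Xs @ [X])) Y Z f g # gs)"
    unfolding lam_def by (subst *(2)) (auto simp: comp_def)
  show "C.path X Y Xs gs \<Longrightarrow> lam X Y Z f (U X Y Xs gs) = W X Z (Y # Xs) (f # gs)"
    unfolding lam_def by (subst *(3)) (auto simp: comp_def)
qed

lemma path_cmp_head:
  assumes X: "X \<in> Ob C" "Y \<in> Ob C" "Z \<in> Ob C" and f: "f \<in> Hom C Y Z" and p: "C.path X Y Xs (g # gs)"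
  shows "C.path X Z Xs (cmp C (hd (Xs @ [X])) Y Z f g # gs)"
proof -
  from p have "set Xs \<subseteq> Ob C" "g \<in> Hom C (hd (Xs @ [X])) Y" by (auto simp: path_hd)
  with X f hd_path_Ob[of X Xs] C.cmp_closed show ?thesis using p by (auto simp: path_hd)
qed

lemma path_neq_Nil: "C.path X Y Xs fs \<Longrightarrow> \<exists>g gs. fs = g # gs"
  using C.path_length[of X Y Xs fs] by (cases fs) auto

lemma lam_mem:
  assumes X: "X \<in> Ob C" "Y \<in> Ob C" "Z \<in> Ob C" and f: "f \<in> Hom C Y Z" and x: "x \<in> omega_sum H C I X Y"
  shows "lam X Y Z f x \<in> omega_sum H C I X Z"
proof (rule omega_mem_image[OF X(1,2) x lam_linear[OF X f] vs_omega subspace_omega_sum])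
  fix Xs fs assume p: "C.path X Y Xs fs" "Xs \<in> I"
  then obtain g gs where fs: "fs = g # gs" using path_neq_Nil by blast
  show "lam X Y Z f (W X Y Xs fs) \<in> omega_sum H C I X Z"
    using p X f unfolding fs by (auto simp: lam_W intro!: W_mem path_cmp_head)
next
  fix Xs fs assume p: "C.path X Y Xs fs" "Y # Xs \<in> I"
  then show "lam X Y Z f (U X Y Xs fs) \<in> omega_sum H C I X Z"
    using X f by (auto simp: lam_U C.path_Cons intro!: W_mem)
qed

text \<open>Exchanges the roles of the two variables: linearity in the parameter \<open>v\<close> is
  checked at words only, because linearity in \<open>x\<close> carries it to all \<open>x\<close>.
  It supplies the second half of bilinearity for \<open>lam\<close>, the action and
  composition.\<close>

lemma linear_on_param:
  assumes V: "vector_space sV" "module.subspace sV V" and "\<And>v. v \<in> V \<Longrightarrow> linear_on (omega_sum H C I X Y) osc sU (F v)"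
    and sU: "vector_space sU" and X: "X \<in> Ob C" "Y \<in> Ob C" and x: "x \<in> omega_sum H C I X Y"
    and W: "\<And>Xs fs. C.path X Y Xs fs \<Longrightarrow> Xs \<in> I \<Longrightarrow> linear_on V sV sU (\<lambda>v. F v (W X Y Xs fs))"
    and U: "\<And>Xs fs. C.path X Y Xs fs \<Longrightarrow> Y # Xs \<in> I \<Longrightarrow> linear_on V sV sU (\<lambda>v. F v (U X Y Xs fs))"
  shows "linear_on V sV sU (\<lambda>v. F v x)"
proof (rule omega_induct_mem[OF X x], goal_cases)
  case 1
  then show ?case by (rule W)
next
  case 2
  then show ?case by (rule U)
next
  case 3
  show ?case
    by (rule iffD2[OF linear_on_cong[OF _ V(2,1)] linear_on_const0[OF sU]])
      (rule linear_on_zero[OF assms(3) osc_closed(1)])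
next
  case (4 x y)
  show ?case
    by (rule iffD2[OF linear_on_cong[OF _ V(2,1)] linear_on_add[OF sU 4(3,4)]])
      (rule linear_on_addD[OF assms(3) 4(1,2)])
next
  case (5 c x)
  show ?case
    by (rule iffD2[OF linear_on_cong[OF _ V(2,1)] linear_on_scale[OF sU 5(2)]])
      (rule linear_on_scaleD[OF assms(3) 5(1)])
qed

lemma lam_linear_f:
  assumes X: "X \<in> Ob C" "Y \<in> Ob C" "Z \<in> Ob C" and x: "x \<in> OM X Y"
  shows "linear_on (Hom C Y Z) (scal C) osc (\<lambda>f. lam X Y Z f x)"
proof (rule linear_on_param[OF C.vector_space_scal C.Hom_subspace[OF X(2,3)] lam_linear[OF X] vs_omega X(1,2) x])
  fix Xs fs assume p: "C.path X Y Xs fs"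
  then obtain g gs where fs: "fs = g # gs" using path_neq_Nil by blast
  from p fs have q: "set Xs \<subseteq> Ob C" "g \<in> Hom C (hd (Xs @ [X])) Y" "list_all2 (\<in>) gs (path_homs C (Xs @ [X]))"
    by (auto simp: path_hd)
  have h: "hd (Xs @ [X]) \<in> Ob C" by (rule hd_path_Ob[OF X(1) q(1)])
  have "linear_on (Hom C Y Z) (scal C) osc (\<lambda>f. W X Z Xs (cmp C (hd (Xs @ [X])) Y Z f g # gs))"
    by (rule linear_on_comp[OF bilinear_onD(1)[OF C.cmp_bilinear[OF h X(2,3)] q(2)] W_head_linear[OF X(1,3) q(1,3)]])
      (use C.cmp_closed[OF h X(2,3)] q in auto)
  moreover have "lam X Y Z f (W X Y Xs fs) = W X Z Xs (cmp C (hd (Xs @ [X])) Y Z f g # gs)" if "f \<in> Hom C Y Z" for f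
    using lam_W[OF X that] p unfolding fs by simp
  ultimately show "linear_on (Hom C Y Z) (scal C) osc (\<lambda>f. lam X Y Z f (W X Y Xs fs))"
    by (subst linear_on_cong[OF _ C.Hom_subspace[OF X(2,3)] C.vector_space_scal])
next
  fix Xs fs assume p: "C.path X Y Xs fs"
  have "linear_on (Hom C Y Z) (scal C) osc (\<lambda>f. W X Z (Y # Xs) (f # fs))"
    using W_head_linear[of X Z "Y # Xs" fs] p X by (auto simp: C.path_def)
  then show "linear_on (Hom C Y Z) (scal C) osc (\<lambda>f. lam X Y Z f (U X Y Xs fs))"
    by (subst linear_on_cong[OF _ C.Hom_subspace[OF X(2,3)] C.vector_space_scal, where g = "\<lambda>f. W X Z (Y # Xs) (f # fs)"])
      (simp_all add: lam_U[OF X _ p])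
qed

lemma lam_lam:
  assumes X: "X \<in> Ob C" "V \<in> Ob C" "Y \<in> Ob C" "Z \<in> Ob C" and f: "f \<in> Hom C Y Z" and g: "g \<in> Hom C V Y"
    and x: "x \<in> OM X V"
  shows "lam X Y Z f (lam X V Y g x) = lam X V Z (cmp C V Y Z f g) x"
proof (rule omega_eqI[OF X(1,2) x])
  have fg: "cmp C V Y Z f g \<in> Hom C V Z" using C.cmp_closed X f g by blast
  show "linear_on (OM X V) osc osc (\<lambda>x. lam X Y Z f (lam X V Y g x))"
    by (rule linear_on_comp[OF lam_linear lam_linear]) (use X f g lam_mem in auto)
  show "linear_on (OM X V) osc osc (lam X V Z (cmp C V Y Z f g))"
    by (rule lam_linear) (use X fg in auto)
  fix Xs fs assume p: "C.path X V Xs fs"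
  then obtain e es where fs: "fs = e # es" using path_neq_Nil by blast
  from p fs have q: "set Xs \<subseteq> Ob C" "e \<in> Hom C (hd (Xs @ [X])) V" by (auto simp: path_hd)
  have h: "hd (Xs @ [X]) \<in> Ob C" by (rule hd_path_Ob[OF X(1) q(1)])
  show "lam X Y Z f (lam X V Y g (W X V Xs fs)) = lam X V Z (cmp C V Y Z f g) (W X V Xs fs)"
    using p X f g fg C.cmp_assoc[OF h X(2,3,4) f g q(2)] path_cmp_head[OF X(1,2,3) g] unfolding fs
    by (simp add: lam_W)
  show "lam X Y Z f (lam X V Y g (U X V Xs fs)) = lam X V Z (cmp C V Y Z f g) (U X V Xs fs)"
    using p X f g fg by (simp add: lam_W lam_U C.path_Cons)
qed

subsection \<open>The differential\<close>

lemma
  assumes X: "X \<in> Ob C" "Y \<in> Ob C"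
  shows diff_lin: "linear_on (OM X Y) osc osc (diff \<Omega> X Y)"
    and diff_W: "C.path X Y Xs fs \<Longrightarrow> diff \<Omega> X Y (W X Y Xs fs) = U X Y Xs fs"
    and diff_U: "C.path X Y Xs fs \<Longrightarrow> diff \<Omega> X Y (U X Y Xs fs) = 0"
proof -
  have d: "diff \<Omega> X Y = omega_lin_ext H C X Y osc (omega_word_diff H C X Y)" by (simp add: Omega_def)
  note * = omega_lin_ext_values[OF X vs_omega U_multilinear[OF X] multilinear_on_const0[OF vs_omega], where g = "omega_word_diff H C X Y"]
  show "linear_on (OM X Y) osc osc (diff \<Omega> X Y)"
    unfolding d by (rule *(1)) (auto simp: omega_word_diff_def U_def)
  show "C.path X Y Xs fs \<Longrightarrow> diff \<Omega> X Y (W X Y Xs fs) = U X Y Xs fs"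
    unfolding d by (subst *(2)) (auto simp: omega_word_diff_def U_def)
  show "C.path X Y Xs fs \<Longrightarrow> diff \<Omega> X Y (U X Y Xs fs) = 0"
    unfolding d by (subst *(3)) (auto simp: omega_word_diff_def U_def)
qed

lemma diff_mem:
  assumes X: "X \<in> Ob C" "Y \<in> Ob C" and x: "x \<in> OD n X Y"
  shows "diff \<Omega> X Y x \<in> OD (Suc n) X Y"
  by (rule omega_mem_image[OF X x diff_lin[OF X] vs_omega subspace_omega_sum])
    (auto simp: diff_W diff_U X osc_closed(1) intro!: U_mem)

lemma diff_mem_OM:
  assumes X: "X \<in> Ob C" "Y \<in> Ob C" and x: "x \<in> OM X Y"
  shows "diff \<Omega> X Y x \<in> OM X Y"
  by (rule omega_mem_image[OF X x diff_lin[OF X] vs_omega subspace_omega_sum])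
    (auto simp: diff_W diff_U X osc_closed(1) intro!: U_mem)

lemma diff_diff_zero:
  assumes X: "X \<in> Ob C" "Y \<in> Ob C" and x: "x \<in> OM X Y"
  shows "diff \<Omega> X Y (diff \<Omega> X Y x) = 0"
  by (rule omega_eqI[OF X x linear_on_comp[OF diff_lin[OF X] diff_lin[OF X] diff_mem_OM[OF X]] linear_on_const0[OF vs_omega]])
    (auto simp: diff_W diff_U X linear_on_zero[OF diff_lin[OF X] osc_closed(1)])

text \<open>Reads f0 df1 ... dfn as f0 d(f1 df2 ... dfn); this single step drives
  \<open>gens_induct\<close>.\<close>

lemma W_Cons_eq:
  assumes X: "X \<in> Ob C" "Y \<in> Ob C" and p: "C.path X Y (X1 # Xs) (f # fs)"
  shows "W X Y (X1 # Xs) (f # fs) = lam X X1 Y f (diff \<Omega> X X1 (W X X1 Xs fs))"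
  using assms by (auto simp: C.path_Cons diff_W lam_U)

definition gens :: "nat \<Rightarrow> 'o \<Rightarrow> 'o \<Rightarrow> ('k, 'o, 'a) omega set" where
  "gens n X Y = {W X Y Xs fs | Xs fs. C.path X Y Xs fs \<and> length Xs = n} \<union>
     {U X Y Xs fs | Xs fs. C.path X Y Xs fs \<and> Suc (length Xs) = n}"

lemma gens_OD: "X \<in> Ob C \<Longrightarrow> Y \<in> Ob C \<Longrightarrow> x \<in> gens n X Y \<Longrightarrow> x \<in> OD n X Y"
  by (auto simp: gens_def intro!: W_mem U_mem)

lemma omega_gens_eqI:
  assumes X: "X \<in> Ob C" "Y \<in> Ob C" and x: "x \<in> OM X Y"
    and L: "linear_on (OM X Y) osc sU L" "linear_on (OM X Y) osc sU L'"
    and P: "\<And>n x. x \<in> gens n X Y \<Longrightarrow> L x = L' x"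
  shows "L x = L' x"
  by (rule omega_eqI[OF X x L]; rule P) (auto simp: gens_def)

text \<open>The source \<open>X\<close> is fixed and the target varies, since
  \<open>W_Cons_eq\<close> peels off the leftmost morphism. \<open>P\<close> carries the degree
  because the signs of the Leibniz rule depend on it. The steps are required for all homogeneous
  \<open>x\<close>, so that later inductions need not name words.\<close>

lemma gens_induct:
  fixes P :: "nat \<Rightarrow> 'o \<Rightarrow> ('k, 'o, 'a) omega \<Rightarrow> bool"
  assumes X: "X \<in> Ob C" "Y \<in> Ob C" and x: "x \<in> gens n X Y"
    and base: "\<And>Y f. Y \<in> Ob C \<Longrightarrow> f \<in> Hom C X Y \<Longrightarrow> P 0 Y (W X Y [] [f])"
    and diff: "\<And>n Y x. Y \<in> Ob C \<Longrightarrow> x \<in> OD n X Y \<Longrightarrow> P n Y x \<Longrightarrow> P (Suc n) Y (diff \<Omega> X Y x)"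
    and lam: "\<And>n Z Y f x. Z \<in> Ob C \<Longrightarrow> Y \<in> Ob C \<Longrightarrow> f \<in> Hom C Z Y \<Longrightarrow> x \<in> OD n X Z \<Longrightarrow> P n Z x \<Longrightarrow> P n Y (lam X Z Y f x)"
  shows "P n Y x"
proof -
  have PW: "P (length Xs) Y (W X Y Xs fs)" if "Y \<in> Ob C" "C.path X Y Xs fs" for Y Xs fs
    using that
  proof (induction Xs arbitrary: Y fs)
    case Nil
    then show ?case by (auto simp: C.path_Nil intro: base)
  next
    case (Cons X1 Xs)
    then obtain f gs where *: "fs = f # gs" "X1 \<in> Ob C" "f \<in> Hom C X1 Y" "C.path X X1 Xs gs"
      by (auto simp: C.path_Cons)
    have m: "W X X1 Xs gs \<in> OD (length Xs) X X1" using * by (auto intro!: W_mem)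
    show ?case
      unfolding *(1) W_Cons_eq[OF X(1) Cons.prems(1) Cons.prems(2)[unfolded *(1)]]
      using * Cons.prems m X by (auto intro!: lam diff diff_mem Cons.IH)
  qed
  have "P (Suc (length Xs)) Y (U X Y Xs fs)" if "C.path X Y Xs fs" for Xs fs
    using diff[OF X(2) _ PW[OF X(2) that]] that X by (auto simp: diff_W intro: W_mem)
  then show ?thesis using x PW X(2) by (auto simp: gens_def)
qed

end

lemma sweedler_length: "hs \<in> set (sweedler H n h) \<Longrightarrow> length hs = Suc n"
  by (induction n arbitrary: h hs) auto

lemma sum_list_concat_map: "(\<Sum>x\<leftarrow>concat (map f xs). g x) = (\<Sum>x\<leftarrow>xs. \<Sum>y\<leftarrow>f x. g y)"
  by (induction xs) auto

lemma sum_sweedler_Suc: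
  "(\<Sum>hs\<leftarrow>sweedler H (Suc n) h. F hs) = (\<Sum>(a, b)\<leftarrow>sw H h. \<Sum>hs\<leftarrow>sweedler H n b. F (a # hs))"
  by (simp add: sum_list_concat_map case_prod_beta' comp_def)

lemma multilinear_on_sum_list:
  "vector_space sU \<Longrightarrow> (\<And>i. i \<in> set is \<Longrightarrow> multilinear_on s Vs sU (F i)) \<Longrightarrow>
     multilinear_on s Vs sU (\<lambda>xs. \<Sum>i\<leftarrow>is. F i xs)"
  unfolding multilinear_on_def by (auto intro!: linear_on_sum_list_fun)

lemma path_act_adjoin_units:
  "path_act (adjoin_units H C) P hs (map (\<lambda>f. (f, 0)) fs) = map (\<lambda>f. (f, 0)) (path_act C P hs fs)"
  by (rule nth_equalityI) (simp_all add: path_act_def adjoin_units_def)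

lemma bilinear_on_comp:
  assumes "bilinear_on sV V sW W sU F" "linear_on A sA sV f" "linear_on B sB sW g"
    "\<And>a. a \<in> A \<Longrightarrow> f a \<in> V" "\<And>b. b \<in> B \<Longrightarrow> g b \<in> W"
  shows "bilinear_on sA A sB B sU (\<lambda>a b. F (f a) (g b))"
  using assms unfolding bilinear_on_def linear_on_def by simp

context H_semicategory
begin

subsection \<open>The action of the Hopf algebra\<close>

lemma act_lin: "X \<in> Ob C \<Longrightarrow> Y \<in> Ob C \<Longrightarrow> linear_on (Hom C X Y) (scal C) (scal C) (act C X Y h)"
  and act_lin_h: "X \<in> Ob C \<Longrightarrow> Y \<in> Ob C \<Longrightarrow> f \<in> Hom C X Y \<Longrightarrow> linear_on UNIV (hscale H) (scal C) (\<lambda>h. act C X Y h f)"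
  using act_bilinear by (auto simp: bilinear_on_def)

lemma path_act_path:
  assumes "X \<in> Ob C" "Y \<in> Ob C" "C.path X Y Xs fs" "length hs = Suc (length Xs)"
  shows "C.path X Y Xs (path_act C (Y # Xs @ [X]) hs fs)"
  using assms
proof (induction Xs arbitrary: Y fs hs)
  case Nil
  then show ?case by (auto simp: C.path_Nil length_Suc_conv path_act_Cons path_act_Nil act_closed)
next
  case (Cons X1 Xs)
  then obtain f gs h hs' where *: "fs = f # gs" "X1 \<in> Ob C" "f \<in> Hom C X1 Y" "C.path X X1 Xs gs" "hs = h # hs'"
    by (auto simp: C.path_Cons length_Suc_conv)
  with Cons.IH[of X1 gs hs'] Cons.prems show ?case
    by (auto simp: C.path_Cons path_act_Cons act_closed)
qed

lemma multilinear_path_act: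
  assumes "X \<in> Ob C" "Y \<in> Ob C" "set Xs \<subseteq> Ob C" "length hs = Suc (length Xs)"
    and F: "multilinear_on (scal C) (path_homs C (Y # Xs @ [X])) sU F"
  shows "multilinear_on (scal C) (path_homs C (Y # Xs @ [X])) sU (\<lambda>fs. F (path_act C (Y # Xs @ [X]) hs fs))"
  unfolding multilinear_on_def
proof (intro allI impI)
  let ?P = "Y # Xs @ [X]"
  fix i fs assume i: "i < length (path_homs C ?P)" and fs: "list_all2 (\<in>) fs (path_homs C ?P)"
  let ?gs = "path_act C ?P hs fs"
  have len: "length fs = Suc (length Xs)" "length (path_homs C ?P) = Suc (length Xs)"
    using fs by (auto simp: path_homs_def dest: list_all2_lengthD)
  have p: "C.path X Y Xs ?gs"
    using path_act_path[OF assms(1,2) _ assms(4), of fs] fs assms(3) by (simp add: C.path_def)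
  have ob: "?P ! i \<in> Ob C" "?P ! Suc i \<in> Ob C"
    using assms(1-3) i len nth_mem[of i ?P] nth_mem[of "Suc i" ?P] by (auto simp del: nth_mem)
  have V: "path_homs C ?P ! i = Hom C (?P ! Suc i) (?P ! i)" using i by (simp add: path_homs_def del: upt_Suc)
  have upd: "path_act C ?P hs (fs[i := x]) = ?gs[i := act C (?P ! Suc i) (?P ! i) (hs ! i) x]" for x
    using i len by (intro nth_equalityI) (auto simp: path_act_def nth_list_update simp del: upt_Suc)
  have "linear_on (path_homs C ?P ! i) (scal C) sU (\<lambda>x. F (?gs[i := x]))"
    using F p i unfolding multilinear_on_def C.path_def by blast
  then show "linear_on (path_homs C ?P ! i) (scal C) sU (\<lambda>x. F (path_act C ?P hs (fs[i := x])))"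
    unfolding upd V by (rule linear_on_comp[OF act_lin[OF ob(2,1)]]) (rule act_closed[OF ob(2,1)])
qed

text \<open>The word of \<open>U\<close> has one entry more than it has differentials, namely the
  unit. The corresponding leg of \<open>h\<close> acts on it by the counit, hence the longer list in
  \<open>act_U_sum\<close> and the shift by \<open>tl\<close>.\<close>

lemma
  assumes X: "X \<in> Ob C" "Y \<in> Ob C"
  shows act_linear_Omega: "linear_on (OM X Y) osc osc (act \<Omega> X Y h)"
    and act_W_sum: "C.path X Y Xs fs \<Longrightarrow> act \<Omega> X Y h (W X Y Xs fs)
      = (\<Sum>hs\<leftarrow>sweedler H (length Xs) h. W X Y Xs (path_act C (Y # Xs @ [X]) hs fs))"
    and act_U_sum: "C.path X Y Xs fs \<Longrightarrow> act \<Omega> X Y h (U X Y Xs fs)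
      = (\<Sum>hs\<leftarrow>sweedler H (Suc (length Xs)) h. osc (counit H (hd hs)) (U X Y Xs (path_act C (Y # Xs @ [X]) (tl hs) fs)))"
proof -
  let ?gW = "\<lambda>Xs fs. \<Sum>hs\<leftarrow>sweedler H (length Xs) h. W X Y Xs (path_act C (Y # Xs @ [X]) hs fs)"
  let ?gU = "\<lambda>Xs fs. \<Sum>hs\<leftarrow>sweedler H (Suc (length Xs)) h. osc (counit H (hd hs)) (U X Y Xs (path_act C (Y # Xs @ [X]) (tl hs) fs))"
  have d: "act \<Omega> X Y h = omega_lin_ext H C X Y osc (omega_word_act H C X Y h)" by (simp add: Omega_def)
  have 1: "multilinear_on (scal C) (path_homs C (Y # Xs @ [X])) osc (?gW Xs)" if Xs: "set Xs \<subseteq> Ob C" for Xs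
    by (intro multilinear_on_sum_list vs_omega multilinear_path_act X Xs W_multilinear) (rule sweedler_length)
  have 2: "multilinear_on (scal C) (path_homs C (Y # Xs @ [X])) osc (?gU Xs)" if Xs: "set Xs \<subseteq> Ob C" for Xs
    by (intro multilinear_on_sum_list vs_omega multilinear_on_scale multilinear_path_act X Xs U_multilinear)
      (auto dest: sweedler_length simp del: sweedler.simps)
  have g0: "omega_word_act H C X Y h ([], [(f, 0)]) = ?gW [] [f]" if "f \<in> Hom C X Y" for f
    using path_act_adjoin_units[of H C "[Y, X]" "[h]" "[f]"] by (simp add: omega_word_act_def W_def)
  have g1: "omega_word_act H C X Y h (X1 # Xs, (f, \<mu>) # map (\<lambda>f. (f, 0)) fs) = ?gW (X1 # Xs) (f # fs) + osc \<mu> (?gU Xs fs)"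
    if p: "C.path X Y (X1 # Xs) (f # fs)" and \<mu>: "X1 \<noteq> Y \<Longrightarrow> \<mu> = 0" for X1 Xs f \<mu> fs
  proof -
    from p have p': "X1 \<in> Ob C" "f \<in> Hom C X1 Y" "C.path X X1 Xs fs" by (auto simp: C.path_Cons)
    have "omega_elem H C X Y (X1 # Xs, path_act (adjoin_units H C) (Y # (X1 # Xs) @ [X]) hs ((f, \<mu>) # map (\<lambda>f. (f, 0)) fs))
      = W X Y (X1 # Xs) (path_act C (Y # (X1 # Xs) @ [X]) hs (f # fs))
        + osc \<mu> (osc (counit H (hd hs)) (U X Y Xs (path_act C (Y # Xs @ [X]) (tl hs) fs)))"
      if hs: "hs \<in> set (sweedler H (Suc (length Xs)) h)" for hs
    proof -
      obtain a hs' where ahs: "hs = a # hs'" "length hs' = Suc (length Xs)"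
        using sweedler_length[OF hs] by (auto simp: length_Suc_conv)
      have "path_act (adjoin_units H C) (Y # X1 # Xs @ [X]) (a # hs') ((f, \<mu>) # map (\<lambda>f. (f, 0)) fs)
        = (act C X1 Y a f, counit H a * \<mu>) # map (\<lambda>f. (f, 0)) (path_act C (X1 # Xs @ [X]) hs' fs)"
        unfolding path_act_Cons path_act_adjoin_units by (simp add: adjoin_units_def)
      moreover have q: "C.path X Y (X1 # Xs) (act C X1 Y a f # path_act C (X1 # Xs @ [X]) hs' fs)"
        using p' path_act_path[OF X(1) p'(1,3) ahs(2)] act_closed[OF p'(1) X(2) p'(2)] by (simp add: C.path_Cons)
      moreover have "X1 \<noteq> Y \<Longrightarrow> counit H a * \<mu> = 0" using \<mu> by simp
      note omega_elem_head[OF X q this]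
      ultimately show ?thesis
        using \<mu> unfolding ahs(1)
        by (cases "X1 = Y") (simp_all add: path_act_Cons osc_osc mult.commute)
    qed
    then have "omega_word_act H C X Y h (X1 # Xs, (f, \<mu>) # map (\<lambda>f. (f, 0)) fs)
      = (\<Sum>hs\<leftarrow>sweedler H (Suc (length Xs)) h. W X Y (X1 # Xs) (path_act C (Y # (X1 # Xs) @ [X]) hs (f # fs))
        + osc \<mu> (osc (counit H (hd hs)) (U X Y Xs (path_act C (Y # Xs @ [X]) (tl hs) fs))))"
      unfolding omega_word_act_def prod.case length_Cons by (intro sum_list_cong_set)
    also have "\<dots> = ?gW (X1 # Xs) (f # fs) + osc \<mu> (?gU Xs fs)"
      unfolding sum_list_addf
      by (subst linear_on_sum_list[OF linear_on_scale[OF vs_omega linear_on_id] vs_omega subspace_whole[OF vs_omega]])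
        (simp_all del: sweedler.simps)
    finally show ?thesis .
  qed
  note * = omega_lin_ext_values[OF X vs_omega 1 2, where g = "omega_word_act H C X Y h", OF _ _ g0 g1]
  show "linear_on (OM X Y) osc osc (act \<Omega> X Y h)"
    unfolding d by (rule *(1))
  show "C.path X Y Xs fs \<Longrightarrow> act \<Omega> X Y h (W X Y Xs fs) = ?gW Xs fs"
    unfolding d by (rule *(2))
  show "C.path X Y Xs fs \<Longrightarrow> act \<Omega> X Y h (U X Y Xs fs) = ?gU Xs fs"
    unfolding d by (rule *(3))
qed

lemma act_W_Nil:
  assumes X: "X \<in> Ob C" "Y \<in> Ob C" and f: "f \<in> Hom C X Y"
  shows "act \<Omega> X Y h (W X Y [] [f]) = W X Y [] [act C X Y h f]"
  using act_W_sum[OF X, of "[]" "[f]"] f by (simp add: C.path_Nil path_act_Cons path_act_Nil)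

lemma sum_list_diff:
  assumes X: "X \<in> Ob C" "Y \<in> Ob C" and "\<And>i. i \<in> set is \<Longrightarrow> x i \<in> OM X Y"
  shows "diff \<Omega> X Y (\<Sum>i\<leftarrow>is. x i) = (\<Sum>i\<leftarrow>is. diff \<Omega> X Y (x i))"
  by (rule linear_on_sum_list[OF diff_lin[OF X] vs_omega subspace_omega_sum assms(3)])

lemma sum_list_lam:
  assumes X: "X \<in> Ob C" "Y \<in> Ob C" "Z \<in> Ob C" "f \<in> Hom C Y Z" and "\<And>i. i \<in> set is \<Longrightarrow> x i \<in> OM X Y"
  shows "lam X Y Z f (\<Sum>i\<leftarrow>is. x i) = (\<Sum>i\<leftarrow>is. lam X Y Z f (x i))"
  by (rule linear_on_sum_list[OF lam_linear[OF X] vs_omega subspace_omega_sum assms(5)])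

text \<open>\<open>sweedler\<close> is nested to the right, so the first leg meets the head and the
  iterated coproduct of the second leg meets the rest. In this form the legs come from a single
  coproduct, and the two-leg Sweedler rules suffice.\<close>

lemma act_W_Cons:
  assumes X: "X \<in> Ob C" "Y \<in> Ob C" and p: "C.path X Y (X1 # Xs) (f # fs)"
  shows "act \<Omega> X Y h (W X Y (X1 # Xs) (f # fs))
    = (\<Sum>(a, b)\<leftarrow>sw H h. lam X X1 Y (act C X1 Y a f) (diff \<Omega> X X1 (act \<Omega> X X1 b (W X X1 Xs fs))))"
proof -
  from p have p': "X1 \<in> Ob C" "f \<in> Hom C X1 Y" "C.path X X1 Xs fs" by (auto simp: C.path_Cons)
  have "lam X X1 Y (act C X1 Y a f) (diff \<Omega> X X1 (act \<Omega> X X1 b (W X X1 Xs fs)))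
    = (\<Sum>hs\<leftarrow>sweedler H (length Xs) b. W X Y (X1 # Xs) (path_act C (Y # (X1 # Xs) @ [X]) (a # hs) (f # fs)))" for a b
  proof -
    have q: "C.path X X1 Xs (path_act C (X1 # Xs @ [X]) hs fs)" if "hs \<in> set (sweedler H (length Xs) b)" for hs
      by (rule path_act_path[OF X(1) p'(1,3) sweedler_length[OF that]])
    note a = act_closed[OF p'(1) X(2) p'(2), of a]
    have "diff \<Omega> X X1 (act \<Omega> X X1 b (W X X1 Xs fs))
      = (\<Sum>hs\<leftarrow>sweedler H (length Xs) b. U X X1 Xs (path_act C (X1 # Xs @ [X]) hs fs))"
      unfolding act_W_sum[OF X(1) p'(1,3)]
      by (subst sum_list_diff[OF X(1) p'(1)])
        (auto intro!: W_mem q sum_list_cong_set diff_W[OF X(1) p'(1)])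
    then show ?thesis
      by (simp add: path_act_Cons)
        (subst sum_list_lam[OF X(1) p'(1) X(2) a],
          auto intro!: U_mem q sum_list_cong_set lam_U[OF X(1) p'(1) X(2) a] X p')
  qed
  then show ?thesis
    unfolding act_W_sum[OF X p] length_Cons sum_sweedler_Suc by simp
qed

lemma act_mem:
  assumes X: "X \<in> Ob C" "Y \<in> Ob C" and x: "x \<in> omega_sum H C I X Y"
  shows "act \<Omega> X Y h x \<in> omega_sum H C I X Y"
proof (rule omega_mem_image[OF X x act_linear_Omega[OF X] vs_omega subspace_omega_sum])
  fix Xs fs assume p: "C.path X Y Xs fs" "Xs \<in> I"
  show "act \<Omega> X Y h (W X Y Xs fs) \<in> omega_sum H C I X Y"
    unfolding act_W_sum[OF X p(1)]
    by (intro osc_closed(4) W_mem path_act_path X p) (rule sweedler_length)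
next
  fix Xs fs assume p: "C.path X Y Xs fs" "Y # Xs \<in> I"
  show "act \<Omega> X Y h (U X Y Xs fs) \<in> omega_sum H C I X Y"
    unfolding act_U_sum[OF X p(1)]
    by (intro osc_closed(3,4) U_mem path_act_path X p) (auto dest: sweedler_length simp del: sweedler.simps)
qed

lemma lam_bilinear:
  assumes X: "X \<in> Ob C" "Y \<in> Ob C" "Z \<in> Ob C"
  shows "bilinear_on (scal C) (Hom C Y Z) osc (OM X Y) osc (lam X Y Z)"
  by (intro bilinear_onI lam_linear lam_linear_f X)

text \<open>Linearity in \<open>h\<close> cannot be read off the sum over
  \<open>sweedler H n h\<close>, whose lists are chosen separately for each \<open>h\<close>. The
  recursion reduces it to one coproduct with a bilinear summand.\<close>

lemma act_W_linear_h:
  assumes X: "X \<in> Ob C" "Y \<in> Ob C" and p: "C.path X Y Xs fs"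
  shows "linear_on UNIV (hscale H) osc (\<lambda>h. act \<Omega> X Y h (W X Y Xs fs))"
  using X(2) p
proof (induction Xs arbitrary: Y fs)
  case Nil
  then obtain f where f: "fs = [f]" "f \<in> Hom C X Y" by (auto simp: C.path_Nil)
  show ?case unfolding f act_W_Nil[OF X(1) Nil(1) f(2)]
    using W_head_linear[OF X(1) Nil(1), of "[]" "[]"] act_closed[OF X(1) Nil(1) f(2)]
    by (intro linear_on_comp[OF act_lin_h[OF X(1) Nil(1) f(2)], where W = "Hom C X Y" and g = "\<lambda>f. W X Y [] [f]"])
      (auto simp: path_homs_single)
next
  case (Cons X1 Xs)
  then obtain f gs where *: "fs = f # gs" "X1 \<in> Ob C" "f \<in> Hom C X1 Y" "C.path X X1 Xs gs"
    by (auto simp: C.path_Cons)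
  have mem: "act \<Omega> X X1 b (W X X1 Xs gs) \<in> OM X X1" for b
    by (intro act_mem X * W_mem) auto
  have bil: "bilinear_on (hscale H) UNIV (hscale H) UNIV osc
    (\<lambda>a b. lam X X1 Y (act C X1 Y a f) (diff \<Omega> X X1 (act \<Omega> X X1 b (W X X1 Xs gs))))"
    by (rule bilinear_on_comp[OF lam_bilinear[OF X(1) *(2) Cons.prems(1)] act_lin_h[OF *(2) Cons.prems(1) *(3)]
        linear_on_comp[OF Cons.IH[OF *(2,4)] diff_lin[OF X(1) *(2)] mem]])
      (auto intro: act_closed diff_mem_OM mem X * Cons.prems)
  show ?case
    unfolding *(1) act_W_Cons[OF X(1) Cons.prems(1) Cons.prems(2)[unfolded *(1)]]
    by (rule linear_on_sw[OF vs_omega linear_on_id bil])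
qed

text \<open>The leg acting on the unit contributes only its counit and is absorbed by the counit
  axiom, which is applicable since the action on \<open>W\<close> is linear in
  \<open>h\<close>.\<close>

lemma act_U:
  assumes X: "X \<in> Ob C" "Y \<in> Ob C" and p: "C.path X Y Xs fs"
  shows "act \<Omega> X Y h (U X Y Xs fs) = diff \<Omega> X Y (act \<Omega> X Y h (W X Y Xs fs))"
proof -
  have "(\<Sum>hs\<leftarrow>sweedler H (length Xs) b. osc c (U X Y Xs (path_act C (Y # Xs @ [X]) hs fs)))
    = osc c (diff \<Omega> X Y (act \<Omega> X Y b (W X Y Xs fs)))" for b c
  proof -
    have q: "C.path X Y Xs (path_act C (Y # Xs @ [X]) hs fs)" if "hs \<in> set (sweedler H (length Xs) b)" for hs
      by (rule path_act_path[OF X p sweedler_length[OF that]])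
    have "diff \<Omega> X Y (act \<Omega> X Y b (W X Y Xs fs))
      = (\<Sum>hs\<leftarrow>sweedler H (length Xs) b. U X Y Xs (path_act C (Y # Xs @ [X]) hs fs))"
      unfolding act_W_sum[OF X p]
      by (subst sum_list_diff[OF X]) (auto intro!: W_mem q sum_list_cong_set diff_W[OF X])
    then show ?thesis
      by (simp add: linear_on_sum_list[OF linear_on_scale[OF vs_omega linear_on_id] vs_omega subspace_whole[OF vs_omega]])
  qed
  then have "act \<Omega> X Y h (U X Y Xs fs)
    = (\<Sum>(a, b)\<leftarrow>sw H h. osc (counit H a) (diff \<Omega> X Y (act \<Omega> X Y b (W X Y Xs fs))))"
    unfolding act_U_sum[OF X p] sum_sweedler_Suc by simp
  also have "\<dots> = diff \<Omega> X Y (act \<Omega> X Y h (W X Y Xs fs))"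
    by (rule sw_counit_left[OF vs_omega linear_on_comp[OF act_W_linear_h[OF X p] diff_lin[OF X]]])
      (intro act_mem X W_mem p UNIV_I)
  finally show ?thesis .
qed

lemma act_diff:
  assumes X: "X \<in> Ob C" "Y \<in> Ob C" and x: "x \<in> OM X Y"
  shows "diff \<Omega> X Y (act \<Omega> X Y h x) = act \<Omega> X Y h (diff \<Omega> X Y x)"
proof (rule omega_eqI[OF X x])
  show "linear_on (OM X Y) osc osc (\<lambda>x. diff \<Omega> X Y (act \<Omega> X Y h x))"
    by (rule linear_on_comp[OF act_linear_Omega[OF X] diff_lin[OF X] act_mem[OF X]])
  show "linear_on (OM X Y) osc osc (\<lambda>x. act \<Omega> X Y h (diff \<Omega> X Y x))"
    by (rule linear_on_comp[OF diff_lin[OF X] act_linear_Omega[OF X] diff_mem_OM[OF X]])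
  fix Xs fs assume p: "C.path X Y Xs fs"
  show "diff \<Omega> X Y (act \<Omega> X Y h (W X Y Xs fs)) = act \<Omega> X Y h (diff \<Omega> X Y (W X Y Xs fs))"
    by (simp add: diff_W[OF X p] act_U[OF X p])
  have "act \<Omega> X Y h (W X Y Xs fs) \<in> OM X Y" by (intro act_mem X W_mem p UNIV_I)
  then show "diff \<Omega> X Y (act \<Omega> X Y h (U X Y Xs fs)) = act \<Omega> X Y h (diff \<Omega> X Y (U X Y Xs fs))"
    by (simp add: diff_U[OF X p] act_U[OF X p] diff_diff_zero[OF X] linear_on_zero[OF act_linear_Omega[OF X] osc_closed(1)])
qed

lemma act_linear_h:
  assumes X: "X \<in> Ob C" "Y \<in> Ob C" and x: "x \<in> OM X Y"
  shows "linear_on UNIV (hscale H) osc (\<lambda>h. act \<Omega> X Y h x)"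
proof (rule linear_on_param[OF vector_space_H subspace_whole[OF vector_space_H] act_linear_Omega[OF X] vs_omega X x])
  fix Xs fs assume p: "C.path X Y Xs fs"
  show "linear_on UNIV (hscale H) osc (\<lambda>h. act \<Omega> X Y h (W X Y Xs fs))" by (rule act_W_linear_h[OF X p])
  show "linear_on UNIV (hscale H) osc (\<lambda>h. act \<Omega> X Y h (U X Y Xs fs))"
    unfolding act_U[OF X p]
    by (rule linear_on_comp[OF act_W_linear_h[OF X p] diff_lin[OF X]]) (intro act_mem X W_mem p UNIV_I)
qed

lemma act_bilinear_Omega:
  assumes X: "X \<in> Ob C" "Y \<in> Ob C"
  shows "bilinear_on (hscale H) UNIV osc (OM X Y) osc (act \<Omega> X Y)"
  by (intro bilinear_onI act_linear_h act_linear_Omega X)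

lemma lam_act_bilinear:
  assumes X: "X \<in> Ob C" "Y \<in> Ob C" "Z \<in> Ob C" and f: "f \<in> Hom C Y Z" and x: "x \<in> OM X Y"
  shows "bilinear_on (hscale H) UNIV (hscale H) UNIV osc (\<lambda>a b. lam X Y Z (act C Y Z a f) (act \<Omega> X Y b x))"
  by (rule bilinear_on_comp[OF lam_bilinear[OF X] act_lin_h[OF X(2,3) f] act_linear_h[OF X(1,2) x]])
    (intro act_closed act_mem X f x)+

text \<open>For \<open>x\<close> of type \<open>U\<close> this is \<open>act_W_Cons\<close>. A word
  \<open>W\<close> of positive degree is \<open>g u\<close> with \<open>u\<close> of type
  \<open>U\<close>; then f (g u) = (f g) u, the action on the composite f g splits by
  \<open>act_cmp\<close>, and coassociativity regroups the three legs.\<close>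

lemma act_lam:
  assumes X: "X \<in> Ob C" "Y \<in> Ob C" "Z \<in> Ob C" and f: "f \<in> Hom C Y Z" and x: "x \<in> OM X Y"
  shows "act \<Omega> X Z h (lam X Y Z f x) = (\<Sum>(a, b)\<leftarrow>sw H h. lam X Y Z (act C Y Z a f) (act \<Omega> X Y b x))"
proof (rule omega_eqI[OF X(1,2) x])
  show "linear_on (OM X Y) osc osc (\<lambda>x. act \<Omega> X Z h (lam X Y Z f x))"
    by (rule linear_on_comp[OF lam_linear[OF X f] act_linear_Omega[OF X(1,3)] lam_mem[OF X f]])
  show "linear_on (OM X Y) osc osc (\<lambda>x. \<Sum>(a, b)\<leftarrow>sw H h. lam X Y Z (act C Y Z a f) (act \<Omega> X Y b x))"
    by (intro linear_on_sum_list_pairs vs_omega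
      linear_on_comp[OF act_linear_Omega[OF X(1,2)] lam_linear[OF X act_closed[OF X(2,3) f]] act_mem[OF X(1,2)]])
  \<comment> \<open>Stated for all \<open>Y\<close>, \<open>Z\<close> and \<open>f\<close>, since it
    is applied to \<open>f\<close>, to \<open>g\<close> and to their composite.\<close>
  have AU: "act \<Omega> X Z h (lam X Y Z f (U X Y Xs fs)) = (\<Sum>(a, b)\<leftarrow>sw H h. lam X Y Z (act C Y Z a f) (act \<Omega> X Y b (U X Y Xs fs)))"
    if "Y \<in> Ob C" "Z \<in> Ob C" "f \<in> Hom C Y Z" and p: "C.path X Y Xs fs" for Y Z f Xs fs h
    using that X p act_W_Cons[OF X(1) that(2), of Y Xs f fs]
    by (simp add: lam_U[OF X(1)] C.path_Cons act_U)
  fix Xs fs assume p: "C.path X Y Xs fs"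
  show "act \<Omega> X Z h (lam X Y Z f (U X Y Xs fs)) = (\<Sum>(a, b)\<leftarrow>sw H h. lam X Y Z (act C Y Z a f) (act \<Omega> X Y b (U X Y Xs fs)))"
    by (rule AU[OF X(2,3) f p])
  show "act \<Omega> X Z h (lam X Y Z f (W X Y Xs fs)) = (\<Sum>(a, b)\<leftarrow>sw H h. lam X Y Z (act C Y Z a f) (act \<Omega> X Y b (W X Y Xs fs)))"
  proof (cases Xs)
    case Nil
    with p obtain g where g: "fs = [g]" "g \<in> Hom C X Y" by (auto simp: C.path_Nil)
    have fg: "cmp C X Y Z f g \<in> Hom C X Z" by (rule C.cmp_closed[OF X f g(2)])
    have L: "linear_on (Hom C X Z) (scal C) osc (\<lambda>f. W X Z [] [f])"
      using W_head_linear[OF X(1,3), of "[]" "[]"] by (simp add: path_homs_single)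
    have pg: "C.path X Y [] [g']" if "g' \<in> Hom C X Y" for g' using that by (simp add: C.path_Nil)
    have "act \<Omega> X Z h (lam X Y Z f (W X Y Xs fs)) = W X Z [] [act C X Z h (cmp C X Y Z f g)]"
      unfolding Nil g(1) lam_W[OF X f pg[OF g(2)]] using fg by (simp add: act_W_Nil X)
    also have "\<dots> = W X Z [] [\<Sum>(a, b)\<leftarrow>sw H h. cmp C X Y Z (act C Y Z a f) (act C X Y b g)]"
      by (simp add: act_cmp[OF X f g(2)])
    also have "\<dots> = (\<Sum>(a, b)\<leftarrow>sw H h. W X Z [] [cmp C X Y Z (act C Y Z a f) (act C X Y b g)])"
      unfolding case_prod_beta'
      by (rule linear_on_sum_list[OF L C.vector_space_scal C.Hom_subspace[OF X(1,3)]])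
        (intro C.cmp_closed X act_closed f g)
    also have "\<dots> = (\<Sum>(a, b)\<leftarrow>sw H h. lam X Y Z (act C Y Z a f) (act \<Omega> X Y b (W X Y Xs fs)))"
      unfolding Nil g(1) act_W_Nil[OF X(1,2) g(2)]
      by (simp add: lam_W[OF X act_closed[OF X(2,3) f] pg[OF act_closed[OF X(1,2) g(2)]]])
    finally show ?thesis .
  next
    case (Cons X1 Xs')
    with p obtain g gs where g: "fs = g # gs" "X1 \<in> Ob C" "g \<in> Hom C X1 Y" "C.path X X1 Xs' gs"
      by (auto simp: C.path_Cons)
    define u where "u = U X X1 Xs' gs"
    have u: "u \<in> OM X X1" unfolding u_def by (intro U_mem X g UNIV_I)
    have Wu: "W X Y Xs fs = lam X X1 Y g u"
      unfolding Cons g(1) u_def by (simp add: lam_U[OF X(1) g(2) X(2) g(3,4)])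
    note fg = C.cmp_closed[OF g(2) X(2,3) f g(3)]
    have au: "act \<Omega> X X1 b u \<in> OM X X1" for b by (rule act_mem[OF X(1) g(2) u])
    have bil: "bilinear_on (scal C) (Hom C X1 Z) osc (OM X X1) osc (lam X X1 Z)"
      by (rule lam_bilinear[OF X(1) g(2) X(3)])
    note cb = C.cmp_bilinear[OF g(2) X(2,3)]
    have cl: "cmp C X1 Y Z (act C Y Z c f) (act C X1 Y e g) \<in> Hom C X1 Z" for c e
      by (intro C.cmp_closed g X act_closed f)
    have "act \<Omega> X Z h (lam X Y Z f (W X Y Xs fs)) = act \<Omega> X Z h (lam X X1 Z (cmp C X1 Y Z f g) u)"
      unfolding Wu by (simp add: lam_lam[OF X(1) g(2) X(2,3) f g(3) u])
    also have "\<dots> = (\<Sum>(a, b)\<leftarrow>sw H h. lam X X1 Z (act C X1 Z a (cmp C X1 Y Z f g)) (act \<Omega> X X1 b u))"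
      unfolding u_def by (rule AU[OF g(2) X(3) fg g(4)])
    also have "\<dots> = (\<Sum>(a, b)\<leftarrow>sw H h. \<Sum>(c, e)\<leftarrow>sw H a.
        lam X X1 Z (cmp C X1 Y Z (act C Y Z c f) (act C X1 Y e g)) (act \<Omega> X X1 b u))"
      unfolding act_cmp[OF g(2) X(2,3) f g(3)] case_prod_beta'
      by (intro arg_cong[of _ _ sum_list] map_cong refl
        linear_on_sum_list[OF bilinear_onD(1)[OF bil au] C.vector_space_scal C.Hom_subspace[OF g(2) X(3)] cl])
    also have "\<dots> = (\<Sum>(a, b)\<leftarrow>sw H h. \<Sum>(c, e)\<leftarrow>sw H b.
        lam X X1 Z (cmp C X1 Y Z (act C Y Z a f) (act C X1 Y c g)) (act \<Omega> X X1 e u))"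
    proof (rule sw_coassoc[OF vs_omega])
      fix b c
      show "linear_on UNIV (hscale H) osc (\<lambda>a. lam X X1 Z (cmp C X1 Y Z (act C Y Z a f) (act C X1 Y b g)) (act \<Omega> X X1 c u))"
        by (rule linear_on_comp[OF linear_on_comp[OF act_lin_h[OF X(2,3) f]
              bilinear_onD(1)[OF cb act_closed[OF g(2) X(2) g(3)]] act_closed[OF X(2,3) f]]
              bilinear_onD(1)[OF bil au] cl])
      show "linear_on UNIV (hscale H) osc (\<lambda>a. lam X X1 Z (cmp C X1 Y Z (act C Y Z b f) (act C X1 Y a g)) (act \<Omega> X X1 c u))"
        by (rule linear_on_comp[OF linear_on_comp[OF act_lin_h[OF g(2) X(2) g(3)]
              bilinear_onD(2)[OF cb act_closed[OF X(2,3) f]] act_closed[OF g(2) X(2) g(3)]]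
              bilinear_onD(1)[OF bil au] cl])
      show "linear_on UNIV (hscale H) osc (\<lambda>a. lam X X1 Z (cmp C X1 Y Z (act C Y Z b f) (act C X1 Y c g)) (act \<Omega> X X1 a u))"
        by (rule linear_on_comp[OF act_linear_h[OF X(1) g(2) u] bilinear_onD(2)[OF bil cl] au])
    qed
    also have "\<dots> = (\<Sum>(a, b)\<leftarrow>sw H h. lam X Y Z (act C Y Z a f) (act \<Omega> X Y b (lam X X1 Y g u)))"
    proof -
      have "lam X Y Z (act C Y Z a f) (act \<Omega> X Y b (lam X X1 Y g u))
        = (\<Sum>(c, e)\<leftarrow>sw H b. lam X X1 Z (cmp C X1 Y Z (act C Y Z a f) (act C X1 Y c g)) (act \<Omega> X X1 e u))" for a b
      proof -
        have "act \<Omega> X Y b (lam X X1 Y g u) = (\<Sum>(c, e)\<leftarrow>sw H b. lam X X1 Y (act C X1 Y c g) (act \<Omega> X X1 e u))"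
          unfolding u_def by (rule AU[OF g(2) X(2) g(3,4)])
        moreover have "lam X Y Z (act C Y Z a f) \<dots>
          = (\<Sum>(c, e)\<leftarrow>sw H b. lam X Y Z (act C Y Z a f) (lam X X1 Y (act C X1 Y c g) (act \<Omega> X X1 e u)))"
          unfolding case_prod_beta'
          by (rule sum_list_lam[OF X act_closed[OF X(2,3) f]])
            (intro lam_mem X g act_closed au)
        moreover have "lam X Y Z (act C Y Z a f) (lam X X1 Y (act C X1 Y c g) (act \<Omega> X X1 e u))
          = lam X X1 Z (cmp C X1 Y Z (act C Y Z a f) (act C X1 Y c g)) (act \<Omega> X X1 e u)" for c e
          by (rule lam_lam[OF X(1) g(2) X(2,3) act_closed[OF X(2,3) f] act_closed[OF g(2) X(2) g(3)] au])
        ultimately show ?thesis by simp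
      qed
      then show ?thesis by simp
    qed
    finally show ?thesis unfolding Wu .
  qed
qed

lemma act_one_Omega:
  assumes X: "X \<in> Ob C" "Y \<in> Ob C" and x: "x \<in> OM X Y"
  shows "act \<Omega> X Y 1 x = x"
proof (rule omega_gens_eqI[OF X x act_linear_Omega[OF X] linear_on_id])
  fix n x assume "x \<in> gens n X Y"
  then show "act \<Omega> X Y 1 x = x"
  proof (rule gens_induct[OF X], goal_cases)
    case (1 Y f)
    then show ?case using act_W_Nil[OF X(1) 1] act_one[OF X(1) 1] by simp
  next
    case (2 n Y x)
    show ?case unfolding act_diff[OF X(1) 2(1) OD_OM[OF 2(2)], symmetric] 2(3) ..
  next
    case (3 n Z Y f x)
    note x = OD_OM[OF 3(4)]
    show ?case
      using 3(5) unfolding act_lam[OF X(1) 3(1,2,3) x] sw_one[OF vs_omega lam_act_bilinear[OF X(1) 3(1,2,3) x]]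
      by (simp add: act_one[OF 3(1,2,3)])
  qed
qed

lemma act_mult_Omega:
  assumes X: "X \<in> Ob C" "Y \<in> Ob C" and x: "x \<in> OM X Y"
  shows "act \<Omega> X Y (h * h') x = act \<Omega> X Y h (act \<Omega> X Y h' x)"
proof (rule omega_gens_eqI[OF X x act_linear_Omega[OF X] linear_on_comp[OF act_linear_Omega[OF X] act_linear_Omega[OF X] act_mem[OF X]]])
  fix n x assume "x \<in> gens n X Y"
  \<comment> \<open>The quantifiers stay inside the induction because the step for
    \<open>lam\<close> uses the hypothesis at the legs of \<open>h\<close> and
    \<open>h'\<close>.\<close>
  then have "\<forall>h h'. act \<Omega> X Y (h * h') x = act \<Omega> X Y h (act \<Omega> X Y h' x)"
  proof (rule gens_induct[OF X], goal_cases)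
    case (1 Y f)
    then show ?case using act_W_Nil[OF X(1) 1(1)] act_mult[OF X(1) 1] act_closed[OF X(1) 1] by simp
  next
    case (2 n Y x)
    note x = OD_OM[OF 2(2)]
    show ?case using 2(3) x act_mem[OF X(1) 2(1) x] by (simp add: act_diff[OF X(1) 2(1), symmetric])
  next
    case (3 n Z Y f x)
    note x = OD_OM[OF 3(4)]
    show ?case
    proof (intro allI)
      fix h h'
      have "act \<Omega> X Y h (act \<Omega> X Y h' (lam X Z Y f x))
        = act \<Omega> X Y h (\<Sum>(c, e)\<leftarrow>sw H h'. lam X Z Y (act C Z Y c f) (act \<Omega> X Z e x))"
        unfolding act_lam[OF X(1) 3(1,2,3) x] ..
      also have "\<dots> = (\<Sum>(c, e)\<leftarrow>sw H h'. act \<Omega> X Y h (lam X Z Y (act C Z Y c f) (act \<Omega> X Z e x)))"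
        unfolding case_prod_beta'
        by (rule linear_on_sum_list[OF act_linear_Omega[OF X(1) 3(2)] vs_omega subspace_omega_sum])
          (intro lam_mem X 3(1,2,3) act_closed act_mem x)
      also have "\<dots> = (\<Sum>(c, e)\<leftarrow>sw H h'. \<Sum>(a, b)\<leftarrow>sw H h. lam X Z Y (act C Z Y (a * c) f) (act \<Omega> X Z (b * e) x))"
        using 3(5) by (simp add: act_lam[OF X(1) 3(1,2) act_closed[OF 3(1,2,3)] act_mem[OF X(1) 3(1) x]] act_mult[OF 3(1,2,3)])
      also have "\<dots> = (\<Sum>(a, b)\<leftarrow>sw H h. \<Sum>(c, e)\<leftarrow>sw H h'. lam X Z Y (act C Z Y (a * c) f) (act \<Omega> X Z (b * e) x))"
        unfolding case_prod_beta' by (rule sum_list_swap)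
      also have "\<dots> = act \<Omega> X Y (h * h') (lam X Z Y f x)"
        unfolding act_lam[OF X(1) 3(1,2,3) x] sw_mult[OF vs_omega lam_act_bilinear[OF X(1) 3(1,2,3) x]] ..
      finally show "act \<Omega> X Y (h * h') (lam X Z Y f x) = act \<Omega> X Y h (act \<Omega> X Y h' (lam X Z Y f x))" by simp
    qed
  qed
  then show "act \<Omega> X Y (h * h') x = act \<Omega> X Y h (act \<Omega> X Y h' x)" by blast
qed

end

section \<open>Merging neighbouring morphisms of a path\<close>

lemma merge_0: "merge C 0 (Z # Y # P) (f # g # gs) = cmp C (hd P) Y Z f g # gs" if "P \<noteq> []"
  using that by (simp add: merge_def hd_conv_nth)

lemma merge_Suc: "merge C (Suc i) (Z # P) (f # fs) = f # merge C i P fs"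
  by (simp add: merge_def)

lemma drop_nth_0: "drop_nth 0 (x # xs) = xs"
  and drop_nth_Suc: "drop_nth (Suc i) (x # xs) = x # drop_nth i xs"
  by (simp_all add: drop_nth_def)

lemma length_drop_nth: "i < length xs \<Longrightarrow> length (drop_nth i xs) = length xs - 1"
  by (simp add: drop_nth_def)

context linear_semicategory
begin

lemma path_append:
  assumes "path Y Z Xs fs" "path X Y Ys gs" "Y \<in> Ob C"
  shows "path X Z (Xs @ Y # Ys) (fs @ gs)"
  using assms(1)
proof (induction Xs arbitrary: Z fs)
  case Nil
  then show ?case using assms(2,3) by (auto simp: path_Nil path_Cons)
next
  case (Cons X1 Xs)
  then show ?case by (auto simp: path_Cons)
qed

lemma path_merge:
  assumes "X \<in> Ob C" "Z \<in> Ob C" "path X Z Qs fs" "i < length Qs"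
  shows "path X Z (drop_nth i Qs) (merge C i (Z # Qs @ [X]) fs)"
  using assms(2-)
proof (induction Qs arbitrary: Z fs i)
  case (Cons Q Qs)
  then obtain f gs where f: "fs = f # gs" "Q \<in> Ob C" "f \<in> Hom C Q Z" "path X Q Qs gs" by (auto simp: path_Cons)
  show ?case
  proof (cases i)
    case 0
    from f(4) obtain g hs where g: "gs = g # hs" "g \<in> Hom C (hd (Qs @ [X])) Q" "list_all2 (\<in>) hs (path_homs C (Qs @ [X]))"
      "set Qs \<subseteq> Ob C" by (auto simp: path_iff)
    then have "hd (Qs @ [X]) \<in> Ob C" using assms(1) by (cases Qs) auto
    with f g Cons.prems(1) cmp_closed show ?thesis unfolding 0 by (simp add: merge_0 drop_nth_0 path_iff)
  next
    case (Suc j)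
    with Cons.IH[OF f(2,4), of j] Cons.prems f show ?thesis by (simp add: merge_Suc drop_nth_Suc path_Cons)
  qed
qed simp

end

context H_semicategory
begin

subsection \<open>Composition\<close>

text \<open>
  \<open>LW\<close> and \<open>LU\<close> are the left multiplications by the words \<open>W\<close> and \<open>U = dW\<close>. The recursion unfolds
  \<open>(df) v = d(f v) - f dv\<close>, so that no word has to be expanded in the spanning set.
\<close>

fun LW :: "'o \<Rightarrow> 'o \<Rightarrow> 'o \<Rightarrow> 'o list \<Rightarrow> 'a list \<Rightarrow> ('k, 'o, 'a) omega \<Rightarrow> ('k, 'o, 'a) omega" where
  "LW X Y Z [] fs v = lam X Y Z (hd fs) v"
| "LW X Y Z (X1 # Xs) fs v = lam X X1 Z (hd fs) (diff \<Omega> X X1 (LW X Y X1 Xs (tl fs) v)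
      - osc ((-1) ^ length Xs) (LW X Y X1 Xs (tl fs) (diff \<Omega> X Y v)))"

definition LU :: "'o \<Rightarrow> 'o \<Rightarrow> 'o \<Rightarrow> 'o list \<Rightarrow> 'a list \<Rightarrow> ('k, 'o, 'a) omega \<Rightarrow> ('k, 'o, 'a) omega" where
  "LU X Y Z Xs fs v = diff \<Omega> X Z (LW X Y Z Xs fs v) - osc ((-1) ^ length Xs) (LW X Y Z Xs fs (diff \<Omega> X Y v))"

lemma LW_Cons: "LW X Y Z (X1 # Xs) (f # fs) v = lam X X1 Z f (LU X Y X1 Xs fs v)"
  by (simp add: LU_def)

lemma linear_on_minus:
  assumes "vector_space s'" "linear_on V s s' f" "linear_on V s s' g"
  shows "linear_on V s s' (\<lambda>x. f x - g x)"
proof -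
  interpret S: vector_space s' by fact
  show ?thesis using assms(2,3) by (auto simp: linear_on_def S.scale_right_diff_distrib)
qed

lemma LU_from_LW:
  assumes X: "X \<in> Ob C" "Y \<in> Ob C" "Z \<in> Ob C"
    and lin: "linear_on (OM X Y) osc osc (LW X Y Z Xs fs)" and mem: "\<And>v. v \<in> OM X Y \<Longrightarrow> LW X Y Z Xs fs v \<in> OM X Z"
  shows "linear_on (OM X Y) osc osc (LU X Y Z Xs fs)" "v \<in> OM X Y \<Longrightarrow> LU X Y Z Xs fs v \<in> OM X Z"
proof -
  show "linear_on (OM X Y) osc osc (LU X Y Z Xs fs)"
    unfolding LU_def
    by (intro linear_on_minus linear_on_scale vs_omega linear_on_comp[OF lin diff_lin[OF X(1,3)] mem]
      linear_on_comp[OF diff_lin[OF X(1,2)] lin diff_mem_OM[OF X(1,2)]])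
  show "v \<in> OM X Y \<Longrightarrow> LU X Y Z Xs fs v \<in> OM X Z"
    unfolding LU_def by (intro osc_closed_diff osc_closed(3) mem diff_mem_OM X)
qed

lemma
  assumes X: "X \<in> Ob C" "Y \<in> Ob C" "Z \<in> Ob C" and p: "C.path Y Z Xs fs"
  shows LW_linear: "linear_on (OM X Y) osc osc (LW X Y Z Xs fs)"
    and LW_mem: "v \<in> OM X Y \<Longrightarrow> LW X Y Z Xs fs v \<in> OM X Z"
proof -
  have "linear_on (OM X Y) osc osc (LW X Y Z Xs fs) \<and> (\<forall>v\<in>OM X Y. LW X Y Z Xs fs v \<in> OM X Z)"
    using p X(3)
  proof (induction Xs arbitrary: Z fs)
    case Nil
    then obtain f where "fs = [f]" "f \<in> Hom C Y Z" by (auto simp: C.path_Nil)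
    then show ?case using lam_linear[OF X(1,2) Nil(2)] lam_mem[OF X(1,2) Nil(2)]
      by (simp add: LW.simps[abs_def])
  next
    case (Cons X1 Xs)
    then obtain f gs where *: "fs = f # gs" "X1 \<in> Ob C" "f \<in> Hom C X1 Z" "C.path Y X1 Xs gs"
      by (auto simp: C.path_Cons)
    from Cons.IH[OF *(4,2)] LU_from_LW[OF X(1,2) *(2)]
    have LU: "linear_on (OM X Y) osc osc (LU X Y X1 Xs gs)" "\<And>v. v \<in> OM X Y \<Longrightarrow> LU X Y X1 Xs gs v \<in> OM X X1" by auto
    show ?case
      unfolding *(1) LW_Cons
      using linear_on_comp[OF LU(1) lam_linear[OF X(1) *(2) Cons.prems(2) *(3)] LU(2)]
        lam_mem[OF X(1) *(2) Cons.prems(2) *(3) LU(2)] by blast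
  qed
  then show "linear_on (OM X Y) osc osc (LW X Y Z Xs fs)" "v \<in> OM X Y \<Longrightarrow> LW X Y Z Xs fs v \<in> OM X Z" by auto
qed

lemma
  assumes X: "X \<in> Ob C" "Y \<in> Ob C" "Z \<in> Ob C" and p: "C.path Y Z Xs fs"
  shows LU_linear: "linear_on (OM X Y) osc osc (LU X Y Z Xs fs)"
    and LU_mem: "v \<in> OM X Y \<Longrightarrow> LU X Y Z Xs fs v \<in> OM X Z"
  using LU_from_LW[OF X LW_linear[OF X p] LW_mem[OF X p]] by blast+

lemma
  assumes X: "X \<in> Ob C" "Y \<in> Ob C" "Z \<in> Ob C" and Xs: "set Xs \<subseteq> Ob C" and v: "v \<in> OM X Y"
  shows LW_multilinear: "multilinear_on (scal C) (path_homs C (Z # Xs @ [Y])) osc (\<lambda>fs. LW X Y Z Xs fs v)"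
    and LU_multilinear: "multilinear_on (scal C) (path_homs C (Z # Xs @ [Y])) osc (\<lambda>fs. LU X Y Z Xs fs v)"
proof -
  \<comment> \<open>The hypothesis ranges over all \<open>v\<close>, because \<open>LU\<close>
    evaluates \<open>LW\<close> at \<open>v\<close> and at the differential of
    \<open>v\<close>.\<close>
  have LU: "multilinear_on (scal C) (path_homs C (Z # Xs @ [Y])) osc (\<lambda>fs. LU X Y Z Xs fs v)"
    if "\<And>v. v \<in> OM X Y \<Longrightarrow> multilinear_on (scal C) (path_homs C (Z # Xs @ [Y])) osc (\<lambda>fs. LW X Y Z Xs fs v)"
      "Z \<in> Ob C" "set Xs \<subseteq> Ob C" "v \<in> OM X Y" for Z Xs v
  proof -
    have "multilinear_on (scal C) (path_homs C (Z # Xs @ [Y])) osc (\<lambda>fs. diff \<Omega> X Z (LW X Y Z Xs fs v))"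
      by (rule multilinear_on_comp[OF that(1)[OF that(4)] diff_lin[OF X(1) that(2)]])
        (rule LW_mem[OF X(1,2) that(2)], use that X in \<open>auto simp: C.path_def\<close>)
    from multilinear_on_add[OF vs_omega this
        multilinear_on_scale[OF vs_omega that(1)[OF diff_mem_OM[OF X(1,2) that(4)]], of "- ((-1) ^ length Xs)"]]
    show ?thesis unfolding LU_def osc_minus by simp
  qed
  have LW: "multilinear_on (scal C) (path_homs C (Z # Xs @ [Y])) osc (\<lambda>fs. LW X Y Z Xs fs v)"
    if "set Xs \<subseteq> Ob C" "Z \<in> Ob C" "v \<in> OM X Y" for Z Xs v
    using that
  proof (induction Xs arbitrary: Z v)
    case Nil
    then show ?case using lam_linear_f[OF X(1,2) Nil(2,3)] C.Hom_zero X by (simp add: multilinear_path_Nil)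
  next
    case (Cons X1 Xs)
    then have Xs: "set Xs \<subseteq> Ob C" "X1 \<in> Ob C" by auto
    have m: "LU X Y X1 Xs fs v \<in> OM X X1" if "list_all2 (\<in>) fs (path_homs C (X1 # Xs @ [Y]))" for fs
      using that Xs X by (intro LU_mem[OF X(1,2) Xs(2)] Cons.prems) (auto simp: C.path_def)
    show ?case
      using C.Hom_zero Cons.prems Xs
        lam_linear_f[OF X(1) Xs(2) Cons.prems(2) m]
        multilinear_on_comp[OF LU[OF Cons.IH[OF Xs] Xs(2,1) Cons.prems(3)] lam_linear[OF X(1) Xs(2) Cons.prems(2)] m]
      by (simp add: multilinear_path_Cons LW_Cons del: LW.simps)
  qed
  show "multilinear_on (scal C) (path_homs C (Z # Xs @ [Y])) osc (\<lambda>fs. LW X Y Z Xs fs v)"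
    by (rule LW[OF Xs X(3) v])
  show "multilinear_on (scal C) (path_homs C (Z # Xs @ [Y])) osc (\<lambda>fs. LU X Y Z Xs fs v)"
    by (rule LU[OF LW[OF Xs X(3)] X(3) Xs v])
qed

text \<open>A word \<open>U\<close> is closed, so the correction term of the Leibniz recursion
  vanishes at every stage and only concatenation remains.\<close>

lemma LW_U:
  assumes X: "X \<in> Ob C" "Y \<in> Ob C" "Z \<in> Ob C" and p: "C.path Y Z Xs fs" "C.path X Y Ys gs"
  shows "LW X Y Z Xs fs (U X Y Ys gs) = W X Z (Xs @ Y # Ys) (fs @ gs)"
  using p(1) X(3)
proof (induction Xs arbitrary: Z fs)
  case Nil
  then show ?case using p(2) X by (auto simp: C.path_Nil lam_U)
next
  case (Cons X1 Xs)
  then obtain f fs' where *: "fs = f # fs'" "X1 \<in> Ob C" "f \<in> Hom C X1 Z" "C.path Y X1 Xs fs'"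
    by (auto simp: C.path_Cons)
  have q: "C.path X X1 (Xs @ Y # Ys) (fs' @ gs)" by (rule C.path_append[OF *(4) p(2) X(2)])
  have "LU X Y X1 Xs fs' (U X Y Ys gs) = U X X1 (Xs @ Y # Ys) (fs' @ gs)"
    unfolding LU_def Cons.IH[OF *(4,2)] diff_U[OF X(1,2) p(2)] diff_W[OF X(1) *(2) q]
      linear_on_zero[OF LW_linear[OF X(1,2) *(2,4)] osc_closed(1)] by simp
  then show ?case unfolding *(1) LW_Cons by (simp add: lam_U[OF X(1) *(2) Cons.prems(2) *(3) q])
qed

lemma LU_U:
  assumes X: "X \<in> Ob C" "Y \<in> Ob C" "Z \<in> Ob C" and p: "C.path Y Z Xs fs" "C.path X Y Ys gs"
  shows "LU X Y Z Xs fs (U X Y Ys gs) = U X Z (Xs @ Y # Ys) (fs @ gs)"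
  unfolding LU_def LW_U[OF X p] diff_U[OF X(1,2) p(2)] diff_W[OF X(1,3) C.path_append[OF p X(2)]]
    linear_on_zero[OF LW_linear[OF X p(1)] osc_closed(1)] by simp

lemma path_merge_append:
  assumes X: "X \<in> Ob C" "Y \<in> Ob C" "Z \<in> Ob C" and p: "C.path Y Z Xs fs" "C.path X Y Ys gs" and i: "i \<le> length Xs"
  shows "C.path X Z (drop_nth i (Xs @ Y # Ys)) (merge C i (Z # Xs @ Y # Ys @ [X]) (fs @ gs))"
  using C.path_merge[OF X(1,3) C.path_append[OF p X(2)], of i] i by simp

text \<open>Solves the recursion for \<open>LW\<close> in closed form: this is the alternating sum
  that \<open>omega_word_cmp\<close> takes as definition. Each step of the recursion adds one
  correction term, which becomes the summand with \<open>i = 0\<close>.\<close>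

lemma
  assumes X: "X \<in> Ob C" "Y \<in> Ob C" "Z \<in> Ob C" and p: "C.path Y Z Xs fs" "C.path X Y Ys gs"
  shows LW_W: "LW X Y Z Xs fs (W X Y Ys gs) = (\<Sum>i\<le>length Xs. osc ((-1) ^ (length Xs - i))
      (W X Z (drop_nth i (Xs @ Y # Ys)) (merge C i (Z # Xs @ Y # Ys @ [X]) (fs @ gs))))"
    and LU_W: "LU X Y Z Xs fs (W X Y Ys gs) = (\<Sum>i\<le>length Xs. osc ((-1) ^ (length Xs - i))
      (U X Z (drop_nth i (Xs @ Y # Ys)) (merge C i (Z # Xs @ Y # Ys @ [X]) (fs @ gs))))
      - osc ((-1) ^ length Xs) (W X Z (Xs @ Y # Ys) (fs @ gs))"
proof -
  let ?W = "\<lambda>Z Xs fs i. W X Z (drop_nth i (Xs @ Y # Ys)) (merge C i (Z # Xs @ Y # Ys @ [X]) (fs @ gs))"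
  let ?U = "\<lambda>Z Xs fs i. U X Z (drop_nth i (Xs @ Y # Ys)) (merge C i (Z # Xs @ Y # Ys @ [X]) (fs @ gs))"
  have LU: "LU X Y Z Xs fs (W X Y Ys gs) = (\<Sum>i\<le>length Xs. osc ((-1) ^ (length Xs - i)) (?U Z Xs fs i))
      - osc ((-1) ^ length Xs) (W X Z (Xs @ Y # Ys) (fs @ gs))"
    if "LW X Y Z Xs fs (W X Y Ys gs) = (\<Sum>i\<le>length Xs. osc ((-1) ^ (length Xs - i)) (?W Z Xs fs i))"
      "C.path Y Z Xs fs" "Z \<in> Ob C" for Z Xs fs
  proof -
    note q = path_merge_append[OF X(1,2) that(3,2) p(2)]
    have "diff \<Omega> X Z (\<Sum>i\<le>length Xs. osc ((-1) ^ (length Xs - i)) (?W Z Xs fs i))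
      = (\<Sum>i\<le>length Xs. diff \<Omega> X Z (osc ((-1) ^ (length Xs - i)) (?W Z Xs fs i)))"
      by (rule linear_on_sum[OF diff_lin[OF X(1) that(3)] vs_omega subspace_omega_sum])
        (auto intro!: osc_closed(3) W_mem q)
    also have "\<dots> = (\<Sum>i\<le>length Xs. osc ((-1) ^ (length Xs - i)) (?U Z Xs fs i))"
      by (intro sum.cong refl)
        (simp add: linear_on_scaleD[OF diff_lin[OF X(1) that(3)] W_mem[OF q]] diff_W[OF X(1) that(3) q])
    finally show ?thesis
      unfolding LU_def diff_W[OF X(1,2) p(2)] LW_U[OF X(1,2) that(3,2) p(2)] that(1) by simp
  qed
  show LW: "LW X Y Z Xs fs (W X Y Ys gs) = (\<Sum>i\<le>length Xs. osc ((-1) ^ (length Xs - i)) (?W Z Xs fs i))"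
    using p(1) X(3)
  proof (induction Xs arbitrary: Z fs)
    case Nil
    then obtain f where f: "fs = [f]" "f \<in> Hom C Y Z" by (auto simp: C.path_Nil)
    obtain g gs' where g: "gs = g # gs'" using path_neq_Nil[OF p(2)] by blast
    show ?case using lam_W[OF X(1,2) Nil(2) f(2) p(2)[unfolded g]] f g
      by (simp add: merge_0 drop_nth_0)
  next
    case (Cons X1 Xs)
    then obtain f fs' where *: "fs = f # fs'" "X1 \<in> Ob C" "f \<in> Hom C X1 Z" "C.path Y X1 Xs fs'"
      by (auto simp: C.path_Cons)
    let ?p = "length Xs"
    note q = path_merge_append[OF X(1,2) *(2,4) p(2)]
    note ap = C.path_append[OF *(4) p(2) X(2)]
    note lam1 = lam_linear[OF X(1) *(2) Cons.prems(2) *(3)]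
    obtain h hs where h: "fs' @ gs = h # hs" using path_neq_Nil[OF ap] by blast
    have hd_eq: "hd ((Xs @ Y # Ys) @ [X]) = hd (Xs @ Y # Ys @ [X])" by simp
    have "LW X Y Z (X1 # Xs) fs (W X Y Ys gs) = lam X X1 Z f
       ((\<Sum>i\<le>?p. osc ((-1) ^ (?p - i)) (?U X1 Xs fs' i)) - osc ((-1) ^ ?p) (W X X1 (Xs @ Y # Ys) (fs' @ gs)))"
      unfolding *(1) LW_Cons LU[OF Cons.IH[OF *(4,2)] *(4,2)] ..
    also have "\<dots> = lam X X1 Z f (\<Sum>i\<le>?p. osc ((-1) ^ (?p - i)) (?U X1 Xs fs' i))
        - lam X X1 Z f (osc ((-1) ^ ?p) (W X X1 (Xs @ Y # Ys) (fs' @ gs)))"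
      by (rule linear_diff[OF lam1 vs_omega]) (auto intro!: osc_closed(3,5) U_mem W_mem q ap X *)
    \<comment> \<open>The correction term of the Leibniz rule is the new summand
      \<open>i = 0\<close>, in which \<open>f\<close> is composed with its right neighbour.\<close>
    also have "lam X X1 Z f (osc ((-1) ^ ?p) (W X X1 (Xs @ Y # Ys) (fs' @ gs)))
      = osc ((-1) ^ ?p) (?W Z (X1 # Xs) fs 0)"
      using linear_on_scaleD[OF lam1 W_mem[OF ap UNIV_I]] ap unfolding h *(1)
      by (simp add: lam_W[OF X(1) *(2) Cons.prems(2) *(3) ap[unfolded h]] h merge_0 drop_nth_0)
    also have "lam X X1 Z f (\<Sum>i\<le>?p. osc ((-1) ^ (?p - i)) (?U X1 Xs fs' i))
      = (\<Sum>i\<le>?p. lam X X1 Z f (osc ((-1) ^ (?p - i)) (?U X1 Xs fs' i)))"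
      by (rule linear_on_sum[OF lam1 vs_omega subspace_omega_sum])
        (auto intro!: osc_closed(3) U_mem q X *)
    also have "\<dots> = (\<Sum>i\<le>?p. osc ((-1) ^ (?p - i)) (?W Z (X1 # Xs) fs (Suc i)))"
      by (intro sum.cong refl)
        (simp add: linear_on_scaleD[OF lam1 U_mem[OF X(1) *(2) q]] lam_U[OF X(1) *(2) Cons.prems(2) *(3) q]
          *(1) merge_Suc drop_nth_Suc)
    \<comment> \<open>The old summands move up by one index; the minus sign in front of the
      correction gives the sign required at \<open>i = 0\<close> for a left factor longer by
      one.\<close>
    also have "\<dots> - osc ((-1) ^ ?p) (?W Z (X1 # Xs) fs 0)
      = (\<Sum>i\<le>Suc ?p. osc ((-1) ^ (Suc ?p - i)) (?W Z (X1 # Xs) fs i))"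
      by (simp only: sum.atMost_Suc_shift) (simp add: osc_minus)
    finally show ?case by simp
  qed
  show "LU X Y Z Xs fs (W X Y Ys gs) = (\<Sum>i\<le>length Xs. osc ((-1) ^ (length Xs - i)) (?U Z Xs fs i))
      - osc ((-1) ^ length Xs) (W X Z (Xs @ Y # Ys) (fs @ gs))"
    by (rule LU[OF LW p(1) X(3)])
qed

text \<open>Left multiplication by a word with head \<open>(f, \<mu>)\<close>, split in the same way
  as the word itself. It mediates between the recursive operators, from which it inherits linearity,
  and the explicit formula.\<close>

definition LE :: "'o \<Rightarrow> 'o \<Rightarrow> 'o \<Rightarrow> 'o list \<times> ('a \<times> 'k) list \<Rightarrow> ('k, 'o, 'a) omega \<Rightarrow> ('k, 'o, 'a) omega" where
  "LE X Y Z = (\<lambda>(Xs, xs) v. LW X Y Z Xs (map fst xs) v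
     + (if snd (hd xs) = 0 then 0 else osc (snd (hd xs)) (LU X Y Z (tl Xs) (tl (map fst xs)) v)))"

lemma merge_adj_0:
  "P \<noteq> [] \<Longrightarrow> merge (adjoin_units H C) 0 (Z # Y # P) ((f, \<mu>) # (g, 0) # xs)
     = (cmp C (hd P) Y Z f g + scal C \<mu> g, 0) # xs"
  by (simp add: merge_0) (simp add: adjoin_units_def)

lemma merge_adj_map:
  "Suc i < length fs \<Longrightarrow> merge (adjoin_units H C) i P (map (\<lambda>f. (f, 0)) fs) = map (\<lambda>f. (f, 0)) (merge C i P fs)"
  by (simp add: merge_def adjoin_units_def take_map drop_map)

lemma LE_linear:
  assumes X: "X \<in> Ob C" "Y \<in> Ob C" "Z \<in> Ob C" and w: "w \<in> omega_words H C Y Z"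
  shows "linear_on (OM X Y) osc osc (LE X Y Z w)"
proof -
  obtain Xs xs where w': "w = (Xs, xs)" by (cases w)
  show ?thesis
  proof (cases Xs)
    case Nil
    with w w' obtain f where f: "f \<in> Hom C Y Z" "xs = [(f, 0)]" by (auto simp: omega_words_cases)
    have "LE X Y Z w = lam X Y Z f" by (rule ext) (simp add: w' Nil f LE_def)
    then show ?thesis using lam_linear[OF X f(1)] by simp
  next
    case (Cons X1 Xs')
    with w w' obtain f \<mu> fs where *: "xs = (f, \<mu>) # map (\<lambda>f. (f, 0)) fs" "X1 \<in> Ob C"
      "f \<in> Hom C X1 Z" "X1 \<noteq> Z \<Longrightarrow> \<mu> = 0" "C.path Y X1 Xs' fs" by (auto simp: omega_words_cases)
    have "linear_on (OM X Y) osc osc (LW X Y Z Xs (f # fs))"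
      by (rule LW_linear[OF X]) (use * Cons in \<open>auto simp: C.path_Cons\<close>)
    moreover have "linear_on (OM X Y) osc osc (LU X Y Z Xs' fs)" if "\<mu> \<noteq> 0"
      by (rule LU_linear[OF X]) (use * that in auto)
    moreover have "LE X Y Z w = (\<lambda>v. LW X Y Z Xs (f # fs) v + osc \<mu> (LU X Y Z Xs' fs v))"
      by (rule ext) (simp add: w' Cons * LE_def comp_def del: LW.simps)
    ultimately show ?thesis
      by (cases "\<mu> = 0") (auto intro!: linear_on_add linear_on_scale vs_omega)
  qed
qed

text \<open>The one place where the definition of composition is compared with the recursion. The
  right factor is split as a \<open>W\<close> plus \<nu> times a \<open>U\<close>: the alternating
  sum accounts for the former and the concluding concatenation for the latter.\<close>

lemma omega_word_cmp_LE:
  assumes X: "X \<in> Ob C" "Y \<in> Ob C" "Z \<in> Ob C" and w: "w \<in> omega_words H C Y Z"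
    and q: "C.path X Y Ys (g # gs)" and \<nu>: "\<nu> \<noteq> 0 \<Longrightarrow> \<exists>Ys'. Ys = Y # Ys' \<and> C.path X Y Ys' gs"
  shows "omega_word_cmp H C X Y Z w (Ys, (g, \<nu>) # map (\<lambda>f. (f, 0)) gs)
    = LE X Y Z w (W X Y Ys (g # gs)) + (if \<nu> = 0 then 0 else osc \<nu> (LE X Y Z w (U X Y (tl Ys) gs)))"
proof -
  obtain Xs xs where w': "w = (Xs, xs)" by (cases w)
  let ?A = "adjoin_units H C"
  have len: "length gs = length Ys" using C.path_length[OF q] by simp
  show ?thesis
  proof (cases Xs)
    case Nil
    with w w' obtain f where f: "f \<in> Hom C Y Z" "xs = [(f, 0)]" by (auto simp: omega_words_cases)
    have "omega_word_cmp H C X Y Z w (Ys, (g, \<nu>) # map (\<lambda>f. (f, 0)) gs)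
      = W X Z Ys (cmp C (hd (Ys @ [X])) Y Z f g # gs) + osc \<nu> (W X Z Ys (f # gs))"
      unfolding w' Nil f(2) omega_word_cmp_def W_def by (simp add: merge_adj_0 drop_nth_0)
    moreover have "LE X Y Z w (W X Y Ys (g # gs)) = W X Z Ys (cmp C (hd (Ys @ [X])) Y Z f g # gs)"
      unfolding w' Nil f(2) LE_def by (simp add: lam_W[OF X f(1) q])
    moreover have "osc \<nu> (LE X Y Z w (U X Y (tl Ys) gs)) = osc \<nu> (W X Z Ys (f # gs))" if nz: "\<nu> \<noteq> 0"
    proof -
      from \<nu>[OF nz] obtain Ys' where Y': "Ys = Y # Ys'" "C.path X Y Ys' gs" by blast
      show ?thesis unfolding w' Nil f(2) LE_def Y'(1) by (simp add: lam_U[OF X f(1) Y'(2)])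
    qed
    ultimately show ?thesis by simp
  next
    case (Cons X1 Xs')
    with w w' obtain f \<mu> fs where *: "xs = (f, \<mu>) # map (\<lambda>f. (f, 0)) fs" "X1 \<in> Ob C"
      "f \<in> Hom C X1 Z" "X1 \<noteq> Z \<Longrightarrow> \<mu> = 0" "C.path Y X1 Xs' fs" by (auto simp: omega_words_cases)
    let ?p = "length Xs'" and ?P = "Xs' @ Y # Ys @ [X]"
    have len_fs: "length fs = Suc ?p" using C.path_length[OF *(5)] .
    have pf: "C.path Y Z (X1 # Xs') (f # fs)" using * by (simp add: C.path_Cons)
    note pm = path_merge_append[OF X(1,2) *(2,5) q]
    note ap = C.path_append[OF *(5) q X(2)]
    obtain h hs where h: "fs @ g # gs = h # hs" using path_neq_Nil[OF ap] by blast
    have Ph: "hd (?P) \<in> Ob C" "h \<in> Hom C (hd ?P) X1" "list_all2 (\<in>) hs (path_homs C ?P)" "set (Xs' @ Y # Ys) \<subseteq> Ob C"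
      using ap[unfolded h] hd_path_Ob[OF X(1), of "Xs' @ Y # Ys"] by (auto simp: path_hd)
    let ?W = "\<lambda>i. W X Z (drop_nth i (Xs @ Y # Ys)) (merge C i (Z # Xs @ Y # Ys @ [X]) ((f # fs) @ g # gs))"
    let ?U = "\<lambda>i. U X X1 (drop_nth i (Xs' @ Y # Ys)) (merge C i (X1 # ?P) (fs @ g # gs))"
    let ?E = "\<lambda>i. omega_elem H C X Z (drop_nth i (Xs @ Y # Ys), merge ?A i (Z # Xs @ Y # Ys @ [X]) (xs @ (g, 0) # map (\<lambda>f. (f, 0)) gs))"
    have xs: "xs @ (g, 0) # map (\<lambda>f. (f, 0)) gs = (f, \<mu>) # map (\<lambda>f. (f, 0)) (fs @ g # gs)" by (simp add: *(1))
    \<comment> \<open>At \<open>i = 0\<close> the head, \<open>f\<close> plus \<mu>, absorbs its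
      neighbour \<open>h\<close>. The summand \<mu> \<open>h\<close> loses the unit and starts an
      ordinary word; it matches the \<open>W\<close> term in \<open>LU_W\<close>.\<close>
    have E0: "?E 0 = ?W 0 + (if \<mu> = 0 then 0 else osc \<mu> (W X Z (Xs' @ Y # Ys) (fs @ g # gs)))"
    proof -
      have E: "?E 0 = W X Z (Xs' @ Y # Ys) ((cmp C (hd ?P) X1 Z f h + scal C \<mu> h) # hs)"
        unfolding xs h Cons W_def by (simp add: merge_adj_0 drop_nth_0)
      have W0: "?W 0 = W X Z (Xs' @ Y # Ys) (cmp C (hd ?P) X1 Z f h # hs)"
        unfolding Cons using h by (simp add: merge_0 drop_nth_0)
      show ?thesis
      proof (cases "\<mu> = 0")
        case True
        then show ?thesis unfolding E W0 by simp
      next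
        case False
        with *(4) have XZ: "X1 = Z" by blast
        have lin: "linear_on (Hom C (hd ((Xs' @ Y # Ys) @ [X])) Z) (scal C) osc (\<lambda>f. W X Z (Xs' @ Y # Ys) (f # hs))"
          by (rule W_head_linear[OF X(1,3) Ph(4)]) (use Ph in simp)
        have cl: "cmp C (hd ?P) X1 Z f h \<in> Hom C (hd ?P) Z" by (rule C.cmp_closed[OF Ph(1) *(2) X(3) *(3) Ph(2)])
        show ?thesis
          using linear_on_addD[OF lin, of "cmp C (hd ?P) X1 Z f h" "scal C \<mu> h"] linear_on_scaleD[OF lin, of h \<mu>]
            cl Ph(1,2) X(3) False unfolding E W0 h XZ by (simp add: C.Hom_scale)
      qed
    qed
    \<comment> \<open>For positive index the head is untouched, so \<mu> still multiplies a word of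
      type \<open>U\<close>.\<close>
    have ES: "?E (Suc i) = ?W (Suc i) + (if \<mu> = 0 then 0 else osc \<mu> (U X Z (drop_nth i (Xs' @ Y # Ys)) (merge C i (Z # ?P) (fs @ g # gs))))"
      if i: "i \<le> ?p" for i
    proof -
      have m: "C.path X Z (X1 # drop_nth i (Xs' @ Y # Ys)) (f # merge C i (X1 # ?P) (fs @ g # gs))"
        using pm[OF i] * by (simp add: C.path_Cons)
      have "?E (Suc i) = omega_elem H C X Z (X1 # drop_nth i (Xs' @ Y # Ys), (f, \<mu>) # map (\<lambda>f. (f, 0)) (merge C i (X1 # ?P) (fs @ g # gs)))"
        unfolding xs Cons using i len_fs by (simp only: append_Cons drop_nth_Suc merge_Suc) (subst merge_adj_map, auto)
      then show ?thesis
        using omega_elem_head[OF X(1,3) m, of \<mu>] *(4) unfolding Cons by (cases "\<mu> = 0") (auto simp: merge_Suc drop_nth_Suc)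
    qed
    have sumE: "(\<Sum>i\<le>length Xs. osc ((-1) ^ (length Xs - i)) (?E i)) = LE X Y Z w (W X Y Ys (g # gs))"
    proof -
      have "(\<Sum>i\<le>length Xs. osc ((-1) ^ (length Xs - i)) (?E i))
        = osc ((-1) ^ Suc ?p) (?E 0) + (\<Sum>i\<le>?p. osc ((-1) ^ (?p - i)) (?E (Suc i)))"
        unfolding Cons by (simp only: length_Cons sum.atMost_Suc_shift) simp
      \<comment> \<open>Sorting by \<mu>: the part without \<mu> is the closed form of
        \<open>LW\<close>, the coefficient of \<mu> is that of \<open>LU\<close>.\<close>
      also have "\<dots> = (osc ((-1) ^ Suc ?p) (?W 0) + (\<Sum>i\<le>?p. osc ((-1) ^ (?p - i)) (?W (Suc i))))
        + (if \<mu> = 0 then 0 else osc \<mu> ((\<Sum>i\<le>?p. osc ((-1) ^ (?p - i)) (U X Z (drop_nth i (Xs' @ Y # Ys)) (merge C i (Z # ?P) (fs @ g # gs))))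
          - osc ((-1) ^ ?p) (W X Z (Xs' @ Y # Ys) (fs @ g # gs))))"
      proof -
        have sc: "osc c (\<Sum>i\<in>J. t i) = (\<Sum>i\<in>J. osc c (t i))" if "finite J" for c J and t :: "nat \<Rightarrow> ('k, 'o, 'a) omega"
          by (rule linear_on_sum[OF linear_on_scale[OF vs_omega linear_on_id] vs_omega subspace_whole[OF vs_omega] that]) simp
        show ?thesis unfolding E0
          by (cases "\<mu> = 0") (simp_all add: ES osc_add osc_diff osc_osc sc sum.distrib osc_minus mult.commute)
      qed
      also have "osc ((-1) ^ Suc ?p) (?W 0) + (\<Sum>i\<le>?p. osc ((-1) ^ (?p - i)) (?W (Suc i)))
        = (\<Sum>i\<le>length Xs. osc ((-1) ^ (length Xs - i)) (?W i))"
        unfolding Cons by (simp only: length_Cons sum.atMost_Suc_shift) simp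
      also have "\<dots> = LW X Y Z Xs (f # fs) (W X Y Ys (g # gs))"
        using LW_W[OF X pf q] unfolding Cons by simp
      also have "(if \<mu> = 0 then 0 else osc \<mu> ((\<Sum>i\<le>?p. osc ((-1) ^ (?p - i)) (U X Z (drop_nth i (Xs' @ Y # Ys)) (merge C i (Z # ?P) (fs @ g # gs))))
          - osc ((-1) ^ ?p) (W X Z (Xs' @ Y # Ys) (fs @ g # gs))))
        = (if \<mu> = 0 then 0 else osc \<mu> (LU X Y Z Xs' fs (W X Y Ys (g # gs))))"
      proof (cases "\<mu> = 0")
        case False
        with *(4) have "X1 = Z" by blast
        with LU_W[OF X _ q, of Xs' fs] *(5) show ?thesis by simp
      qed simp
      finally show ?thesis unfolding w' LE_def by (simp add: *(1) Cons comp_def del: LW.simps)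
    qed
    \<comment> \<open>On a right factor of type \<open>U\<close> both operators only concatenate,
      which is the last summand of the formula.\<close>
    have nu: "osc \<nu> (omega_elem H C X Z (Xs @ Ys, xs @ map (\<lambda>f. (f, 0)) gs))
      = (if \<nu> = 0 then 0 else osc \<nu> (LE X Y Z w (U X Y (tl Ys) gs)))"
    proof (cases "\<nu> = 0")
      case False
      from \<nu>[OF False] obtain Ys' where Y': "Ys = Y # Ys'" "C.path X Y Ys' gs" by blast
      have m: "C.path X Z (X1 # (Xs' @ Y # Ys')) (f # (fs @ gs))"
        using C.path_append[OF pf Y'(2) X(2)] by simp
      have "omega_elem H C X Z (Xs @ Ys, xs @ map (\<lambda>f. (f, 0)) gs) = LE X Y Z w (U X Y Ys' gs)"
      proof (cases "\<mu> = 0")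
        case True
        with omega_elem_head[OF X(1,3) m, of \<mu>] *(4) LW_U[OF X pf Y'(2)] show ?thesis
          unfolding w' LE_def Cons Y'(1) *(1) by (simp add: comp_def del: LW.simps)
      next
        case False
        with *(4) have XZ: "X1 = Z" by blast
        with False omega_elem_head[OF X(1,3) m, of \<mu>] LW_U[OF X pf Y'(2)] LU_U[OF X _ Y'(2), of Xs' fs] *(5)
        show ?thesis
          unfolding w' LE_def Cons Y'(1) *(1) by (simp add: comp_def del: LW.simps)
      qed
      then show ?thesis using Y' by simp
    qed simp
    have "omega_word_cmp H C X Y Z w (Ys, (g, \<nu>) # map (\<lambda>f. (f, 0)) gs)
      = (\<Sum>i\<le>length Xs. osc ((-1) ^ (length Xs - i)) (?E i)) + osc \<nu> (omega_elem H C X Z (Xs @ Ys, xs @ map (\<lambda>f. (f, 0)) gs))"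
      unfolding w' omega_word_cmp_def by (simp add: Let_def)
    then show ?thesis unfolding sumE nu .
  qed
qed


text \<open>Handles the inner of the two nested linear extensions in composition: its prescribed
  values are those of the linear map \<open>LE\<close>, so the extension has them and equals
  \<open>LE\<close>.\<close>

lemma inner_lin_ext:
  assumes X: "X \<in> Ob C" "Y \<in> Ob C" "Z \<in> Ob C" and w: "w \<in> omega_words H C Y Z" and y: "y \<in> OM X Y"
  shows "omega_lin_ext H C X Y osc (omega_word_cmp H C X Y Z w) y = LE X Y Z w y"
proof -
  note lin = LE_linear[OF X w]
  have 1: "multilinear_on (scal C) (path_homs C (Y # Xs @ [X])) osc (\<lambda>fs. LE X Y Z w (W X Y Xs fs))"
    if "set Xs \<subseteq> Ob C" for Xs
    by (rule multilinear_on_comp[OF W_multilinear[OF X(1,2) that] lin]) (rule W_mem, use that in \<open>auto simp: C.path_def\<close>)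
  have 2: "multilinear_on (scal C) (path_homs C (Y # Xs @ [X])) osc (\<lambda>fs. LE X Y Z w (U X Y Xs fs))"
    if "set Xs \<subseteq> Ob C" for Xs
    by (rule multilinear_on_comp[OF U_multilinear[OF X(1,2) that] lin]) (rule U_mem[OF X(1,2)], use that in \<open>auto simp: C.path_def\<close>)
  have g0: "omega_word_cmp H C X Y Z w ([], [(f, 0)]) = LE X Y Z w (W X Y [] [f])" if "f \<in> Hom C X Y" for f
    using omega_word_cmp_LE[OF X w, of "[]" f "[]" 0] that by (simp add: C.path_Nil)
  have g1: "omega_word_cmp H C X Y Z w (X1 # Xs, (f, \<mu>) # map (\<lambda>f. (f, 0)) fs)
      = LE X Y Z w (W X Y (X1 # Xs) (f # fs)) + osc \<mu> (LE X Y Z w (U X Y Xs fs))"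
    if "C.path X Y (X1 # Xs) (f # fs)" "X1 \<noteq> Y \<Longrightarrow> \<mu> = 0" for X1 Xs f \<mu> fs
  proof -
    have "\<exists>Ys'. X1 # Xs = Y # Ys' \<and> C.path X Y Ys' fs" if "\<mu> \<noteq> 0"
      using that \<open>X1 \<noteq> Y \<Longrightarrow> \<mu> = 0\<close> \<open>C.path X Y (X1 # Xs) (f # fs)\<close> by (cases "X1 = Y") (auto simp: C.path_Cons)
    from omega_word_cmp_LE[OF X w that(1), of \<mu>, OF this] show ?thesis by (cases "\<mu> = 0") auto
  qed
  note * = omega_lin_ext_values[OF X(1,2) vs_omega 1 2, where g = "omega_word_cmp H C X Y Z w", OF _ _ g0 g1]
  show ?thesis
    by (rule omega_eqI[OF X(1,2) y *(1) lin]) (assumption | rule *(2) *(3))+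
qed

lemma
  assumes X: "X \<in> Ob C" "Y \<in> Ob C" "Z \<in> Ob C" and y: "y \<in> OM X Y"
  shows cmp_linear_left: "linear_on (OM Y Z) osc osc (\<lambda>x. cmp \<Omega> X Y Z x y)"
    and cmp_W: "C.path Y Z Xs fs \<Longrightarrow> cmp \<Omega> X Y Z (W Y Z Xs fs) y = LW X Y Z Xs fs y"
    and cmp_U: "C.path Y Z Xs fs \<Longrightarrow> cmp \<Omega> X Y Z (U Y Z Xs fs) y = LU X Y Z Xs fs y"
proof -
  let ?g = "\<lambda>v. omega_lin_ext H C X Y osc (omega_word_cmp H C X Y Z v) y"
  have d: "cmp \<Omega> X Y Z x y = omega_lin_ext H C Y Z osc ?g x" for x by (simp add: Omega_def)
  have g0: "?g ([], [(f, 0)]) = LW X Y Z [] [f] y" if f: "f \<in> Hom C Y Z" for f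
  proof -
    have "([], [(f, 0)]) \<in> omega_words H C Y Z" using f by (simp add: omega_words_cases)
    from inner_lin_ext[OF X this y] show ?thesis by (simp add: LE_def)
  qed
  have g1: "?g (X1 # Xs, (f, \<mu>) # map (\<lambda>f. (f, 0)) fs) = LW X Y Z (X1 # Xs) (f # fs) y + osc \<mu> (LU X Y Z Xs fs y)"
    if p: "C.path Y Z (X1 # Xs) (f # fs)" and \<mu>: "X1 \<noteq> Z \<Longrightarrow> \<mu> = 0" for X1 Xs f \<mu> fs
  proof -
    have "(X1 # Xs, (f, \<mu>) # map (\<lambda>f. (f, 0)) fs) \<in> omega_words H C Y Z"
      using p \<mu> by (auto simp: omega_words_cases C.path_Cons)
    from inner_lin_ext[OF X this y] show ?thesis by (simp add: LE_def comp_def del: LW.simps)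
  qed
  note * = omega_lin_ext_values[OF X(2,3) vs_omega LW_multilinear[OF X _ y] LU_multilinear[OF X _ y], where g = ?g, OF _ _ g0 g1]
  show "linear_on (OM Y Z) osc osc (\<lambda>x. cmp \<Omega> X Y Z x y)" unfolding d by (rule *(1))
  show "C.path Y Z Xs fs \<Longrightarrow> cmp \<Omega> X Y Z (W Y Z Xs fs) y = LW X Y Z Xs fs y" unfolding d by (rule *(2))
  show "C.path Y Z Xs fs \<Longrightarrow> cmp \<Omega> X Y Z (U Y Z Xs fs) y = LU X Y Z Xs fs y" unfolding d by (rule *(3))
qed

lemma cmp_linear_right:
  assumes X: "X \<in> Ob C" "Y \<in> Ob C" "Z \<in> Ob C" and x: "x \<in> OM Y Z"
  shows "linear_on (OM X Y) osc osc (cmp \<Omega> X Y Z x)"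
proof (rule linear_on_param[OF vs_omega subspace_omega_sum _ vs_omega X(2,3) x])
  show "linear_on (OM Y Z) osc osc (\<lambda>x. cmp \<Omega> X Y Z x v)" if "v \<in> OM X Y" for v
    by (rule cmp_linear_left[OF X that])
  fix Xs fs assume p: "C.path Y Z Xs fs"
  show "linear_on (OM X Y) osc osc (cmp \<Omega> X Y Z (W Y Z Xs fs))"
    by (rule iffD2[OF linear_on_cong[OF cmp_W[OF X _ p] subspace_omega_sum vs_omega] LW_linear[OF X p]])
  show "linear_on (OM X Y) osc osc (cmp \<Omega> X Y Z (U Y Z Xs fs))"
    by (rule iffD2[OF linear_on_cong[OF cmp_U[OF X _ p] subspace_omega_sum vs_omega] LU_linear[OF X p]])
qed

lemma cmp_mem:
  assumes X: "X \<in> Ob C" "Y \<in> Ob C" "V \<in> Ob C" and x: "x \<in> OM Y V" and y: "y \<in> OM X Y"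
  shows "cmp \<Omega> X Y V x y \<in> OM X V"
  by (rule omega_mem_image[OF X(2,3) x cmp_linear_left[OF X y] vs_omega subspace_omega_sum])
    (simp_all add: cmp_W cmp_U X y LW_mem LU_mem)

text \<open>For \<open>x\<close> of type \<open>U\<close> this is the recursion of \<open>LW\<close>
  itself; for type \<open>W\<close> the head of \<open>x\<close> is composed with \<open>f\<close>,
  and \<open>lam_lam\<close> separates them again.\<close>

lemma cmp_lam:
  assumes X: "X \<in> Ob C" "Y \<in> Ob C" "V \<in> Ob C" "Z \<in> Ob C" and f: "f \<in> Hom C V Z" and x: "x \<in> OM Y V" and y: "y \<in> OM X Y"
  shows "cmp \<Omega> X Y Z (lam Y V Z f x) y = lam X V Z f (cmp \<Omega> X Y V x y)"
proof -
  note mem = cmp_mem[OF X(1,2,3) _ y]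
  show "cmp \<Omega> X Y Z (lam Y V Z f x) y = lam X V Z f (cmp \<Omega> X Y V x y)"
  proof (rule omega_eqI[OF X(2,3) x])
    show "linear_on (OM Y V) osc osc (\<lambda>x. cmp \<Omega> X Y Z (lam Y V Z f x) y)"
      by (rule linear_on_comp[OF lam_linear[OF X(2,3,4) f] cmp_linear_left[OF X(1,2,4) y] lam_mem[OF X(2,3,4) f]])
    show "linear_on (OM Y V) osc osc (\<lambda>x. lam X V Z f (cmp \<Omega> X Y V x y))"
      by (rule linear_on_comp[OF cmp_linear_left[OF X(1,2,3) y] lam_linear[OF X(1,3,4) f] mem])
    fix Xs fs assume p: "C.path Y V Xs fs"
    have "cmp \<Omega> X Y Z (lam Y V Z f (U Y V Xs fs)) y = LW X Y Z (V # Xs) (f # fs) y"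
      unfolding lam_U[OF X(2,3,4) f p] using p f X by (intro cmp_W[OF X(1,2,4) y]) (auto simp: C.path_Cons)
    then show "cmp \<Omega> X Y Z (lam Y V Z f (U Y V Xs fs)) y = lam X V Z f (cmp \<Omega> X Y V (U Y V Xs fs) y)"
      unfolding LW_Cons cmp_U[OF X(1,2,3) y p] .
    obtain g gs where g: "fs = g # gs" using path_neq_Nil[OF p] by blast
    have q: "C.path Y Z Xs (cmp C (hd (Xs @ [Y])) V Z f g # gs)"
      by (rule path_cmp_head[OF X(2,3,4) f p[unfolded g]])
    show "cmp \<Omega> X Y Z (lam Y V Z f (W Y V Xs fs)) y = lam X V Z f (cmp \<Omega> X Y V (W Y V Xs fs) y)"
    proof (cases Xs)
      case Nil
      then have "g \<in> Hom C Y V" using p g by (auto simp: C.path_Nil)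
      then show ?thesis
        unfolding cmp_W[OF X(1,2,3) y p] unfolding g lam_W[OF X(2,3,4) f p[unfolded g]] cmp_W[OF X(1,2,4) y q]
        using Nil lam_lam[OF X f _ y, of g] by simp
    next
      case (Cons X1 Xs')
      then have *: "g \<in> Hom C X1 V" "X1 \<in> Ob C" "C.path Y X1 Xs' gs" using p g by (auto simp: C.path_Cons)
      show ?thesis
        unfolding cmp_W[OF X(1,2,3) y p] unfolding g lam_W[OF X(2,3,4) f p[unfolded g]] cmp_W[OF X(1,2,4) y q]
        unfolding Cons LW_Cons
        using lam_lam[OF X(1) *(2) X(3,4) f *(1) LU_mem[OF X(1,2) *(2,3) y]] by simp
    qed
  qed
qed

lemma cmp_W_Nil:
  assumes X: "X \<in> Ob C" "Y \<in> Ob C" "Z \<in> Ob C" and f: "f \<in> Hom C Y Z" and y: "y \<in> OM X Y"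
  shows "cmp \<Omega> X Y Z (W Y Z [] [f]) y = lam X Y Z f y"
  using cmp_W[OF X y, of "[]" "[f]"] f by (simp add: C.path_Nil)

text \<open>The Leibniz rule solved for (dx) y: a product with dx is expressed by products with x,
  the form that inductions over the left factor need. On \<open>W\<close> it is the definition of
  \<open>LU\<close>; on \<open>U\<close> the left side is 0 and the right side cancels because d
  squares to zero.\<close>

lemma cmp_diff:
  assumes X: "X \<in> Ob C" "Y \<in> Ob C" "Z \<in> Ob C" and x: "x \<in> OD n Y Z" and y: "y \<in> OM X Y"
  shows "cmp \<Omega> X Y Z (diff \<Omega> Y Z x) y
    = diff \<Omega> X Z (cmp \<Omega> X Y Z x y) - osc ((-1) ^ n) (cmp \<Omega> X Y Z x (diff \<Omega> X Y y))"
proof (rule omega_eqI[OF X(2,3) x])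
  have sub: "OD n Y Z \<subseteq> OM Y Z" by (rule omega_sum_mono) simp
  note dy = diff_mem_OM[OF X(1,2) y]
  show "linear_on (OD n Y Z) osc osc (\<lambda>x. cmp \<Omega> X Y Z (diff \<Omega> Y Z x) y)"
    by (rule linear_on_mono[OF linear_on_comp[OF diff_lin[OF X(2,3)] cmp_linear_left[OF X y] diff_mem_OM[OF X(2,3)]] sub])
  show "linear_on (OD n Y Z) osc osc (\<lambda>x. diff \<Omega> X Z (cmp \<Omega> X Y Z x y) - osc ((-1) ^ n) (cmp \<Omega> X Y Z x (diff \<Omega> X Y y)))"
    by (rule linear_on_mono[OF _ sub])
      (intro linear_on_minus linear_on_scale vs_omega cmp_linear_left[OF X dy]
        linear_on_comp[OF cmp_linear_left[OF X y] diff_lin[OF X(1,3)] cmp_mem[OF X(1,2,3) _ y]])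
  fix Xs fs assume p: "C.path Y Z Xs fs"
  show "cmp \<Omega> X Y Z (diff \<Omega> Y Z (W Y Z Xs fs)) y = diff \<Omega> X Z (cmp \<Omega> X Y Z (W Y Z Xs fs) y)
      - osc ((-1) ^ n) (cmp \<Omega> X Y Z (W Y Z Xs fs) (diff \<Omega> X Y y))" if "Xs \<in> {Xs. length Xs = n}"
    using that by (simp add: diff_W[OF X(2,3) p] cmp_U[OF X y p] cmp_W[OF X y p] cmp_W[OF X dy p] LU_def)
  show "cmp \<Omega> X Y Z (diff \<Omega> Y Z (U Y Z Xs fs)) y = diff \<Omega> X Z (cmp \<Omega> X Y Z (U Y Z Xs fs) y)
      - osc ((-1) ^ n) (cmp \<Omega> X Y Z (U Y Z Xs fs) (diff \<Omega> X Y y))" if n: "Z # Xs \<in> {Xs. length Xs = n}"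
  proof -
    have n: "n = Suc (length Xs)" using n by simp
    note m = LW_mem[OF X p]
    have "diff \<Omega> X Z (LU X Y Z Xs fs y) = - osc ((-1) ^ length Xs) (diff \<Omega> X Z (LW X Y Z Xs fs (diff \<Omega> X Y y)))"
      unfolding LU_def
      by (subst linear_diff[OF diff_lin[OF X(1,3)] vs_omega])
        (auto intro!: osc_closed(3) m diff_mem_OM X y simp: diff_diff_zero[OF X(1,3) m] y dy
          linear_on_scaleD[OF diff_lin[OF X(1,3)] m])
    moreover have "LU X Y Z Xs fs (diff \<Omega> X Y y) = diff \<Omega> X Z (LW X Y Z Xs fs (diff \<Omega> X Y y))"
      unfolding LU_def diff_diff_zero[OF X(1,2) y] by (simp add: linear_on_zero[OF LW_linear[OF X p] osc_closed(1)])
    ultimately show ?thesis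
      unfolding diff_U[OF X(2,3) p] cmp_U[OF X y p] cmp_U[OF X dy p] n
      by (simp add: linear_on_zero[OF cmp_linear_left[OF X y] osc_closed(1)] osc_minus)
  qed
qed

lemma cmp_mem_OD:
  assumes X: "X \<in> Ob C" "Y \<in> Ob C" "Z \<in> Ob C" and x: "x \<in> OD n Y Z" and y: "y \<in> OD m X Y"
  shows "cmp \<Omega> X Y Z x y \<in> OD (n + m) X Z"
proof -
  \<comment> \<open>All \<open>m\<close> and \<open>y\<close> are quantified, since the step for the
    differential uses the hypothesis at \<open>y\<close> and at its differential, which has another
    degree.\<close>
  have g: "\<forall>m. \<forall>y\<in>OD m X Y. cmp \<Omega> X Y Z x y \<in> OD (n + m) X Z" if "x \<in> gens n Y Z" for x
    using X(2,3) that
  proof (rule gens_induct, goal_cases)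
    case (1 Z f)
    then show ?case by (auto simp: cmp_W_Nil[OF X(1,2) 1] OD_OM intro: lam_mem[OF X(1,2)])
  next
    case (2 n Z x)
    show ?case
    proof (intro allI ballI)
      fix m y assume y: "y \<in> OD m X Y"
      have "cmp \<Omega> X Y Z x (diff \<Omega> X Y y) \<in> OD (Suc (n + m)) X Z"
        using 2(3) diff_mem[OF X(1,2) y] by fastforce
      moreover have "diff \<Omega> X Z (cmp \<Omega> X Y Z x y) \<in> OD (Suc (n + m)) X Z"
        using 2(3) y by (intro diff_mem X 2(1)) auto
      ultimately show "cmp \<Omega> X Y Z (diff \<Omega> Y Z x) y \<in> OD (Suc n + m) X Z"
        unfolding cmp_diff[OF X(1,2) 2(1,2) OD_OM[OF y]]
        by (auto intro!: osc_closed_diff osc_closed(3))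
    qed
  next
    case (3 n V Z f x)
    then show ?case
      by (auto simp: cmp_lam[OF X(1,2) 3(1,2,3) OD_OM[OF 3(4)]] OD_OM intro!: lam_mem[OF X(1)])
  qed
  show ?thesis
    by (intro omega_mem_image[OF X(2,3) x cmp_linear_left[OF X OD_OM[OF y]] vs_omega subspace_omega_sum];
      rule g[rule_format, OF _ y]) (auto simp: gens_def)
qed

lemma cmp_bilinear_Omega:
  assumes X: "X \<in> Ob C" "Y \<in> Ob C" "Z \<in> Ob C"
  shows "bilinear_on osc (OM Y Z) osc (OM X Y) osc (cmp \<Omega> X Y Z)"
  by (intro bilinear_onI cmp_linear_left cmp_linear_right X)

lemma leibniz_Omega:
  assumes X: "X \<in> Ob C" "Y \<in> Ob C" "Z \<in> Ob C" and x: "x \<in> OD n Y Z" and y: "y \<in> OM X Y"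
  shows "diff \<Omega> X Z (cmp \<Omega> X Y Z x y)
    = cmp \<Omega> X Y Z (diff \<Omega> Y Z x) y + osc ((-1) ^ n) (cmp \<Omega> X Y Z x (diff \<Omega> X Y y))"
  unfolding cmp_diff[OF assms] by simp

text \<open>Induction over the generation of \<open>x\<close>. For dx both sides are expanded by
  \<open>cmp_diff\<close>, and the hypothesis is used at (y, z), (dy, z) and (y, dz). The signs
  require \<open>x\<close> and \<open>y\<close> to be homogeneous, so both are reduced to words
  beforehand while \<open>z\<close> stays arbitrary.\<close>

lemma cmp_assoc_Omega:
  assumes X: "V \<in> Ob C" "X \<in> Ob C" "Y \<in> Ob C" "Z \<in> Ob C"
    and x: "x \<in> OM Y Z" and y: "y \<in> OM X Y" and z: "z \<in> OM V X"
  shows "cmp \<Omega> V X Z (cmp \<Omega> X Y Z x y) z = cmp \<Omega> V Y Z x (cmp \<Omega> V X Y y z)"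
proof (rule omega_gens_eqI[OF X(3,4) x])
  have yz: "cmp \<Omega> V X Y y z \<in> OM V Y" by (rule cmp_mem[OF X(1,2,3) y z])
  show "linear_on (OM Y Z) osc osc (\<lambda>x. cmp \<Omega> V X Z (cmp \<Omega> X Y Z x y) z)"
    by (rule linear_on_comp[OF cmp_linear_left[OF X(2,3,4) y] cmp_linear_left[OF X(1,2,4) z] cmp_mem[OF X(2,3,4) _ y]])
  show "linear_on (OM Y Z) osc osc (\<lambda>x. cmp \<Omega> V Y Z x (cmp \<Omega> V X Y y z))"
    by (rule cmp_linear_left[OF X(1,3,4) yz])
  fix n x assume xg: "x \<in> gens n Y Z"
  then have x: "x \<in> OD n Y Z" by (rule gens_OD[OF X(3,4)])
  show "cmp \<Omega> V X Z (cmp \<Omega> X Y Z x y) z = cmp \<Omega> V Y Z x (cmp \<Omega> V X Y y z)"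
  proof (rule omega_gens_eqI[OF X(2,3) y])
    show "linear_on (OM X Y) osc osc (\<lambda>y. cmp \<Omega> V X Z (cmp \<Omega> X Y Z x y) z)"
      by (rule linear_on_comp[OF cmp_linear_right[OF X(2,3,4) OD_OM[OF x]] cmp_linear_left[OF X(1,2,4) z]
            cmp_mem[OF X(2,3,4) OD_OM[OF x]]])
    show "linear_on (OM X Y) osc osc (\<lambda>y. cmp \<Omega> V Y Z x (cmp \<Omega> V X Y y z))"
      by (rule linear_on_comp[OF cmp_linear_left[OF X(1,2,3) z] cmp_linear_right[OF X(1,3,4) OD_OM[OF x]]
            cmp_mem[OF X(1,2,3) _ z]])
    fix m y assume "y \<in> gens m X Y"
    then have y: "y \<in> OD m X Y" by (rule gens_OD[OF X(2,3)])
    have "\<forall>m. \<forall>y\<in>OD m X Y. \<forall>z\<in>OM V X. cmp \<Omega> V X Z (cmp \<Omega> X Y Z x y) z = cmp \<Omega> V Y Z x (cmp \<Omega> V X Y y z)"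
      using X(3,4) xg
    proof (rule gens_induct, goal_cases)
      case (1 Z f)
      show ?case
      proof (intro allI ballI)
        fix m y z assume yz: "y \<in> OD m X Y" "z \<in> OM V X"
        then show "cmp \<Omega> V X Z (cmp \<Omega> X Y Z (W Y Z [] [f]) y) z = cmp \<Omega> V Y Z (W Y Z [] [f]) (cmp \<Omega> V X Y y z)"
          using cmp_lam[OF X(1,2,3) 1 OD_OM[OF yz(1)] yz(2)]
          by (simp add: cmp_W_Nil[OF X(2,3) 1] cmp_W_Nil[OF X(1,3) 1] OD_OM cmp_mem[OF X(1,2,3)])
      qed
    next
      case (2 n Z x)
      note x = OD_OM[OF 2(2)]
      show ?case
      proof (intro allI ballI)
        fix m y z assume y: "y \<in> OD m X Y" and z: "z \<in> OM V X"
        note y' = OD_OM[OF y] and dy = diff_mem[OF X(2,3) y] and dz = diff_mem_OM[OF X(1,2) z]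
        note lin1 = cmp_linear_left[OF X(1,2) 2(1) z] and lin2 = cmp_linear_right[OF X(1,3) 2(1) x]
        have mems: "diff \<Omega> X Z (cmp \<Omega> X Y Z x y) \<in> OM X Z" "cmp \<Omega> X Y Z x (diff \<Omega> X Y y) \<in> OM X Z"
          "cmp \<Omega> V X Y (diff \<Omega> X Y y) z \<in> OM V Y" "cmp \<Omega> V X Y y (diff \<Omega> V X z) \<in> OM V Y"
          by (intro diff_mem_OM cmp_mem X 2(1) x y' z OD_OM[OF dy] dz)+
        have "cmp \<Omega> V X Z (cmp \<Omega> X Y Z (diff \<Omega> Y Z x) y) z
          = cmp \<Omega> V X Z (diff \<Omega> X Z (cmp \<Omega> X Y Z x y)) z - osc ((-1) ^ n) (cmp \<Omega> V X Z (cmp \<Omega> X Y Z x (diff \<Omega> X Y y)) z)"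
          unfolding cmp_diff[OF X(2,3) 2(1,2) y']
          using linear_diff[OF lin1 vs_omega mems(1) osc_closed(3)[OF mems(2)], of "(-1) ^ n"]
            linear_on_scaleD[OF lin1 mems(2), of "(-1) ^ n"] by simp
        also have "\<dots> = diff \<Omega> V Z (cmp \<Omega> V Y Z x (cmp \<Omega> V X Y y z))
            - osc ((-1) ^ (n + m)) (cmp \<Omega> V Y Z x (cmp \<Omega> V X Y y (diff \<Omega> V X z)))
            - osc ((-1) ^ n) (cmp \<Omega> V Y Z x (cmp \<Omega> V X Y (diff \<Omega> X Y y) z))"
          unfolding cmp_diff[OF X(1,2) 2(1) cmp_mem_OD[OF X(2,3) 2(1,2) y] z]
          using 2(3) y z dy dz by simp
        \<comment> \<open>The two correction terms reassemble to the differential of the product of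
          \<open>y\<close> and \<open>z\<close>.\<close>
        also have "\<dots> = diff \<Omega> V Z (cmp \<Omega> V Y Z x (cmp \<Omega> V X Y y z))
            - osc ((-1) ^ n) (cmp \<Omega> V Y Z x (diff \<Omega> V Y (cmp \<Omega> V X Y y z)))"
          unfolding leibniz_Omega[OF X(1,2,3) y z]
          using linear_on_addD[OF lin2 mems(3) osc_closed(3)[OF mems(4)], of "(-1) ^ m"]
            linear_on_scaleD[OF lin2 mems(4), of "(-1) ^ m"]
          by (simp add: osc_add osc_osc power_add)
        also have "\<dots> = cmp \<Omega> V Y Z (diff \<Omega> Y Z x) (cmp \<Omega> V X Y y z)"
          by (rule cmp_diff[OF X(1,3) 2(1,2) cmp_mem[OF X(1,2,3) y' z], symmetric])
        finally show "cmp \<Omega> V X Z (cmp \<Omega> X Y Z (diff \<Omega> Y Z x) y) z = cmp \<Omega> V Y Z (diff \<Omega> Y Z x) (cmp \<Omega> V X Y y z)" .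
      qed
    next
      case (3 n U' Z f x)
      note x = OD_OM[OF 3(4)]
      show ?case
      proof (intro allI ballI)
        fix m y z assume y: "y \<in> OD m X Y" and z: "z \<in> OM V X"
        note y' = OD_OM[OF y]
        show "cmp \<Omega> V X Z (cmp \<Omega> X Y Z (lam Y U' Z f x) y) z = cmp \<Omega> V Y Z (lam Y U' Z f x) (cmp \<Omega> V X Y y z)"
          using 3(5) y z
          by (simp add: cmp_lam[OF X(2,3) 3(1,2,3) x y'] cmp_lam[OF X(1,2) 3(1,2,3) cmp_mem[OF X(2,3) 3(1) x y'] z]
            cmp_lam[OF X(1,3) 3(1,2,3) x cmp_mem[OF X(1,2,3) y' z]])
      qed
    qed
    then show "cmp \<Omega> V X Z (cmp \<Omega> X Y Z x y) z = cmp \<Omega> V Y Z x (cmp \<Omega> V X Y y z)" using y z by blast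
  qed
qed

lemma cmp_act_bilinear:
  assumes X: "X \<in> Ob C" "Y \<in> Ob C" "Z \<in> Ob C" and x: "x \<in> OM Y Z" and y: "y \<in> OM X Y"
  shows "bilinear_on (hscale H) UNIV (hscale H) UNIV osc (\<lambda>a b. cmp \<Omega> X Y Z (act \<Omega> Y Z a x) (act \<Omega> X Y b y))"
  by (rule bilinear_on_comp[OF cmp_bilinear_Omega[OF X] act_linear_h[OF X(2,3) x] act_linear_h[OF X(1,2) y]])
    (intro act_mem X x y)+

lemma act_cmp_Omega:
  assumes X: "X \<in> Ob C" "Y \<in> Ob C" "Z \<in> Ob C" and x: "x \<in> OM Y Z" and y: "y \<in> OM X Y"
  shows "act \<Omega> X Z h (cmp \<Omega> X Y Z x y) = (\<Sum>(a, b)\<leftarrow>sw H h. cmp \<Omega> X Y Z (act \<Omega> Y Z a x) (act \<Omega> X Y b y))"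
proof (rule omega_gens_eqI[OF X(2,3) x])
  show "linear_on (OM Y Z) osc osc (\<lambda>x. act \<Omega> X Z h (cmp \<Omega> X Y Z x y))"
    by (rule linear_on_comp[OF cmp_linear_left[OF X y] act_linear_Omega[OF X(1,3)] cmp_mem[OF X _ y]])
  show "linear_on (OM Y Z) osc osc (\<lambda>x. \<Sum>(a, b)\<leftarrow>sw H h. cmp \<Omega> X Y Z (act \<Omega> Y Z a x) (act \<Omega> X Y b y))"
    by (intro linear_on_sum_list_pairs vs_omega
      linear_on_comp[OF act_linear_Omega[OF X(2,3)] cmp_linear_left[OF X act_mem[OF X(1,2) y]] act_mem[OF X(2,3)]])
  fix n x assume "x \<in> gens n Y Z"
  with X(2,3) have "\<forall>h. \<forall>y\<in>OM X Y. act \<Omega> X Z h (cmp \<Omega> X Y Z x y) = (\<Sum>(a, b)\<leftarrow>sw H h. cmp \<Omega> X Y Z (act \<Omega> Y Z a x) (act \<Omega> X Y b y))"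
  proof (rule gens_induct, goal_cases)
    case (1 Z f)
    then show ?case
      by (simp add: cmp_W_Nil[OF X(1,2) 1] act_W_Nil[OF X(2) 1] act_lam[OF X(1,2) 1]
        cmp_W_Nil[OF X(1,2) 1(1) act_closed[OF X(2) 1]] act_mem[OF X(1,2)])
  next
    case (2 n Z x)
    note x = OD_OM[OF 2(2)]
    show ?case
    proof (intro allI ballI)
      fix h y assume y: "y \<in> OM X Y"
      note dy = diff_mem_OM[OF X(1,2) y]
      note al = act_linear_Omega[OF X(1) 2(1), of h]
      have mems: "diff \<Omega> X Z (cmp \<Omega> X Y Z x y) \<in> OM X Z" "cmp \<Omega> X Y Z x (diff \<Omega> X Y y) \<in> OM X Z"
        by (intro diff_mem_OM cmp_mem X 2(1) x y dy)+
      have cm: "cmp \<Omega> X Y Z (act \<Omega> Y Z a x) (act \<Omega> X Y b y) \<in> OM X Z" for a b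
        by (intro cmp_mem act_mem X 2(1) x y)
      have D: "(\<Sum>(a, b)\<leftarrow>ps. f a b) - osc c (\<Sum>(a, b)\<leftarrow>ps. g a b) = (\<Sum>(a, b)\<leftarrow>ps. f a b - osc c (g a b))"
        for ps :: "('h \<times> 'h) list" and f g c
        by (induction ps) (auto simp: osc_add)
      have "act \<Omega> X Z h (cmp \<Omega> X Y Z (diff \<Omega> Y Z x) y)
        = diff \<Omega> X Z (act \<Omega> X Z h (cmp \<Omega> X Y Z x y)) - osc ((-1) ^ n) (act \<Omega> X Z h (cmp \<Omega> X Y Z x (diff \<Omega> X Y y)))"
        unfolding cmp_diff[OF X(1,2) 2(1,2) y] act_diff[OF X(1) 2(1) cmp_mem[OF X(1,2) 2(1) x y]]
        using linear_diff[OF al vs_omega mems(1) osc_closed(3)[OF mems(2)], of "(-1) ^ n"]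
          linear_on_scaleD[OF al mems(2), of "(-1) ^ n"] by simp
      also have "act \<Omega> X Z h (cmp \<Omega> X Y Z x y) = (\<Sum>(a, b)\<leftarrow>sw H h. cmp \<Omega> X Y Z (act \<Omega> Y Z a x) (act \<Omega> X Y b y))"
        using 2(3) y by blast
      also have "act \<Omega> X Z h (cmp \<Omega> X Y Z x (diff \<Omega> X Y y))
        = (\<Sum>(a, b)\<leftarrow>sw H h. cmp \<Omega> X Y Z (act \<Omega> Y Z a x) (act \<Omega> X Y b (diff \<Omega> X Y y)))"
        using 2(3) dy by blast
      also have "diff \<Omega> X Z (\<Sum>(a, b)\<leftarrow>sw H h. cmp \<Omega> X Y Z (act \<Omega> Y Z a x) (act \<Omega> X Y b y))
        = (\<Sum>(a, b)\<leftarrow>sw H h. diff \<Omega> X Z (cmp \<Omega> X Y Z (act \<Omega> Y Z a x) (act \<Omega> X Y b y)))"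
        unfolding case_prod_beta' by (rule sum_list_diff[OF X(1) 2(1) cm])
      also have "\<dots> - osc ((-1) ^ n) (\<Sum>(a, b)\<leftarrow>sw H h. cmp \<Omega> X Y Z (act \<Omega> Y Z a x) (act \<Omega> X Y b (diff \<Omega> X Y y)))
        = (\<Sum>(a, b)\<leftarrow>sw H h. cmp \<Omega> X Y Z (act \<Omega> Y Z a (diff \<Omega> Y Z x)) (act \<Omega> X Y b y))"
        unfolding D act_diff[OF X(1,2) y, symmetric] act_diff[OF X(2) 2(1) x, symmetric]
          cmp_diff[OF X(1,2) 2(1) act_mem[OF X(2) 2(1,2)] act_mem[OF X(1,2) y]] ..
      finally show "act \<Omega> X Z h (cmp \<Omega> X Y Z (diff \<Omega> Y Z x) y)
        = (\<Sum>(a, b)\<leftarrow>sw H h. cmp \<Omega> X Y Z (act \<Omega> Y Z a (diff \<Omega> Y Z x)) (act \<Omega> X Y b y))" .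
    qed
  next
    case (3 n V Z f x)
    note x = OD_OM[OF 3(4)]
    show ?case
    proof (intro allI ballI)
      fix h y assume y: "y \<in> OM X Y"
      have bl: "bilinear_on (scal C) (Hom C V Z) osc (OM X V) osc (lam X V Z)" by (rule lam_bilinear[OF X(1) 3(1,2)])
      note cb = cmp_bilinear_Omega[OF X(1,2) 3(1)]
      have cm: "cmp \<Omega> X Y V (act \<Omega> Y V a x) (act \<Omega> X Y b y) \<in> OM X V" for a b
        by (intro cmp_mem act_mem X 3(1) x y)
      have af: "act C V Z a f \<in> Hom C V Z" for a by (rule act_closed[OF 3(1,2,3)])
      have "act \<Omega> X Z h (cmp \<Omega> X Y Z (lam Y V Z f x) y)
        = (\<Sum>(a, b)\<leftarrow>sw H h. lam X V Z (act C V Z a f) (act \<Omega> X V b (cmp \<Omega> X Y V x y)))"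
        unfolding cmp_lam[OF X(1,2) 3(1,2,3) x y] by (rule act_lam[OF X(1) 3(1,2,3) cmp_mem[OF X(1,2) 3(1) x y]])
      also have "\<dots> = (\<Sum>(a, b)\<leftarrow>sw H h. \<Sum>(c, e)\<leftarrow>sw H b.
          lam X V Z (act C V Z a f) (cmp \<Omega> X Y V (act \<Omega> Y V c x) (act \<Omega> X Y e y)))"
      proof -
        have "lam X V Z (act C V Z a f) (act \<Omega> X V b (cmp \<Omega> X Y V x y))
          = (\<Sum>(c, e)\<leftarrow>sw H b. lam X V Z (act C V Z a f) (cmp \<Omega> X Y V (act \<Omega> Y V c x) (act \<Omega> X Y e y)))" for a b
        proof -
          have "act \<Omega> X V b (cmp \<Omega> X Y V x y) = (\<Sum>(c, e)\<leftarrow>sw H b. cmp \<Omega> X Y V (act \<Omega> Y V c x) (act \<Omega> X Y e y))"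
            using 3(5) y by blast
          then show ?thesis
            unfolding case_prod_beta' by (simp add: sum_list_lam[OF X(1) 3(1,2) af cm])
        qed
        then show ?thesis by simp
      qed
      \<comment> \<open>Coassociativity moves the split from the second leg to the first, so that
        the legs acting on \<open>f\<close> and \<open>x\<close> can be collected by
        \<open>act_lam\<close>.\<close>
      also have "\<dots> = (\<Sum>(a, b)\<leftarrow>sw H h. \<Sum>(c, e)\<leftarrow>sw H a.
          lam X V Z (act C V Z c f) (cmp \<Omega> X Y V (act \<Omega> Y V e x) (act \<Omega> X Y b y)))"
      proof (rule sw_coassoc[OF vs_omega, symmetric])
        fix b c
        show "linear_on UNIV (hscale H) osc (\<lambda>a. lam X V Z (act C V Z a f) (cmp \<Omega> X Y V (act \<Omega> Y V b x) (act \<Omega> X Y c y)))"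
          by (rule linear_on_comp[OF act_lin_h[OF 3(1,2,3)] bilinear_onD(1)[OF bl cm] af])
        show "linear_on UNIV (hscale H) osc (\<lambda>a. lam X V Z (act C V Z b f) (cmp \<Omega> X Y V (act \<Omega> Y V a x) (act \<Omega> X Y c y)))"
          by (rule linear_on_comp[OF bilinear_onD(1)[OF cmp_act_bilinear[OF X(1,2) 3(1) x y] UNIV_I] bilinear_onD(2)[OF bl af] cm])
        show "linear_on UNIV (hscale H) osc (\<lambda>a. lam X V Z (act C V Z b f) (cmp \<Omega> X Y V (act \<Omega> Y V c x) (act \<Omega> X Y a y)))"
          by (rule linear_on_comp[OF bilinear_onD(2)[OF cmp_act_bilinear[OF X(1,2) 3(1) x y] UNIV_I] bilinear_onD(2)[OF bl af] cm])
      qed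
      also have "\<dots> = (\<Sum>(a, b)\<leftarrow>sw H h. cmp \<Omega> X Y Z (act \<Omega> Y Z a (lam Y V Z f x)) (act \<Omega> X Y b y))"
      proof -
        have "cmp \<Omega> X Y Z (act \<Omega> Y Z a (lam Y V Z f x)) (act \<Omega> X Y b y)
          = (\<Sum>(c, e)\<leftarrow>sw H a. lam X V Z (act C V Z c f) (cmp \<Omega> X Y V (act \<Omega> Y V e x) (act \<Omega> X Y b y)))" for a b
        proof -
          have "cmp \<Omega> X Y Z (act \<Omega> Y Z a (lam Y V Z f x)) (act \<Omega> X Y b y)
            = (\<Sum>(c, e)\<leftarrow>sw H a. cmp \<Omega> X Y Z (lam Y V Z (act C V Z c f) (act \<Omega> Y V e x)) (act \<Omega> X Y b y))"
            unfolding act_lam[OF X(2) 3(1,2,3) x] case_prod_beta'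
            by (rule linear_on_sum_list[OF cmp_linear_left[OF X(1,2) 3(2) act_mem[OF X(1,2) y]] vs_omega subspace_omega_sum])
              (intro lam_mem X 3(1,2) af act_mem x)
          then show ?thesis
            by (simp add: cmp_lam[OF X(1,2) 3(1,2) af act_mem[OF X(2) 3(1) x] act_mem[OF X(1,2) y]])
        qed
        then show ?thesis by simp
      qed
      finally show "act \<Omega> X Z h (cmp \<Omega> X Y Z (lam Y V Z f x) y)
        = (\<Sum>(a, b)\<leftarrow>sw H h. cmp \<Omega> X Y Z (act \<Omega> Y Z a (lam Y V Z f x)) (act \<Omega> X Y b y))" .
    qed
  qed
  then show "act \<Omega> X Z h (cmp \<Omega> X Y Z x y) = (\<Sum>(a, b)\<leftarrow>sw H h. cmp \<Omega> X Y Z (act \<Omega> Y Z a x) (act \<Omega> X Y b y))"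
    using y by blast
qed

end

context H_semicategory
begin

subsection \<open>The DGH-semicategory axioms\<close>

lemma omega_sum_support:
  "f \<in> omega_sum H C I X Y \<longleftrightarrow>
     (\<forall>Xs. Xs \<in> I \<and> set Xs \<subseteq> Ob C \<longrightarrow>
        f Xs \<in> tensors_space (scal (adjoin_units H C)) (omega_factors H C X Y Xs)) \<and>
     (\<forall>Xs. \<not> (Xs \<in> I \<and> set Xs \<subseteq> Ob C) \<longrightarrow> f Xs = 0) \<and> finite {Xs. f Xs \<noteq> 0}"
  by (simp add: omega_sum_def direct_sum_def)

lemma omega_degree_decomposition:
  assumes f: "f \<in> OM X Y"
  shows "\<exists>!x. x \<in> direct_sum UNIV (\<lambda>n. OD n X Y) \<and> f = (\<Sum>n\<in>{n. x n \<noteq> 0}. x n)"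
proof -
  \<comment> \<open>The component of degree \<open>n\<close> is the restriction of \<open>f\<close>
    to index lists of length \<open>n\<close>, since elements of \<Omega> are functions on lists of
    inner objects.\<close>
  define x where "x n = (\<lambda>Xs. if length Xs = n then f Xs else 0)" for n
  have x_zero: "x n = 0 \<longleftrightarrow> (\<forall>Xs. length Xs = n \<longrightarrow> f Xs = 0)" for n
    by (auto simp: x_def fun_eq_iff zero_fun_def)
  have fin: "finite {Xs. f Xs \<noteq> 0}" using f by (simp add: omega_sum_support)
  have "{n. x n \<noteq> 0} \<subseteq> length ` {Xs. f Xs \<noteq> 0}" unfolding x_zero by auto
  then have fin_x: "finite {n. x n \<noteq> 0}" by (rule finite_subset) (simp add: fin)
  have OD: "x n \<in> OD n X Y" for n
    unfolding omega_sum_support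
  proof (intro conjI allI impI)
    show "finite {Xs. x n Xs \<noteq> 0}" by (rule finite_subset[OF _ fin]) (auto simp: x_def)
  qed (use f in \<open>auto simp: x_def omega_sum_support\<close>)
  \<comment> \<open>Evaluated at \<open>Xs\<close>, a decomposition shows only its component of
    degree \<open>length Xs\<close>; this yields both the sum formula and uniqueness.\<close>
  have sum_at: "(\<Sum>n\<in>{n. y n \<noteq> 0}. y n) Xs = y (length Xs) Xs"
    if "y \<in> direct_sum UNIV (\<lambda>n. OD n X Y)" for y Xs
  proof -
    have y: "finite {n. y n \<noteq> 0}" "\<And>n. y n \<in> OD n X Y" using that by (auto simp: direct_sum_def)
    have "y n Xs = 0" if "n \<noteq> length Xs" for n using y(2)[of n] that by (simp add: omega_sum_support)
    then have "(\<Sum>n\<in>{n. y n \<noteq> 0}. y n Xs) = (\<Sum>n\<in>{n. y n \<noteq> 0}. if length Xs = n then y n Xs else 0)"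
      by (intro sum.cong) auto
    also have "\<dots> = y (length Xs) Xs" using y(1) by (simp add: zero_fun_def)
    finally show ?thesis by (simp add: sum_fun_apply)
  qed
  have xm: "x \<in> direct_sum UNIV (\<lambda>n. OD n X Y)" using OD fin_x by (simp add: direct_sum_def)
  show ?thesis
  proof (rule ex1I[of _ x])
    show "x \<in> direct_sum UNIV (\<lambda>n. OD n X Y) \<and> f = (\<Sum>n\<in>{n. x n \<noteq> 0}. x n)"
      using xm sum_at[OF xm] by (auto simp: fun_eq_iff x_def)
    fix y assume "y \<in> direct_sum UNIV (\<lambda>n. OD n X Y) \<and> f = (\<Sum>n\<in>{n. y n \<noteq> 0}. y n)"
    then have y: "y \<in> direct_sum UNIV (\<lambda>n. OD n X Y)" "f = (\<Sum>n\<in>{n. y n \<noteq> 0}. y n)" by auto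
    show "y = x"
    proof (rule ext, rule ext)
      fix n Xs
      have "y n \<in> OD n X Y" using y(1) by (simp add: direct_sum_def)
      then show "y n Xs = x n Xs" using sum_at[OF y(1), of Xs] y(2) by (auto simp: x_def omega_sum_support)
    qed
  qed
qed

lemma DGH_Omega: "DGH_semicategory H \<Omega>"
proof -
  have lin: "linear_semicategory \<Omega>"
  proof (rule linear_semicategory.intro)
    show "vector_space (scal \<Omega>)" using vs_omega by simp
    show "linear_semicategory_axioms \<Omega>"
      by unfold_locales
        (simp_all add: subspace_omega_sum cmp_mem cmp_bilinear_Omega cmp_assoc_Omega)
  qed
  have "H_semicategory H \<Omega>"
    by (intro H_semicategory.intro hopf_algebra_axioms lin, unfold_locales)
      (simp_all add: act_mem act_bilinear_Omega act_one_Omega act_mult_Omega act_cmp_Omega)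
  then show ?thesis
  proof (rule DGH_semicategory.intro)
    show "DGH_semicategory_axioms \<Omega>"
    proof (unfold_locales, goal_cases)
      case (3 X Y f)
      then show ?case using omega_degree_decomposition by simp
    next
      case (8 X Y f)
      then show ?case by (simp add: diff_diff_zero)
    qed (simp_all add: subspace_omega_sum OD_OM subsetI cmp_mem_OD act_mem diff_mem diff_lin
      leibniz_Omega act_diff)
  qed
qed

end

section \<open>The functor induced on the universal DG-semicategory\<close>

lemma path_cmp_Cons:
  "P \<noteq> [] \<Longrightarrow> gs \<noteq> [] \<Longrightarrow> path_cmp S (X # Y # P) (f # gs) = cmp S (last P) Y X f (path_cmp S (Y # P) gs)"
  by (cases P; cases gs) simp_all

locale DGH_functor = H_semicategory H C + S: DGH_semicategory H S
  for H :: "('k::field, 'h::ring_1) hopf"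
    and C :: "('k, 'h, 'o, 'a::ab_group_add, 'z) hsemicat_scheme"
    and S :: "('k, 'h, 'p, 's::ab_group_add) dgh" +
  fixes \<rho>o :: "'o \<Rightarrow> 'p" and \<rho> :: "'o \<Rightarrow> 'o \<Rightarrow> 'a \<Rightarrow> 's"
  assumes semifunctor: "H_semifunctor C (degree0 S) \<rho>o \<rho>"
begin

lemma \<rho>o_Ob: "X \<in> Ob C \<Longrightarrow> \<rho>o X \<in> Ob S"
  and \<rho>_mem: "X \<in> Ob C \<Longrightarrow> Y \<in> Ob C \<Longrightarrow> f \<in> Hom C X Y \<Longrightarrow> \<rho> X Y f \<in> HomD S 0 (\<rho>o X) (\<rho>o Y)"
  and \<rho>_linear: "X \<in> Ob C \<Longrightarrow> Y \<in> Ob C \<Longrightarrow> linear_on (Hom C X Y) (scal C) (scal S) (\<rho> X Y)"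
  and \<rho>_act: "X \<in> Ob C \<Longrightarrow> Y \<in> Ob C \<Longrightarrow> f \<in> Hom C X Y \<Longrightarrow> \<rho> X Y (act C X Y h f) = act S (\<rho>o X) (\<rho>o Y) h (\<rho> X Y f)"
  and \<rho>_cmp: "X \<in> Ob C \<Longrightarrow> Y \<in> Ob C \<Longrightarrow> Z \<in> Ob C \<Longrightarrow> g \<in> Hom C Y Z \<Longrightarrow> f \<in> Hom C X Y \<Longrightarrow>
    \<rho> X Z (cmp C X Y Z g f) = cmp S (\<rho>o X) (\<rho>o Y) (\<rho>o Z) (\<rho> Y Z g) (\<rho> X Y f)"
  using semifunctor by (auto simp: H_semifunctor_def degree0_def image_subset_iff)

lemma vsS: "vector_space (scal S)" by (rule S.C.vector_space_scal)

lemma scalS [simp]: "scal S 0 x = 0" "scal S 1 x = x" "scal S c 0 = 0"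
proof -
  interpret V: vector_space "scal S" by (rule vsS)
  show "scal S 0 x = 0" "scal S 1 x = x" "scal S c 0 = 0" by auto
qed

lemma HomD_Hom: "X \<in> Ob S \<Longrightarrow> Y \<in> Ob S \<Longrightarrow> f \<in> HomD S n X Y \<Longrightarrow> f \<in> Hom S X Y"
  using S.HomD_subset by blast

lemma cmp_zero:
  assumes "X \<in> Ob S" "Y \<in> Ob S" "Z \<in> Ob S"
  shows "f \<in> Hom S X Y \<Longrightarrow> cmp S X Y Z 0 f = 0" "g \<in> Hom S Y Z \<Longrightarrow> cmp S X Y Z g 0 = 0"
  using linear_on_zero[OF bilinear_onD(1)[OF S.C.cmp_bilinear[OF assms]] S.C.Hom_zero[OF assms(2,3)]]
    linear_on_zero[OF bilinear_onD(2)[OF S.C.cmp_bilinear[OF assms]] S.C.Hom_zero[OF assms(1,2)]] by auto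

text \<open>\<open>dcomp\<close> and \<open>wcomp\<close> are the images of the words
  \<open>U\<close> and \<open>W\<close> under the induced functor, written as recursions along the
  path. In \<open>rho_path\<close> the first entry is treated differently from the rest, which makes
  it awkward for induction.\<close>

fun dcomp :: "'o \<Rightarrow> 'o \<Rightarrow> 'o list \<Rightarrow> 'a list \<Rightarrow> 's" where
  "dcomp X Y [] fs = diff S (\<rho>o X) (\<rho>o Y) (\<rho> X Y (hd fs))"
| "dcomp X Y (X1 # Xs) fs = cmp S (\<rho>o X) (\<rho>o X1) (\<rho>o Y)
     (diff S (\<rho>o X1) (\<rho>o Y) (\<rho> X1 Y (hd fs))) (dcomp X X1 Xs (tl fs))"

fun wcomp :: "'o \<Rightarrow> 'o \<Rightarrow> 'o list \<Rightarrow> 'a list \<Rightarrow> 's" where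
  "wcomp X Y [] fs = \<rho> X Y (hd fs)"
| "wcomp X Y (X1 # Xs) fs = cmp S (\<rho>o X) (\<rho>o X1) (\<rho>o Y) (\<rho> X1 Y (hd fs)) (dcomp X X1 Xs (tl fs))"

text \<open>The tail of \<open>rho_path\<close>, where no entry is exempt from the
  differential.\<close>

definition dpath :: "'o list \<Rightarrow> 'a list \<Rightarrow> 's list" where
  "dpath P fs = map (\<lambda>i. diff S (\<rho>o (P ! Suc i)) (\<rho>o (P ! i)) (\<rho> (P ! Suc i) (P ! i) (fs ! i))) [0..<length fs]"

lemma dpath_Cons: "dpath (Y # Z # P) (f # fs) = diff S (\<rho>o Z) (\<rho>o Y) (\<rho> Z Y f) # dpath (Z # P) fs"
  by (simp add: dpath_def upt_conv_Cons map_Suc_upt[symmetric] comp_def del: upt_Suc)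

lemma rho_path_Cons: "rho_path S \<rho>o \<rho> (Y # Z # P) (f # fs) = \<rho> Z Y f # dpath (Z # P) fs"
  by (simp add: rho_path_def dpath_def upt_conv_Cons map_Suc_upt[symmetric] comp_def Let_def del: upt_Suc)

lemma path_cmp_dpath:
  "length fs = Suc (length Xs) \<Longrightarrow> path_cmp S (map \<rho>o (Y # Xs @ [X])) (dpath (Y # Xs @ [X]) fs) = dcomp X Y Xs fs"
proof (induction Xs arbitrary: Y fs)
  case Nil
  then show ?case by (auto simp: length_Suc_conv dpath_Cons) (simp add: dpath_def)
next
  case (Cons X1 Xs)
  then obtain f gs where "fs = f # gs" "length gs = Suc (length Xs)" by (auto simp: length_Suc_conv)
  moreover from this have "dpath (X1 # Xs @ [X]) gs \<noteq> []" by (auto simp: dpath_def)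
  ultimately show ?case using Cons.IH[of gs X1] by (simp add: dpath_Cons path_cmp_Cons)
qed

lemma path_cmp_rho_path:
  assumes "length fs = Suc (length Xs)"
  shows "path_cmp S (map \<rho>o (Y # Xs @ [X])) (rho_path S \<rho>o \<rho> (Y # Xs @ [X]) fs) = wcomp X Y Xs fs"
proof (cases Xs)
  case Nil
  with assms show ?thesis by (auto simp: length_Suc_conv rho_path_Cons) (simp add: dpath_def)
next
  case (Cons X1 Xs')
  with assms obtain f gs where "fs = f # gs" "length gs = Suc (length Xs')" by (auto simp: length_Suc_conv)
  moreover from this have "dpath (X1 # Xs' @ [X]) gs \<noteq> []" by (auto simp: dpath_def)
  ultimately show ?thesis using path_cmp_dpath[of gs Xs' X1 X] Cons by (simp add: rho_path_Cons path_cmp_Cons)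
qed

lemma diff_\<rho>_mem: "X \<in> Ob C \<Longrightarrow> Y \<in> Ob C \<Longrightarrow> f \<in> Hom C X Y \<Longrightarrow>
    diff S (\<rho>o X) (\<rho>o Y) (\<rho> X Y f) \<in> HomD S 1 (\<rho>o X) (\<rho>o Y)"
  using S.diff_degree[OF \<rho>o_Ob \<rho>o_Ob \<rho>_mem] by simp

lemma diff_\<rho>_linear:
  "X \<in> Ob C \<Longrightarrow> Y \<in> Ob C \<Longrightarrow> linear_on (Hom C X Y) (scal C) (scal S) (\<lambda>f. diff S (\<rho>o X) (\<rho>o Y) (\<rho> X Y f))"
  by (rule linear_on_comp[OF \<rho>_linear S.diff_linear[OF \<rho>o_Ob \<rho>o_Ob]])
    (auto intro!: HomD_Hom \<rho>_mem \<rho>o_Ob)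

lemma dcomp_mem:
  assumes X: "X \<in> Ob C" and Y: "Y \<in> Ob C" and p: "C.path X Y Xs fs"
  shows "dcomp X Y Xs fs \<in> HomD S (Suc (length Xs)) (\<rho>o X) (\<rho>o Y)"
  using Y p
proof (induction Xs arbitrary: Y fs)
  case Nil
  then show ?case using diff_\<rho>_mem[OF X] by (auto simp: C.path_Nil)
next
  case (Cons X1 Xs)
  then obtain f gs where *: "fs = f # gs" "X1 \<in> Ob C" "f \<in> Hom C X1 Y" "C.path X X1 Xs gs" by (auto simp: C.path_Cons)
  show ?case
    using S.cmp_degree[OF \<rho>o_Ob[OF X] \<rho>o_Ob[OF *(2)] \<rho>o_Ob[OF Cons.prems(1)] diff_\<rho>_mem[OF *(2) Cons.prems(1) *(3)] Cons.IH[OF *(2,4)]]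
    by (simp add: *(1))
qed

lemma wcomp_mem:
  assumes X: "X \<in> Ob C" "Y \<in> Ob C" and p: "C.path X Y Xs fs"
  shows "wcomp X Y Xs fs \<in> HomD S (length Xs) (\<rho>o X) (\<rho>o Y)"
proof (cases Xs)
  case Nil
  then show ?thesis using p \<rho>_mem[OF X] by (auto simp: C.path_Nil)
next
  case (Cons X1 Xs')
  then obtain f gs where *: "fs = f # gs" "X1 \<in> Ob C" "f \<in> Hom C X1 Y" "C.path X X1 Xs' gs" using p by (auto simp: C.path_Cons)
  show ?thesis
    using S.cmp_degree[OF \<rho>o_Ob[OF X(1)] \<rho>o_Ob[OF *(2)] \<rho>o_Ob[OF X(2)] \<rho>_mem[OF *(2) X(2) *(3)] dcomp_mem[OF X(1) *(2,4)]]
    by (simp add: *(1) Cons)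
qed

lemma dcomp_Hom: "X \<in> Ob C \<Longrightarrow> Y \<in> Ob C \<Longrightarrow> C.path X Y Xs fs \<Longrightarrow> dcomp X Y Xs fs \<in> Hom S (\<rho>o X) (\<rho>o Y)"
  by (rule HomD_Hom[OF \<rho>o_Ob \<rho>o_Ob dcomp_mem])

lemma dcomp_closed:
  assumes X: "X \<in> Ob C" and Y: "Y \<in> Ob C" and p: "C.path X Y Xs fs"
  shows "diff S (\<rho>o X) (\<rho>o Y) (dcomp X Y Xs fs) = 0"
  using Y p
proof (induction Xs arbitrary: Y fs)
  case Nil
  then obtain f where f: "fs = [f]" "f \<in> Hom C X Y" by (auto simp: C.path_Nil)
  show ?case using S.diff_diff[OF \<rho>o_Ob[OF X] \<rho>o_Ob[OF Nil(1)] HomD_Hom[OF \<rho>o_Ob[OF X] \<rho>o_Ob[OF Nil(1)] \<rho>_mem[OF X Nil(1) f(2)]]] f(1) by simp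
next
  case (Cons X1 Xs)
  then obtain f gs where *: "fs = f # gs" "X1 \<in> Ob C" "f \<in> Hom C X1 Y" "C.path X X1 Xs gs" by (auto simp: C.path_Cons)
  note ob = \<rho>o_Ob[OF X] \<rho>o_Ob[OF *(2)] \<rho>o_Ob[OF Cons.prems(1)]
  note r = HomD_Hom[OF ob(2,3) \<rho>_mem[OF *(2) Cons.prems(1) *(3)]]
  note dr = diff_\<rho>_mem[OF *(2) Cons.prems(1) *(3)]
  \<comment> \<open>Both terms of the Leibniz rule vanish: the first factor is a differential, and
    the second is closed by induction.\<close>
  show ?case
    using S.leibniz[OF ob dr dcomp_mem[OF X *(2,4)]] Cons.IH[OF *(2,4)]
    by (simp add: *(1) S.diff_diff[OF ob(2,3) r] cmp_zero[OF ob] dcomp_Hom[OF X *(2,4)] HomD_Hom[OF ob(2,3) dr])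
qed

lemma dcomp_multilinear:
  assumes X: "X \<in> Ob C" and Y: "Y \<in> Ob C" and Xs: "set Xs \<subseteq> Ob C"
  shows "multilinear_on (scal C) (path_homs C (Y # Xs @ [X])) (scal S) (dcomp X Y Xs)"
  using Y Xs
proof (induction Xs arbitrary: Y)
  case Nil
  then show ?case using diff_\<rho>_linear[OF X] C.Hom_zero[OF X] by (simp add: multilinear_path_Nil)
next
  case (Cons X1 Xs)
  then have X1: "X1 \<in> Ob C" "set Xs \<subseteq> Ob C" by auto
  note ob = \<rho>o_Ob[OF X] \<rho>o_Ob[OF X1(1)] \<rho>o_Ob[OF Cons.prems(1)]
  note bil = S.C.cmp_bilinear[OF ob]
  have m: "dcomp X X1 Xs fs \<in> Hom S (\<rho>o X) (\<rho>o X1)" if "list_all2 (\<in>) fs (path_homs C (X1 # Xs @ [X]))" for fs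
    using that X1 by (intro dcomp_Hom X) (auto simp: C.path_def)
  have r: "diff S (\<rho>o X1) (\<rho>o Y) (\<rho> X1 Y f) \<in> Hom S (\<rho>o X1) (\<rho>o Y)" if "f \<in> Hom C X1 Y" for f
    by (rule HomD_Hom[OF ob(2,3) diff_\<rho>_mem[OF X1(1) Cons.prems(1) that]])
  show ?case
    using linear_on_comp[OF diff_\<rho>_linear[OF X1(1) Cons.prems(1)] bilinear_onD(1)[OF bil m] r]
      multilinear_on_comp[OF Cons.IH[OF X1] bilinear_onD(2)[OF bil r] m] C.Hom_zero[OF X1(1) Cons.prems(1)]
    by (simp add: multilinear_path_Cons)
qed

lemma wcomp_multilinear:
  assumes X: "X \<in> Ob C" and Y: "Y \<in> Ob C" and Xs: "set Xs \<subseteq> Ob C"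
  shows "multilinear_on (scal C) (path_homs C (Y # Xs @ [X])) (scal S) (wcomp X Y Xs)"
proof (cases Xs)
  case Nil
  then show ?thesis using \<rho>_linear[OF X Y] C.Hom_zero[OF X Y] by (simp add: multilinear_path_Nil)
next
  case (Cons X1 Xs')
  then have X1: "X1 \<in> Ob C" "set Xs' \<subseteq> Ob C" using Xs by auto
  note ob = \<rho>o_Ob[OF X] \<rho>o_Ob[OF X1(1)] \<rho>o_Ob[OF Y]
  note bil = S.C.cmp_bilinear[OF ob]
  have m: "dcomp X X1 Xs' fs \<in> Hom S (\<rho>o X) (\<rho>o X1)" if "list_all2 (\<in>) fs (path_homs C (X1 # Xs' @ [X]))" for fs
    using that X1 by (intro dcomp_Hom X) (auto simp: C.path_def)
  have r: "\<rho> X1 Y f \<in> Hom S (\<rho>o X1) (\<rho>o Y)" if "f \<in> Hom C X1 Y" for f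
    by (rule HomD_Hom[OF ob(2,3) \<rho>_mem[OF X1(1) Y that]])
  show ?thesis
    using linear_on_comp[OF \<rho>_linear[OF X1(1) Y] bilinear_onD(1)[OF bil m] r]
      multilinear_on_comp[OF dcomp_multilinear[OF X X1] bilinear_onD(2)[OF bil r] m] C.Hom_zero[OF X1(1) Y]
    unfolding Cons by (simp add: multilinear_path_Cons)
qed

abbreviation R :: "'o \<Rightarrow> 'o \<Rightarrow> ('k, 'o, 'a) omega \<Rightarrow> 's" where
  "R \<equiv> rho_hat H C S \<rho>o \<rho>"

lemma
  assumes X: "X \<in> Ob C" "Y \<in> Ob C"
  shows R_linear: "linear_on (OM X Y) osc (scal S) (R X Y)"
    and R_W: "C.path X Y Xs fs \<Longrightarrow> R X Y (W X Y Xs fs) = wcomp X Y Xs fs"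
    and R_U: "C.path X Y Xs fs \<Longrightarrow> R X Y (U X Y Xs fs) = dcomp X Y Xs fs"
proof -
  let ?g = "\<lambda>(Xs, xs). let rs = rho_path S \<rho>o \<rho> (Y # Xs @ [X]) (map fst xs) in
     path_cmp S (map \<rho>o (Y # Xs @ [X])) rs
     + scal S (snd (hd xs)) (path_cmp S (map \<rho>o (Xs @ [X])) (tl rs))"
  have g0: "?g ([], [(f, 0)]) = wcomp X Y [] [f]" for f
    using path_cmp_rho_path[of "[f]" "[]" Y X] by (simp add: Let_def)
  have g1: "?g (X1 # Xs, (f, \<mu>) # map (\<lambda>f. (f, 0)) fs) = wcomp X Y (X1 # Xs) (f # fs) + scal S \<mu> (dcomp X Y Xs fs)"
    if p: "C.path X Y (X1 # Xs) (f # fs)" and \<mu>: "X1 \<noteq> Y \<Longrightarrow> \<mu> = 0" for X1 Xs f \<mu> fs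
  proof -
    have len: "length (f # fs) = Suc (length (X1 # Xs))" "length fs = Suc (length Xs)" using C.path_length[OF p] by auto
    \<comment> \<open>The formula composes along the path that ends in \<open>X1\<close>, whereas
      \<open>dcomp\<close> is wanted for target \<open>Y\<close>; a nonzero \<mu> identifies the
      two.\<close>
    have "scal S \<mu> (path_cmp S (map \<rho>o ((X1 # Xs) @ [X])) (tl (rho_path S \<rho>o \<rho> (Y # (X1 # Xs) @ [X]) (f # fs))))
      = scal S \<mu> (dcomp X Y Xs fs)"
      using \<mu> path_cmp_dpath[OF len(2), of X1 X] by (cases "X1 = Y") (simp_all add: rho_path_Cons)
    then show ?thesis using path_cmp_rho_path[OF len(1), of Y X] by (simp add: Let_def comp_def)
  qed
  note * = omega_lin_ext_values[OF X vsS wcomp_multilinear[OF X] dcomp_multilinear[OF X], where g = ?g, OF _ _ g0 g1]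
  show "linear_on (OM X Y) osc (scal S) (R X Y)" unfolding rho_hat_def by (rule *(1))
  show "C.path X Y Xs fs \<Longrightarrow> R X Y (W X Y Xs fs) = wcomp X Y Xs fs" unfolding rho_hat_def by (rule *(2))
  show "C.path X Y Xs fs \<Longrightarrow> R X Y (U X Y Xs fs) = dcomp X Y Xs fs" unfolding rho_hat_def by (rule *(3))
qed

lemma R_mem:
  assumes X: "X \<in> Ob C" "Y \<in> Ob C" and x: "x \<in> OD n X Y"
  shows "R X Y x \<in> HomD S n (\<rho>o X) (\<rho>o Y)"
  by (rule omega_mem_image[OF X x R_linear[OF X] vsS S.HomD_subspace[OF \<rho>o_Ob[OF X(1)] \<rho>o_Ob[OF X(2)]]])
    (auto simp: R_W R_U X wcomp_mem dcomp_mem)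

lemma R_mem_Hom:
  assumes X: "X \<in> Ob C" "Y \<in> Ob C" and x: "x \<in> OM X Y"
  shows "R X Y x \<in> Hom S (\<rho>o X) (\<rho>o Y)"
  by (rule omega_mem_image[OF X x R_linear[OF X] vsS S.C.Hom_subspace[OF \<rho>o_Ob[OF X(1)] \<rho>o_Ob[OF X(2)]]])
    (auto simp: R_W R_U X dcomp_Hom intro!: HomD_Hom \<rho>o_Ob wcomp_mem)

lemma R_diff:
  assumes X: "X \<in> Ob C" "Y \<in> Ob C" and x: "x \<in> OM X Y"
  shows "R X Y (diff \<Omega> X Y x) = diff S (\<rho>o X) (\<rho>o Y) (R X Y x)"
proof (rule omega_eqI[OF X x])
  note ob = \<rho>o_Ob[OF X(1)] \<rho>o_Ob[OF X(2)]
  show "linear_on (OM X Y) osc (scal S) (\<lambda>x. R X Y (diff \<Omega> X Y x))"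
    by (rule linear_on_comp[OF diff_lin[OF X] R_linear[OF X] diff_mem_OM[OF X]])
  show "linear_on (OM X Y) osc (scal S) (\<lambda>x. diff S (\<rho>o X) (\<rho>o Y) (R X Y x))"
    by (rule linear_on_comp[OF R_linear[OF X] S.diff_linear[OF ob] R_mem_Hom[OF X]])
  fix Xs fs assume p: "C.path X Y Xs fs"
  show "R X Y (diff \<Omega> X Y (U X Y Xs fs)) = diff S (\<rho>o X) (\<rho>o Y) (R X Y (U X Y Xs fs))"
    unfolding diff_U[OF X p] R_U[OF X p] dcomp_closed[OF X p] by (rule linear_on_zero[OF R_linear[OF X] osc_closed(1)])
  show "R X Y (diff \<Omega> X Y (W X Y Xs fs)) = diff S (\<rho>o X) (\<rho>o Y) (R X Y (W X Y Xs fs))"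
  proof (cases Xs)
    case Nil
    then show ?thesis unfolding diff_W[OF X p] R_U[OF X p] R_W[OF X p] by simp
  next
    case (Cons X1 Xs')
    then obtain f gs where *: "fs = f # gs" "X1 \<in> Ob C" "f \<in> Hom C X1 Y" "C.path X X1 Xs' gs" using p by (auto simp: C.path_Cons)
    note ob' = ob(1) \<rho>o_Ob[OF *(2)] ob(2)
    note r = \<rho>_mem[OF *(2) X(2) *(3)]
    show ?thesis
      unfolding diff_W[OF X p] R_U[OF X p] R_W[OF X p]
      using S.leibniz[OF ob' r dcomp_mem[OF X(1) *(2,4)]]
      by (simp add: Cons *(1) dcomp_closed[OF X(1) *(2,4)] cmp_zero[OF ob'] HomD_Hom[OF ob'(2,3) r])
  qed
qed

lemma R_lam:
  assumes X: "X \<in> Ob C" "Y \<in> Ob C" "Z \<in> Ob C" and f: "f \<in> Hom C Y Z" and x: "x \<in> OM X Y"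
  shows "R X Z (lam X Y Z f x) = cmp S (\<rho>o X) (\<rho>o Y) (\<rho>o Z) (\<rho> Y Z f) (R X Y x)"
proof (rule omega_eqI[OF X(1,2) x])
  note ob = \<rho>o_Ob[OF X(1)] \<rho>o_Ob[OF X(2)] \<rho>o_Ob[OF X(3)]
  note rf = HomD_Hom[OF ob(2,3) \<rho>_mem[OF X(2,3) f]]
  show "linear_on (OM X Y) osc (scal S) (\<lambda>x. R X Z (lam X Y Z f x))"
    by (rule linear_on_comp[OF lam_linear[OF X f] R_linear[OF X(1,3)] lam_mem[OF X f]])
  show "linear_on (OM X Y) osc (scal S) (\<lambda>x. cmp S (\<rho>o X) (\<rho>o Y) (\<rho>o Z) (\<rho> Y Z f) (R X Y x))"
    by (rule linear_on_comp[OF R_linear[OF X(1,2)] bilinear_onD(2)[OF S.C.cmp_bilinear[OF ob] rf] R_mem_Hom[OF X(1,2)]])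
  fix Xs fs assume p: "C.path X Y Xs fs"
  have q: "C.path X Z (Y # Xs) (f # fs)" using p f X by (simp add: C.path_Cons)
  show "R X Z (lam X Y Z f (U X Y Xs fs)) = cmp S (\<rho>o X) (\<rho>o Y) (\<rho>o Z) (\<rho> Y Z f) (R X Y (U X Y Xs fs))"
    unfolding lam_U[OF X f p] R_U[OF X(1,2) p] R_W[OF X(1,3) q] by simp
  obtain g gs where g: "fs = g # gs" using path_neq_Nil[OF p] by blast
  have q': "C.path X Z Xs (cmp C (hd (Xs @ [X])) Y Z f g # gs)" by (rule path_cmp_head[OF X f p[unfolded g]])
  show "R X Z (lam X Y Z f (W X Y Xs fs)) = cmp S (\<rho>o X) (\<rho>o Y) (\<rho>o Z) (\<rho> Y Z f) (R X Y (W X Y Xs fs))"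
  proof (cases Xs)
    case Nil
    then have "g \<in> Hom C X Y" using p g by (auto simp: C.path_Nil)
    then show ?thesis
      unfolding R_W[OF X(1,2) p] unfolding g lam_W[OF X f p[unfolded g]] R_W[OF X(1,3) q']
      using \<rho>_cmp[OF X f] by (simp add: Nil)
  next
    case (Cons X1 Xs')
    then have *: "g \<in> Hom C X1 Y" "X1 \<in> Ob C" "C.path X X1 Xs' gs" using p g by (auto simp: C.path_Cons)
    note ob1 = \<rho>o_Ob[OF *(2)]
    show ?thesis
      unfolding R_W[OF X(1,2) p] unfolding g lam_W[OF X f p[unfolded g]] R_W[OF X(1,3) q']
      using S.C.cmp_assoc[OF ob(1) ob1 ob(2,3) rf HomD_Hom[OF ob1 ob(2) \<rho>_mem[OF *(2) X(2) *(1)]] dcomp_Hom[OF X(1) *(2,3)]]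
      by (simp add: Cons \<rho>_cmp[OF *(2) X(2,3) f *(1)])
  qed
qed

lemma R_act:
  assumes X: "X \<in> Ob C" "Y \<in> Ob C" and x: "x \<in> OM X Y"
  shows "R X Y (act \<Omega> X Y h x) = act S (\<rho>o X) (\<rho>o Y) h (R X Y x)"
proof (rule omega_gens_eqI[OF X x])
  note ob = \<rho>o_Ob[OF X(1)] \<rho>o_Ob[OF X(2)]
  show "linear_on (OM X Y) osc (scal S) (\<lambda>x. R X Y (act \<Omega> X Y h x))"
    by (rule linear_on_comp[OF act_linear_Omega[OF X] R_linear[OF X] act_mem[OF X]])
  show "linear_on (OM X Y) osc (scal S) (\<lambda>x. act S (\<rho>o X) (\<rho>o Y) h (R X Y x))"
    by (rule linear_on_comp[OF R_linear[OF X] bilinear_onD(2)[OF S.act_bilinear[OF ob] UNIV_I] R_mem_Hom[OF X]])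
  fix n x assume "x \<in> gens n X Y"
  with X have "\<forall>h. R X Y (act \<Omega> X Y h x) = act S (\<rho>o X) (\<rho>o Y) h (R X Y x)"
  proof (rule gens_induct, goal_cases)
    case (1 Y f)
    have "C.path X Y [] [act C X Y h f]" "C.path X Y [] [f]" for h
      using act_closed[OF X(1) 1] 1 by (simp_all add: C.path_Nil)
    then show ?case by (simp add: act_W_Nil[OF X(1) 1] R_W[OF X(1) 1(1)] \<rho>_act[OF X(1) 1])
  next
    case (2 n Y x)
    note x = OD_OM[OF 2(2)]
    show ?case
      using 2(3) S.diff_act[OF \<rho>o_Ob[OF X(1)] \<rho>o_Ob[OF 2(1)] R_mem_Hom[OF X(1) 2(1) x]]
      unfolding act_diff[OF X(1) 2(1) x, symmetric] R_diff[OF X(1) 2(1) x] R_diff[OF X(1) 2(1) act_mem[OF X(1) 2(1) x]]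
      by metis
  next
    case (3 n Z Y f x)
    note x = OD_OM[OF 3(4)]
    note ob = \<rho>o_Ob[OF X(1)] \<rho>o_Ob[OF 3(1)] \<rho>o_Ob[OF 3(2)]
    have "R X Y (act \<Omega> X Y h (lam X Z Y f x)) = act S (\<rho>o X) (\<rho>o Y) h (R X Y (lam X Z Y f x))" for h
    proof -
      have "R X Y (act \<Omega> X Y h (lam X Z Y f x)) = (\<Sum>(a, b)\<leftarrow>sw H h. R X Y (lam X Z Y (act C Z Y a f) (act \<Omega> X Z b x)))"
        unfolding act_lam[OF X(1) 3(1,2,3) x] case_prod_beta'
        by (rule linear_on_sum_list[OF R_linear[OF X(1) 3(2)] vs_omega subspace_omega_sum])
          (intro lam_mem X 3(1,2,3) act_closed act_mem x)
      also have "\<dots> = (\<Sum>(a, b)\<leftarrow>sw H h. cmp S (\<rho>o X) (\<rho>o Z) (\<rho>o Y) (act S (\<rho>o Z) (\<rho>o Y) a (\<rho> Z Y f)) (act S (\<rho>o X) (\<rho>o Z) b (R X Z x)))"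
        using 3(5) by (simp add: R_lam[OF X(1) 3(1,2) act_closed[OF 3(1,2,3)] act_mem[OF X(1) 3(1) x]] \<rho>_act[OF 3(1,2,3)])
      also have "\<dots> = act S (\<rho>o X) (\<rho>o Y) h (R X Y (lam X Z Y f x))"
        unfolding R_lam[OF X(1) 3(1,2,3) x]
        by (rule S.act_cmp[OF ob HomD_Hom[OF ob(2,3) \<rho>_mem[OF 3(1,2,3)]] R_mem_Hom[OF X(1) 3(1) x], symmetric])
      finally show ?thesis .
    qed
    then show ?case by blast
  qed
  then show "R X Y (act \<Omega> X Y h x) = act S (\<rho>o X) (\<rho>o Y) h (R X Y x)" ..
qed

text \<open>The Leibniz rule holds in both semicategories, so the step for dx reduces to the
  hypothesis at \<open>y\<close> and dy. \<open>y\<close> is homogeneous because the rule in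
  \<open>S\<close> is assumed for homogeneous elements.\<close>

lemma R_cmp:
  assumes X: "X \<in> Ob C" "Y \<in> Ob C" "Z \<in> Ob C" and x: "x \<in> OM Y Z" and y: "y \<in> OD m X Y"
  shows "R X Z (cmp \<Omega> X Y Z x y) = cmp S (\<rho>o X) (\<rho>o Y) (\<rho>o Z) (R Y Z x) (R X Y y)"
proof (rule omega_gens_eqI[OF X(2,3) x])
  note ob = \<rho>o_Ob[OF X(1)] \<rho>o_Ob[OF X(2)] \<rho>o_Ob[OF X(3)] and y' = OD_OM[OF y]
  show "linear_on (OM Y Z) osc (scal S) (\<lambda>x. R X Z (cmp \<Omega> X Y Z x y))"
    by (rule linear_on_comp[OF cmp_linear_left[OF X y'] R_linear[OF X(1,3)] cmp_mem[OF X _ y']])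
  show "linear_on (OM Y Z) osc (scal S) (\<lambda>x. cmp S (\<rho>o X) (\<rho>o Y) (\<rho>o Z) (R Y Z x) (R X Y y))"
    by (rule linear_on_comp[OF R_linear[OF X(2,3)] bilinear_onD(1)[OF S.C.cmp_bilinear[OF ob] R_mem_Hom[OF X(1,2) y']] R_mem_Hom[OF X(2,3)]])
  fix n x assume "x \<in> gens n Y Z"
  with X(2,3) have "\<forall>m. \<forall>y\<in>OD m X Y. R X Z (cmp \<Omega> X Y Z x y) = cmp S (\<rho>o X) (\<rho>o Y) (\<rho>o Z) (R Y Z x) (R X Y y)"
  proof (rule gens_induct, goal_cases)
    case (1 Z f)
    then have "C.path Y Z [] [f]" by (simp add: C.path_Nil)
    then show ?case by (simp add: cmp_W_Nil[OF X(1,2) 1] OD_OM R_lam[OF X(1,2) 1] R_W[OF X(2) 1(1)])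
  next
    case (2 n Z x)
    note x = OD_OM[OF 2(2)]
    note ob = \<rho>o_Ob[OF X(1)] \<rho>o_Ob[OF X(2)] \<rho>o_Ob[OF 2(1)]
    show ?case
    proof (intro allI ballI)
      fix m y assume y: "y \<in> OD m X Y"
      note y' = OD_OM[OF y] and dy = diff_mem[OF X(1,2) y]
      note c = cmp_mem[OF X(1,2) 2(1) x y'] and c' = cmp_mem[OF X(1,2) 2(1) x OD_OM[OF dy]]
      have "R X Z (cmp \<Omega> X Y Z (diff \<Omega> Y Z x) y)
        = R X Z (diff \<Omega> X Z (cmp \<Omega> X Y Z x y)) - scal S ((-1) ^ n) (R X Z (cmp \<Omega> X Y Z x (diff \<Omega> X Y y)))"
        unfolding cmp_diff[OF X(1,2) 2(1,2) y']
        using linear_diff[OF R_linear[OF X(1) 2(1)] vsS diff_mem_OM[OF X(1) 2(1) c] osc_closed(3)[OF c'], of "(-1) ^ n"]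
          linear_on_scaleD[OF R_linear[OF X(1) 2(1)] c', of "(-1) ^ n"] by simp
      also have "\<dots> = diff S (\<rho>o X) (\<rho>o Z) (cmp S (\<rho>o X) (\<rho>o Y) (\<rho>o Z) (R Y Z x) (R X Y y))
          - scal S ((-1) ^ n) (cmp S (\<rho>o X) (\<rho>o Y) (\<rho>o Z) (R Y Z x) (diff S (\<rho>o X) (\<rho>o Y) (R X Y y)))"
        unfolding R_diff[OF X(1) 2(1) c] R_diff[OF X(1,2) y', symmetric] using 2(3) y dy by metis
      also have "\<dots> = cmp S (\<rho>o X) (\<rho>o Y) (\<rho>o Z) (R Y Z (diff \<Omega> Y Z x)) (R X Y y)"
        unfolding S.leibniz[OF ob R_mem[OF X(2) 2(1,2)] R_mem[OF X(1,2) y]] R_diff[OF X(2) 2(1) x] by simp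
      finally show "R X Z (cmp \<Omega> X Y Z (diff \<Omega> Y Z x) y) = cmp S (\<rho>o X) (\<rho>o Y) (\<rho>o Z) (R Y Z (diff \<Omega> Y Z x)) (R X Y y)" .
    qed
  next
    case (3 n V Z f x)
    note x = OD_OM[OF 3(4)]
    note ob = \<rho>o_Ob[OF X(1)] \<rho>o_Ob[OF X(2)] \<rho>o_Ob[OF 3(1)] \<rho>o_Ob[OF 3(2)]
    show ?case
    proof (intro allI ballI)
      fix m y assume y: "y \<in> OD m X Y"
      note y' = OD_OM[OF y]
      show "R X Z (cmp \<Omega> X Y Z (lam Y V Z f x) y) = cmp S (\<rho>o X) (\<rho>o Y) (\<rho>o Z) (R Y Z (lam Y V Z f x)) (R X Y y)"
        using 3(5) y S.C.cmp_assoc[OF ob HomD_Hom[OF ob(3,4) \<rho>_mem[OF 3(1,2,3)]] R_mem_Hom[OF X(2) 3(1) x] R_mem_Hom[OF X(1,2) y']]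
        by (simp add: cmp_lam[OF X(1,2) 3(1,2,3) x y'] R_lam[OF X(1) 3(1,2,3) cmp_mem[OF X(1,2) 3(1) x y']] R_lam[OF X(2) 3(1,2,3) x])
    qed
  qed
  then show "R X Z (cmp \<Omega> X Y Z x y) = cmp S (\<rho>o X) (\<rho>o Y) (\<rho>o Z) (R Y Z x) (R X Y y)" using y by blast
qed

end

section \<open>Traces as bilinear forms\<close>

text \<open>The conditions of \<open>closed_graded_trace\<close> with each trace curried to a
  bilinear form. The universal property of the tensor product makes the two notions interchangeable,
  and sums of pure tensors become sums of scalars.\<close>

definition trace_form ::
  "('k::field, 'h::ring_1) hopf \<Rightarrow> ('k, 'h, 'm::ab_group_add) sayd \<Rightarrow> nat \<Rightarrow>
   ('k, 'h, 'o, 'a::ab_group_add) dgh \<Rightarrow> ('o \<Rightarrow> 'm \<Rightarrow> 'a \<Rightarrow> 'k) \<Rightarrow> bool" where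
  "trace_form H M n S t \<longleftrightarrow>
     (\<forall>X\<in>Ob S. bilinear_on (mscale M) UNIV (scal S) (HomD S n X X) (*) (t X)) \<and>
     (\<forall>X\<in>Ob S. \<forall>m h. \<forall>f\<in>HomD S n X X.
        (\<Sum>(a, b)\<leftarrow>sw H h. t X (mact M m a) (act S X X (antipode H b) f)) = counit H h * t X m f) \<and>
     (\<forall>X\<in>Ob S. \<forall>m j. \<forall>f\<in>HomD S j X X. Suc j = n \<longrightarrow> t X m (diff S X X f) = 0) \<and>
     (\<forall>X\<in>Ob S. \<forall>Y\<in>Ob S. \<forall>m i j. \<forall>g\<in>HomD S i X Y. \<forall>g'\<in>HomD S j Y X. i + j = n \<longrightarrow>
        t X m (cmp S X Y X g' g)
        = (- 1) ^ (i * j) *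
          (\<Sum>(a, m0)\<leftarrow>csw H M m. t Y m0 (cmp S Y X Y (act S X Y (inv (antipode H) a) g) g')))"

lemma closed_graded_trace_iff:
  assumes "DGH_semicategory H S"
    and lin: "\<And>X. X \<in> Ob S \<Longrightarrow> linear_on (tensor_space (mscale M) UNIV (scal S) (HomD S n X X)) (fscale (*)) (*) (T X)"
    and val: "\<And>X m f. X \<in> Ob S \<Longrightarrow> f \<in> HomD S n X X \<Longrightarrow> T X (trace_ten M n S X m f) = t X m f"
  shows "closed_graded_trace H M n S T \<longleftrightarrow> trace_form H M n S t"
proof -
  interpret DGH_semicategory H S by fact
  have sum: "T X (\<Sum>(a, b)\<leftarrow>ps. trace_ten M n S X (u a b) (v a b)) = (\<Sum>(a, b)\<leftarrow>ps. t X (u a b) (v a b))"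
    if "X \<in> Ob S" "\<And>a b. v a b \<in> HomD S n X X" for X ps u v
    unfolding case_prod_beta'
    using linear_on_sum_list[OF lin[OF that(1)] vector_space_fscale_mult subspace_tensor_space, of ps
        "\<lambda>p. trace_ten M n S X (u (fst p) (snd p)) (v (fst p) (snd p))"]
    by (simp add: ten_in_tensor_space that val)
  have bil: "bilinear_on (mscale M) UNIV (scal S) (HomD S n X X) (*) (t X)" if X: "X \<in> Ob S" for X
  proof (rule bilinear_onI)
    fix f assume f: "f \<in> HomD S n X X"
    have "linear_on UNIV (mscale M) (*) (\<lambda>m. T X (trace_ten M n S X m f))"
      by (rule linear_on_comp[OF bilinear_onD(1)[OF ten_bilinear f] lin[OF X]]) (simp add: ten_in_tensor_space f)
    then show "linear_on UNIV (mscale M) (*) (\<lambda>m. t X m f)" by (simp add: val[OF X f])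
  next
    fix m
    have "linear_on (HomD S n X X) (scal S) (*) (\<lambda>f. T X (trace_ten M n S X m f))"
      by (rule linear_on_comp[OF bilinear_onD(2)[OF ten_bilinear UNIV_I] lin[OF X]]) (simp add: ten_in_tensor_space)
    moreover have "linear_on (HomD S n X X) (scal S) (*) (\<lambda>f. T X (trace_ten M n S X m f))
        = linear_on (HomD S n X X) (scal S) (*) (t X m)"
      by (rule linear_on_cong[OF _ HomD_subspace[OF X X] C.vector_space_scal]) (rule val[OF X])
    ultimately show "linear_on (HomD S n X X) (scal S) (*) (\<lambda>f. t X m f)" by simp
  qed
  have c2: "T X (\<Sum>(a, b)\<leftarrow>sw H h. trace_ten M n S X (mact M m a) (act S X X (antipode H b) f))
      = (\<Sum>(a, b)\<leftarrow>sw H h. t X (mact M m a) (act S X X (antipode H b) f))"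
    if "X \<in> Ob S" "f \<in> HomD S n X X" for X m h f
    by (rule sum) (auto intro: act_degree that)
  have c4: "T X (trace_ten M n S X m (cmp S X Y X g' g)) = t X m (cmp S X Y X g' g)"
    "T Y (\<Sum>(a, m0)\<leftarrow>csw H M m. trace_ten M n S Y m0 (cmp S Y X Y (act S X Y (inv (antipode H) a) g) g'))
      = (\<Sum>(a, m0)\<leftarrow>csw H M m. t Y m0 (cmp S Y X Y (act S X Y (inv (antipode H) a) g) g'))"
    if "X \<in> Ob S" "Y \<in> Ob S" "g \<in> HomD S i X Y" "g' \<in> HomD S j Y X" "i + j = n" for X Y m i j g g'
  proof -
    have "cmp S X Y X g' g \<in> HomD S n X X" using cmp_degree[OF that(1,2,1,4,3)] that(5) by (simp add: add.commute)
    then show "T X (trace_ten M n S X m (cmp S X Y X g' g)) = t X m (cmp S X Y X g' g)" by (rule val[OF that(1)])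
    have "cmp S Y X Y (act S X Y (inv (antipode H) a) g) g' \<in> HomD S n Y Y" for a
      using cmp_degree[OF that(2,1,2) act_degree[OF that(1,2,3)] that(4)] that(5) by simp
    then show "T Y (\<Sum>(a, m0)\<leftarrow>csw H M m. trace_ten M n S Y m0 (cmp S Y X Y (act S X Y (inv (antipode H) a) g) g'))
      = (\<Sum>(a, m0)\<leftarrow>csw H M m. t Y m0 (cmp S Y X Y (act S X Y (inv (antipode H) a) g) g'))"
      by (intro sum that)
  qed
  have c3: "T X (trace_ten M n S X m (diff S X X f)) = t X m (diff S X X f)"
    if "X \<in> Ob S" "f \<in> HomD S j X X" "Suc j = n" for X m j f
    using val[OF that(1)] diff_degree[OF that(1,1,2)] that(3) by simp
  show ?thesis
    unfolding closed_graded_trace_def trace_form_def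
    by (intro arg_cong2[of _ _ _ _ "(\<and>)"] ball_cong all_cong1 imp_cong refl)
      (simp_all add: lin bil c2 val c3 c4)
qed

lemma trace_form_of_trace:
  assumes "DGH_semicategory H S" "closed_graded_trace H M n S T"
  shows "trace_form H M n S (\<lambda>X m f. T X (trace_ten M n S X m f))"
  using closed_graded_trace_iff[OF assms(1), of M n T "\<lambda>X m f. T X (trace_ten M n S X m f)"] assms(2)
  by (auto simp: closed_graded_trace_def)

lemma trace_of_trace_form:
  assumes "DGH_semicategory H S" "trace_form H M n S t"
  obtains T where "closed_graded_trace H M n S T"
    "\<And>X m f. X \<in> Ob S \<Longrightarrow> f \<in> HomD S n X X \<Longrightarrow> T X (trace_ten M n S X m f) = t X m f"
proof -
  have "\<exists>L. linear_on (tensor_space (mscale M) UNIV (scal S) (HomD S n X X)) (fscale (*)) (*) L \<and>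
             (\<forall>v\<in>UNIV. \<forall>w\<in>HomD S n X X. L (trace_ten M n S X v w) = t X v w)" if "X \<in> Ob S" for X
    by (rule tensor_universal[OF vector_space_field]) (use assms(2) that in \<open>simp add: trace_form_def\<close>)
  then have "\<forall>X\<in>Ob S. \<exists>L. linear_on (tensor_space (mscale M) UNIV (scal S) (HomD S n X X)) (fscale (*)) (*) L \<and>
             (\<forall>v\<in>UNIV. \<forall>w\<in>HomD S n X X. L (trace_ten M n S X v w) = t X v w)" by blast
  then obtain T where T: "\<And>X. X \<in> Ob S \<Longrightarrow> linear_on (tensor_space (mscale M) UNIV (scal S) (HomD S n X X)) (fscale (*)) (*) (T X)"
    "\<And>X m f. X \<in> Ob S \<Longrightarrow> f \<in> HomD S n X X \<Longrightarrow> T X (trace_ten M n S X m f) = t X m f"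
    unfolding bchoice_iff by blast
  show thesis by (rule that[OF _ T(2)]) (use closed_graded_trace_iff[OF assms(1) T] assms(2) in auto)
qed

section \<open>Cochains\<close>

text \<open>Rotation and the last coface modify the last morphism of a word, so multilinearity of
  their values is checked by splitting off the last factor instead of the first.\<close>

lemma multilinear_on_snoc:
  assumes "\<And>xs. list_all2 (\<in>) xs Vs \<Longrightarrow> linear_on V s sU (\<lambda>x. F (xs @ [x]))"
    and "\<And>x. x \<in> V \<Longrightarrow> multilinear_on s Vs sU (\<lambda>xs. F (xs @ [x]))"
  shows "multilinear_on s (Vs @ [V]) sU F"
  unfolding multilinear_on_def
proof (intro allI impI)
  fix i ys assume i: "i < length (Vs @ [V])" and "list_all2 (\<in>) ys (Vs @ [V])"
  then obtain xs x where ys: "ys = xs @ [x]" "list_all2 (\<in>) xs Vs" "x \<in> V"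
    by (auto simp: list_all2_append2 list_all2_Cons2)
  have len: "length xs = length Vs" using list_all2_lengthD[OF ys(2)] .
  show "linear_on ((Vs @ [V]) ! i) s sU (\<lambda>x. F (ys[i := x]))"
  proof (cases "i < length Vs")
    case True
    then show ?thesis using assms(2)[OF ys(3)] ys len by (simp add: multilinear_on_def nth_append list_update_append)
  next
    case False
    then have "i = length Vs" using i by simp
    then show ?thesis using assms(1)[OF ys(2)] ys(1) len by (simp add: list_update_append)
  qed
qed

lemma path_homs_snoc: "path_homs C (P @ [Y, X]) = path_homs C (P @ [Y]) @ [Hom C X Y]"
  by (induction P rule: induct_list012) (simp_all add: path_homs_Cons path_homs_single)

lemma neg_one_power_diff: "i \<le> n \<Longrightarrow> (- 1 :: 'k::comm_ring_1) ^ (n - i) = (- 1) ^ n * (- 1) ^ i"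
proof -
  assume "i \<le> n"
  then have "(- 1 :: 'k) ^ n * (- 1) ^ i = (- 1) ^ (n - i) * ((- 1) ^ i * (- 1) ^ i)"
    by (metis le_add_diff_inverse2 mult.assoc power_add)
  then show ?thesis by (simp flip: power_mult_distrib)
qed

locale sayd_semicategory = sayd_module H M + H_semicategory H C
  for H :: "('k::field, 'h::ring_1) hopf"
    and M :: "('k, 'h, 'm::ab_group_add) sayd"
    and C :: "('k, 'h, 'o, 'a::ab_group_add, 'z) hsemicat_scheme"
begin

lemma cn_words_Cons: "(X # Qs, fs) \<in> cn_words C n \<longleftrightarrow> X \<in> Ob C \<and> length Qs = n \<and> C.path X X Qs fs"
  by (auto simp: cn_words_def C.path_def)

lemma cn_words_cases:
  assumes "(Xs, fs) \<in> cn_words C n"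
  obtains X Qs where "Xs = X # Qs" "X \<in> Ob C" "length Qs = n" "C.path X X Qs fs"
proof -
  from assms obtain X Qs where "Xs = X # Qs" by (cases Xs) (auto simp: cn_words_def)
  with assms that show thesis by (auto simp: cn_words_Cons)
qed

text \<open>Exposes the object \<open>L\<close> and the morphism \<open>f\<close> that the cyclic
  operator moves to the front; for \<open>n = 0\<close> the list \<open>Bs\<close> is empty and
  \<open>L\<close> is the only object.\<close>

lemma cn_words_snoc:
  assumes "(Xs, fs) \<in> cn_words C n"
  obtains Bs L gs f where "Xs = Bs @ [L]" "fs = gs @ [f]" "set Bs \<subseteq> Ob C" "L \<in> Ob C" "length Bs = n"
    "f \<in> Hom C (hd Xs) L" "list_all2 (\<in>) gs (path_homs C (Bs @ [L]))"
proof -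
  from assms have *: "length Xs = Suc n" "set Xs \<subseteq> Ob C" "list_all2 (\<in>) fs (path_homs C (Xs @ [hd Xs]))"
    by (auto simp: cn_words_def)
  then obtain Bs L where B: "Xs = Bs @ [L]" by (cases Xs rule: rev_cases) auto
  with * have "list_all2 (\<in>) fs (path_homs C (Bs @ [L]) @ [Hom C (hd Xs) L])" by (simp add: path_homs_snoc)
  then obtain gs f where "fs = gs @ [f]" "list_all2 (\<in>) gs (path_homs C (Bs @ [L]))" "f \<in> Hom C (hd Xs) L"
    by (auto simp: list_all2_append2 list_all2_Cons2)
  with B * that show thesis by auto
qed

lemma cn_words_rotate:
  assumes "set Bs \<subseteq> Ob C" "L \<in> Ob C" "length Bs = n" "f \<in> Hom C (hd (Bs @ [L])) L" "list_all2 (\<in>) gs (path_homs C (Bs @ [L]))"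
  shows "(L # Bs, f # gs) \<in> cn_words C n"
  using assms by (simp add: cn_words_Cons path_hd)

lemma CN_span: "CN C n = module.span cn_scale ((\<lambda>(Xs, fs). cn_elem C Xs fs) ` cn_words C n)"
proof -
  have 1: "(\<lambda>(Xs, fs). single Xs (tens (scal C) (path_homs C (Xs @ [hd Xs])) fs)) = (\<lambda>(Xs, fs). cn_elem C Xs fs)"
    by (auto simp: cn_elem_def)
  have 2: "{(Xs, fs). Xs \<in> {Xs. length Xs = Suc n \<and> set Xs \<subseteq> Ob C} \<and> list_all2 (\<in>) fs (path_homs C (Xs @ [hd Xs]))} = cn_words C n"
    by (auto simp: cn_words_def)
  show ?thesis
    unfolding CN_def
    using span_single_tens[of "scal C" "\<lambda>Xs. path_homs C (Xs @ [hd Xs])" "{Xs. length Xs = Suc n \<and> set Xs \<subseteq> Ob C}"]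
    unfolding 1 2 by simp
qed

lemma subspace_CN: "module.subspace cn_scale (CN C n)"
  unfolding CN_span by (rule subspace_span_of[OF vector_space_fscale2_mult])

lemma cn_elem_mem: "(Xs, fs) \<in> cn_words C n \<Longrightarrow> cn_elem C Xs fs \<in> CN C n"
  unfolding CN_span by (rule span_mem_of[OF vector_space_fscale2_mult]) force

lemma cn_elem_multilinear:
  "multilinear_on (scal C) (path_homs C (X # Qs @ [X])) cn_scale (cn_elem C (X # Qs))"
proof -
  have "multilinear_on (scal C) (path_homs C ((X # Qs) @ [hd (X # Qs)])) cn_scale (\<lambda>fs. cn_elem C (X # Qs) fs)"
    unfolding cn_elem_def
    by (rule multilinear_on_comp[OF tens_multilinear single_linear[OF vector_space_fscale_mult]]) simp
  then show ?thesis by simp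
qed

lemma mcn_space_eqI:
  assumes f: "linear_on (mcn_space M C n) (fscale (*)) (*) F" and g: "linear_on (mcn_space M C n) (fscale (*)) (*) G"
    and eq: "\<And>m Xs fs. (Xs, fs) \<in> cn_words C n \<Longrightarrow> F (mcn_ten M C n m (cn_elem C Xs fs)) = G (mcn_ten M C n m (cn_elem C Xs fs))"
    and t: "t \<in> mcn_space M C n"
  shows "F t = G t"
proof (rule tensor_space_eq[OF f g _ t])
  fix m v assume v: "v \<in> CN C n"
  have lin: "linear_on (CN C n) cn_scale (*) (\<lambda>v. L (mcn_ten M C n m v))"
    if "linear_on (mcn_space M C n) (fscale (*)) (*) L" for L
    by (rule linear_on_comp[OF bilinear_onD(2)[OF ten_bilinear UNIV_I] that]) (simp add: ten_in_tensor_space)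
  show "F (mcn_ten M C n m v) = G (mcn_ten M C n m v)"
  proof (rule linear_on_span_eq[OF vector_space_fscale2_mult, where f = "\<lambda>v. F (mcn_ten M C n m v)"
        and g = "\<lambda>v. G (mcn_ten M C n m v)" and G = "(\<lambda>(Xs, fs). cn_elem C Xs fs) ` cn_words C n"],
      unfold CN_span[symmetric])
    show "linear_on (CN C n) cn_scale (*) (\<lambda>v. F (mcn_ten M C n m v))" by (rule lin[OF f])
    show "linear_on (CN C n) cn_scale (*) (\<lambda>v. G (mcn_ten M C n m v))" by (rule lin[OF g])
  qed (use eq v in auto)
qed

text \<open>The prescription is extended in three stages: to the tensor space of each closed path,
  to their direct sum \<open>CN\<close>, and to its tensor product with the module.\<close>

lemma
  assumes lm: "\<And>Xs fs. (Xs, fs) \<in> cn_words C n \<Longrightarrow> linear_on UNIV (mscale M) (*) (\<lambda>m. g m Xs fs)"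
    and ml: "\<And>m X Qs. X \<in> Ob C \<Longrightarrow> set Qs \<subseteq> Ob C \<Longrightarrow> length Qs = n \<Longrightarrow>
      multilinear_on (scal C) (path_homs C (X # Qs @ [X])) (*) (g m (X # Qs))"
  shows cochain_of_linear: "linear_on (mcn_space M C n) (fscale (*)) (*) (cochain_of M C n g)"
    and cochain_of_value: "(Xs, fs) \<in> cn_words C n \<Longrightarrow> cochain_of M C n g (mcn_ten M C n m (cn_elem C Xs fs)) = g m Xs fs"
proof -
  let ?G = "UNIV \<times> cn_words C n" and ?e = "\<lambda>(m, Xs, fs). mcn_ten M C n m (cn_elem C Xs fs)"
  have "\<exists>F. linear_on (CN C n) cn_scale (*) F \<and> (\<forall>(Xs, fs)\<in>cn_words C n. F (cn_elem C Xs fs) = g m Xs fs)" for m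
  proof -
    have "multilinear_on (scal C) (path_homs C (Xs @ [hd Xs])) (*) (g m Xs)"
      if "Xs \<in> {Xs. length Xs = Suc n \<and> set Xs \<subseteq> Ob C}" for Xs
      using that ml[of "hd Xs" "tl Xs"] by (cases Xs) auto
    from single_tens_universal[OF vector_space_field this, of "{Xs. length Xs = Suc n \<and> set Xs \<subseteq> Ob C}" "\<lambda>Xs. Xs"] obtain F where
      F: "linear_on (CN C n) cn_scale (*) F"
      "\<And>Xs fs. length Xs = Suc n \<Longrightarrow> set Xs \<subseteq> Ob C \<Longrightarrow> list_all2 (\<in>) fs (path_homs C (Xs @ [hd Xs])) \<Longrightarrow>
        F (cn_elem C Xs fs) = g m Xs fs"
      unfolding CN_def cn_elem_def by auto
    show ?thesis by (intro exI[of _ F] conjI F(1)) (auto simp: cn_words_def F(2))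
  qed
  then have "\<exists>F. \<forall>m. linear_on (CN C n) cn_scale (*) (F m) \<and> (\<forall>(Xs, fs)\<in>cn_words C n. F m (cn_elem C Xs fs) = g m Xs fs)"
    by (intro choice allI)
  then obtain F where F: "\<And>m. linear_on (CN C n) cn_scale (*) (F m)"
    "\<And>m Xs fs. (Xs, fs) \<in> cn_words C n \<Longrightarrow> F m (cn_elem C Xs fs) = g m Xs fs" by blast
  interpret O: vector_space "cn_scale :: 'k \<Rightarrow> ('k, 'o, 'a) cn \<Rightarrow> _" by (rule vector_space_fscale2_mult)
  note CNc = subspace_closed[OF vector_space_fscale2_mult subspace_CN]
  \<comment> \<open>Each \<open>F m\<close> was chosen separately, so its dependence on
    \<open>m\<close> is known on words only. Since \<open>F m\<close> is linear in \<open>v\<close>,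
    linearity in \<open>m\<close> spreads from the words to all of \<open>CN\<close>.\<close>
  have Fm: "linear_on UNIV (mscale M) (*) (\<lambda>m. F m v)" if v: "v \<in> CN C n" for v
  proof -
    have "v \<in> CN C n \<and> linear_on UNIV (mscale M) (*) (\<lambda>m. F m v)"
    proof (rule span_predicate_induct[OF vector_space_fscale2_mult v[unfolded CN_span]])
      fix x assume "x \<in> (\<lambda>(Xs, fs). cn_elem C Xs fs) ` cn_words C n"
      then show "x \<in> CN C n \<and> linear_on UNIV (mscale M) (*) (\<lambda>m. F m x)"
        using lm by (auto simp: F(2) cn_elem_mem)
    next
      show "module.subspace cn_scale {x. x \<in> CN C n \<and> linear_on UNIV (mscale M) (*) (\<lambda>m. F m x)}"
        unfolding O.subspace_def
        using CNc linear_on_zero[OF F(1) CNc(1)] linear_on_addD[OF F(1)] linear_on_scaleD[OF F(1)]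
        by simp (intro conjI allI impI linear_on_add[OF vector_space_field]
          linear_on_scale[OF vector_space_field] linear_on_const0[OF vector_space_field]; simp)
    qed
    then show ?thesis ..
  qed
  have "bilinear_on (mscale M) UNIV cn_scale (CN C n) (*) F" by (rule bilinear_onI[OF Fm F(1)])
  from tensor_universal[OF vector_space_field this] obtain L where
    L: "linear_on (mcn_space M C n) (fscale (*)) (*) L" "\<And>m v. v \<in> CN C n \<Longrightarrow> L (mcn_ten M C n m v) = F m v" by auto
  \<comment> \<open>\<open>lin_ext\<close> refers to the span of tensors of some \<open>m\<close>
    with a word, so this span has to be recognised as the whole space.\<close>
  have sp: "module.span (fscale (*)) (?e ` ?G) = mcn_space M C n"
  proof
    interpret T: vector_space "fscale (*) :: 'k \<Rightarrow> ('k, 'm, ('k, 'o, 'a) cn) tensor \<Rightarrow> _" by (rule vector_space_fscale_mult)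
    show "module.span (fscale (*)) (?e ` ?G) \<subseteq> mcn_space M C n"
      by (rule T.span_minimal[OF _ subspace_tensor_space]) (auto intro!: ten_in_tensor_space cn_elem_mem)
    have "mcn_ten M C n m v \<in> T.span (?e ` ?G)" if v: "v \<in> CN C n" for m v
    proof -
      note b = bilinear_onD(2)[OF ten_bilinear[where sV = "mscale M" and sW = cn_scale and W = "CN C n"] UNIV_I, of m]
      have "v \<in> CN C n \<and> mcn_ten M C n m v \<in> T.span (?e ` ?G)"
      proof (rule span_predicate_induct[OF vector_space_fscale2_mult v[unfolded CN_span]])
        fix x assume "x \<in> (\<lambda>(Xs, fs). cn_elem C Xs fs) ` cn_words C n"
        then obtain Xs fs where "x = cn_elem C Xs fs" "(Xs, fs) \<in> cn_words C n" by auto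
        then show "x \<in> CN C n \<and> mcn_ten M C n m x \<in> T.span (?e ` ?G)"
          by (auto intro!: cn_elem_mem T.span_base image_eqI[of _ ?e "(m, Xs, fs)"])
      next
        show "module.subspace cn_scale {x. x \<in> CN C n \<and> mcn_ten M C n m x \<in> T.span (?e ` ?G)}"
          unfolding O.subspace_def
          using CNc linear_on_zero[OF b CNc(1)] linear_on_addD[OF b] linear_on_scaleD[OF b]
          by (simp add: T.span_zero T.span_add T.span_scale)
      qed
      then show ?thesis ..
    qed
    then show "mcn_space M C n \<subseteq> module.span (fscale (*)) (?e ` ?G)"
      unfolding tensor_space_def by (intro T.span_minimal T.subspace_span) auto
  qed
  have val: "L (?e p) = (\<lambda>(m, Xs, fs). g m Xs fs) p" if "p \<in> ?G" for p
    using that by (auto simp: L(2) F(2) cn_elem_mem)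
  note * = lin_ext_unique_spec[of "fscale (*)" ?e ?G "(*)" L "\<lambda>(m, Xs, fs). g m Xs fs", unfolded sp, OF L(1) val]
  show "linear_on (mcn_space M C n) (fscale (*)) (*) (cochain_of M C n g)"
    unfolding cochain_of_def by (rule *(1))
  show "(Xs, fs) \<in> cn_words C n \<Longrightarrow> cochain_of M C n g (mcn_ten M C n m (cn_elem C Xs fs)) = g m Xs fs"
    unfolding cochain_of_def using *(2)[of "(m, Xs, fs)"] by auto
qed

definition cval :: "nat \<Rightarrow> ('k, 'm, 'o, 'a) cochain \<Rightarrow> 'm \<Rightarrow> 'o list \<Rightarrow> 'a list \<Rightarrow> 'k" where
  "cval n \<phi> m Xs fs = \<phi> (mcn_ten M C n m (cn_elem C Xs fs))"

context
  fixes n :: nat and \<phi> :: "('k, 'm, 'o, 'a) cochain"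
  assumes \<phi>: "\<phi> \<in> cochains H M C n"
begin

lemma cochain_linear: "linear_on (mcn_space M C n) (fscale (*)) (*) \<phi>"
  using \<phi> by (simp add: cochains_def)

lemma cval_linear: "(Xs, fs) \<in> cn_words C n \<Longrightarrow> linear_on UNIV (mscale M) (*) (\<lambda>m. cval n \<phi> m Xs fs)"
  unfolding cval_def
  by (rule linear_on_comp[OF bilinear_onD(1)[OF ten_bilinear cn_elem_mem] cochain_linear])
    (auto intro!: ten_in_tensor_space cn_elem_mem)

lemma cval_multilinear:
  assumes "X \<in> Ob C" "set Qs \<subseteq> Ob C" "length Qs = n"
  shows "multilinear_on (scal C) (path_homs C (X # Qs @ [X])) (*) (cval n \<phi> m (X # Qs))"
proof -
  have lin: "linear_on (CN C n) cn_scale (*) (\<lambda>v. \<phi> (mcn_ten M C n m v))"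
    by (rule linear_on_comp[OF bilinear_onD(2)[OF ten_bilinear UNIV_I] cochain_linear]) (simp add: ten_in_tensor_space)
  have "multilinear_on (scal C) (path_homs C (X # Qs @ [X])) (*) (\<lambda>fs. \<phi> (mcn_ten M C n m (cn_elem C (X # Qs) fs)))"
    by (rule multilinear_on_comp[OF cn_elem_multilinear lin])
      (use assms in \<open>auto intro!: cn_elem_mem simp: cn_words_Cons C.path_def\<close>)
  then show ?thesis unfolding cval_def[abs_def] .
qed

lemma cval_head_linear:
  assumes "set Bs \<subseteq> Ob C" "L \<in> Ob C" "length Bs = n" "list_all2 (\<in>) gs (path_homs C (Bs @ [L]))"
  shows "linear_on (Hom C (hd (Bs @ [L])) L) (scal C) (*) (\<lambda>f. cval n \<phi> m (L # Bs) (f # gs))"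
  using cval_multilinear[OF assms(2,1,3)] assms multilinear_path_hd[OF assms(2,2,1)] by blast

text \<open>The parameter \<open>e\<close> covers two uses: the identity for the cyclic operator,
  and composition with the first morphism of the word for the last coface. Bilinearity in
  \<open>a\<close> and \<open>m0\<close> makes the sum over the coaction linear in
  \<open>m\<close>.\<close>

lemma cval_act_bilinear:
  assumes "set Bs \<subseteq> Ob C" "L \<in> Ob C" "length Bs = n" "list_all2 (\<in>) gs (path_homs C (Bs @ [L]))"
    and e: "linear_on (Hom C X Y) (scal C) (scal C) e" "\<And>f. f \<in> Hom C X Y \<Longrightarrow> e f \<in> Hom C (hd (Bs @ [L])) L"
    and X: "X \<in> Ob C" "Y \<in> Ob C" and f: "f \<in> Hom C X Y"
  shows "bilinear_on (hscale H) UNIV (mscale M) UNIV (*)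
      (\<lambda>a m0. cval n \<phi> m0 (L # Bs) (e (act C X Y (inv (antipode H) a) f) # gs))"
proof (rule bilinear_onI)
  fix m0
  have inv: "linear_on UNIV (hscale H) (hscale H) (inv (antipode H))"
    using linear_on_inv_antipode[OF linear_on_id] .
  have "linear_on UNIV (hscale H) (scal C) (\<lambda>a. e (act C X Y (inv (antipode H) a) f))"
    by (rule linear_on_comp[OF linear_on_comp[OF inv act_lin_h[OF X f] UNIV_I] e(1) act_closed[OF X f]])
  from linear_on_comp[OF this cval_head_linear[OF assms(1-4)] e(2)[OF act_closed[OF X f]]]
  show "linear_on UNIV (hscale H) (*) (\<lambda>a. cval n \<phi> m0 (L # Bs) (e (act C X Y (inv (antipode H) a) f) # gs))" .
next
  fix a
  show "linear_on UNIV (mscale M) (*) (\<lambda>m0. cval n \<phi> m0 (L # Bs) (e (act C X Y (inv (antipode H) a) f) # gs))"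
    by (rule cval_linear, rule cn_words_rotate) (use assms act_closed[OF X f] in auto)
qed

lemma cochain_sum:
  assumes "\<And>a. (Xs a, fs a) \<in> cn_words C n"
  shows "\<phi> (\<Sum>(a, m0)\<leftarrow>ps. mcn_ten M C n m0 (cn_elem C (Xs a) (fs a))) = (\<Sum>(a, m0)\<leftarrow>ps. cval n \<phi> m0 (Xs a) (fs a))"
  unfolding case_prod_beta' cval_def
  by (rule linear_on_sum_list[OF cochain_linear vector_space_fscale_mult subspace_tensor_space])
    (intro ten_in_tensor_space cn_elem_mem assms UNIV_I)

definition rot :: "'m \<Rightarrow> 'o list \<Rightarrow> 'a list \<Rightarrow> 'k" where
  "rot m Xs fs = (\<Sum>(a, m0)\<leftarrow>csw H M m. cval n \<phi> m0 (last Xs # butlast Xs)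
     (act C (hd Xs) (last Xs) (inv (antipode H) a) (last fs) # butlast fs))"

lemma
  shows cyclic_op_linear: "linear_on (mcn_space M C n) (fscale (*)) (*) (cyclic_op H M C n \<phi>)"
    and cyclic_op_value: "(Xs, fs) \<in> cn_words C n \<Longrightarrow>
      cyclic_op H M C n \<phi> (mcn_ten M C n m (cn_elem C Xs fs)) = rot m Xs fs"
proof -
  let ?g = "\<lambda>m Xs fs. \<phi> (\<Sum>(a, m0)\<leftarrow>csw H M m. mcn_ten M C n m0
          (cn_elem C (last Xs # butlast Xs)
             (act C (hd Xs) (last Xs) (inv (antipode H) a) (last fs) # butlast fs)))"
  have g: "?g m Xs fs = rot m Xs fs" if w: "(Xs, fs) \<in> cn_words C n" for m Xs fs
  proof -
    obtain Bs L gs f where B: "Xs = Bs @ [L]" "fs = gs @ [f]" "set Bs \<subseteq> Ob C" "L \<in> Ob C" "length Bs = n"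
      "f \<in> Hom C (hd Xs) L" "list_all2 (\<in>) gs (path_homs C (Bs @ [L]))" by (rule cn_words_snoc[OF w])
    have hd: "hd Xs \<in> Ob C" using B by (cases Bs) auto
    show ?thesis unfolding rot_def
      by (rule cochain_sum) (use B hd in \<open>auto intro!: cn_words_rotate act_closed\<close>)
  qed
  have 1: "linear_on UNIV (mscale M) (*) (\<lambda>m. ?g m Xs fs)" if w: "(Xs, fs) \<in> cn_words C n" for Xs fs
  proof -
    obtain Bs L gs f where B: "Xs = Bs @ [L]" "fs = gs @ [f]" "set Bs \<subseteq> Ob C" "L \<in> Ob C" "length Bs = n"
      "f \<in> Hom C (hd Xs) L" "list_all2 (\<in>) gs (path_homs C (Bs @ [L]))" by (rule cn_words_snoc[OF w])
    have hd: "hd Xs \<in> Ob C" using B by (cases Bs) auto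
    have "bilinear_on (hscale H) UNIV (mscale M) UNIV (*)
      (\<lambda>a m0. cval n \<phi> m0 (L # Bs) (act C (hd Xs) L (inv (antipode H) a) f # gs))"
      by (rule cval_act_bilinear[OF B(3,4,5,7) linear_on_id _ hd B(4,6)]) (simp add: B(1))
    from linear_on_csw[OF vector_space_field this] show ?thesis
      unfolding g[OF w] by (simp add: rot_def B(1,2))
  qed
  have 2: "multilinear_on (scal C) (path_homs C (X # Qs @ [X])) (*) (?g m (X # Qs))"
    if X: "X \<in> Ob C" "set Qs \<subseteq> Ob C" "length Qs = n" for m X Qs
  proof -
    \<comment> \<open>The same object list is cut at the other end, because rotation acts on the
      last morphism, from \<open>X\<close> to \<open>L\<close>.\<close>
    obtain Bs L where B: "X # Qs = Bs @ [L]" by (metis list.distinct(1) rev_exhaust)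
    have B': "set Bs \<subseteq> Ob C" "L \<in> Ob C" "length Bs = n" "hd (Bs @ [L]) = X"
    proof -
      have "set (Bs @ [L]) \<subseteq> Ob C" "length (Bs @ [L]) = Suc n" using X unfolding B[symmetric] by auto
      then show "set Bs \<subseteq> Ob C" "L \<in> Ob C" "length Bs = n" by auto
      show "hd (Bs @ [L]) = X" unfolding B[symmetric] by simp
    qed
    have PH: "path_homs C (X # Qs @ [X]) = path_homs C (Bs @ [L]) @ [Hom C X L]"
      using path_homs_snoc[of C Bs L X] B by (metis append.assoc append_Cons append_Nil)
    have sub: "module.subspace (scal C) V" if "V \<in> set (path_homs C (X # Qs @ [X]))" for V
      using that X by (intro C.subspace_path_homs) auto
    have "multilinear_on (scal C) (path_homs C (X # Qs @ [X])) (*) (rot m (X # Qs))"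
      unfolding PH
    proof (rule multilinear_on_snoc)
      fix xs assume xs: "list_all2 (\<in>) xs (path_homs C (Bs @ [L]))"
      have "linear_on (Hom C X L) (scal C) (*) (\<lambda>x. \<Sum>(a, m0)\<leftarrow>csw H M m. cval n \<phi> m0 (L # Bs) (act C X L (inv (antipode H) a) x # xs))"
        using cval_head_linear[OF B'(1,2,3) xs] B'(4)
        by (intro linear_on_sum_list_pairs vector_space_field linear_on_comp[OF act_lin[OF X(1) B'(2)]])
          (use act_closed[OF X(1) B'(2)] B'(4) in auto)
      then show "linear_on (Hom C X L) (scal C) (*) (\<lambda>x. rot m (X # Qs) (xs @ [x]))"
        using B'(4) by (simp add: rot_def B)
    next
      fix x assume x: "x \<in> Hom C X L"
      have "multilinear_on (scal C) (path_homs C (Bs @ [L])) (*) (\<lambda>xs. cval n \<phi> m0 (L # Bs) (act C X L (inv (antipode H) a) x # xs))" for a m0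
        using cval_multilinear[OF B'(2,1,3), of m0] act_closed[OF X(1) B'(2) x] B'(4)
        unfolding multilinear_path_hd[OF B'(2,2,1)] by simp
      then have "multilinear_on (scal C) (path_homs C (Bs @ [L])) (*)
          (\<lambda>xs. \<Sum>(a, m0)\<leftarrow>csw H M m. cval n \<phi> m0 (L # Bs) (act C X L (inv (antipode H) a) x # xs))"
        by (intro multilinear_on_sum_list_pairs vector_space_field)
      then show "multilinear_on (scal C) (path_homs C (Bs @ [L])) (*) (\<lambda>xs. rot m (X # Qs) (xs @ [x]))"
        using B'(4) by (simp add: rot_def B)
    qed
    then show ?thesis
    proof (rule multilinear_on_cong[OF _ C.vector_space_scal sub])
      fix fs assume "list_all2 (\<in>) fs (path_homs C (X # Qs @ [X]))"
      then have "(X # Qs, fs) \<in> cn_words C n" using X by (simp add: cn_words_Cons C.path_def)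
      then show "rot m (X # Qs) fs = ?g m (X # Qs) fs" by (rule g[symmetric])
    qed
  qed
  show "linear_on (mcn_space M C n) (fscale (*)) (*) (cyclic_op H M C n \<phi>)"
    unfolding cyclic_op_def by (rule cochain_of_linear[OF 1 2])
  assume w: "(Xs, fs) \<in> cn_words C n"
  show "cyclic_op H M C n \<phi> (mcn_ten M C n m (cn_elem C Xs fs)) = rot m Xs fs"
    unfolding cyclic_op_def by (rule trans[OF cochain_of_value[OF 1 2 w] g[OF w]])
qed

end

end

section \<open>Cofaces and the cocycle conditions on words\<close>

context sayd_semicategory
begin

text \<open>Induction moves the merge to the head of the path, where the claim is the bilinearity of
  composition.\<close>

lemma multilinear_merge:
  assumes X: "X \<in> Ob C" "Z \<in> Ob C" and Qs: "set Qs \<subseteq> Ob C" "i < length Qs"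
    and G: "multilinear_on (scal C) (path_homs C (Z # drop_nth i Qs @ [X])) sU G"
  shows "multilinear_on (scal C) (path_homs C (Z # Qs @ [X])) sU (\<lambda>fs. G (merge C i (Z # Qs @ [X]) fs))"
  using X(2) Qs G
proof (induction Qs arbitrary: Z i G)
  case (Cons Q Qs)
  then have Q: "Q \<in> Ob C" "set Qs \<subseteq> Ob C" by auto
  have Z0: "0 \<in> Hom C Q Z" by (rule C.Hom_zero[OF Q(1) Cons.prems(1)])
  show ?case
  proof (cases i)
    case 0
    let ?V = "hd (Qs @ [X])"
    note V = hd_path_Ob[OF X(1) Q(2)]
    have G: "multilinear_on (scal C) (path_homs C (Z # Qs @ [X])) sU G" using Cons.prems(4) by (simp add: 0 drop_nth_0)
    note G' = G[unfolded multilinear_path_hd[OF X(1) Cons.prems(1) Q(2)]]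
    note bil = C.cmp_bilinear[OF V Q(1) Cons.prems(1)] and cl = C.cmp_closed[OF V Q(1) Cons.prems(1)]
    have m: "merge C 0 (Z # Q # Qs @ [X]) (f # g # fs) = cmp C ?V Q Z f g # fs" for f g fs
      by (simp add: merge_0)
    have a: "linear_on (Hom C Q Z) (scal C) sU (\<lambda>f. G (merge C 0 (Z # Q # Qs @ [X]) (f # fs)))"
      if fs: "list_all2 (\<in>) fs (path_homs C (Q # Qs @ [X]))" for fs
    proof -
      from fs obtain g gs where g: "fs = g # gs" "g \<in> Hom C ?V Q" "list_all2 (\<in>) gs (path_homs C (Qs @ [X]))"
        unfolding path_homs_hd by (auto simp: list_all2_Cons2)
      show ?thesis
        unfolding g(1) m
        by (rule linear_on_comp[OF bilinear_onD(1)[OF bil g(2)]]) (use G' g cl in auto)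
    qed
    have b: "multilinear_on (scal C) (path_homs C (Q # Qs @ [X])) sU (\<lambda>fs. G (merge C 0 (Z # Q # Qs @ [X]) (f # fs)))"
      if f: "f \<in> Hom C Q Z" for f
      unfolding multilinear_path_hd[OF X(1) Q] m
    proof (intro conjI allI impI ballI)
      fix fs assume "list_all2 (\<in>) fs (path_homs C (Qs @ [X]))"
      then show "linear_on (Hom C ?V Q) (scal C) sU (\<lambda>g. G (cmp C ?V Q Z f g # fs))"
        using G' cl[OF f] by (intro linear_on_comp[OF bilinear_onD(2)[OF bil f]]) auto
    qed (use G' cl[OF f] in auto)
    show ?thesis using a b Z0 unfolding 0 by (simp add: multilinear_path_Cons)
  next
    case (Suc j)
    have G: "multilinear_on (scal C) (path_homs C (Z # Q # drop_nth j Qs @ [X])) sU G"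
      using Cons.prems(4) by (simp add: Suc drop_nth_Suc)
    note G' = G[unfolded multilinear_path_Cons[where P = "drop_nth j Qs @ [X]", OF Z0]]
    have a: "list_all2 (\<in>) (merge C j (Q # Qs @ [X]) fs) (path_homs C (Q # drop_nth j Qs @ [X]))"
      if "list_all2 (\<in>) fs (path_homs C (Q # Qs @ [X]))" for fs
      using C.path_merge[OF X(1) Q(1), of Qs fs j] that Q Cons.prems(3) Suc by (simp add: C.path_def)
    have b: "multilinear_on (scal C) (path_homs C (Q # Qs @ [X])) sU (\<lambda>fs. G (f # merge C j (Q # Qs @ [X]) fs))"
      if "f \<in> Hom C Q Z" for f
      using Cons.IH[OF Q, of j "\<lambda>fs. G (f # fs)"] G' that Cons.prems(3) Suc by simp
    show ?thesis using a b G' Z0 unfolding Suc by (simp add: multilinear_path_Cons merge_Suc)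
  qed
qed simp

lemma cn_words_Suc_snoc:
  assumes "(Xs, fs) \<in> cn_words C (Suc n)"
  obtains X Bs L g gs f where "Xs = X # Bs @ [L]" "fs = g # gs @ [f]" "X \<in> Ob C" "set Bs \<subseteq> Ob C" "L \<in> Ob C" "length Bs = n"
    "f \<in> Hom C X L" "g \<in> Hom C (hd (Bs @ [L])) X" "list_all2 (\<in>) gs (path_homs C (Bs @ [L]))"
proof -
  obtain Bs' L gs' f where B: "Xs = Bs' @ [L]" "fs = gs' @ [f]" "set Bs' \<subseteq> Ob C" "L \<in> Ob C" "length Bs' = Suc n"
    "f \<in> Hom C (hd Xs) L" "list_all2 (\<in>) gs' (path_homs C (Bs' @ [L]))" by (rule cn_words_snoc[OF assms])
  then obtain X Bs where X: "Bs' = X # Bs" by (cases Bs') auto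
  with B obtain g gs where "gs' = g # gs" "g \<in> Hom C (hd (Bs @ [L])) X" "list_all2 (\<in>) gs (path_homs C (Bs @ [L]))"
    by (auto simp: path_homs_hd list_all2_Cons2)
  with B X that show thesis by auto
qed

context
  fixes n :: nat and \<phi> :: "('k, 'm, 'o, 'a) cochain"
  assumes \<phi>: "\<phi> \<in> cochains H M C n"
begin

definition last_face :: "'m \<Rightarrow> 'o list \<Rightarrow> 'a list \<Rightarrow> 'k" where
  "last_face m Xs fs = (\<Sum>(a, m0)\<leftarrow>csw H M m. cval n \<phi> m0 (last Xs # butlast (tl Xs))
     (cmp C (cyc_path Xs ! 1) (hd Xs) (last Xs)
        (act C (hd Xs) (last Xs) (inv (antipode H) a) (last fs)) (hd fs) # butlast (tl fs)))"

lemma last_face_snoc: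
  "last_face m (X # Bs @ [L]) (g # gs @ [f]) = (\<Sum>(a, m0)\<leftarrow>csw H M m. cval n \<phi> m0 (L # Bs)
     (cmp C (hd (Bs @ [L])) X L (act C X L (inv (antipode H) a) f) g # gs))"
  by (cases Bs) (simp_all add: last_face_def)

lemma
  shows coface_last_linear: "linear_on (mcn_space M C (Suc n)) (fscale (*)) (*) (coface H M C (Suc n) (Suc n) \<phi>)"
    and coface_last_value: "(Xs, fs) \<in> cn_words C (Suc n) \<Longrightarrow>
      coface H M C (Suc n) (Suc n) \<phi> (mcn_ten M C (Suc n) m (cn_elem C Xs fs)) = last_face m Xs fs"
proof -
  let ?g = "\<lambda>m Xs fs. \<phi> (\<Sum>(a, m0)\<leftarrow>csw H M m. mcn_ten M C n m0
               (cn_elem C (last Xs # butlast (tl Xs))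
                  (cmp C (cyc_path Xs ! 1) (hd Xs) (last Xs)
                     (act C (hd Xs) (last Xs) (inv (antipode H) a) (last fs)) (hd fs)
                   # butlast (tl fs))))"
  have g: "?g m Xs fs = last_face m Xs fs" if w: "(Xs, fs) \<in> cn_words C (Suc n)" for m Xs fs
  proof -
    obtain X Bs L g gs f where B: "Xs = X # Bs @ [L]" "fs = g # gs @ [f]" "X \<in> Ob C" "set Bs \<subseteq> Ob C" "L \<in> Ob C" "length Bs = n"
      "f \<in> Hom C X L" "g \<in> Hom C (hd (Bs @ [L])) X" "list_all2 (\<in>) gs (path_homs C (Bs @ [L]))" by (rule cn_words_Suc_snoc[OF w])
    \<comment> \<open>Position 1 of the closed path is \<open>L\<close> itself when
      \<open>Bs\<close> is empty; \<open>hd (Bs @ [L])\<close> covers both cases.\<close>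
    have nth: "cyc_path Xs ! 1 = hd (Bs @ [L])" unfolding B(1) by (cases Bs) simp_all
    show ?thesis
      unfolding last_face_def
    proof (rule cochain_sum[OF \<phi>])
      fix a
      have "cmp C (hd (Bs @ [L])) X L (act C X L (inv (antipode H) a) f) g \<in> Hom C (hd (Bs @ [L])) L"
        by (rule C.cmp_closed[OF hd_path_Ob[OF B(5,4)] B(3,5) act_closed[OF B(3,5,7)] B(8)])
      from cn_words_rotate[OF B(4,5,6) this B(9)]
      show "(last Xs # butlast (tl Xs), cmp C (cyc_path Xs ! 1) (hd Xs) (last Xs)
          (act C (hd Xs) (last Xs) (inv (antipode H) a) (last fs)) (hd fs) # butlast (tl fs)) \<in> cn_words C n"
        unfolding nth by (simp add: B(1,2))
    qed
  qed
  have 1: "linear_on UNIV (mscale M) (*) (\<lambda>m. ?g m Xs fs)" if w: "(Xs, fs) \<in> cn_words C (Suc n)" for Xs fs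
  proof -
    obtain X Bs L g' gs f where B: "Xs = X # Bs @ [L]" "fs = g' # gs @ [f]" "X \<in> Ob C" "set Bs \<subseteq> Ob C" "L \<in> Ob C" "length Bs = n"
      "f \<in> Hom C X L" "g' \<in> Hom C (hd (Bs @ [L])) X" "list_all2 (\<in>) gs (path_homs C (Bs @ [L]))" by (rule cn_words_Suc_snoc[OF w])
    note V = hd_path_Ob[OF B(5,4)]
    have "bilinear_on (hscale H) UNIV (mscale M) UNIV (*)
      (\<lambda>a m0. cval n \<phi> m0 (L # Bs) (cmp C (hd (Bs @ [L])) X L (act C X L (inv (antipode H) a) f) g' # gs))"
      by (rule cval_act_bilinear[OF \<phi> B(4,5,6,9) bilinear_onD(1)[OF C.cmp_bilinear[OF V B(3,5)] B(8)] _ B(3,5,7)])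
        (rule C.cmp_closed[OF V B(3,5) _ B(8)])
    from linear_on_csw[OF vector_space_field this] show ?thesis
      unfolding g[OF w] unfolding B(1,2) last_face_snoc .
  qed
  have 2: "multilinear_on (scal C) (path_homs C (X # Qs @ [X])) (*) (?g m (X # Qs))"
    if X: "X \<in> Ob C" "set Qs \<subseteq> Ob C" "length Qs = Suc n" for m X Qs
  proof -
    obtain Bs L where B: "Qs = Bs @ [L]" using X(3) by (cases Qs rule: rev_cases) auto
    have B': "set Bs \<subseteq> Ob C" "L \<in> Ob C" "length Bs = n" using X unfolding B by auto
    note V = hd_path_Ob[OF B'(2,1)]
    note bil = C.cmp_bilinear[OF V X(1) B'(2)] and cl = C.cmp_closed[OF V X(1) B'(2)]
    have PH: "path_homs C (X # Qs @ [X]) = path_homs C (X # Bs @ [L]) @ [Hom C X L]"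
      using path_homs_snoc[of C "X # Bs" L X] B by simp
    have sub: "module.subspace (scal C) V" if "V \<in> set (path_homs C (X # Qs @ [X]))" for V
      using that X by (intro C.subspace_path_homs) auto
    have "multilinear_on (scal C) (path_homs C (X # Qs @ [X])) (*) (last_face m (X # Qs))"
      unfolding PH
    proof (rule multilinear_on_snoc)
      fix xs assume "list_all2 (\<in>) xs (path_homs C (X # Bs @ [L]))"
      then obtain x0 ys where x: "xs = x0 # ys" "x0 \<in> Hom C (hd (Bs @ [L])) X" "list_all2 (\<in>) ys (path_homs C (Bs @ [L]))"
        by (auto simp: path_homs_hd list_all2_Cons2)
      have "linear_on (Hom C X L) (scal C) (*) (\<lambda>f. \<Sum>(a, m0)\<leftarrow>csw H M m. cval n \<phi> m0 (L # Bs)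
          (cmp C (hd (Bs @ [L])) X L (act C X L (inv (antipode H) a) f) x0 # ys))"
        by (intro linear_on_sum_list_pairs vector_space_field
          linear_on_comp[OF linear_on_comp[OF act_lin[OF X(1) B'(2)] bilinear_onD(1)[OF bil x(2)] act_closed[OF X(1) B'(2)]]
            cval_head_linear[OF \<phi> B'(1,2,3) x(3)] cl[OF act_closed[OF X(1) B'(2)] x(2)]])
      then show "linear_on (Hom C X L) (scal C) (*) (\<lambda>f. last_face m (X # Qs) (xs @ [f]))"
        unfolding B x(1) append_Cons last_face_snoc .
    next
      fix f assume f: "f \<in> Hom C X L"
      have "multilinear_on (scal C) (path_homs C (X # Bs @ [L])) (*)
          (\<lambda>xs. cval n \<phi> m0 (L # Bs) (cmp C (hd (Bs @ [L])) X L (act C X L (inv (antipode H) a) f) (hd xs) # tl xs))" for a m0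
      proof -
        note af = act_closed[OF X(1) B'(2) f, of "inv (antipode H) a"]
        note pm = cval_multilinear[OF \<phi> B'(2,1,3), of m0, unfolded multilinear_path_hd[OF B'(2,2,1)]]
        show ?thesis
          unfolding multilinear_path_hd[OF B'(2) X(1) B'(1)] list.sel
        proof (intro conjI allI impI ballI)
          fix fs assume "list_all2 (\<in>) fs (path_homs C (Bs @ [L]))"
          then show "linear_on (Hom C (hd (Bs @ [L])) X) (scal C) (*)
              (\<lambda>x. cval n \<phi> m0 (L # Bs) (cmp C (hd (Bs @ [L])) X L (act C X L (inv (antipode H) a) f) x # fs))"
            using pm cl[OF af] by (intro linear_on_comp[OF bilinear_onD(2)[OF bil af]]) auto
        qed (use pm cl[OF af] in auto)
      qed
      then have "multilinear_on (scal C) (path_homs C (X # Bs @ [L])) (*) (\<lambda>xs. \<Sum>(a, m0)\<leftarrow>csw H M m.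
          cval n \<phi> m0 (L # Bs) (cmp C (hd (Bs @ [L])) X L (act C X L (inv (antipode H) a) f) (hd xs) # tl xs))"
        by (intro multilinear_on_sum_list_pairs vector_space_field)
      then show "multilinear_on (scal C) (path_homs C (X # Bs @ [L])) (*) (\<lambda>xs. last_face m (X # Qs) (xs @ [f]))"
      proof (rule multilinear_on_cong[OF _ C.vector_space_scal])
        fix V assume "V \<in> set (path_homs C (X # Bs @ [L]))"
        then show "module.subspace (scal C) V" using sub unfolding PH by simp
      next
        fix xs assume "list_all2 (\<in>) xs (path_homs C (X # Bs @ [L]))"
        then obtain x0 ys where "xs = x0 # ys" by (auto simp: path_homs_hd list_all2_Cons2)
        then show "(\<Sum>(a, m0)\<leftarrow>csw H M m. cval n \<phi> m0 (L # Bs)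
            (cmp C (hd (Bs @ [L])) X L (act C X L (inv (antipode H) a) f) (hd xs) # tl xs)) = last_face m (X # Qs) (xs @ [f])"
          using last_face_snoc[of m X Bs L x0 ys f] by (simp add: B)
      qed
    qed
    then show ?thesis
    proof (rule multilinear_on_cong[OF _ C.vector_space_scal sub])
      fix fs assume "list_all2 (\<in>) fs (path_homs C (X # Qs @ [X]))"
      then have "(X # Qs, fs) \<in> cn_words C (Suc n)" using X by (simp add: cn_words_Cons C.path_def)
      then show "last_face m (X # Qs) fs = ?g m (X # Qs) fs" by (rule g[symmetric])
    qed
  qed
  have d: "coface H M C (Suc n) (Suc n) \<phi> = cochain_of M C (Suc n) ?g" by (simp add: coface_def)
  show "linear_on (mcn_space M C (Suc n)) (fscale (*)) (*) (coface H M C (Suc n) (Suc n) \<phi>)"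
    unfolding d by (rule cochain_of_linear[OF 1 2])
  assume w: "(Xs, fs) \<in> cn_words C (Suc n)"
  show "coface H M C (Suc n) (Suc n) \<phi> (mcn_ten M C (Suc n) m (cn_elem C Xs fs)) = last_face m Xs fs"
    unfolding d by (rule trans[OF cochain_of_value[OF 1 2 w] g[OF w]])
qed

lemma
  assumes i: "i \<le> n"
  shows coface_linear: "linear_on (mcn_space M C (Suc n)) (fscale (*)) (*) (coface H M C (Suc n) i \<phi>)"
    and coface_value: "(Xs, fs) \<in> cn_words C (Suc n) \<Longrightarrow>
      coface H M C (Suc n) i \<phi> (mcn_ten M C (Suc n) m (cn_elem C Xs fs)) = cval n \<phi> m (drop_nth (Suc i) Xs) (merge C i (cyc_path Xs) fs)"
proof -
  let ?g = "\<lambda>m Xs fs. cval n \<phi> m (drop_nth (Suc i) Xs) (merge C i (cyc_path Xs) fs)"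
  have d: "coface H M C (Suc n) i \<phi> = cochain_of M C (Suc n) ?g" using i by (simp add: coface_def cval_def)
  have 1: "linear_on UNIV (mscale M) (*) (\<lambda>m. ?g m Xs fs)" if w: "(Xs, fs) \<in> cn_words C (Suc n)" for Xs fs
  proof (rule cval_linear[OF \<phi>])
    obtain X Qs where "Xs = X # Qs" "X \<in> Ob C" "length Qs = Suc n" "C.path X X Qs fs" by (rule cn_words_cases[OF w])
    then show "(drop_nth (Suc i) Xs, merge C i (cyc_path Xs) fs) \<in> cn_words C n"
      using C.path_merge[of X X Qs fs i] i by (simp add: cn_words_Cons drop_nth_Suc length_drop_nth)
  qed
  have 2: "multilinear_on (scal C) (path_homs C (X # Qs @ [X])) (*) (?g m (X # Qs))"
    if X: "X \<in> Ob C" "set Qs \<subseteq> Ob C" "length Qs = Suc n" for m X Qs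
  proof -
    have "set (drop_nth i Qs) \<subseteq> Ob C" "length (drop_nth i Qs) = n"
      using X i set_take_subset[of i Qs] set_drop_subset[of "Suc i" Qs] by (auto simp: drop_nth_def)
    from multilinear_merge[OF X(1,1,2) _ cval_multilinear[OF \<phi> X(1) this, of m]] show ?thesis
      using X i by (simp add: drop_nth_Suc)
  qed
  show "linear_on (mcn_space M C (Suc n)) (fscale (*)) (*) (coface H M C (Suc n) i \<phi>)"
    unfolding d by (rule cochain_of_linear[OF 1 2])
  assume w: "(Xs, fs) \<in> cn_words C (Suc n)"
  show "coface H M C (Suc n) i \<phi> (mcn_ten M C (Suc n) m (cn_elem C Xs fs)) = ?g m Xs fs"
    unfolding d by (rule cochain_of_value[OF 1 2 w])
qed

text \<open>Both conditions compare linear forms on a tensor product with a space spanned by words,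
  so they may be tested on words, where cofaces and rotation have explicit values. Among the cofaces
  the last one stands apart, since it alone involves the coaction.\<close>

lemma cyclic_cocycles_iff:
  "\<phi> \<in> cyclic_cocycles H M C n \<longleftrightarrow>
     (\<forall>m. \<forall>(Xs, fs)\<in>cn_words C (Suc n).
        (\<Sum>i\<le>n. (- 1) ^ i * cval n \<phi> m (drop_nth (Suc i) Xs) (merge C i (cyc_path Xs) fs))
        + (- 1) ^ Suc n * last_face m Xs fs = 0) \<and>
     (\<forall>m. \<forall>(Xs, fs)\<in>cn_words C n. cval n \<phi> m Xs fs = (- 1) ^ n * rot n \<phi> m Xs fs)"
proof -
  have b: "hochschild_b H M C n \<phi> t = (\<Sum>i\<le>n. (- 1) ^ i * coface H M C (Suc n) i \<phi> t)
      + (- 1) ^ Suc n * coface H M C (Suc n) (Suc n) \<phi> t" for t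
    by (simp add: hochschild_b_def)
  have blin: "linear_on (mcn_space M C (Suc n)) (fscale (*)) (*) (hochschild_b H M C n \<phi>)"
    unfolding b[abs_def]
    by (intro linear_on_add linear_on_scale linear_on_sum_fun vector_space_field coface_last_linear coface_linear) simp
  have clin: "linear_on (mcn_space M C n) (fscale (*)) (*) (\<lambda>t. (- 1) ^ n * cyclic_op H M C n \<phi> t)"
    by (intro linear_on_scale vector_space_field cyclic_op_linear \<phi>)
  have bval: "hochschild_b H M C n \<phi> (mcn_ten M C (Suc n) m (cn_elem C Xs fs))
      = (\<Sum>i\<le>n. (- 1) ^ i * cval n \<phi> m (drop_nth (Suc i) Xs) (merge C i (cyc_path Xs) fs)) + (- 1) ^ Suc n * last_face m Xs fs"
    if "(Xs, fs) \<in> cn_words C (Suc n)" for m Xs fs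
    unfolding b by (simp add: coface_last_value[OF that] coface_value[OF _ that])
  have mem: "mcn_ten M C k m (cn_elem C Xs fs) \<in> mcn_space M C k" if "(Xs, fs) \<in> cn_words C k" for k m Xs fs
    by (intro ten_in_tensor_space cn_elem_mem that UNIV_I)
  have B: "(\<forall>t\<in>mcn_space M C (Suc n). hochschild_b H M C n \<phi> t = 0) \<longleftrightarrow>
    (\<forall>m. \<forall>(Xs, fs)\<in>cn_words C (Suc n).
        (\<Sum>i\<le>n. (- 1) ^ i * cval n \<phi> m (drop_nth (Suc i) Xs) (merge C i (cyc_path Xs) fs))
        + (- 1) ^ Suc n * last_face m Xs fs = 0)" (is "?L \<longleftrightarrow> ?R")
  proof
    assume ?L
    show ?R
    proof (intro allI ballI, clarify)
      fix m Xs fs assume w: "(Xs, fs) \<in> cn_words C (Suc n)"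
      show "(\<Sum>i\<le>n. (- 1) ^ i * cval n \<phi> m (drop_nth (Suc i) Xs) (merge C i (cyc_path Xs) fs))
        + (- 1) ^ Suc n * last_face m Xs fs = 0"
        unfolding bval[OF w, symmetric] using \<open>?L\<close> mem[OF w] by blast
    qed
  next
    assume R: ?R
    show ?L
    proof
      fix t assume t: "t \<in> mcn_space M C (Suc n)"
      show "hochschild_b H M C n \<phi> t = 0"
      proof (rule mcn_space_eqI[OF blin linear_on_const0[OF vector_space_field] _ t])
        fix m Xs fs assume w: "(Xs, fs) \<in> cn_words C (Suc n)"
        show "hochschild_b H M C n \<phi> (mcn_ten M C (Suc n) m (cn_elem C Xs fs)) = 0"
          unfolding bval[OF w] using R w by blast
      qed
    qed
  qed
  have Cc: "(\<forall>t\<in>mcn_space M C n. \<phi> t = (- 1) ^ n * cyclic_op H M C n \<phi> t) \<longleftrightarrow>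
    (\<forall>m. \<forall>(Xs, fs)\<in>cn_words C n. cval n \<phi> m Xs fs = (- 1) ^ n * rot n \<phi> m Xs fs)" (is "?L \<longleftrightarrow> ?R")
  proof
    assume ?L
    show ?R
    proof (intro allI ballI, clarify)
      fix m Xs fs assume w: "(Xs, fs) \<in> cn_words C n"
      show "cval n \<phi> m Xs fs = (- 1) ^ n * rot n \<phi> m Xs fs"
        unfolding cyclic_op_value[OF \<phi> w, symmetric] cval_def using \<open>?L\<close> mem[OF w] by blast
    qed
  next
    assume R: ?R
    show ?L
    proof
      fix t assume t: "t \<in> mcn_space M C n"
      show "\<phi> t = (- 1) ^ n * cyclic_op H M C n \<phi> t"
      proof (rule mcn_space_eqI[OF cochain_linear[OF \<phi>] clin _ t])
        fix m Xs fs assume w: "(Xs, fs) \<in> cn_words C n"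
        show "\<phi> (mcn_ten M C n m (cn_elem C Xs fs)) = (- 1) ^ n * cyclic_op H M C n \<phi> (mcn_ten M C n m (cn_elem C Xs fs))"
          unfolding cyclic_op_value[OF \<phi> w] using R w unfolding cval_def by blast
      qed
    qed
  qed
  show ?thesis unfolding cyclic_cocycles_def using \<phi> B Cc by blast
qed

end

end

section \<open>Characters, traces and cocycles\<close>

context H_semicategory
begin

text \<open>The closed form \<open>LW_W\<close> for a right factor of degree 0, with (-1)^(n-i)
  rewritten as (-1)^n (-1)^i: the faces 0 to n of the Hochschild coboundary appear. The index shifts
  to \<open>Suc i\<close> because the cyclic object list carries the base object in front.\<close>

lemma form_cmp_W_iota:
  fixes \<tau> :: "('k, 'o, 'a) omega \<Rightarrow> 'k"
  assumes X: "X \<in> Ob C" "Y \<in> Ob C" and lin: "linear_on (OD n X X) osc (*) \<tau>"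
    and val: "\<And>Qs fs. C.path X X Qs fs \<Longrightarrow> length Qs = n \<Longrightarrow> \<tau> (W X X Qs fs) = v (X # Qs) fs"
    and p: "C.path Y X Xs gs" "length Xs = n" and f: "f \<in> Hom C X Y"
  shows "\<tau> (cmp \<Omega> X Y X (W Y X Xs gs) (W X Y [] [f])) = (- 1) ^ n *
    (\<Sum>i\<le>n. (- 1) ^ i * v (drop_nth (Suc i) (X # Xs @ [Y])) (merge C i (X # Xs @ [Y, X]) (gs @ [f])))"
proof -
  have pf: "C.path X Y [] [f]" using f by (simp add: C.path_Nil)
  have m: "W X Y [] [f] \<in> OM X Y" by (rule W_mem[OF pf UNIV_I])
  have path: "C.path X X (drop_nth i (Xs @ [Y])) (merge C i (X # Xs @ [Y, X]) (gs @ [f]))" if "i \<le> n" for i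
    using path_merge_append[OF X X(1) p(1) pf, of i] that p(2) by simp
  have len: "length (drop_nth i (Xs @ [Y])) = n" if "i \<le> n" for i using that p(2) by (simp add: length_drop_nth)
  let ?W = "\<lambda>i. W X X (drop_nth i (Xs @ [Y])) (merge C i (X # Xs @ [Y, X]) (gs @ [f]))"
  have Wm: "?W i \<in> OD n X X" if "i \<le> n" for i using path[OF that] len[OF that] by (auto intro: W_mem)
  have "\<tau> (cmp \<Omega> X Y X (W Y X Xs gs) (W X Y [] [f])) = \<tau> (\<Sum>i\<le>n. osc ((- 1) ^ (n - i)) (?W i))"
    using LW_W[OF X X(1) p(1) pf] p(2) by (simp add: cmp_W[OF X X(1) m p(1)])
  also have "\<dots> = (\<Sum>i\<le>n. \<tau> (osc ((- 1) ^ (n - i)) (?W i)))"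
    by (rule linear_on_sum[OF lin vs_omega subspace_omega_sum]) (auto intro: osc_closed(3) Wm)
  also have "\<dots> = (\<Sum>i\<le>n. (- 1) ^ n * ((- 1) ^ i * v (drop_nth (Suc i) (X # Xs @ [Y])) (merge C i (X # Xs @ [Y, X]) (gs @ [f]))))"
    by (intro sum.cong refl)
      (simp add: linear_on_scaleD[OF lin Wm] val[OF path len] neg_one_power_diff drop_nth_Suc)
  finally show ?thesis by (simp add: sum_distrib_left)
qed

text \<open>The relation (df) w = d(f w) - f dw. A closed form kills the first term and leaves a
  single word with \<open>f\<close> in front.\<close>

lemma cmp_U_iota_W:
  assumes X: "X \<in> Ob C" "Y \<in> Ob C" and f: "f \<in> Hom C X Y" and p: "C.path Y X Xs gs"
  shows "cmp \<Omega> Y X Y (U X Y [] [f]) (W Y X Xs gs) = diff \<Omega> Y Y (lam Y X Y f (W Y X Xs gs)) - W Y Y (X # Xs) (f # gs)"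
proof -
  have pf: "C.path X Y [] [f]" using f by (simp add: C.path_Nil)
  show ?thesis
    unfolding cmp_U[OF X(2,1,2) W_mem[OF p UNIV_I] pf] LU_def diff_W[OF X(2,1) p]
    by (simp add: lam_U[OF X(2,1,2) f p])
qed

lemma act_U_iota:
  assumes "X \<in> Ob C" "Y \<in> Ob C" "f \<in> Hom C X Y"
  shows "act \<Omega> X Y h (U X Y [] [f]) = U X Y [] [act C X Y h f]"
  using assms by (simp add: act_U C.path_Nil act_W_Nil diff_W act_closed)

lemma omega_cyc_W: "omega_cyc H C (X # Qs) fs = W X X Qs fs"
  by (simp add: omega_cyc_def W_def)

end

context sayd_semicategory
begin

lemma trace_imp_cocycle:
  assumes \<phi>: "\<phi> \<in> cochains H M C n"
    and identities: "\<And>X. X \<in> Ob C \<Longrightarrow> \<exists>e\<in>Hom C X X. (\<forall>Y\<in>Ob C. \<forall>f\<in>Hom C X Y. cmp C X X Y f e = f) \<and>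
       (\<forall>Y\<in>Ob C. \<forall>f\<in>Hom C Y X. cmp C Y X X e f = f)"
    and t: "trace_form H M n \<Omega> t"
    and val: "\<And>m Xs fs. (Xs, fs) \<in> cn_words C n \<Longrightarrow> cval n \<phi> m Xs fs = t (hd Xs) m (omega_cyc H C Xs fs)"
  shows "\<phi> \<in> cyclic_cocycles H M C n"
proof -
  have lin: "linear_on (OD n X X) osc (*) (t X m)" if "X \<in> Ob C" for X m
    using t that by (simp add: trace_form_def bilinear_on_def)
  have tW: "t X m (W X X Qs fs) = cval n \<phi> m (X # Qs) fs"
    if "X \<in> Ob C" "C.path X X Qs fs" "length Qs = n" for X m Qs fs
    using val[of "X # Qs" fs m] that by (simp add: cn_words_Cons omega_cyc_W)
  have td: "t X m (diff \<Omega> X X x) = 0" if "X \<in> Ob C" "x \<in> OD j X X" "Suc j = n" for X m x j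
    using t that by (simp add: trace_form_def)
  have tr: "t X m (cmp \<Omega> X Y X g' g) = (- 1) ^ (i * j) *
      (\<Sum>(a, m0)\<leftarrow>csw H M m. t Y m0 (cmp \<Omega> Y X Y (act \<Omega> X Y (inv (antipode H) a) g) g'))"
    if "X \<in> Ob C" "Y \<in> Ob C" "g \<in> OD i X Y" "g' \<in> OD j Y X" "i + j = n" for X Y m g g' i j
    using t that by (simp add: trace_form_def)
  have B: "(\<Sum>i\<le>n. (- 1) ^ i * cval n \<phi> m (drop_nth (Suc i) Xs) (merge C i (cyc_path Xs) fs))
        + (- 1) ^ Suc n * last_face n \<phi> m Xs fs = 0" if w: "(Xs, fs) \<in> cn_words C (Suc n)" for m Xs fs
  proof -
    obtain X Bs L g gs f where B: "Xs = X # Bs @ [L]" "fs = g # gs @ [f]" "X \<in> Ob C" "set Bs \<subseteq> Ob C" "L \<in> Ob C" "length Bs = n"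
      "f \<in> Hom C X L" "g \<in> Hom C (hd (Bs @ [L])) X" "list_all2 (\<in>) gs (path_homs C (Bs @ [L]))" by (rule cn_words_Suc_snoc[OF w])
    have p: "C.path L X Bs (g # gs)" using B by (simp add: path_hd)
    have pf: "C.path X L [] [f]" using B by (simp add: C.path_Nil)
    have m: "W L X Bs (g # gs) \<in> OD n L X" "W X L [] [f] \<in> OD 0 X L" using p pf B(6) by (auto intro!: W_mem)
    let ?S = "\<Sum>i\<le>n. (- 1) ^ i * cval n \<phi> m (drop_nth (Suc i) Xs) (merge C i (cyc_path Xs) fs)"
    \<comment> \<open>The word without its last morphism \<open>f\<close> is multiplied by
      \<open>f\<close>. One side of the trace property gives all inner faces; the other, with
      \<open>f\<close> moved to the front, gives the last coface.\<close>
    have "(- 1) ^ n * ?S = t X m (cmp \<Omega> X L X (W L X Bs (g # gs)) (W X L [] [f]))"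
      using form_cmp_W_iota[OF B(3,5) lin[OF B(3)] tW[OF B(3)] p B(6,7), of m] by (simp add: B(1,2))
    also have "\<dots> = (\<Sum>(a, m0)\<leftarrow>csw H M m. t L m0 (cmp \<Omega> L X L (act \<Omega> X L (inv (antipode H) a) (W X L [] [f])) (W L X Bs (g # gs))))"
      using tr[OF B(3,5) m(2,1)] by simp
    also have "\<dots> = last_face n \<phi> m Xs fs"
    proof -
      have "t L m0 (cmp \<Omega> L X L (act \<Omega> X L a' (W X L [] [f])) (W L X Bs (g # gs)))
        = cval n \<phi> m0 (L # Bs) (cmp C (hd (Bs @ [L])) X L (act C X L a' f) g # gs)" for a' m0
      proof -
        note af = act_closed[OF B(3,5,7), of a']
        show ?thesis
          unfolding act_W_Nil[OF B(3,5,7)] cmp_W_Nil[OF B(5,3,5) af OD_OM[OF m(1)]] lam_W[OF B(5,3,5) af p]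
          by (rule tW[OF B(5) path_cmp_head[OF B(5,3,5) af p] B(6)])
      qed
      then show ?thesis unfolding B(1,2) last_face_snoc[OF \<phi>] by simp
    qed
    finally have "last_face n \<phi> m Xs fs = (- 1) ^ n * ?S" by simp
    then show ?thesis by (simp flip: mult.assoc power_mult_distrib)
  qed
  have Cc: "cval n \<phi> m Xs fs = (- 1) ^ n * rot n \<phi> m Xs fs" if w: "(Xs, fs) \<in> cn_words C n" for m Xs fs
  proof (cases n)
    case 0
    obtain X where X: "Xs = [X]" "X \<in> Ob C" "C.path X X [] fs"
      using cn_words_cases[OF w] 0 by (metis length_0_conv)
    then obtain f where f: "fs = [f]" "f \<in> Hom C X X" by (auto simp: C.path_Nil)
    \<comment> \<open>In degree 0 the morphism is written as e f with a unit e; the trace property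
      moves f to the front, and e disappears on the other side as well.\<close>
    obtain e where e: "e \<in> Hom C X X" "\<And>f. f \<in> Hom C X X \<Longrightarrow> cmp C X X X f e = f" "\<And>f. f \<in> Hom C X X \<Longrightarrow> cmp C X X X e f = f"
      using identities[OF X(2)] X(2) by blast
    have pp: "C.path X X [] [h]" if "h \<in> Hom C X X" for h using that by (simp add: C.path_Nil)
    have m: "W X X [] [h] \<in> OD 0 X X" if "h \<in> Hom C X X" for h using pp[OF that] by (auto intro!: W_mem)
    have c: "cmp \<Omega> X X X (W X X [] [h]) (W X X [] [k]) = W X X [] [cmp C X X X h k]"
      if "h \<in> Hom C X X" "k \<in> Hom C X X" for h k
      using that lam_W[OF X(2,2,2) that(1) pp[OF that(2)]] by (simp add: cmp_W_Nil[OF X(2,2,2) _ OD_OM[OF m]])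
    have "cval n \<phi> m Xs fs = t X m (cmp \<Omega> X X X (W X X [] [e]) (W X X [] [f]))"
      using tW[OF X(2) pp[OF f(2)], of m] 0 by (simp add: c e f X(1))
    also have "\<dots> = (\<Sum>(a, m0)\<leftarrow>csw H M m. t X m0 (cmp \<Omega> X X X (act \<Omega> X X (inv (antipode H) a) (W X X [] [f])) (W X X [] [e])))"
      using tr[OF X(2,2) m[OF f(2)] m[OF e(1)]] 0 by simp
    also have "\<dots> = (\<Sum>(a, m0)\<leftarrow>csw H M m. cval n \<phi> m0 [X] [act C X X (inv (antipode H) a) f])"
      using 0 by (simp add: act_W_Nil[OF X(2,2) f(2)] c[OF act_closed[OF X(2,2) f(2)] e(1)]
        e(2)[OF act_closed[OF X(2,2) f(2)]] tW[OF X(2) pp[OF act_closed[OF X(2,2) f(2)]]])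
    finally show ?thesis unfolding rot_def[OF \<phi>] X(1) f(1) using 0 by simp
  next
    case (Suc k)
    have w': "(Xs, fs) \<in> cn_words C (Suc k)" using w Suc by simp
    obtain X Bs L g gs f where B: "Xs = X # Bs @ [L]" "fs = g # gs @ [f]" "X \<in> Ob C" "set Bs \<subseteq> Ob C" "L \<in> Ob C" "length Bs = k"
      "f \<in> Hom C X L" "g \<in> Hom C (hd (Bs @ [L])) X" "list_all2 (\<in>) gs (path_homs C (Bs @ [L]))" by (rule cn_words_Suc_snoc[OF w'])
    have p: "C.path L X Bs (g # gs)" using B by (simp add: path_hd)
    have pf: "C.path X L [] [f]" using B by (simp add: C.path_Nil)
    have m: "W L X Bs (g # gs) \<in> OD k L X" "U X L [] [f] \<in> OD 1 X L" using p pf B by (auto intro!: W_mem U_mem)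
    have q: "C.path X X (Bs @ [L]) (g # gs @ [f])" using C.path_append[OF p pf B(5)] by simp
    \<comment> \<open>The full word is the shorter word, of degree \<open>k\<close>, times df for
      its last morphism; no alternating sum arises because df is closed.\<close>
    have "cval n \<phi> m Xs fs = t X m (cmp \<Omega> X L X (W L X Bs (g # gs)) (U X L [] [f]))"
      unfolding cmp_W[OF B(3,5,3) OD_OM[OF m(2)] p] LW_U[OF B(3,5,3) p pf]
      using tW[OF B(3) q, of m] B(6) Suc by (simp add: B(1,2))
    also have "\<dots> = (- 1) ^ k * (\<Sum>(a, m0)\<leftarrow>csw H M m. t L m0 (cmp \<Omega> L X L (act \<Omega> X L (inv (antipode H) a) (U X L [] [f])) (W L X Bs (g # gs))))"
      using tr[OF B(3,5) m(2,1)] Suc by simp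
    \<comment> \<open>On the other side df stands in front. Closedness of the trace removes d(f w),
      and the remaining minus sign turns (-1)^k into (-1)^n.\<close>
    also have "\<dots> = (- 1) ^ k * (\<Sum>(a, m0)\<leftarrow>csw H M m. - cval n \<phi> m0 (L # X # Bs) (act C X L (inv (antipode H) a) f # g # gs))"
    proof -
      have "t L m0 (cmp \<Omega> L X L (act \<Omega> X L a' (U X L [] [f])) (W L X Bs (g # gs)))
        = - cval n \<phi> m0 (L # X # Bs) (act C X L a' f # g # gs)" for a' m0
      proof -
        note af = act_closed[OF B(3,5,7), of a']
        have q': "C.path L L (X # Bs) (act C X L a' f # g # gs)" using p af B(3) by (simp add: C.path_Cons)
        have l: "lam L X L (act C X L a' f) (W L X Bs (g # gs)) \<in> OD k L L" by (rule lam_mem[OF B(5,3,5) af m(1)])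
        have "t L m0 (diff \<Omega> L L (lam L X L (act C X L a' f) (W L X Bs (g # gs))) - W L L (X # Bs) (act C X L a' f # g # gs))
          = 0 - cval n \<phi> m0 (L # X # Bs) (act C X L a' f # g # gs)"
          using linear_diff[OF lin[OF B(5)] vector_space_field, of "diff \<Omega> L L (lam L X L (act C X L a' f) (W L X Bs (g # gs)))"
              "W L L (X # Bs) (act C X L a' f # g # gs)" m0]
            diff_mem[OF B(5,5) l] W_mem[OF q', of "{Xs. length Xs = n}"] td[OF B(5) l, of m0] tW[OF B(5) q', of m0] Suc B(6) by simp
        then show ?thesis unfolding act_U_iota[OF B(3,5,7)] cmp_U_iota_W[OF B(3,5) af p] by simp
      qed
      then show ?thesis by simp
    qed
    also have "\<dots> = (- 1) ^ n * rot n \<phi> m Xs fs"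
    proof -
      have "(\<Sum>(a, m0)\<leftarrow>ps. - u a m0) = - (\<Sum>(a, m0)\<leftarrow>ps. u a m0 :: 'k)" for ps :: "('h \<times> 'm) list" and u
        by (induction ps) auto
      then show ?thesis unfolding rot_def[OF \<phi>] B(1,2) using Suc by (simp add: butlast_append)
    qed
    finally show ?thesis .
  qed
  show ?thesis unfolding cyclic_cocycles_iff[OF \<phi>] using B Cc by blast
qed

lemma character_imp_trace:
  fixes S :: "('k, 'h, 'p, 's::ab_group_add) dgh"
  assumes "is_character_of H M C n \<phi> S T \<rho>o \<rho>"
  shows "\<exists>T. closed_graded_trace H M n \<Omega> T \<and>
    (\<forall>m. \<forall>(Xs, fs)\<in>cn_words C n. \<phi> (mcn_ten M C n m (cn_elem C Xs fs))
        = T (hd Xs) (trace_ten M n \<Omega> (hd Xs) m (omega_cyc H C Xs fs)))"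
proof -
  have S: "DGH_semicategory H S" and T: "closed_graded_trace H M n S T" and fn: "H_semifunctor C (degree0 S) \<rho>o \<rho>"
    and val: "\<And>m Xs fs. (Xs, fs) \<in> cn_words C n \<Longrightarrow> \<phi> (mcn_ten M C n m (cn_elem C Xs fs))
          = T (\<rho>o (hd Xs)) (trace_ten M n S (\<rho>o (hd Xs)) m
                (rho_hat H C S \<rho>o \<rho> (hd Xs) (hd Xs) (omega_cyc H C Xs fs)))"
    using assms by (auto simp: is_character_of_def is_cycle_def)
  interpret F: DGH_functor H C S \<rho>o \<rho>
    by (intro DGH_functor.intro H_semicategory_axioms S DGH_functor_axioms.intro fn)
  define tS where "tS X m f = T X (trace_ten M n S X m f)" for X m f
  have tS: "trace_form H M n S tS" unfolding tS_def[abs_def] by (rule trace_form_of_trace[OF S T])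
  \<comment> \<open>Every trace condition transfers, since \<open>R\<close> commutes with
    composition, differential and action and preserves degrees.\<close>
  define t where "t X m x = tS (\<rho>o X) m (F.R X X x)" for X m x
  have sub: "OD n X Y \<subseteq> OM X Y" for n X Y by (auto dest: OD_OM)
  have "trace_form H M n \<Omega> t"
    unfolding trace_form_def
  proof (intro conjI ballI allI impI; unfold Omega_simps)
    fix X assume X: "X \<in> Ob C"
    have bil: "bilinear_on (mscale M) UNIV (scal S) (HomD S n (\<rho>o X) (\<rho>o X)) (*) (tS (\<rho>o X))"
      using tS F.\<rho>o_Ob[OF X] by (simp add: trace_form_def)
    show "bilinear_on (mscale M) UNIV osc (OD n X X) (*) (t X)"
      unfolding t_def
      by (rule bilinear_on_comp[OF bil linear_on_id linear_on_mono[OF F.R_linear[OF X X] sub]]) (auto intro: F.R_mem X)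
  next
    fix X m h f assume X: "X \<in> Ob C" and f: "f \<in> OD n X X"
    show "(\<Sum>(a, b)\<leftarrow>sw H h. t X (mact M m a) (act \<Omega> X X (antipode H b) f)) = counit H h * t X m f"
      unfolding t_def F.R_act[OF X X OD_OM[OF f]]
      using tS F.\<rho>o_Ob[OF X] F.R_mem[OF X X f] by (simp add: trace_form_def)
  next
    fix X m j f assume X: "X \<in> Ob C" and f: "f \<in> OD j X X" and j: "Suc j = n"
    show "t X m (diff \<Omega> X X f) = 0"
      unfolding t_def F.R_diff[OF X X OD_OM[OF f]]
      using tS F.\<rho>o_Ob[OF X] F.R_mem[OF X X f] j by (simp add: trace_form_def)
  next
    fix X Y m i j g g' assume X: "X \<in> Ob C" "Y \<in> Ob C" and g: "g \<in> OD i X Y" "g' \<in> OD j Y X" and ij: "i + j = n"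
    have "t X m (cmp \<Omega> X Y X g' g) = (- 1) ^ (i * j) * (\<Sum>(a, m0)\<leftarrow>csw H M m. tS (\<rho>o Y) m0
        (cmp S (\<rho>o Y) (\<rho>o X) (\<rho>o Y) (act S (\<rho>o X) (\<rho>o Y) (inv (antipode H) a) (F.R X Y g)) (F.R Y X g')))"
      unfolding t_def F.R_cmp[OF X X(1) OD_OM[OF g(2)] g(1)]
      using tS F.\<rho>o_Ob[OF X(1)] F.\<rho>o_Ob[OF X(2)] F.R_mem[OF X g(1)] F.R_mem[OF X(2,1) g(2)] ij by (simp add: trace_form_def)
    then show "t X m (cmp \<Omega> X Y X g' g) = (- 1) ^ (i * j) *
        (\<Sum>(a, m0)\<leftarrow>csw H M m. t Y m0 (cmp \<Omega> Y X Y (act \<Omega> X Y (inv (antipode H) a) g) g'))"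
      unfolding t_def by (simp add: F.R_cmp[OF X(2,1,2) OD_OM[OF act_mem[OF X g(1)]] g(2)] F.R_act[OF X OD_OM[OF g(1)]])
  qed
  from trace_of_trace_form[OF DGH_Omega this]
  obtain T' where T': "closed_graded_trace H M n \<Omega> T'"
    "\<And>X m f. X \<in> Ob \<Omega> \<Longrightarrow> f \<in> HomD \<Omega> n X X \<Longrightarrow> T' X (trace_ten M n \<Omega> X m f) = t X m f"
    by blast
  have "\<phi> (mcn_ten M C n m (cn_elem C Xs fs)) = T' (hd Xs) (trace_ten M n \<Omega> (hd Xs) m (omega_cyc H C Xs fs))"
    if w: "(Xs, fs) \<in> cn_words C n" for m Xs fs
  proof -
    obtain X Qs where X: "Xs = X # Qs" "X \<in> Ob C" "length Qs = n" "C.path X X Qs fs" by (rule cn_words_cases[OF w])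
    then have "omega_cyc H C Xs fs \<in> OD n X X" by (auto simp: omega_cyc_W intro!: W_mem)
    then show ?thesis using val[OF w, of m] T'(2)[of X "omega_cyc H C Xs fs" m] X(1,2) by (simp add: t_def tS_def)
  qed
  with T'(1) show ?thesis by blast
qed

lemma trace_imp_character:
  assumes T: "closed_graded_trace H M n \<Omega> T"
    and val: "\<And>m Xs fs. (Xs, fs) \<in> cn_words C n \<Longrightarrow> \<phi> (mcn_ten M C n m (cn_elem C Xs fs))
        = T (hd Xs) (trace_ten M n \<Omega> (hd Xs) m (omega_cyc H C Xs fs))"
  shows "is_character_of H M C n \<phi> \<Omega> T (\<lambda>X. X) (\<lambda>X Y f. W X Y [] [f])"
proof -
  let ?\<rho> = "\<lambda>X Y f. W X Y [] [f]"
  have lin: "linear_on (Hom C X Y) (scal C) osc (\<lambda>f. W X Y [] [f])" if "X \<in> Ob C" "Y \<in> Ob C" for X Y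
    using W_head_linear[OF that, of "[]" "[]"] by (simp add: path_homs_single)
  have fn: "H_semifunctor C (degree0 \<Omega>) (\<lambda>X. X) ?\<rho>"
    unfolding H_semifunctor_def degree0_def
    by (auto simp: act_W_Nil cmp_W_Nil lam_W W_mem C.path_Nil lin)
  interpret F: DGH_functor H C \<Omega> "\<lambda>X. X" ?\<rho>
    by (intro DGH_functor.intro H_semicategory_axioms DGH_Omega DGH_functor_axioms.intro fn)
  \<comment> \<open>For the inclusion of the degree 0 part the induced functor fixes every word, so
    both expressions required of a character reduce to the value of the given trace.\<close>
  have d: "F.dcomp X Y Xs fs = U X Y Xs fs" if "X \<in> Ob C" "Y \<in> Ob C" "C.path X Y Xs fs" for X Y Xs fs
    using that(2,3)
  proof (induction Xs arbitrary: Y fs)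
    case Nil
    then obtain f where "fs = [f]" "f \<in> Hom C X Y" by (auto simp: C.path_Nil)
    then show ?case using diff_W[OF that(1) Nil(1), of "[]" "[f]"] by (simp add: C.path_Nil)
  next
    case (Cons X1 Xs)
    then obtain f gs where *: "fs = f # gs" "X1 \<in> Ob C" "f \<in> Hom C X1 Y" "C.path X X1 Xs gs" by (auto simp: C.path_Cons)
    have pf: "C.path X1 Y [] [f]" using * by (simp add: C.path_Nil)
    have um: "U X X1 Xs gs \<in> OM X X1" by (intro U_mem that * UNIV_I)
    show ?case
      using cmp_U[OF that(1) *(2) Cons.prems(1) um pf] LU_U[OF that(1) *(2) Cons.prems(1) pf *(4)]
        Cons.IH[OF *(2,4)] by (simp add: *(1) diff_W[OF *(2) Cons.prems(1) pf])
  qed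
  have w: "F.wcomp X Y Xs fs = W X Y Xs fs" if XY: "X \<in> Ob C" "Y \<in> Ob C" "C.path X Y Xs fs" for X Y Xs fs
  proof (cases Xs)
    case Nil
    then show ?thesis using XY by (auto simp: C.path_Nil)
  next
    case (Cons X1 Xs')
    then obtain f gs where *: "fs = f # gs" "X1 \<in> Ob C" "f \<in> Hom C X1 Y" "C.path X X1 Xs' gs" using XY by (auto simp: C.path_Cons)
    have um: "U X X1 Xs' gs \<in> OM X X1" by (intro U_mem XY * UNIV_I)
    show ?thesis
      unfolding Cons *(1) using XY * by (simp add: d cmp_W_Nil[OF _ _ _ _ um] lam_U)
  qed
  have "F.R X X (omega_cyc H C Xs fs) = omega_cyc H C Xs fs \<and>
    path_cmp \<Omega> (map (\<lambda>X. X) (cyc_path Xs)) (rho_path \<Omega> (\<lambda>X. X) ?\<rho> (cyc_path Xs) fs) = omega_cyc H C Xs fs"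
    if X: "Xs = X # Qs" "X \<in> Ob C" "C.path X X Qs fs" for X Xs Qs fs
    using F.R_W[OF X(2,2,3)] F.path_cmp_rho_path[OF C.path_length[OF X(3)], of X X]
    by (simp add: X(1) omega_cyc_W w[OF X(2,2,3)])
  note single_cyc = this
  have "F.R (hd Xs) (hd Xs) (omega_cyc H C Xs fs) = omega_cyc H C Xs fs \<and>
    path_cmp \<Omega> (map (\<lambda>X. X) (cyc_path Xs)) (rho_path \<Omega> (\<lambda>X. X) ?\<rho> (cyc_path Xs) fs) = omega_cyc H C Xs fs"
    if w: "(Xs, fs) \<in> cn_words C n" for Xs fs
  proof -
    obtain X Qs where X: "Xs = X # Qs" "X \<in> Ob C" "length Qs = n" "C.path X X Qs fs" by (rule cn_words_cases[OF w])
    show ?thesis using single_cyc[OF X(1,2,4)] unfolding X(1) list.sel .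
  qed
  then show ?thesis
    unfolding is_character_of_def is_cycle_def using DGH_Omega T fn val by auto
qed


text \<open>Only the first components of the entries are used, so the unit coefficient is discarded:
  this encodes that the form vanishes on df1 ... dfn. Words of other degrees get the value 0, so
  that the form is defined on the whole Hom space.\<close>

definition cyc_form :: "nat \<Rightarrow> ('k, 'm, 'o, 'a) cochain \<Rightarrow> 'o \<Rightarrow> 'm \<Rightarrow> ('k, 'o, 'a) omega \<Rightarrow> 'k" where
  "cyc_form n \<phi> X m = omega_lin_ext H C X X (*)
     (\<lambda>(Xs, xs). if length Xs = n then cval n \<phi> m (X # Xs) (map fst xs) else 0)"

context
  fixes n :: nat and \<phi> :: "('k, 'm, 'o, 'a) cochain"
  assumes \<phi>: "\<phi> \<in> cochains H M C n"
begin

abbreviation cf :: "'o \<Rightarrow> 'm \<Rightarrow> ('k, 'o, 'a) omega \<Rightarrow> 'k" where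
  "cf \<equiv> cyc_form n \<phi>"

lemma
  assumes X: "X \<in> Ob C"
  shows cf_linear: "linear_on (OM X X) osc (*) (cf X m)"
    and cf_W: "C.path X X Qs fs \<Longrightarrow> cf X m (W X X Qs fs) = (if length Qs = n then cval n \<phi> m (X # Qs) fs else 0)"
    and cf_U: "C.path X X Qs fs \<Longrightarrow> cf X m (U X X Qs fs) = 0"
proof -
  let ?gW = "\<lambda>Xs fs. if length Xs = n then cval n \<phi> m (X # Xs) fs else 0"
  let ?g = "\<lambda>(Xs, xs). if length Xs = n then cval n \<phi> m (X # Xs) (map fst xs) else 0"
  have 1: "multilinear_on (scal C) (path_homs C (X # Xs @ [X])) (*) (?gW Xs)" if "set Xs \<subseteq> Ob C" for Xs
    by (cases "length Xs = n") (simp_all add: cval_multilinear[OF \<phi> X that] multilinear_on_const0[OF vector_space_field])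
  note * = omega_lin_ext_values[OF X X vector_space_field 1 multilinear_on_const0[OF vector_space_field], where g = ?g]
  show "linear_on (OM X X) osc (*) (cf X m)"
    unfolding cyc_form_def by (rule *(1)) (auto simp: comp_def)
  show "C.path X X Qs fs \<Longrightarrow> cf X m (W X X Qs fs) = ?gW Qs fs"
    unfolding cyc_form_def by (subst *(2)) (auto simp: comp_def)
  show "C.path X X Qs fs \<Longrightarrow> cf X m (U X X Qs fs) = 0"
    unfolding cyc_form_def by (subst *(3)) (auto simp: comp_def)
qed

lemma cf_diff:
  assumes X: "X \<in> Ob C" and x: "x \<in> OM X X"
  shows "cf X m (diff \<Omega> X X x) = 0"
  by (rule omega_eqI[OF X X x linear_on_comp[OF diff_lin[OF X X] cf_linear[OF X] diff_mem_OM[OF X X]]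
        linear_on_const0[OF vector_space_field]])
    (simp_all add: diff_W diff_U X cf_U linear_on_zero[OF cf_linear[OF X] osc_closed(1)])

lemma cf_linear_m:
  assumes X: "X \<in> Ob C" and x: "x \<in> OM X X"
  shows "linear_on UNIV (mscale M) (*) (\<lambda>m. cf X m x)"
proof (rule linear_on_param[OF M.vector_space_axioms subspace_whole[OF M.vector_space_axioms] cf_linear[OF X]
      vector_space_field X X x])
  fix Xs fs assume p: "C.path X X Xs fs"
  show "linear_on UNIV (mscale M) (*) (\<lambda>m. cf X m (W X X Xs fs))"
  proof (cases "length Xs = n")
    case True
    then have "(X # Xs, fs) \<in> cn_words C n" using X p by (simp add: cn_words_Cons)
    from cval_linear[OF \<phi> this] show ?thesis using True by (simp add: cf_W[OF X p])
  next
    case False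
    then show ?thesis by (simp add: cf_W[OF X p] linear_on_const0[OF vector_space_field])
  qed
  show "linear_on UNIV (mscale M) (*) (\<lambda>m. cf X m (U X X Xs fs))"
    unfolding cf_U[OF X p] by (rule linear_on_const0[OF vector_space_field])
qed

text \<open>On \<open>W\<close> the action on \<Omega> and \<open>cn_act\<close> run over the same
  lists of legs, so this is the invariance of \<phi>. On \<open>U\<close> both sides vanish, because
  the action commutes with the differential and the form kills differentials.\<close>

lemma cf_equivariant:
  assumes X: "X \<in> Ob C" and x: "x \<in> OD n X X"
  shows "(\<Sum>(a, b)\<leftarrow>sw H h. cf X (mact M m a) (act \<Omega> X X (antipode H b) x)) = counit H h * cf X m x"
proof (rule omega_eqI[OF X X x])
  have sub: "OD n X X \<subseteq> OM X X" by (auto dest: OD_OM)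
  show "linear_on (OD n X X) osc (*) (\<lambda>x. \<Sum>(a, b)\<leftarrow>sw H h. cf X (mact M m a) (act \<Omega> X X (antipode H b) x))"
    by (rule linear_on_mono[OF _ sub])
      (intro linear_on_sum_list_pairs vector_space_field
        linear_on_comp[OF act_linear_Omega[OF X X] cf_linear[OF X] act_mem[OF X X]])
  show "linear_on (OD n X X) osc (*) (\<lambda>x. counit H h * cf X m x)"
    by (rule linear_on_mono[OF linear_on_scale[OF vector_space_field cf_linear[OF X]] sub])
  fix Xs fs assume p: "C.path X X Xs fs"
  show "(\<Sum>(a, b)\<leftarrow>sw H h. cf X (mact M m a) (act \<Omega> X X (antipode H b) (U X X Xs fs))) = counit H h * cf X m (U X X Xs fs)"
    by (simp add: act_U[OF X X p] cf_U[OF X p] cf_diff[OF X act_mem[OF X X W_mem[OF p UNIV_I]]])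
      (simp add: case_prod_beta')
  assume len: "Xs \<in> {Xs. length Xs = n}"
  have w: "(X # Xs, fs) \<in> cn_words C n" using X p len by (simp add: cn_words_Cons)
  have q: "C.path X X Xs (path_act C (X # Xs @ [X]) hs fs)" if "hs \<in> set (sweedler H n b)" for hs b
    using path_act_path[OF X X p] sweedler_length[OF that] len by simp
  have w': "(X # Xs, path_act C (X # Xs @ [X]) hs fs) \<in> cn_words C n" if "hs \<in> set (sweedler H n b)" for hs b
    using X q[OF that] len by (simp add: cn_words_Cons)
  have act_eq: "cn_act H C b (X # Xs) fs = (\<Sum>hs\<leftarrow>sweedler H n b. cn_elem C (X # Xs) (path_act C (X # Xs @ [X]) hs fs))" for b
    using len by (simp add: cn_act_def)
  have "cf X m' (act \<Omega> X X b (W X X Xs fs)) = \<phi> (mcn_ten M C n m' (cn_act H C b (X # Xs) fs))" for m' b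
  proof -
    have "cf X m' (act \<Omega> X X b (W X X Xs fs))
      = (\<Sum>hs\<leftarrow>sweedler H n b. cf X m' (W X X Xs (path_act C (X # Xs @ [X]) hs fs)))"
      using len unfolding act_W_sum[OF X X p]
      by (subst linear_on_sum_list[OF cf_linear[OF X] vs_omega subspace_omega_sum])
        (auto intro: W_mem q)
    also have "\<dots> = (\<Sum>hs\<leftarrow>sweedler H n b. \<phi> (mcn_ten M C n m' (cn_elem C (X # Xs) (path_act C (X # Xs @ [X]) hs fs))))"
      by (rule sum_list_cong_set) (use len in \<open>simp add: cf_W[OF X q] cval_def\<close>)
    also have "\<dots> = \<phi> (mcn_ten M C n m' (cn_act H C b (X # Xs) fs))"
    proof -
      have lin: "linear_on (CN C n) cn_scale (*) (\<lambda>v. \<phi> (mcn_ten M C n m' v))"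
        by (rule linear_on_comp[OF bilinear_onD(2)[OF ten_bilinear UNIV_I] cochain_linear[OF \<phi>]]) (simp add: ten_in_tensor_space)
      show ?thesis
        unfolding act_eq
        by (rule linear_on_sum_list[OF lin vector_space_fscale2_mult subspace_CN, symmetric]) (rule cn_elem_mem[OF w'])
    qed
    finally show ?thesis .
  qed
  moreover have "\<phi> (\<Sum>(a, b)\<leftarrow>sw H h. mcn_ten M C n (mact M m a) (cn_act H C (antipode H b) (X # Xs) fs))
    = (\<Sum>(a, b)\<leftarrow>sw H h. \<phi> (mcn_ten M C n (mact M m a) (cn_act H C (antipode H b) (X # Xs) fs)))"
  proof -
    have "cn_act H C b (X # Xs) fs \<in> CN C n" for b
      unfolding act_eq
      by (intro subspace_closed(4)[OF vector_space_fscale2_mult subspace_CN] cn_elem_mem[OF w'])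
    then show ?thesis
      unfolding case_prod_beta'
      by (intro linear_on_sum_list[OF cochain_linear[OF \<phi>] vector_space_fscale_mult subspace_tensor_space] ten_in_tensor_space UNIV_I)
  qed
  moreover have "\<phi> (\<Sum>(a, b)\<leftarrow>sw H h. mcn_ten M C n (mact M m a) (cn_act H C (antipode H b) (X # Xs) fs))
    = counit H h * \<phi> (mcn_ten M C n m (cn_elem C (X # Xs) fs))"
    using \<phi> w unfolding cochains_def by blast
  ultimately show "(\<Sum>(a, b)\<leftarrow>sw H h. cf X (mact M m a) (act \<Omega> X X (antipode H b) (W X X Xs fs))) = counit H h * cf X m (W X X Xs fs)"
    using len by (simp add: cf_W[OF X p] cval_def)
qed

text \<open>The trace identity with one factor \<open>g\<close> fixed and the other ranging over all
  elements of complementary degree; in this shape it is a property of \<open>g\<close> alone and can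
  be composed in \<open>g\<close>.\<close>

definition traces :: "nat \<Rightarrow> 'o \<Rightarrow> 'o \<Rightarrow> ('k, 'o, 'a) omega \<Rightarrow> bool" where
  "traces i X Y g \<longleftrightarrow> (\<forall>m j. \<forall>g'\<in>OD j Y X. i + j = n \<longrightarrow>
     cf X m (cmp \<Omega> X Y X g' g) = (- 1) ^ (i * j) *
       (\<Sum>(a, m0)\<leftarrow>csw H M m. cf Y m0 (cmp \<Omega> Y X Y (act \<Omega> X Y (inv (antipode H) a) g) g')))"

lemma cf_cmp_linear_left:
  assumes X: "X \<in> Ob C" "Y \<in> Ob C" and y: "y \<in> OM X Y"
  shows "linear_on (OM Y X) osc (*) (\<lambda>x. cf X m (cmp \<Omega> X Y X x y))"
  by (rule linear_on_comp[OF cmp_linear_left[OF X X(1) y] cf_linear[OF X(1)] cmp_mem[OF X X(1) _ y]])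

lemma cf_cmp_linear_right:
  assumes X: "X \<in> Ob C" "Y \<in> Ob C" and x: "x \<in> OM Y X"
  shows "linear_on (OM X Y) osc (*) (\<lambda>y. cf X m (cmp \<Omega> X Y X x y))"
  by (rule linear_on_comp[OF cmp_linear_right[OF X X(1) x] cf_linear[OF X(1)] cmp_mem[OF X X(1) x]])

lemma traces_generatorI:
  assumes X: "X \<in> Ob C" "Y \<in> Ob C" and g: "g \<in> OM X Y"
    and W: "\<And>m j Xs gs. C.path Y X Xs gs \<Longrightarrow> length Xs = j \<Longrightarrow> i + j = n \<Longrightarrow>
      cf X m (cmp \<Omega> X Y X (W Y X Xs gs) g) = (- 1) ^ (i * j) *
       (\<Sum>(a, m0)\<leftarrow>csw H M m. cf Y m0 (cmp \<Omega> Y X Y (act \<Omega> X Y (inv (antipode H) a) g) (W Y X Xs gs)))"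
    and U: "\<And>m j Xs gs. C.path Y X Xs gs \<Longrightarrow> Suc (length Xs) = j \<Longrightarrow> i + j = n \<Longrightarrow>
      cf X m (cmp \<Omega> X Y X (U Y X Xs gs) g) = (- 1) ^ (i * j) *
       (\<Sum>(a, m0)\<leftarrow>csw H M m. cf Y m0 (cmp \<Omega> Y X Y (act \<Omega> X Y (inv (antipode H) a) g) (U Y X Xs gs)))"
  shows "traces i X Y g"
  unfolding traces_def
proof (intro allI ballI impI)
  fix m j g' assume g': "g' \<in> OD j Y X" and ij: "i + j = n"
  have sub: "OD j Y X \<subseteq> OM Y X" by (auto dest: OD_OM)
  show "cf X m (cmp \<Omega> X Y X g' g) = (- 1) ^ (i * j) *
       (\<Sum>(a, m0)\<leftarrow>csw H M m. cf Y m0 (cmp \<Omega> Y X Y (act \<Omega> X Y (inv (antipode H) a) g) g'))"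
  proof (rule omega_eqI[OF X(2,1) g'])
    show "linear_on (OD j Y X) osc (*) (\<lambda>g'. cf X m (cmp \<Omega> X Y X g' g))"
      by (rule linear_on_mono[OF cf_cmp_linear_left[OF X g] sub])
    show "linear_on (OD j Y X) osc (*) (\<lambda>g'. (- 1) ^ (i * j) *
       (\<Sum>(a, m0)\<leftarrow>csw H M m. cf Y m0 (cmp \<Omega> Y X Y (act \<Omega> X Y (inv (antipode H) a) g) g')))"
      by (rule linear_on_mono[OF _ sub])
        (intro linear_on_scale linear_on_sum_list_pairs vector_space_field cf_cmp_linear_right X act_mem g)
  qed (use W U ij in auto)
qed

lemma traces_cmp:
  assumes X: "X \<in> Ob C" "Y \<in> Ob C" "Z \<in> Ob C" and u: "u \<in> OD i Z Y" and v: "v \<in> OD i' X Z"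
    and tu: "traces i Z Y u" and tv: "traces i' X Z v"
  shows "traces (i + i') X Y (cmp \<Omega> X Z Y u v)"
  unfolding traces_def
proof (intro allI ballI impI)
  fix m j g' assume g': "g' \<in> OD j Y X" and n: "i + i' + j = n"
  note u' = OD_OM[OF u] and v' = OD_OM[OF v] and g'' = OD_OM[OF g']
  let ?S = "inv (antipode H)"
  have tr_u: "cf Z m (cmp \<Omega> Z Y Z x u) = (- 1) ^ (i * k) *
       (\<Sum>(a, m0)\<leftarrow>csw H M m. cf Y m0 (cmp \<Omega> Y Z Y (act \<Omega> Z Y (?S a) u) x))" if "x \<in> OD k Y Z" "i + k = n" for x k m
    using tu that by (auto simp: traces_def)
  have tr_v: "cf X m (cmp \<Omega> X Z X x v) = (- 1) ^ (i' * k) *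
       (\<Sum>(a, m0)\<leftarrow>csw H M m. cf Z m0 (cmp \<Omega> Z X Z (act \<Omega> X Z (?S a) v) x))" if "x \<in> OD k Z X" "i' + k = n" for x k m
    using tv that by (auto simp: traces_def)
  have av: "act \<Omega> X Z a v \<in> OD i' X Z" "act \<Omega> Z Y a u \<in> OD i Z Y" for a
    by (intro act_mem X u v)+
  define F where "F a b m0 = cf Y m0 (cmp \<Omega> Y Z Y (act \<Omega> Z Y (?S b) u) (cmp \<Omega> Y X Z (act \<Omega> X Z (?S a) v) g'))" for a b m0
  have avg: "cmp \<Omega> Y X Z (act \<Omega> X Z a v) g' \<in> OD (i' + j) Y Z" for a
    by (rule cmp_mem_OD[OF X(2,1,3) av(1) g'])
  have g'u: "cmp \<Omega> Z Y X g' u \<in> OD (j + i) Z X" by (rule cmp_mem_OD[OF X(3,2,1) g' u])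
  have inv: "linear_on UNIV (hscale H) (hscale H) ?S" using linear_on_inv_antipode[OF linear_on_id] .
  have mm: "cmp \<Omega> Y Z Y (act \<Omega> Z Y b u) (cmp \<Omega> Y X Z (act \<Omega> X Z a v) g') \<in> OM Y Y" for a b
    by (rule cmp_mem[OF X(2,3,2) OD_OM[OF av(2)] OD_OM[OF avg]])
  have B: "bilinear_on (hscale H) UNIV (hscale H) UNIV (*)
      (\<lambda>x y. cf Y m0 (cmp \<Omega> Y Z Y (act \<Omega> Z Y x u) (cmp \<Omega> Y X Z (act \<Omega> X Z y v) g')))" for m0
  proof (rule bilinear_onI)
    fix y
    show "linear_on UNIV (hscale H) (*) (\<lambda>x. cf Y m0 (cmp \<Omega> Y Z Y (act \<Omega> Z Y x u) (cmp \<Omega> Y X Z (act \<Omega> X Z y v) g')))"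
      by (rule linear_on_comp[OF act_linear_h[OF X(3,2) u'] cf_cmp_linear_left[OF X(2,3) OD_OM[OF avg]] OD_OM[OF av(2)]])
  next
    fix x
    show "linear_on UNIV (hscale H) (*) (\<lambda>y. cf Y m0 (cmp \<Omega> Y Z Y (act \<Omega> Z Y x u) (cmp \<Omega> Y X Z (act \<Omega> X Z y v) g')))"
      by (rule linear_on_comp[OF linear_on_comp[OF act_linear_h[OF X(1,3) v'] cmp_linear_left[OF X(2,1,3) g''] OD_OM[OF av(1)]]
            cf_cmp_linear_right[OF X(2,3) OD_OM[OF av(2)]] OD_OM[OF avg]])
  qed
  \<comment> \<open>Two turns, up to signs and twists: (g' u) v becomes v (g' u) = (v g') u, and
    this becomes u (v g').\<close>
  have "cf X m (cmp \<Omega> X Y X g' (cmp \<Omega> X Z Y u v)) = cf X m (cmp \<Omega> X Z X (cmp \<Omega> Z Y X g' u) v)"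
    by (simp add: cmp_assoc_Omega[OF X(1,3,2,1) g'' u' v'])
  also have "\<dots> = (- 1) ^ (i' * (j + i)) *
      (\<Sum>(a, m0)\<leftarrow>csw H M m. cf Z m0 (cmp \<Omega> Z X Z (act \<Omega> X Z (?S a) v) (cmp \<Omega> Z Y X g' u)))"
    by (rule tr_v[OF g'u]) (use n in simp)
  also have "\<dots> = (- 1) ^ (i' * (j + i)) * (\<Sum>(a, m0)\<leftarrow>csw H M m. (- 1) ^ (i * (i' + j)) * (\<Sum>(b, l)\<leftarrow>csw H M m0. F a b l))"
  proof -
    have "cf Z m0 (cmp \<Omega> Z X Z (act \<Omega> X Z (?S a) v) (cmp \<Omega> Z Y X g' u)) = (- 1) ^ (i * (i' + j)) * (\<Sum>(b, l)\<leftarrow>csw H M m0. F a b l)" for a m0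
      unfolding cmp_assoc_Omega[OF X(3,2,1,3) OD_OM[OF av(1)] g'' u', symmetric] F_def
      by (rule tr_u[OF avg]) (use n in simp)
    then show ?thesis by simp
  qed
  also have "\<dots> = (- 1) ^ (i' * (j + i)) * ((- 1) ^ (i * (i' + j)) * (\<Sum>(a, m0)\<leftarrow>csw H M m. \<Sum>(b, l)\<leftarrow>csw H M m0. F a b l))"
    by (simp add: scale_sum_list_pairs[OF vector_space_field, of "(- 1) ^ (i * (i' + j))"])
  also have "\<dots> = (- 1) ^ ((i + i') * j) * (\<Sum>(a, m0)\<leftarrow>csw H M m. \<Sum>(b, l)\<leftarrow>csw H M m0. F a b l)"
  proof -
    \<comment> \<open>The exponents i'(j+i) and i(i'+j) add up to (i+i')j plus twice ii'.\<close>
    have "(- 1 :: 'k) ^ (i' * (j + i)) * (- 1) ^ (i * (i' + j)) = (- 1) ^ ((i + i') * j) * ((- 1) ^ (i * i') * (- 1) ^ (i * i'))"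
      by (simp only: power_add[symmetric], rule arg_cong[where f = "\<lambda>e. (- 1) ^ e"]) (simp add: algebra_simps)
    also have "(- 1 :: 'k) ^ (i * i') * (- 1) ^ (i * i') = 1" by (simp flip: power_mult_distrib)
    finally show ?thesis by (simp flip: mult.assoc)
  qed
  also have "(\<Sum>(a, m0)\<leftarrow>csw H M m. \<Sum>(b, l)\<leftarrow>csw H M m0. F a b l) = (\<Sum>(a, m0)\<leftarrow>csw H M m. \<Sum>(b, c)\<leftarrow>sw H a. F b c m0)"
  proof (rule csw_coassoc[symmetric])
    show "linear_on UNIV (hscale H) (*) (\<lambda>a. F a b m0)" for b m0
      unfolding F_def by (rule linear_on_comp[OF inv bilinear_onD(2)[OF B UNIV_I] UNIV_I])
    show "linear_on UNIV (hscale H) (*) (\<lambda>b. F a b m0)" for a m0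
      unfolding F_def by (rule linear_on_comp[OF inv bilinear_onD(1)[OF B UNIV_I] UNIV_I])
    show "linear_on UNIV (mscale M) (*) (\<lambda>m0. F a b m0)" for a b
      unfolding F_def by (rule cf_linear_m[OF X(2) mm])
  qed
  also have "\<dots> = (\<Sum>(a, m0)\<leftarrow>csw H M m. cf Y m0 (cmp \<Omega> Y X Y (act \<Omega> X Y (?S a) (cmp \<Omega> X Z Y u v)) g'))"
  proof -
    have "cf Y m0 (cmp \<Omega> Y X Y (act \<Omega> X Y (?S a) (cmp \<Omega> X Z Y u v)) g') = (\<Sum>(b, c)\<leftarrow>sw H a. F b c m0)" for a m0
    proof -
      have uv: "cmp \<Omega> X Z Y (act \<Omega> Z Y x u) (act \<Omega> X Z y v) \<in> OM X Y" for x y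
        by (rule cmp_mem[OF X(1,3,2) OD_OM[OF av(2)] OD_OM[OF av(1)]])
      have "cf Y m0 (cmp \<Omega> Y X Y (act \<Omega> X Y (?S a) (cmp \<Omega> X Z Y u v)) g')
        = (\<Sum>(x, y)\<leftarrow>sw H (?S a). cf Y m0 (cmp \<Omega> Y X Y (cmp \<Omega> X Z Y (act \<Omega> Z Y x u) (act \<Omega> X Z y v)) g'))"
        unfolding act_cmp_Omega[OF X(1,3,2) u' v'] case_prod_beta'
        by (rule linear_on_sum_list[OF cf_cmp_linear_left[OF X(2,1) g''] vs_omega subspace_omega_sum uv])
      also have "\<dots> = (\<Sum>(x, y)\<leftarrow>sw H (?S a). cf Y m0 (cmp \<Omega> Y Z Y (act \<Omega> Z Y x u) (cmp \<Omega> Y X Z (act \<Omega> X Z y v) g')))"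
        by (simp add: cmp_assoc_Omega[OF X(2,1,3,2) OD_OM[OF av(2)] OD_OM[OF av(1)] g''])
      \<comment> \<open>The inverse antipode exchanges the legs of \<open>a\<close>, so the second
        one acts on \<open>u\<close> and the first on \<open>v\<close>, the order found in
        \<open>F\<close>.\<close>
      also have "\<dots> = (\<Sum>(b, c)\<leftarrow>sw H a. F b c m0)"
        unfolding sw_inv_antipode[OF vector_space_field B] F_def ..
      finally show ?thesis .
    qed
    then show ?thesis by simp
  qed
  finally show "cf X m (cmp \<Omega> X Y X g' (cmp \<Omega> X Z Y u v)) = (- 1) ^ ((i + i') * j) *
      (\<Sum>(a, m0)\<leftarrow>csw H M m. cf Y m0 (cmp \<Omega> Y X Y (act \<Omega> X Y (?S a) (cmp \<Omega> X Z Y u v)) g'))" .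
qed

text \<open>The cocycle conditions at the word extended by \<open>f\<close>, arranged as the two
  sides of the trace identity evaluate. The assumptions on \<open>length Xs\<close> differ because
  the coboundary condition lives one degree higher.\<close>

lemma cocycle_values:
  assumes c: "\<phi> \<in> cyclic_cocycles H M C n" and X: "X \<in> Ob C" "Y \<in> Ob C" and f: "f \<in> Hom C X Y" and p: "C.path Y X Xs (g # gs)"
  shows "length Xs = n \<Longrightarrow> (- 1) ^ n * (\<Sum>i\<le>n. (- 1) ^ i * cval n \<phi> m (drop_nth (Suc i) (X # Xs @ [Y])) (merge C i (X # Xs @ [Y, X]) ((g # gs) @ [f])))
      = (\<Sum>(a, m0)\<leftarrow>csw H M m. cval n \<phi> m0 (Y # Xs) (cmp C (hd (Xs @ [Y])) X Y (act C X Y (inv (antipode H) a) f) g # gs))"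
    and "Suc (length Xs) = n \<Longrightarrow> cval n \<phi> m (X # Xs @ [Y]) ((g # gs) @ [f])
      = (- 1) ^ n * (\<Sum>(a, m0)\<leftarrow>csw H M m. cval n \<phi> m0 (Y # X # Xs) (act C X Y (inv (antipode H) a) f # g # gs))"
proof -
  have pf: "C.path X Y [] [f]" using f by (simp add: C.path_Nil)
  have q: "C.path X X (Xs @ [Y]) ((g # gs) @ [f])" by (rule C.path_append[OF p pf X(2)])
  show "(- 1) ^ n * (\<Sum>i\<le>n. (- 1) ^ i * cval n \<phi> m (drop_nth (Suc i) (X # Xs @ [Y])) (merge C i (X # Xs @ [Y, X]) ((g # gs) @ [f])))
      = (\<Sum>(a, m0)\<leftarrow>csw H M m. cval n \<phi> m0 (Y # Xs) (cmp C (hd (Xs @ [Y])) X Y (act C X Y (inv (antipode H) a) f) g # gs))"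
    (is "_ * ?S = ?R") if len: "length Xs = n"
  proof -
    have "(X # Xs @ [Y], (g # gs) @ [f]) \<in> cn_words C (Suc n)" using X q len by (simp add: cn_words_Cons)
    then have "?S + (- 1) ^ Suc n * last_face n \<phi> m (X # Xs @ [Y]) (g # gs @ [f]) = 0"
      using c unfolding cyclic_cocycles_iff[OF \<phi>] by fastforce
    then have "?S = (- 1) ^ n * ?R" unfolding last_face_snoc[OF \<phi>] by simp
    then show ?thesis by (simp flip: mult.assoc power_mult_distrib)
  qed
  show "cval n \<phi> m (X # Xs @ [Y]) ((g # gs) @ [f])
      = (- 1) ^ n * (\<Sum>(a, m0)\<leftarrow>csw H M m. cval n \<phi> m0 (Y # X # Xs) (act C X Y (inv (antipode H) a) f # g # gs))"
    if len: "Suc (length Xs) = n"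
  proof -
    have "(X # Xs @ [Y], (g # gs) @ [f]) \<in> cn_words C n" using X q len by (simp add: cn_words_Cons)
    then have "cval n \<phi> m (X # Xs @ [Y]) ((g # gs) @ [f]) = (- 1) ^ n * rot n \<phi> m (X # Xs @ [Y]) ((g # gs) @ [f])"
      using c unfolding cyclic_cocycles_iff[OF \<phi>] by blast
    then show ?thesis by (simp add: rot_def[OF \<phi>] butlast_append)
  qed
qed

lemma traces_iota:
  assumes c: "\<phi> \<in> cyclic_cocycles H M C n" and X: "X \<in> Ob C" "Y \<in> Ob C" and f: "f \<in> Hom C X Y"
  shows "traces 0 X Y (W X Y [] [f])"
proof (rule traces_generatorI[OF X])
  have pf: "C.path X Y [] [f]" using f by (simp add: C.path_Nil)
  show m: "W X Y [] [f] \<in> OM X Y" by (rule W_mem[OF pf UNIV_I])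
  note af = act_closed[OF X f]
  have sub: "OD n X X \<subseteq> OM X X" by (auto dest: OD_OM)
  fix m j Xs gs assume p: "C.path Y X Xs gs"
  then obtain g gs' where gs: "gs = g # gs'" using path_neq_Nil by blast
  have ap: "C.path X X (Xs @ [Y]) (gs @ [f])" by (rule C.path_append[OF p pf X(2)])
  \<comment> \<open>Against a word of type \<open>W\<close>, the identity for \<open>f\<close> is
    the coboundary condition.\<close>
  show "cf X m (cmp \<Omega> X Y X (W Y X Xs gs) (W X Y [] [f])) = (- 1) ^ (0 * j) *
       (\<Sum>(a, m0)\<leftarrow>csw H M m. cf Y m0 (cmp \<Omega> Y X Y (act \<Omega> X Y (inv (antipode H) a) (W X Y [] [f])) (W Y X Xs gs)))"
    if "length Xs = j" "0 + j = n"
  proof -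
    have len: "length Xs = n" using that by simp
    have "cf X m (cmp \<Omega> X Y X (W Y X Xs gs) (W X Y [] [f])) = (- 1) ^ n *
      (\<Sum>i\<le>n. (- 1) ^ i * cval n \<phi> m (drop_nth (Suc i) (X # Xs @ [Y])) (merge C i (X # Xs @ [Y, X]) (gs @ [f])))"
      by (rule form_cmp_W_iota[OF X linear_on_mono[OF cf_linear[OF X(1)] sub] _ p len f]) (simp add: cf_W X)
    also have "\<dots> = (\<Sum>(a, m0)\<leftarrow>csw H M m. cval n \<phi> m0 (Y # Xs) (cmp C (hd (Xs @ [Y])) X Y (act C X Y (inv (antipode H) a) f) g # gs'))"
      unfolding gs by (rule cocycle_values(1)[OF c X f p[unfolded gs] len])
    also have "\<dots> = (\<Sum>(a, m0)\<leftarrow>csw H M m. cf Y m0 (cmp \<Omega> Y X Y (act \<Omega> X Y (inv (antipode H) a) (W X Y [] [f])) (W Y X Xs gs)))"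
      unfolding act_W_Nil[OF X f] cmp_W_Nil[OF X(2,1,2) af W_mem[OF p UNIV_I]] unfolding gs
        lam_W[OF X(2,1,2) af p[unfolded gs]] cf_W[OF X(2) path_cmp_head[OF X(2,1,2) af p[unfolded gs]]] using len by simp
    finally show ?thesis by simp
  qed
  \<comment> \<open>Against dw, the Leibniz rule rewrites (dw) f as d(w f) up to a multiple of w df.
    Only the latter survives, a word ending in \<open>f\<close>; the right-hand side is its
    rotation, so the cyclic condition applies.\<close>
  show "cf X m (cmp \<Omega> X Y X (U Y X Xs gs) (W X Y [] [f])) = (- 1) ^ (0 * j) *
       (\<Sum>(a, m0)\<leftarrow>csw H M m. cf Y m0 (cmp \<Omega> Y X Y (act \<Omega> X Y (inv (antipode H) a) (W X Y [] [f])) (U Y X Xs gs)))"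
    if "Suc (length Xs) = j" "0 + j = n"
  proof -
    have len: "Suc (length Xs) = n" using that by simp
    let ?m = "LW X Y X Xs gs (W X Y [] [f])"
    have lm: "?m \<in> OM X X" by (rule LW_mem[OF X X(1) p m])
    have "LW X Y X Xs gs (diff \<Omega> X Y (W X Y [] [f])) = W X X (Xs @ [Y]) (gs @ [f])"
      unfolding diff_W[OF X pf] by (rule LW_U[OF X X(1) p pf])
    then have "cmp \<Omega> X Y X (U Y X Xs gs) (W X Y [] [f]) = diff \<Omega> X X ?m - osc ((- 1) ^ length Xs) (W X X (Xs @ [Y]) (gs @ [f]))"
      unfolding cmp_U[OF X X(1) m p] LU_def by simp
    then have "cf X m (cmp \<Omega> X Y X (U Y X Xs gs) (W X Y [] [f])) = - ((- 1) ^ length Xs) * cval n \<phi> m (X # Xs @ [Y]) (gs @ [f])"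
      using linear_diff[OF cf_linear[OF X(1)] vector_space_field diff_mem_OM[OF X(1,1) lm] osc_closed(3)[OF W_mem[OF ap UNIV_I]], of m "(- 1) ^ length Xs"]
        linear_on_scaleD[OF cf_linear[OF X(1)] W_mem[OF ap UNIV_I], of m "(- 1) ^ length Xs"] len
      by (simp add: cf_diff[OF X(1) lm] cf_W[OF X(1) ap])
    also have "\<dots> = (- 1) ^ n * cval n \<phi> m (X # Xs @ [Y]) (gs @ [f])" using len by auto
    also have "\<dots> = (\<Sum>(a, m0)\<leftarrow>csw H M m. cval n \<phi> m0 (Y # X # Xs) (act C X Y (inv (antipode H) a) f # gs))"
      unfolding gs cocycle_values(2)[OF c X f p[unfolded gs] len] by (simp flip: mult.assoc power_mult_distrib)
    also have "\<dots> = (\<Sum>(a, m0)\<leftarrow>csw H M m. cf Y m0 (cmp \<Omega> Y X Y (act \<Omega> X Y (inv (antipode H) a) (W X Y [] [f])) (U Y X Xs gs)))"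
    proof -
      have "C.path Y Y (X # Xs) (act C X Y a f # gs)" for a using p af X by (simp add: C.path_Cons)
      then show ?thesis
        unfolding act_W_Nil[OF X f] cmp_W_Nil[OF X(2,1,2) af U_mem[OF X(2,1) p UNIV_I]] lam_U[OF X(2,1,2) af p]
        using len by (simp add: cf_W[OF X(2)])
    qed
    finally show ?thesis by simp
  qed
qed

lemma traces_d_iota:
  assumes c: "\<phi> \<in> cyclic_cocycles H M C n" and X: "X \<in> Ob C" "Y \<in> Ob C" and f: "f \<in> Hom C X Y"
  shows "traces 1 X Y (U X Y [] [f])"
proof (rule traces_generatorI[OF X])
  have pf: "C.path X Y [] [f]" using f by (simp add: C.path_Nil)
  show m: "U X Y [] [f] \<in> OM X Y" by (rule U_mem[OF X pf UNIV_I])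
  note af = act_closed[OF X f]
  fix m j Xs gs assume p: "C.path Y X Xs gs"
  then obtain g gs' where gs: "gs = g # gs'" using path_neq_Nil by blast
  have ap: "C.path X X (Xs @ [Y]) (gs @ [f])" by (rule C.path_append[OF p pf X(2)])
  \<comment> \<open>For df against \<open>W\<close> the left side is a single word, and the right
    side is minus its rotation up to d(f w); the sign is absorbed since \<open>j\<close> is one less
    than \<open>n\<close>.\<close>
  show "cf X m (cmp \<Omega> X Y X (W Y X Xs gs) (U X Y [] [f])) = (- 1) ^ (1 * j) *
       (\<Sum>(a, m0)\<leftarrow>csw H M m. cf Y m0 (cmp \<Omega> Y X Y (act \<Omega> X Y (inv (antipode H) a) (U X Y [] [f])) (W Y X Xs gs)))"
    if "length Xs = j" "1 + j = n"
  proof -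
    have len: "Suc (length Xs) = n" using that by simp
    have "cf Y m0 (cmp \<Omega> Y X Y (act \<Omega> X Y a (U X Y [] [f])) (W Y X Xs gs)) = - cval n \<phi> m0 (Y # X # Xs) (act C X Y a f # gs)" for a m0
    proof -
      have q: "C.path Y Y (X # Xs) (act C X Y a f # gs)" using p af X by (simp add: C.path_Cons)
      have l: "lam Y X Y (act C X Y a f) (W Y X Xs gs) \<in> OM Y Y" by (rule lam_mem[OF X(2,1,2) af W_mem[OF p UNIV_I]])
      show ?thesis
        unfolding act_U_iota[OF X f] cmp_U_iota_W[OF X af p]
        using linear_diff[OF cf_linear[OF X(2)] vector_space_field diff_mem_OM[OF X(2,2) l] W_mem[OF q UNIV_I], of m0] len
        by (simp add: cf_diff[OF X(2) l] cf_W[OF X(2) q])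
    qed
    moreover have "(\<Sum>(a, m0)\<leftarrow>ps. - v a m0) = - (\<Sum>(a, m0)\<leftarrow>ps. v a m0 :: 'k)" for ps :: "('h \<times> 'm) list" and v
      by (induction ps) auto
    moreover have "cf X m (cmp \<Omega> X Y X (W Y X Xs gs) (U X Y [] [f])) = cval n \<phi> m (X # Xs @ [Y]) (gs @ [f])"
      unfolding cmp_W[OF X X(1) m p] LW_U[OF X X(1) p pf] cf_W[OF X(1) ap] using len by simp
    moreover have "(- 1 :: 'k) ^ n = - ((- 1) ^ j)" using that by auto
    ultimately show ?thesis
      using cocycle_values(2)[OF c X f p[unfolded gs] len, of m] unfolding gs by simp
  qed
  \<comment> \<open>Both products are words of differentials only, where the form vanishes.\<close>
  show "cf X m (cmp \<Omega> X Y X (U Y X Xs gs) (U X Y [] [f])) = (- 1) ^ (1 * j) *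
       (\<Sum>(a, m0)\<leftarrow>csw H M m. cf Y m0 (cmp \<Omega> Y X Y (act \<Omega> X Y (inv (antipode H) a) (U X Y [] [f])) (U Y X Xs gs)))"
  proof -
    have "cf Y m0 (cmp \<Omega> Y X Y (act \<Omega> X Y a (U X Y [] [f])) (U Y X Xs gs)) = 0" for a m0
    proof -
      have pa: "C.path X Y [] [act C X Y a f]" using af by (simp add: C.path_Nil)
      have q: "C.path Y Y (X # Xs) (act C X Y a f # gs)" using p af X by (simp add: C.path_Cons)
      show ?thesis
        unfolding act_U_iota[OF X f] cmp_U[OF X(2,1,2) U_mem[OF X(2,1) p UNIV_I] pa] LU_U[OF X(2,1,2) pa p]
        using cf_U[OF X(2) q] by simp
    qed
    moreover have "cf X m (cmp \<Omega> X Y X (U Y X Xs gs) (U X Y [] [f])) = 0"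
      unfolding cmp_U[OF X X(1) m p] LU_U[OF X X(1) p pf] by (rule cf_U[OF X(1) ap])
    ultimately show ?thesis by (simp add: case_prod_beta')
  qed
qed

lemma traces_all:
  assumes c: "\<phi> \<in> cyclic_cocycles H M C n" and X: "X \<in> Ob C" "Y \<in> Ob C" and g: "g \<in> OD i X Y"
  shows "traces i X Y g"
proof -
  \<comment> \<open>\<open>U\<close> is a product of elements df, and \<open>W\<close> of positive
    degree is a morphism of degree 0 times a \<open>U\<close>; \<open>traces_cmp\<close> therefore
    reaches all words from the two generator cases.\<close>
  have PU: "traces (Suc (length Xs)) X Y (U X Y Xs fs)" if "Y \<in> Ob C" "C.path X Y Xs fs" for Y Xs fs
    using that
  proof (induction Xs arbitrary: Y fs)
    case Nil
    then show ?case using traces_d_iota[OF c X(1)] by (auto simp: C.path_Nil)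
  next
    case (Cons X1 Xs)
    then obtain f gs where *: "fs = f # gs" "X1 \<in> Ob C" "f \<in> Hom C X1 Y" "C.path X X1 Xs gs" by (auto simp: C.path_Cons)
    have pf: "C.path X1 Y [] [f]" using * by (simp add: C.path_Nil)
    have m: "U X1 Y [] [f] \<in> OD 1 X1 Y" "U X X1 Xs gs \<in> OD (Suc (length Xs)) X X1"
      using U_mem[OF *(2) Cons.prems(1) pf] U_mem[OF X(1) *(2,4)] by auto
    have eq: "cmp \<Omega> X X1 Y (U X1 Y [] [f]) (U X X1 Xs gs) = U X Y (X1 # Xs) fs"
      using cmp_U[OF X(1) *(2) Cons.prems(1) OD_OM[OF m(2)] pf] LU_U[OF X(1) *(2) Cons.prems(1) pf *(4)] by (simp add: *(1))
    show ?case
      using traces_cmp[OF X(1) Cons.prems(1) *(2) m traces_d_iota[OF c *(2) Cons.prems(1) *(3)] Cons.IH[OF *(2,4)]]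
      unfolding eq by simp
  qed
  have PW: "traces (length Xs) X Y (W X Y Xs fs)" if p: "C.path X Y Xs fs" for Xs fs
  proof (cases Xs)
    case Nil
    then show ?thesis using p traces_iota[OF c X] by (auto simp: C.path_Nil)
  next
    case (Cons X1 Xs')
    then obtain f gs where *: "fs = f # gs" "X1 \<in> Ob C" "f \<in> Hom C X1 Y" "C.path X X1 Xs' gs" using p by (auto simp: C.path_Cons)
    have pf: "C.path X1 Y [] [f]" using * by (simp add: C.path_Nil)
    have m: "W X1 Y [] [f] \<in> OD 0 X1 Y" "U X X1 Xs' gs \<in> OD (Suc (length Xs')) X X1"
      using W_mem[OF pf] U_mem[OF X(1) *(2,4)] by auto
    have eq: "cmp \<Omega> X X1 Y (W X1 Y [] [f]) (U X X1 Xs' gs) = W X Y Xs fs"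
      unfolding cmp_W_Nil[OF X(1) *(2) X(2) *(3) OD_OM[OF m(2)]] lam_U[OF X(1) *(2) X(2) *(3,4)] Cons *(1) ..
    show ?thesis
      using traces_cmp[OF X *(2) m traces_iota[OF c *(2) X(2) *(3)] PU[OF *(2,4)]]
      unfolding eq by (simp add: Cons)
  qed
  show ?thesis
    unfolding traces_def
  proof (intro allI ballI impI)
    fix m j g' assume g': "g' \<in> OD j Y X" and ij: "i + j = n"
    have sub: "OD i X Y \<subseteq> OM X Y" by (auto dest: OD_OM)
    show "cf X m (cmp \<Omega> X Y X g' g) = (- 1) ^ (i * j) *
       (\<Sum>(a, m0)\<leftarrow>csw H M m. cf Y m0 (cmp \<Omega> Y X Y (act \<Omega> X Y (inv (antipode H) a) g) g'))"
    proof (rule omega_eqI[OF X g])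
      show "linear_on (OD i X Y) osc (*) (\<lambda>g. cf X m (cmp \<Omega> X Y X g' g))"
        by (rule linear_on_mono[OF cf_cmp_linear_right[OF X OD_OM[OF g']] sub])
      show "linear_on (OD i X Y) osc (*) (\<lambda>g. (- 1) ^ (i * j) *
         (\<Sum>(a, m0)\<leftarrow>csw H M m. cf Y m0 (cmp \<Omega> Y X Y (act \<Omega> X Y (inv (antipode H) a) g) g')))"
        by (rule linear_on_mono[OF _ sub])
          (intro linear_on_scale linear_on_sum_list_pairs vector_space_field
            linear_on_comp[OF act_linear_Omega[OF X] cf_cmp_linear_left[OF X(2,1) OD_OM[OF g']] act_mem[OF X]])
    qed (use PW PU[OF X(2)] g' ij in \<open>auto simp: traces_def\<close>)
  qed
qed

lemma cocycle_imp_trace: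
  assumes c: "\<phi> \<in> cyclic_cocycles H M C n"
  shows "\<exists>T. closed_graded_trace H M n \<Omega> T \<and>
    (\<forall>m. \<forall>(Xs, fs)\<in>cn_words C n. \<phi> (mcn_ten M C n m (cn_elem C Xs fs))
        = T (hd Xs) (trace_ten M n \<Omega> (hd Xs) m (omega_cyc H C Xs fs)))"
proof -
  have sub: "OD n X Y \<subseteq> OM X Y" for X Y by (auto dest: OD_OM)
  have "trace_form H M n \<Omega> cf"
    unfolding trace_form_def
  proof (intro conjI ballI allI impI; unfold Omega_simps)
    fix X assume X: "X \<in> Ob C"
    show "bilinear_on (mscale M) UNIV osc (OD n X X) (*) (cf X)"
      by (rule bilinear_onI) (auto intro: cf_linear_m X OD_OM linear_on_mono[OF cf_linear[OF X] sub])
  next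
    fix X m j f assume "X \<in> Ob C" "f \<in> OD j X X"
    then show "cf X m (diff \<Omega> X X f) = 0" by (auto intro: cf_diff OD_OM)
  next
    fix X Y m i j g g' assume "X \<in> Ob C" "Y \<in> Ob C" "g \<in> OD i X Y" "g' \<in> OD j Y X" "i + j = n"
    then show "cf X m (cmp \<Omega> X Y X g' g) = (- 1) ^ (i * j) *
        (\<Sum>(a, m0)\<leftarrow>csw H M m. cf Y m0 (cmp \<Omega> Y X Y (act \<Omega> X Y (inv (antipode H) a) g) g'))"
      using traces_all[OF c, of X Y g i] by (simp add: traces_def)
  qed (rule cf_equivariant)
  from trace_of_trace_form[OF DGH_Omega this]
  obtain T where T: "closed_graded_trace H M n \<Omega> T"
    "\<And>X m f. X \<in> Ob \<Omega> \<Longrightarrow> f \<in> HomD \<Omega> n X X \<Longrightarrow> T X (trace_ten M n \<Omega> X m f) = cf X m f"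
    by blast
  have "\<phi> (mcn_ten M C n m (cn_elem C Xs fs)) = T (hd Xs) (trace_ten M n \<Omega> (hd Xs) m (omega_cyc H C Xs fs))"
    if w: "(Xs, fs) \<in> cn_words C n" for m Xs fs
  proof -
    obtain X Qs where X: "Xs = X # Qs" "X \<in> Ob C" "length Qs = n" "C.path X X Qs fs" by (rule cn_words_cases[OF w])
    then have "W X X Qs fs \<in> OD n X X" by (auto intro!: W_mem)
    then show ?thesis using T(2)[of X "W X X Qs fs" m] X by (simp add: omega_cyc_W cf_W[OF X(2,4)] cval_def)
  qed
  with T(1) show ?thesis by blast
qed

end

end

text \<open>The existence of a cycle cannot be quantified over types. The first equivalence fixes
  the type of \<Omega>, where a cycle can always be produced; the last conjunct allows arbitrary
  types of objects and morphisms, so that the passage from characters to cocycles covers every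
  cycle.\<close>

theorem theorem5p11:
  fixes H :: "('k::field_char_0, 'h::ring_1) hopf"
    and M :: "('k, 'h, 'm::ab_group_add) sayd"
    and D :: "('k, 'h, 'o, 'a::ab_group_add) hsemicat"
    and n :: nat
    and \<phi> :: "('k, 'm, 'o, 'a) cochain"
  assumes "hopf_algebra H"
    and "H_category H D"
    and "sayd_module H M"
    and "\<phi> \<in> cochains H M D n"
  shows
    "((\<exists>(S :: ('k, 'h, 'o, ('k, 'o, 'a) omega) dgh) T \<rho>o \<rho>. is_character_of H M D n \<phi> S T \<rho>o \<rho>)
        \<longleftrightarrow> (\<exists>T. closed_graded_trace H M n (Omega H D) T \<and>
              (\<forall>m. \<forall>(Xs, fs)\<in>cn_words D n.
                 \<phi> (mcn_ten M D n m (cn_elem D Xs fs))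
                 = T (hd Xs) (trace_ten M n (Omega H D) (hd Xs) m (omega_cyc H D Xs fs)))))
     \<and> ((\<exists>T. closed_graded_trace H M n (Omega H D) T \<and>
              (\<forall>m. \<forall>(Xs, fs)\<in>cn_words D n.
                 \<phi> (mcn_ten M D n m (cn_elem D Xs fs))
                 = T (hd Xs) (trace_ten M n (Omega H D) (hd Xs) m (omega_cyc H D Xs fs))))
        \<longleftrightarrow> \<phi> \<in> cyclic_cocycles H M D n)
     \<and> ((\<exists>(S :: ('k, 'h, 'p, 's::ab_group_add) dgh) T \<rho>o \<rho>. is_character_of H M D n \<phi> S T \<rho>o \<rho>)
        \<longrightarrow> \<phi> \<in> cyclic_cocycles H M D n)"
proof -
  interpret D: H_category H D by fact
  interpret sayd_semicategory H M D
    by (intro sayd_semicategory.intro assms D.H_semicategory_axioms)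
  let ?trace = "\<exists>T. closed_graded_trace H M n (Omega H D) T \<and>
              (\<forall>m. \<forall>(Xs, fs)\<in>cn_words D n.
                 \<phi> (mcn_ten M D n m (cn_elem D Xs fs))
                 = T (hd Xs) (trace_ten M n (Omega H D) (hd Xs) m (omega_cyc H D Xs fs)))"
  have 23: "\<phi> \<in> cyclic_cocycles H M D n" if "?trace"
  proof -
    from that obtain T where T: "closed_graded_trace H M n (Omega H D) T"
      and val: "\<And>m Xs fs. (Xs, fs) \<in> cn_words D n \<Longrightarrow> \<phi> (mcn_ten M D n m (cn_elem D Xs fs))
                 = T (hd Xs) (trace_ten M n (Omega H D) (hd Xs) m (omega_cyc H D Xs fs))" by blast
    show ?thesis
    proof (rule trace_imp_cocycle[OF assms(4) _ trace_form_of_trace[OF D.DGH_Omega T]])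
      fix X assume "X \<in> Ob D"
      from D.identities[OF this] show "\<exists>e\<in>Hom D X X. (\<forall>Y\<in>Ob D. \<forall>f\<in>Hom D X Y. cmp D X X Y f e = f) \<and>
          (\<forall>Y\<in>Ob D. \<forall>f\<in>Hom D Y X. cmp D Y X X e f = f)" by blast
    qed (simp add: cval_def val)
  qed
  have 21: "\<exists>(S :: ('k, 'h, 'o, ('k, 'o, 'a) omega) dgh) T \<rho>o \<rho>. is_character_of H M D n \<phi> S T \<rho>o \<rho>" if "?trace"
    using that trace_imp_character[of n _ \<phi>] by blast
  \<comment> \<open>One polymorphic implication is instantiated twice: at the type of \<Omega> and
    at arbitrary types of cycles.\<close>
  have char1: "?trace" if "\<exists>(S :: ('k, 'h, 'o, ('k, 'o, 'a) omega) dgh) T \<rho>o \<rho>. is_character_of H M D n \<phi> S T \<rho>o \<rho>"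
    using that by (elim exE) (rule character_imp_trace)
  have char2: "?trace" if "\<exists>(S :: ('k, 'h, 'p, 's) dgh) T \<rho>o \<rho>. is_character_of H M D n \<phi> S T \<rho>o \<rho>"
    using that by (elim exE) (rule character_imp_trace)
  show ?thesis
    using 23 21 char1 char2 cocycle_imp_trace[OF assms(4)] by blast
qed

end
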